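(* Let $m_0:[0,\infty)\to\mathbb C$ be a smooth function on $[0,\infty)$ and let $m_j(t)=m_0(t)\varphi(2^{-j}t)$, $t\ge0$, $j\ge1$. Suppose that there exist $\epsilon>0$, $\beta>1$ and a constant $C$ independent of $j$ such that $$\|m_j\|_{L^2_\beta}\le C2^{-j\epsilon}\qquad\text{for all } j\ge1 .$$ Then the maximal operator $\mathcal T^*_m$ associated with $m(\xi,\eta)=m_0(|(\xi,\eta)|^2)$ extends to a bounded operator from $L^2(\mathbb R^n)\times L^2(\mathbb R^n)$ to $L^1(\mathbb R^n)$.
   Context: Fourier transform: $\hat f(\xi)=\int_{\mathbb R^n}f(x)e^{-2\pi i x\cdot\xi}\,dx$; $n\ge1$; $|(\xi,\eta)|^2=|\xi|^2+|\eta|^2$ for $\xi,\eta\in\mathbb R^n$. For $m$ on $\mathbb R^{2n}$, $s>0$ and Schwartz functions $f,g$ on $\mathbb R^n$, $$\mathcal T_{m,s}(f,g)(x)=\int_{\mathbb R^n}\int_{\mathbb R^n}m(s\xi,s\eta)\hat f(\xi)\hat g(\eta)e^{2\pi i x\cdot(\xi+\eta)}\,d\xi\,d\eta,\qquad \mathcal T^*_m(f,g)(x)=\sup_{s>0}|\mathcal T_{m,s}(f,g)(x)|.$$ $\varphi,\phi:[0,\infty)\to\mathbb C$ are fixed compactly supported smooth functions with $\sum_{j\ge1}\varphi(2^{-j}x)+\phi(x)=1$ for all $x\in[0,\infty)$, $\operatorname{supp}\varphi\subset[1/2,2]$ and $\operatorname{supp}\phi\subset[0,3/2]$. For $\beta\ge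 0$ the fractional derivative $(d/dt)^\beta h$ of a function $h$ on $\mathbb R$ is defined by $\widehat{(d/dt)^\beta h}(\nu)=(-2\pi i\nu)^\beta\hat h(\nu)$ (in the sense of distributions). For $h$ smooth with compact support in $(0,\infty)$, put $M(t)=h(t)/t$ (extended by zero to $\mathbb R$) and $$\|h\|_{L^2_\beta}^2=\int_0^\infty\left|t^{\beta+1}\left(\frac{d}{dt}\right)^\beta M(t)\right|^2\frac{dt}{t}.$$ *)

theory Defs
  imports "HOL-Analysis.Analysis"
begin

text \<open>Smoothness on the closed half-line: derivatives of all orders exist, one-sided at 0.
  Values at negative arguments play no role.\<close>

definition smooth_on_halfline :: "(real \<Rightarrow> complex) \<Rightarrow> bool" where
  "smooth_on_halfline h \<longleftrightarrow>
     (\<exists>D :: nat \<Rightarrow> real \<Rightarrow> complex. (\<forall>t\<ge>0. D 0 t = h t) \<and>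
        (\<forall>k. \<forall>t\<ge>0. (D k has_vector_derivative D (Suc k) t) (at t within {0..})))"

definition supp_halfline :: "(real \<Rightarrow> complex) \<Rightarrow> real set" where
  "supp_halfline h = closure {t. 0 \<le> t \<and> h t \<noteq> 0}"

fun iter_partial :: "'a::euclidean_space list \<Rightarrow> ('a \<Rightarrow> complex) \<Rightarrow> 'a \<Rightarrow> complex" where
  "iter_partial [] f = f"
| "iter_partial (b # bs) f = (\<lambda>x. frechet_derivative (iter_partial bs f) (at x) b)"

text \<open>Differentiability of all iterated partial derivatives amounts to \<open>f\<close> being smooth.\<close>

definition schwartz :: "('a::euclidean_space \<Rightarrow> complex) \<Rightarrow> bool" where
  "schwartz f \<longleftrightarrow> (\<forall>bs. set bs \<subseteq> Basis \<longrightarrow>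
     (\<forall>x. iter_partial bs f differentiable (at x)) \<and>
     (\<forall>k::nat. \<exists>C. \<forall>x. norm x ^ k * norm (iter_partial bs f x) \<le> C))"

definition fourier :: "('a::euclidean_space \<Rightarrow> complex) \<Rightarrow> 'a \<Rightarrow> complex" where
  "fourier f \<xi> = (LINT x|lborel. f x * exp (- 2 * of_real pi * \<i> * of_real (x \<bullet> \<xi>)))"

text \<open>\<open>G\<close> is the Fourier transform of \<open>g\<close> in the sense of distributions. Both functions are
  required to pair integrably with every Schwartz function (in particular they are measurable
  and locally integrable).\<close>

definition has_distr_fourier :: "(real \<Rightarrow> complex) \<Rightarrow> (real \<Rightarrow> complex) \<Rightarrow> bool" where
  "has_distr_fourier g G \<longleftrightarrow> (\<forall>\<psi>. schwartz \<psi> \<longrightarrow>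
     integrable lborel (\<lambda>t. g t * \<psi> t) \<and> integrable lborel (\<lambda>\<nu>. G \<nu> * \<psi> \<nu>) \<and>
     (LINT t|lborel. g t * fourier \<psi> t) = (LINT \<nu>|lborel. G \<nu> * \<psi> \<nu>))"

text \<open>Meant for integrable \<open>h\<close>. The complex power is the principal branch; a function \<open>g\<close>
  with the given distributional transform is unique almost everywhere, and for smooth compactly
  supported \<open>h\<close> it exists.\<close>

definition frac_deriv :: "real \<Rightarrow> (real \<Rightarrow> complex) \<Rightarrow> real \<Rightarrow> complex" where
  "frac_deriv \<beta> h =
     (SOME g. has_distr_fourier g
        (\<lambda>\<nu>. (- 2 * of_real pi * \<i> * of_real \<nu>) powr (of_real \<beta>) * fourier h \<nu>))"

definition div_by_id :: "(real \<Rightarrow> complex) \<Rightarrow> real \<Rightarrow> complex" where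
  "div_by_id h t = (if t > 0 then h t / of_real t else 0)"

definition L2beta_norm_sq :: "real \<Rightarrow> (real \<Rightarrow> complex) \<Rightarrow> ennreal" where
  "L2beta_norm_sq \<beta> h =
     (\<integral>\<^sup>+ t \<in> {0<..}. ennreal ((norm (of_real (t powr (\<beta> + 1)) *
                          frac_deriv \<beta> (div_by_id h) t))\<^sup>2 / t) \<partial>lborel)"

text \<open>The square root of the above, with value \<open>\<infinity>\<close> if the integral diverges.\<close>

definition L2beta_norm :: "real \<Rightarrow> (real \<Rightarrow> complex) \<Rightarrow> ennreal" where
  "L2beta_norm \<beta> h =
     (if L2beta_norm_sq \<beta> h = \<infinity> then \<infinity> else ennreal (sqrt (enn2real (L2beta_norm_sq \<beta> h))))"

definition bilin_mult ::
  "('a::euclidean_space \<times> 'a \<Rightarrow> complex) \<Rightarrow> real \<Rightarrow> ('a \<Rightarrow> complex) \<Rightarrow> ('a \<Rightarrow> complex) \<Rightarrow> 'a \<Rightarrow> complex"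
  where
  "bilin_mult m s f g x =
     (LINT \<eta>|lborel. LINT \<xi>|lborel. m (s *\<^sub>R \<xi>, s *\<^sub>R \<eta>) * fourier f \<xi> * fourier g \<eta> *
        exp (2 * of_real pi * \<i> * of_real (x \<bullet> (\<xi> + \<eta>))))"

definition max_bilin_mult ::
  "('a::euclidean_space \<times> 'a \<Rightarrow> complex) \<Rightarrow> ('a \<Rightarrow> complex) \<Rightarrow> ('a \<Rightarrow> complex) \<Rightarrow> 'a \<Rightarrow> ennreal"
  where
  "max_bilin_mult m f g x = (SUP s \<in> {0<..}. ennreal (norm (bilin_mult m s f g x)))"

definition L2_fun :: "('a::euclidean_space \<Rightarrow> complex) \<Rightarrow> bool" where
  "L2_fun f \<longleftrightarrow> f \<in> borel_measurable lborel \<and> integrable lborel (\<lambda>x. (norm (f x))\<^sup>2)"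

definition L2_norm :: "('a::euclidean_space \<Rightarrow> complex) \<Rightarrow> real" where
  "L2_norm f = sqrt (LINT x|lborel. (norm (f x))\<^sup>2)"

text \<open>\<open>S\<close> is a nonnegative operator that is sublinear in each argument, given on pairs of Schwartz
  functions; it extends to a bounded operator \<open>T\<close> from \<open>L\<^sup>2 \<times> L\<^sup>2\<close> to \<open>L\<^sup>1\<close>. The extension is
  required to be sublinear in each argument as well. Together with the bound this makes \<open>T\<close>
  continuous, compatible with almost everywhere equality, and (by density of the Schwartz
  functions) determined almost everywhere by \<open>S\<close>; without it, \<open>T\<close> could simply be set to 0 off the
  Schwartz functions.\<close>

definition extends_bounded_L2_L2_L1 ::
  "(('a::euclidean_space \<Rightarrow> complex) \<Rightarrow> ('a \<Rightarrow> complex) \<Rightarrow> 'a \<Rightarrow> ennreal) \<Rightarrow> bool" where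
  "extends_bounded_L2_L2_L1 S \<longleftrightarrow>
     (\<exists>(T :: ('a \<Rightarrow> complex) \<Rightarrow> ('a \<Rightarrow> complex) \<Rightarrow> 'a \<Rightarrow> real) (A :: real).
        (\<forall>f g. schwartz f \<and> schwartz g \<longrightarrow> (AE x in lborel. S f g x = ennreal (T f g x))) \<and>
        (\<forall>f g. L2_fun f \<and> L2_fun g \<longrightarrow>
           (AE x in lborel. 0 \<le> T f g x) \<and> integrable lborel (T f g) \<and>
           (LINT x|lborel. \<bar>T f g x\<bar>) \<le> A * L2_norm f * L2_norm g) \<and>
        (\<forall>f f' g. L2_fun f \<and> L2_fun f' \<and> L2_fun g \<longrightarrow>
           (AE x in lborel. T (\<lambda>y. f y + f' y) g x \<le> T f g x + T f' g x) \<and>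
           (AE x in lborel. T g (\<lambda>y. f y + f' y) x \<le> T g f x + T g f' x)) \<and>
        (\<forall>c f g. L2_fun f \<and> L2_fun g \<longrightarrow>
           (AE x in lborel. T (\<lambda>y. c * f y) g x = norm c * T f g x) \<and>
           (AE x in lborel. T f (\<lambda>y. c * g y) x = norm c * T f g x)))"

end

theory Submission
  imports Defs "HOL-Probability.Probability"
begin

text \<open>
  The symbol is cut into \<open>L = m\<^sub>0 * \<phi>\<^sub>0\<close> and the pieces \<open>m j\<close>, and each piece is written as a superposition of
  truncated powers. For the pieces \<open>m j\<close> this is fractional integration (\<open>frac_deriv_subordination\<close>):
  \<open>m j t\<close> is \<open>t\<close> times the integral over \<open>\<tau> > t\<close> of \<open>w j \<tau> * (\<tau> - t) powr (\<beta> - 1)\<close>, where \<open>w j\<close> is the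
  fractional derivative of \<open>m j t / t\<close> divided by \<open>Gamma \<beta>\<close>. Thus the hypothesis bounds a weighted
  square integral of \<open>w j\<close>. The piece \<open>L\<close> is smooth up to 0, and there Taylor's formula with the second
  derivative as density is enough (\<open>low_piece_subordination\<close>).

  At \<open>t = (norm \<xi>)\<^sup>2 + (norm \<eta>)\<^sup>2\<close> a truncated power decouples. With \<open>d = \<beta> / 2 - 1\<close> the Beta integral
  expresses, up to a constant, \<open>(\<tau> - t) powr (2 * d + 1)\<close> as an integral over \<open>v\<close> of the product of
  \<open>(\<tau> - v - (norm \<xi>)\<^sup>2) powr d\<close> and \<open>(v - (norm \<eta>)\<^sup>2) powr d\<close>, truncated to be 0 at negative arguments
  (\<open>beta_subordination\<close>). So the bilinear operator becomes an integral of products of linear Riesz means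
  of \<open>f\<close> and \<open>g\<close>. By Cauchy--Schwarz in \<open>v\<close> it is bounded by the energies of these means, the integrals
  over \<open>v < \<tau>\<close> of their squares; the condition \<open>\<beta> > 1\<close> says that \<open>d > -1/2\<close>, which is what makes these
  squares integrable. After division by \<open>\<tau> powr (2 * d + 1)\<close> the energy is majorized by an integrable maximal
  function, by comparison with the heat semigroup (\<open>energy_maximal\<close>, resting on \<open>dyadic_heat_max_L2\<close>). For
  the pieces \<open>m j\<close> only square integrability in \<open>\<tau>\<close> is available, and there the factor \<open>t\<close> helps: the
  form splits into two, in each of which one summand falls on one function, and the energy of that function,
  integrated over \<open>\<tau>\<close>, is an integrable square function (\<open>square_fun_integral_le\<close>). The outcome is
  \<open>bilinear_square_function_estimate\<close>.

  Replacing the symbol by a dilate only dilates the densities and preserves their weighted norms. Hence the pointwise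
  bound is the same for all \<open>s\<close>, and it holds for the maximal operator (\<open>symbol_estimate\<close>). The bounds
  of the pieces sum up by the factor \<open>2 powr (- j * \<epsilon>)\<close>. The square of the maximal function is thus at most a
  constant times the product of a majorant of \<open>f\<close> and one of \<open>g\<close>, both integrable with integral at most a constant times
  the squared \<open>L\<^sup>2\<close> norm, and Cauchy--Schwarz in \<open>x\<close> gives the bound on Schwartz functions. The extension to
  \<open>L\<^sup>2\<close> uses density (\<open>schwartz_dense\<close>) and sublinearity (\<open>extends\<close>).
\<close>

section \<open>Notation\<close>

text \<open>The nonnegative integral with respect to Lebesgue measure; the lower plus distinguishes it from the integral over a
  named measure.\<close>

abbreviation nn_integral_lborel :: "('a::euclidean_space \<Rightarrow> ennreal) \<Rightarrow> ennreal" (binder "\<integral>\<^sub>+" 10) where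
  "nn_integral_lborel f \<equiv> integral\<^sup>N lborel f"

abbreviation borel_functions :: "('a::topological_space \<Rightarrow> 'b::topological_space) set" ("\<B>") where
  "\<B> \<equiv> borel_measurable borel"

abbreviation enorm :: "'a::real_normed_vector \<Rightarrow> ennreal" where "enorm z \<equiv> ennreal (norm z)"

abbreviation nsq :: "'a::real_normed_vector \<Rightarrow> ennreal" where "nsq z \<equiv> ennreal ((norm z)\<^sup>2)"

abbreviation character :: "real \<Rightarrow> complex" ("\<e>") where "\<e> r \<equiv> cis (2 * pi * r)"

lemmas LINT_cong = Bochner_Integration.integral_cong

section \<open>Integration\<close>

text \<open>The pointwise square root of \<open>ennreal\<close> turns the hypothesis into a bound by a product, to which the
  usual inequality applies. In this form no square root of a weight has to be named in applications.\<close>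

lemma nn_integral_Cauchy_Schwarz_dominated:
  fixes f a b :: "'a \<Rightarrow> ennreal"
  assumes [measurable]: "f \<in> borel_measurable M" "a \<in> borel_measurable M" "b \<in> borel_measurable M"
    and le: "\<And>x. (f x)\<^sup>2 \<le> a x * b x"
  shows "(\<integral>\<^sup>+x. f x \<partial>M)\<^sup>2 \<le> (\<integral>\<^sup>+x. a x \<partial>M) * (\<integral>\<^sup>+x. b x \<partial>M)"
proof -
  define rt :: "ennreal \<Rightarrow> ennreal" where "rt z = (if z = \<infinity> then \<infinity> else ennreal (sqrt (enn2real z)))" for z
  have [measurable]: "rt \<in> \<B>" unfolding rt_def by measurable
  have sq: "(rt z)\<^sup>2 = z" for z
    by (cases z rule: ennreal_cases) (auto simp: rt_def ennreal_power power2_eq_square ennreal_top_mult simp flip: ennreal_mult)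
  have rt: "rt (y\<^sup>2) = y" for y
    by (cases y rule: ennreal_cases) (auto simp: rt_def ennreal_power power2_eq_square ennreal_top_mult simp flip: ennreal_mult)
  have mono: "rt z \<le> rt w" if "z \<le> w" for z w
    using that by (cases z rule: ennreal_cases; cases w rule: ennreal_cases) (auto simp: rt_def top_unique)
  have "f x \<le> rt (a x) * rt (b x)" for x
    using mono[OF le[of x]] rt[of "f x"] rt[of "rt (a x) * rt (b x)"] by (simp add: power_mult_distrib sq)
  then have "(\<integral>\<^sup>+x. f x \<partial>M)\<^sup>2 \<le> (\<integral>\<^sup>+x. rt (a x) * rt (b x) \<partial>M)\<^sup>2"
    by (intro power_mono nn_integral_mono) auto
  also have "\<dots> \<le> (\<integral>\<^sup>+x. (rt (a x))\<^sup>2 \<partial>M) * (\<integral>\<^sup>+x. (rt (b x))\<^sup>2 \<partial>M)"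
    by (rule Cauchy_Schwarz_nn_integral) measurable
  finally show ?thesis unfolding sq .
qed

lemma nn_integral_lborel_translation:
  fixes f :: "'a::euclidean_space \<Rightarrow> ennreal"
  assumes [measurable]: "f \<in> \<B>"
  shows "(\<integral>\<^sub>+x. f (t + x)) = (\<integral>\<^sub>+x. f x)"
  by (subst (2) lborel_affine[of 1 t]) (simp_all add: nn_integral_density nn_integral_distr)

lemma nn_integral_lborel_reflection:
  fixes f :: "'a::euclidean_space \<Rightarrow> ennreal"
  assumes [measurable]: "f \<in> \<B>"
  shows "(\<integral>\<^sub>+x. f (t - x)) = (\<integral>\<^sub>+x. f x)"
  by (subst (2) lborel_affine[of "-1" t]) (simp_all add: nn_integral_density nn_integral_distr)

lemma integral_lborel_translation:
  fixes f :: "'a::euclidean_space \<Rightarrow> complex"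
  assumes [measurable]: "f \<in> \<B>"
  shows "(LINT x|lborel. f (t + x)) = (LINT x|lborel. f x)"
  by (subst (2) lborel_affine[of 1 t]) (simp_all add: density_1 integral_distr)

lemma integrable_lborel_translation:
  fixes f :: "'a::euclidean_space \<Rightarrow> complex"
  assumes "integrable lborel f"
  shows "integrable lborel (\<lambda>x. f (t + x))"
  using assms unfolding integrable_iff_bounded
  by (subst nn_integral_lborel_translation[of "\<lambda>x. enorm (f x)" t]) auto

lemma integral_lborel_reflection:
  fixes f :: "'a::euclidean_space \<Rightarrow> complex"
  assumes [measurable]: "f \<in> \<B>"
  shows "(LINT x|lborel. f (t - x)) = (LINT x|lborel. f x)"
  by (subst (2) lborel_affine[of "-1" t]) (simp_all add: density_1 integral_distr)

lemma nn_integral_lborel_scale: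
  fixes f :: "'a::euclidean_space \<Rightarrow> ennreal"
  assumes [measurable]: "f \<in> \<B>" and "c > 0"
  shows "(\<integral>\<^sub>+x. f x) = ennreal (c ^ DIM('a)) * (\<integral>\<^sub>+x. f (c *\<^sub>R x))"
  using assms(2) by (subst (1) lborel_affine[of c 0])
    (simp_all add: nn_integral_density nn_integral_distr nn_integral_cmult)

lemma integral_lborel_scale:
  fixes f :: "'a::euclidean_space \<Rightarrow> complex"
  assumes [measurable]: "f \<in> \<B>" and "c > 0"
  shows "(LINT x|lborel. f x) = c ^ DIM('a) *\<^sub>R (LINT x|lborel. f (c *\<^sub>R x))"
  using assms(2) by (subst (1) lborel_affine[of c 0])
    (simp_all add: integral_density integral_distr)

lemma integrable_lborel_pairI:
  fixes f :: "'a::euclidean_space \<Rightarrow> 'b::euclidean_space \<Rightarrow> 'c::{banach, second_countable_topology}"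
  assumes m: "case_prod f \<in> borel_measurable (lborel \<Otimes>\<^sub>M lborel)"
    and fin: "(\<integral>\<^sub>+x. \<integral>\<^sub>+y. enorm (f x y)) < \<infinity>"
  shows "integrable (lborel \<Otimes>\<^sub>M lborel) (case_prod f)"
proof (rule integrableI_bounded[OF m])
  note m[measurable]
  have "(\<integral>\<^sup>+ p. enorm (case_prod f p) \<partial>(lborel \<Otimes>\<^sub>M lborel)) =
     (\<integral>\<^sub>+x. \<integral>\<^sub>+y. enorm (f x y))"
    by (subst lborel.nn_integral_fst[symmetric]) auto
  with fin show "(\<integral>\<^sup>+ p. enorm (case_prod f p) \<partial>(lborel \<Otimes>\<^sub>M lborel)) < \<infinity>" by simp
qed

lemma borel_measurable_cis [measurable (raw)]:
  "f \<in> borel_measurable M \<Longrightarrow> (\<lambda>x. cis (f x)) \<in> borel_measurable M"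
  by (rule borel_measurable_continuous_on[where f=cis]) (auto intro!: continuous_intros)

lemma integrable_mult_bounded:
  fixes f g :: "'a \<Rightarrow> complex"
  assumes f: "integrable M f" and [measurable]: "g \<in> borel_measurable M"
    and b: "\<And>x. norm (g x) \<le> B"
  shows "integrable M (\<lambda>x. f x * g x)"
proof (rule Bochner_Integration.integrable_bound[of M "\<lambda>x. B * norm (f x)"])
  show "integrable M (\<lambda>x. B * norm (f x))" using f by simp
  show "(\<lambda>x. f x * g x) \<in> borel_measurable M" using f by measurable
  have "B \<ge> 0" using b[of undefined] norm_ge_zero order_trans by blast
  then show "AE x in M. norm (f x * g x) \<le> norm (B * norm (f x))"
    using b by (intro AE_I2) (simp add: norm_mult mult.commute[of B] mult_left_mono)
qed

lemma integrable_mult_cis: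
  assumes f: "integrable M f" and [measurable]: "g \<in> borel_measurable M"
  shows "integrable M (\<lambda>x. f x * cis (g x))"
  by (rule integrable_mult_bounded[OF f, where B=1]) auto

section \<open>Gaussians and heat kernels\<close>

definition gaussian :: "real \<Rightarrow> 'a::euclidean_space \<Rightarrow> real" where
  "gaussian t x = exp (- pi * t * (norm x)\<^sup>2)"

lemma gaussian_pos [simp]: "gaussian t x > 0" by (simp add: gaussian_def)
lemma gaussian_nonneg [simp]: "gaussian t x \<ge> 0" by (simp add: gaussian_def)

lemma gaussian_le_1: "t \<ge> 0 \<Longrightarrow> gaussian t x \<le> 1" by (simp add: gaussian_def)

lemma gaussian_measurable [measurable]: "gaussian t \<in> \<B>"
  unfolding gaussian_def by measurable

lemma gaussian_prod: "gaussian t x = (\<Prod>b\<in>Basis. exp (- pi * t * (x \<bullet> b)\<^sup>2))"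
proof -
  have "(norm x)\<^sup>2 = (\<Sum>b\<in>Basis. (x \<bullet> b)\<^sup>2)"
    by (subst power2_norm_eq_inner, subst euclidean_inner) (simp add: power2_eq_square)
  then show ?thesis by (simp add: gaussian_def exp_sum[symmetric] sum_distrib_left)
qed

text \<open>Lebesgue measure is the image of the product measure over the coordinates.\<close>

lemma integral_lborel_prod:
  fixes f :: "'a::euclidean_space \<Rightarrow> real \<Rightarrow> complex"
  assumes "\<And>b. b \<in> Basis \<Longrightarrow> integrable lborel (f b)"
  shows "integrable lborel (\<lambda>x::'a. \<Prod>b\<in>Basis. f b (x \<bullet> b))"
    and "(LINT (x::'a)|lborel. (\<Prod>b\<in>Basis. f b (x \<bullet> b))) = (\<Prod>b\<in>Basis. (LINT t|lborel. f b t))"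
proof -
  interpret product_sigma_finite "\<lambda>_::'a. lborel :: real measure" ..
  define T where "T = (\<lambda>g::'a \<Rightarrow> real. \<Sum>b\<in>Basis. g b *\<^sub>R b)"
  have T[measurable]: "T \<in> measurable (\<Pi>\<^sub>M b\<in>(Basis::'a set). lborel) borel" unfolding T_def by measurable
  have [measurable]: "\<And>b. b \<in> Basis \<Longrightarrow> f b \<in> \<B>" using assms by fastforce
  have eq: "(\<Prod>b\<in>Basis. f b (T g \<bullet> b)) = (\<Prod>b\<in>Basis. f b (g b))" for g
    by (intro prod.cong refl) (simp add: T_def inner_sum_left inner_Basis if_distrib sum.delta cong: if_cong)
  have lb: "lborel = distr (\<Pi>\<^sub>M b\<in>(Basis::'a set). lborel) borel T" unfolding T_def by (rule lborel_eq)
  have m: "(\<lambda>x::'a. \<Prod>b\<in>Basis. f b (x \<bullet> b)) \<in> \<B>" by measurable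
  show "integrable lborel (\<lambda>x::'a. \<Prod>b\<in>Basis. f b (x \<bullet> b))"
    unfolding lb by (subst integrable_distr_eq[OF T m])
      (simp add: eq product_integrable_prod assms)
  show "(LINT (x::'a)|lborel. (\<Prod>b\<in>Basis. f b (x \<bullet> b))) = (\<Prod>b\<in>Basis. (LINT t|lborel. f b t))"
    unfolding lb by (subst integral_distr[OF T m])
      (simp add: eq product_integral_prod assms)
qed

text \<open>A rescaling of the characteristic function of the standard normal distribution.\<close>

lemma gaussian_fourier_real:
  "integrable lborel (\<lambda>x::real. exp (- pi * x\<^sup>2))"
  "(LINT x|lborel. complex_of_real (exp (- pi * x\<^sup>2)) * \<e> (x * y)) = of_real (exp (- pi * y\<^sup>2))"
proof -
  have i1: "integrable lborel std_normal_density" by simp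
  have c: "sqrt (2*pi) \<noteq> 0" by simp
  have eq: "std_normal_density (0 + sqrt (2*pi) * x) * sqrt (2*pi) = exp (- pi * x\<^sup>2)" for x
    by (simp add: normal_density_def power_mult_distrib)
  have "integrable lborel (\<lambda>x. std_normal_density (0 + sqrt (2*pi) * x) * sqrt (2*pi))"
    using lborel_integrable_real_affine[OF i1 c, of 0] by simp
  then show "integrable lborel (\<lambda>x::real. exp (- pi * x\<^sup>2))" unfolding eq .
  have "char std_normal_distribution (sqrt (2*pi) * y) = of_real (exp (- (sqrt (2*pi) * y)\<^sup>2 / 2))"
    by (simp add: char_std_normal_distribution)
  also have "- (sqrt (2*pi) * y)\<^sup>2 / 2 = - pi * y\<^sup>2" by (simp add: power_mult_distrib)
  finally have ch: "char std_normal_distribution (sqrt (2*pi) * y) = of_real (exp (- pi * y\<^sup>2))" .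
  have "char std_normal_distribution (sqrt (2*pi) * y) =
     (LINT x|lborel. std_normal_density x *\<^sub>R iexp (sqrt (2*pi) * y * x))"
    unfolding char_def by (subst integral_density) auto
  also have "\<dots> = \<bar>sqrt (2*pi)\<bar> *\<^sub>R (LINT x|lborel. std_normal_density (0 + sqrt (2*pi) * x) *\<^sub>R
       iexp (sqrt (2*pi) * y * (0 + sqrt (2*pi) * x)))"
    by (rule lborel_integral_real_affine[OF c])
  also have "\<dots> = (LINT x|lborel. sqrt (2*pi) *\<^sub>R (std_normal_density (0 + sqrt (2*pi) * x) *\<^sub>R
       iexp (sqrt (2*pi) * y * (0 + sqrt (2*pi) * x))))"
    unfolding integral_scaleR_right by simp
  also have "\<dots> = (LINT x|lborel. complex_of_real (exp (- pi * x\<^sup>2)) * \<e> (x * y))"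
  proof (intro LINT_cong refl)
    fix x
    have "sqrt (2*pi) * y * (0 + sqrt (2*pi) * x) = (sqrt (2*pi) * sqrt (2*pi)) * (x * y)" by (simp only: ac_simps add_0)
    also have "\<dots> = 2 * pi * (x * y)" by (subst real_sqrt_mult_self) simp
    finally have 1: "sqrt (2*pi) * y * (0 + sqrt (2*pi) * x) = 2 * pi * (x * y)" .
    have 2: "iexp (sqrt (2*pi) * y * (0 + sqrt (2*pi) * x)) = \<e> (x * y)"
      unfolding cis_conv_exp 1 ..
    show "sqrt (2*pi) *\<^sub>R (std_normal_density (0 + sqrt (2*pi) * x) *\<^sub>R
       iexp (sqrt (2*pi) * y * (0 + sqrt (2*pi) * x))) = complex_of_real (exp (- pi * x\<^sup>2)) * \<e> (x * y)"
      unfolding 2 eq[of x, symmetric] by (simp only: scaleR_conv_of_real of_real_mult mult_ac)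
  qed
  finally show "(LINT x|lborel. complex_of_real (exp (- pi * x\<^sup>2)) * \<e> (x * y)) = of_real (exp (- pi * y\<^sup>2))"
    using ch by simp
qed

lemma gaussian_scale: "t > 0 \<Longrightarrow> gaussian t x = gaussian 1 (sqrt t *\<^sub>R x)"
  by (simp add: gaussian_def power_mult_distrib)

lemma
  fixes y :: "'a::euclidean_space"
  shows gaussian_1_integrable: "integrable lborel (\<lambda>x::'a. complex_of_real (gaussian 1 x))"
  and gaussian_1_fourier: "(LINT x|lborel. of_real (gaussian 1 x) * \<e> (x \<bullet> y)) = complex_of_real (gaussian 1 y)"
proof -
  have ex: "integrable lborel (\<lambda>x::real. complex_of_real (exp (- pi * x\<^sup>2)))"
    using gaussian_fourier_real(1) by simp
  show "integrable lborel (\<lambda>x::'a. complex_of_real (gaussian 1 x))"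
    unfolding gaussian_prod of_real_prod using ex
    by (intro integral_lborel_prod(1)) simp
  have "(LINT x|lborel. of_real (gaussian 1 x) * \<e> (x \<bullet> y)) =
    (LINT (x::'a)|lborel. (\<Prod>b\<in>Basis. (of_real (exp (- pi * (x \<bullet> b)\<^sup>2)) * \<e> ((x \<bullet> b) * (y \<bullet> b)))))"
  proof (intro LINT_cong refl)
    fix x :: 'a
    have "\<e> (x \<bullet> y) = cis (\<Sum>b\<in>Basis. 2 * pi * ((x \<bullet> b) * (y \<bullet> b)))"
      by (simp add: euclidean_inner[of x y] sum_distrib_left)
    also have "\<dots> = (\<Prod>b\<in>Basis. \<e> ((x \<bullet> b) * (y \<bullet> b)))"
      by (simp add: cis_conv_exp exp_sum sum_distrib_left)
    finally show "of_real (gaussian 1 x) * \<e> (x \<bullet> y) =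
      (\<Prod>b\<in>Basis. (of_real (exp (- pi * (x \<bullet> b)\<^sup>2)) * \<e> ((x \<bullet> b) * (y \<bullet> b))))"
      by (simp add: gaussian_prod prod.distrib)
  qed
  also have "\<dots> = (\<Prod>b\<in>Basis. (LINT t|lborel. of_real (exp (- pi * t\<^sup>2)) * \<e> (t * (y \<bullet> b))))"
    by (rule integral_lborel_prod(2)) (intro integrable_mult_cis ex, simp)
  also have "\<dots> = complex_of_real (gaussian 1 y)"
    by (subst gaussian_fourier_real(2)) (simp add: gaussian_prod)
  finally show "(LINT x|lborel. of_real (gaussian 1 x) * \<e> (x \<bullet> y)) = complex_of_real (gaussian 1 y)" .
qed

text \<open>Normalized to have Fourier transform \<open>gaussian r\<close>, so that convolutions add up the parameters. This is
  the usual heat kernel at time \<open>r / (4 \<pi>)\<close>.\<close>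

definition heat :: "real \<Rightarrow> 'a::euclidean_space \<Rightarrow> real" where
  "heat r x = r powr (- real DIM('a) / 2) * gaussian (1 / r) x"

lemma heat_nonneg [simp]: "heat r x \<ge> 0" by (simp add: heat_def)

lemma heat_measurable [measurable]: "heat r \<in> \<B>"
  unfolding heat_def by measurable

lemma heat_minus [simp]: "heat r (- x) = heat r x" by (simp add: heat_def gaussian_def)
lemma heat_diff_commute: "heat r (x - y) = heat r (y - x)"
  by (metis heat_minus minus_diff_eq)

lemma powr_half_dim: "r > 0 \<Longrightarrow> sqrt r ^ n = r powr (real n / 2)"
  by (simp add: powr_half_sqrt[symmetric] powr_realpow[symmetric] powr_powr)

lemma gaussian_fourier:
  fixes y :: "'a::euclidean_space"
  assumes t: "t > 0"
  shows "integrable lborel (\<lambda>x::'a. complex_of_real (gaussian t x))"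
    and "(LINT x|lborel. of_real (gaussian t x) * \<e> (x \<bullet> y)) = complex_of_real (heat t y)"
proof -
  let ?c = "1 / sqrt t"
  have c: "?c > 0" "?c \<noteq> 0" using t by auto
  have gs: "gaussian t (?c *\<^sub>R x) = gaussian 1 x" for x :: 'a
    using t by (subst gaussian_scale) auto
  show "integrable lborel (\<lambda>x::'a. complex_of_real (gaussian t x))"
    unfolding integrable_iff_bounded
  proof
    have "(\<integral>\<^sub>+(x::'a). enorm (complex_of_real (gaussian t x))) =
       ennreal (?c ^ DIM('a)) * (\<integral>\<^sub>+(x::'a). enorm (complex_of_real (gaussian t (?c *\<^sub>R x))))"
      by (rule nn_integral_lborel_scale[OF _ c(1)]) measurable
    also have "\<dots> < \<infinity>" unfolding gs
      using gaussian_1_integrable[where 'a='a] unfolding integrable_iff_bounded by (simp add: ennreal_mult_less_top)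
    finally show "(\<integral>\<^sub>+(x::'a). enorm (complex_of_real (gaussian t x))) < \<infinity>" .
  qed measurable
  have "(LINT x|lborel. of_real (gaussian t x) * \<e> (x \<bullet> y)) =
     ?c ^ DIM('a) *\<^sub>R (LINT x|lborel. of_real (gaussian t (?c *\<^sub>R x)) * \<e> ((?c *\<^sub>R x) \<bullet> y))"
    by (rule integral_lborel_scale[OF _ c(1)]) measurable
  also have "\<dots> = ?c ^ DIM('a) *\<^sub>R (LINT x|lborel. of_real (gaussian 1 x) * \<e> (x \<bullet> (?c *\<^sub>R y)))"
    unfolding gs by simp
  also have "\<dots> = ?c ^ DIM('a) *\<^sub>R complex_of_real (gaussian 1 (?c *\<^sub>R y))"
    unfolding gaussian_1_fourier ..
  also have "gaussian 1 (?c *\<^sub>R y) = gaussian (1/t) y"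
    using t by (subst gaussian_scale[of "1/t"]) (auto simp: real_sqrt_divide)
  also have "?c ^ DIM('a) = t powr (- real DIM('a) / 2)"
    unfolding power_divide power_one powr_half_dim[OF t] minus_divide_left[symmetric] powr_minus_divide ..
  finally show "(LINT x|lborel. of_real (gaussian t x) * \<e> (x \<bullet> y)) = complex_of_real (heat t y)"
    by (simp add: heat_def scaleR_conv_of_real)
qed

lemma gaussian_eq_heat: "t > 0 \<Longrightarrow> gaussian t (x::'a::euclidean_space) = t powr (- real DIM('a) / 2) * heat (1 / t) x"
  by (simp add: heat_def powr_divide powr_minus)

lemma heat_fourier:
  fixes y :: "'a::euclidean_space"
  assumes r: "r > 0"
  shows "integrable lborel (\<lambda>x::'a. complex_of_real (heat r x))"
    and "(LINT x|lborel. of_real (heat r x) * \<e> (x \<bullet> y)) = complex_of_real (gaussian r y)"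
proof -
  show "integrable lborel (\<lambda>x::'a. complex_of_real (heat r x))"
    unfolding heat_def of_real_mult using gaussian_fourier(1)[of "1/r"] r by (intro integrable_mult_right) auto
  have "(LINT x|lborel. of_real (heat r x) * \<e> (x \<bullet> y)) =
     of_real (r powr (- real DIM('a) / 2)) * (LINT x|lborel. of_real (gaussian (1/r) x) * \<e> (x \<bullet> y))"
    unfolding heat_def of_real_mult by (simp only: mult.assoc integral_mult_right_zero)
  also have "\<dots> = of_real (r powr (- real DIM('a) / 2) * heat (1/r) y)"
    using r by (subst gaussian_fourier(2)) auto
  also have "r powr (- real DIM('a) / 2) * heat (1/r) y = gaussian r y"
    using r gaussian_eq_heat[of r y] by simp
  finally show "(LINT x|lborel. of_real (heat r x) * \<e> (x \<bullet> y)) = complex_of_real (gaussian r y)" .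
qed

lemma heat_nn_integral:
  assumes r: "r > 0"
  shows "(\<integral>\<^sub>+(x::'a::euclidean_space). ennreal (heat r x)) = 1"
proof -
  have i: "integrable lborel (\<lambda>x::'a. heat r x)" using integrable_Re[OF heat_fourier(1)[OF r, where 'a='a]] by simp
  have "complex_of_real (LINT (x::'a)|lborel. heat r x) = 1"
    using heat_fourier(2)[OF r, of "0::'a"] by (simp add: gaussian_def)
  then have "(LINT (x::'a)|lborel. heat r x) = 1" by simp
  then show ?thesis using i by (subst nn_integral_eq_integral) auto
qed

section \<open>Fourier integrals\<close>

text \<open>The integral with the opposite sign in the exponent. Most estimates concern this transform, because
  all the operators are given by their symbols.\<close>

definition ift :: "('a::euclidean_space \<Rightarrow> complex) \<Rightarrow> 'a \<Rightarrow> complex" where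
  "ift U x = (LINT \<xi>|lborel. U \<xi> * \<e> (x \<bullet> \<xi>))"

lemma exp_eq_cis: "exp (2 * of_real pi * \<i> * of_real r) = \<e> r"
  by (simp add: cis_conv_exp mult_ac)

lemma fourier_eq_cis: "fourier f \<xi> = (LINT x|lborel. f x * cis (- 2 * pi * (x \<bullet> \<xi>)))"
  unfolding fourier_def using exp_eq_cis[of "- (x \<bullet> \<xi>)" for x] by simp

lemma fourier_eq_ift: "fourier f \<xi> = ift f (- \<xi>)"
  unfolding fourier_eq_cis ift_def by (simp add: inner_commute)

lemma ift_measurable [measurable]:
  assumes [measurable]: "U \<in> \<B>"
  shows "ift U \<in> \<B>"
  unfolding ift_def by measurable

lemma ift_bound: "integrable lborel U \<Longrightarrow> norm (ift U x) \<le> (LINT \<xi>|lborel. norm (U \<xi>))"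
  unfolding ift_def
  by (rule order_trans[OF integral_norm_bound]) (simp add: norm_mult)

text \<open>The Bochner integral of a function that is not integrable is 0, so estimates for \<open>ift\<close> need no
  integrability hypothesis.\<close>

lemma ift_not_integrable:
  assumes [measurable]: "U \<in> \<B>" and n: "\<not> integrable lborel U"
  shows "ift U x = 0"
proof -
  have "\<not> integrable lborel (\<lambda>\<xi>. U \<xi> * \<e> (x \<bullet> \<xi>))"
  proof
    assume "integrable lborel (\<lambda>\<xi>. U \<xi> * \<e> (x \<bullet> \<xi>))"
    then have "integrable lborel (\<lambda>\<xi>. U \<xi> * \<e> (x \<bullet> \<xi>) * cis (- (2 * pi * (x \<bullet> \<xi>))))"
      by (rule integrable_mult_cis) simp
    then have "integrable lborel U" by (simp add: mult.assoc cis_mult)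
    with n show False ..
  qed
  then show ?thesis unfolding ift_def by (rule not_integrable_integral_eq)
qed

lemma Fubini_lborel:
  fixes f :: "'a::euclidean_space \<Rightarrow> 'b::euclidean_space \<Rightarrow> 'c::{banach, second_countable_topology}"
  assumes m: "case_prod f \<in> borel_measurable (lborel \<Otimes>\<^sub>M lborel)"
    and fin: "(\<integral>\<^sub>+x. \<integral>\<^sub>+y. enorm (f x y)) < \<infinity>"
  shows "(LINT x|lborel. LINT y|lborel. f x y) = (LINT y|lborel. LINT x|lborel. f x y)"
  using lborel_pair.Fubini_integral[OF integrable_lborel_pairI[OF m fin]] by simp

lemma nn_integral_norm_finite:
  fixes f :: "'a \<Rightarrow> 'b::{banach, second_countable_topology}"
  shows "integrable M f \<Longrightarrow> (\<integral>\<^sup>+x. enorm (f x) \<partial>M) < \<infinity>"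
  by (rule conjunct2[OF integrable_iff_bounded[THEN iffD1]])

lemma nn_integral_product_finite:
  fixes U :: "'a::euclidean_space \<Rightarrow> complex" and V :: "'b::euclidean_space \<Rightarrow> complex"
  assumes "integrable lborel U" "integrable lborel V"
  shows "(\<integral>\<^sub>+x. \<integral>\<^sub>+y. ennreal (norm (U x) * norm (V y))) < \<infinity>"
proof -
  have [measurable]: "U \<in> \<B>" "V \<in> \<B>" using assms by auto
  have "(\<integral>\<^sub>+x. \<integral>\<^sub>+y. ennreal (norm (U x) * norm (V y))) =
     (\<integral>\<^sub>+x. enorm (U x)) * (\<integral>\<^sub>+y. enorm (V y))"
    by (simp add: ennreal_mult nn_integral_cmult nn_integral_multc)
  then show ?thesis using nn_integral_norm_finite[OF assms(1)] nn_integral_norm_finite[OF assms(2)]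
    by (simp add: ennreal_mult_less_top)
qed

lemma fourier_multiplication_formula:
  assumes U: "integrable lborel U" and V: "integrable lborel V"
  shows "(LINT x|lborel. ift U x * V x) = (LINT \<xi>|lborel. U \<xi> * ift V \<xi>)"
proof -
  have [measurable]: "U \<in> \<B>" "V \<in> \<B>" using U V by auto
  have "(LINT x|lborel. ift U x * V x) = (LINT x|lborel. LINT \<xi>|lborel. U \<xi> * V x * \<e> (x \<bullet> \<xi>))"
    unfolding ift_def integral_mult_left_zero[symmetric] by (simp only: mult_ac)
  also have "\<dots> = (LINT \<xi>|lborel. LINT x|lborel. U \<xi> * V x * \<e> (x \<bullet> \<xi>))"
    using nn_integral_product_finite[OF V U] by (intro Fubini_lborel) (auto simp: norm_mult mult.commute)
  also have "\<dots> = (LINT \<xi>|lborel. U \<xi> * ift V \<xi>)"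
    unfolding ift_def by (simp add: inner_commute mult.assoc)
  finally show ?thesis .
qed

lemma borel_measurable_cnj [measurable (raw)]:
  "f \<in> borel_measurable M \<Longrightarrow> (\<lambda>x. cnj (f x)) \<in> borel_measurable M"
  by (rule borel_measurable_continuous_on[where f=cnj]) (auto intro!: continuous_intros)

lemma norm_integral_le_nn_integral:
  fixes f :: "'a \<Rightarrow> 'b::{banach, second_countable_topology}"
  shows "enorm (integral\<^sup>L M f) \<le> (\<integral>\<^sup>+x. enorm (f x) \<partial>M)"
proof (cases "integrable M f")
  case True then show ?thesis by (rule integral_norm_bound_ennreal)
next
  case False then show ?thesis by (simp add: not_integrable_integral_eq)
qed

lemma nn_integral_le_of_tendsto:
  fixes u :: "nat \<Rightarrow> 'a \<Rightarrow> ennreal"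
  assumes [measurable]: "\<And>n. u n \<in> borel_measurable M"
    and lim: "AE x in M. (\<lambda>n. u n x) \<longlonglongrightarrow> v x"
    and le: "\<And>n. (\<integral>\<^sup>+x. u n x \<partial>M) \<le> B"
  shows "(\<integral>\<^sup>+x. v x \<partial>M) \<le> B"
proof -
  have "(\<integral>\<^sup>+x. v x \<partial>M) = (\<integral>\<^sup>+x. liminf (\<lambda>n. u n x) \<partial>M)"
    using lim by (intro nn_integral_cong_AE) (auto elim!: eventually_mono simp: lim_imp_Liminf)
  also have "\<dots> \<le> liminf (\<lambda>n. \<integral>\<^sup>+x. u n x \<partial>M)" by (intro nn_integral_liminf) simp
  also have "\<dots> \<le> B" by (rule order_trans[OF Liminf_le_Limsup Limsup_bounded]) (auto simp: le)
  finally show ?thesis .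
qed

lemma integrable_gaussian_cis:
  "t > 0 \<Longrightarrow> integrable lborel (\<lambda>x::'a::euclidean_space. complex_of_real (gaussian t x) * \<e> (y \<bullet> x))"
  by (intro integrable_mult_cis gaussian_fourier(1)) auto

lemma ift_gaussian_modulated:
  fixes y z :: "'a::euclidean_space"
  assumes "t > 0"
  shows "ift (\<lambda>x. of_real (gaussian t x) * \<e> (y \<bullet> x)) z = of_real (heat t (y + z))"
proof -
  have "ift (\<lambda>x. of_real (gaussian t x) * \<e> (y \<bullet> x)) z
    = (LINT x|lborel. of_real (gaussian t x) * \<e> (x \<bullet> (y + z)))"
    unfolding ift_def by (simp only: mult.assoc cis_mult inner_add_right distrib_left inner_commute)
  also have "\<dots> = of_real (heat t (y + z))" by (rule gaussian_fourier(2)[OF assms])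
  finally show ?thesis .
qed

lemma fourier_gaussian_mean:
  fixes f :: "'a::euclidean_space \<Rightarrow> complex"
  assumes t: "t > 0" and f: "integrable lborel f"
  shows "ift (\<lambda>\<xi>. of_real (gaussian t \<xi>) * fourier f \<xi>) x = (LINT y|lborel. f y * of_real (heat t (y - x)))"
proof -
  have [measurable]: "f \<in> \<B>" using f by simp
  let ?V = "\<lambda>\<xi>. complex_of_real (gaussian t \<xi>) * \<e> ((- x) \<bullet> \<xi>)"
  have "ift (\<lambda>\<xi>. of_real (gaussian t \<xi>) * fourier f \<xi>) x =
     (LINT \<xi>|lborel. ift f (0 - \<xi>) * ?V (0 - \<xi>))"
    unfolding ift_def fourier_eq_ift by (simp add: gaussian_def mult_ac)
  also have "\<dots> = (LINT \<xi>|lborel. ift f \<xi> * ?V \<xi>)"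
    by (rule integral_lborel_reflection[of "\<lambda>\<xi>. ift f \<xi> * ?V \<xi>"]) measurable
  also have "\<dots> = (LINT y|lborel. f y * ift ?V y)"
    by (rule fourier_multiplication_formula[OF f integrable_gaussian_cis[OF t]])
  also have "\<dots> = (LINT y|lborel. f y * of_real (heat t (y - x)))"
    unfolding ift_gaussian_modulated[OF t] by simp
  finally show ?thesis .
qed

lemma gaussian_tendsto_1: "(\<lambda>n. gaussian (1 / real (Suc n)) x) \<longlonglongrightarrow> 1"
proof -
  have "(\<lambda>n. exp (- pi * (1 / real (Suc n)) * (norm x)\<^sup>2)) \<longlonglongrightarrow> exp (- pi * 0 * (norm x)\<^sup>2)"
    by (intro tendsto_exp tendsto_mult tendsto_const LIMSEQ_Suc[OF lim_1_over_n])
  then show ?thesis by (simp add: gaussian_def)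
qed

text \<open>The inequality in Plancherel's theorem. The integral of \<open>(norm (ift U x))\<^sup>2\<close> against a
  Gaussian of small parameter \<open>t\<close> is, by the multiplication formula, a double integral of
  \<open>U \<xi> * cnj (U \<eta>)\<close> against \<open>heat t (\<xi> - \<eta>)\<close>. As the heat kernel has mass 1, the bound
  \<open>2 p q \<le> p\<^sup>2 + q\<^sup>2\<close> estimates it by the right-hand side; let \<open>t\<close> tend to 0.\<close>

theorem ift_L2_le:
  fixes U :: "'a::euclidean_space \<Rightarrow> complex"
  assumes [measurable]: "U \<in> \<B>"
  shows "(\<integral>\<^sub>+x. nsq (ift U x)) \<le> (\<integral>\<^sub>+\<xi>. nsq (U \<xi>))"
proof (cases "integrable lborel U")
  case False
  then show ?thesis by (simp add: ift_not_integrable)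
next
  case U: True
  let ?I = "\<integral>\<^sub>+\<xi>. nsq (U \<xi>)"
  have weighted: "(\<integral>\<^sub>+x. ennreal ((norm (ift U x))\<^sup>2 * gaussian t x)) \<le> ?I" if t: "t > 0" for t
  proof -
    define W where "W = (\<lambda>\<eta>. cnj (U (0 - \<eta>)))"
    have W[measurable]: "W \<in> \<B>" unfolding W_def by measurable
    have Wi: "integrable lborel W"
      unfolding integrable_iff_bounded
    proof
      have "(\<integral>\<^sub>+\<eta>. enorm (W \<eta>)) = (\<integral>\<^sub>+\<eta>. enorm (U \<eta>))"
        unfolding W_def by (simp only: complex_mod_cnj) (rule nn_integral_lborel_reflection, measurable)
      also have "\<dots> < \<infinity>" by (rule nn_integral_norm_finite[OF U])
      finally show "(\<integral>\<^sub>+\<eta>. enorm (W \<eta>)) < \<infinity>" .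
    qed simp
    have cnj: "cnj (ift U x) = ift W x" for x
    proof -
      have "cnj (ift U x) = (LINT \<xi>|lborel. cnj (U \<xi>) * cis (- (2 * pi * (x \<bullet> \<xi>))))"
        unfolding ift_def Bochner_Integration.integral_cnj[symmetric] by (simp add: cis_cnj)
      also have "\<dots> = (LINT \<xi>|lborel. cnj (U (0 - \<xi>)) * cis (- (2 * pi * (x \<bullet> (0 - \<xi>)))))"
        by (rule integral_lborel_reflection[symmetric]) measurable
      also have "\<dots> = ift W x" unfolding ift_def W_def by simp
      finally show ?thesis .
    qed
    define B where "B = (LINT \<xi>|lborel. norm (U \<xi>))"
    have B: "norm (ift U x) \<le> B" for x unfolding B_def by (rule ift_bound[OF U])
    define V where "V = (\<lambda>x. complex_of_real (gaussian t x) * cnj (ift U x))"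
    have V: "integrable lborel V" unfolding V_def
      by (rule integrable_mult_bounded[OF gaussian_fourier(1)[OF t], where B=B]) (auto simp: B)
    have iV: "ift V \<xi> = (LINT \<eta>|lborel. cnj (U \<eta>) * of_real (heat t (\<xi> - \<eta>)))" for \<xi>
    proof -
      have "ift V \<xi> = (LINT x|lborel. ift W x * (of_real (gaussian t x) * \<e> (\<xi> \<bullet> x)))"
        unfolding ift_def[of V] unfolding V_def cnj by (simp only: mult_ac)
      also have "\<dots> = (LINT \<eta>|lborel. W \<eta> * of_real (heat t (\<xi> + \<eta>)))"
        by (subst fourier_multiplication_formula[OF Wi integrable_gaussian_cis[OF t]])
          (simp only: ift_gaussian_modulated[OF t])
      also have "\<dots> = (LINT \<eta>|lborel. W (0 - \<eta>) * of_real (heat t (\<xi> + (0 - \<eta>))))"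
        by (rule integral_lborel_reflection[symmetric]) measurable
      also have "\<dots> = (LINT \<eta>|lborel. cnj (U \<eta>) * of_real (heat t (\<xi> - \<eta>)))" unfolding W_def by simp
      finally show ?thesis .
    qed
    have pt: "ift U x * V x = of_real ((norm (ift U x))\<^sup>2 * gaussian t x)" for x
      unfolding V_def using complex_norm_square[of "ift U x"] by (simp add: mult_ac)
    have int: "integrable lborel (\<lambda>x. (norm (ift U x))\<^sup>2 * gaussian t x)"
    proof -
      have "integrable lborel (\<lambda>x. V x * ift U x)"
        by (rule integrable_mult_bounded[OF V, where B=B]) (auto simp: B)
      then have "integrable lborel (\<lambda>x. complex_of_real ((norm (ift U x))\<^sup>2 * gaussian t x))"
        by (subst pt[symmetric]) (simp only: mult.commute)
      from integrable_Re[OF this] show ?thesis by simp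
    qed
    define J where "J = (LINT x|lborel. (norm (ift U x))\<^sup>2 * gaussian t x)"
    have "complex_of_real J = (LINT x|lborel. ift U x * V x)"
      unfolding J_def pt by (rule integral_complex_of_real[symmetric])
    also have "\<dots> = (LINT \<xi>|lborel. U \<xi> * ift V \<xi>)"
      by (rule fourier_multiplication_formula[OF U V])
    finally have Jeq: "complex_of_real J = (LINT \<xi>|lborel. U \<xi> * ift V \<xi>)" .
    have J0: "J \<ge> 0" unfolding J_def by (intro integral_nonneg_AE) auto
    have "(\<integral>\<^sub>+x. ennreal ((norm (ift U x))\<^sup>2 * gaussian t x)) = ennreal J"
      unfolding J_def by (rule nn_integral_eq_integral[OF int]) auto
    also have "ennreal J = enorm (complex_of_real J)" using J0 by simp
    also have "\<dots> \<le> (\<integral>\<^sub>+\<xi>. enorm (U \<xi> * ift V \<xi>))"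
      unfolding Jeq by (rule norm_integral_le_nn_integral)
    also have "\<dots> = (\<integral>\<^sub>+\<xi>. enorm (U \<xi>) * enorm (ift V \<xi>))"
      by (simp add: norm_mult ennreal_mult)
    also have "\<dots> \<le> (\<integral>\<^sub>+\<xi>. enorm (U \<xi>) *
        (\<integral>\<^sub>+\<eta>. enorm (U \<eta>) * ennreal (heat t (\<xi> - \<eta>))))"
    proof (intro nn_integral_mono mult_left_mono)
      fix \<xi> show "enorm (ift V \<xi>) \<le> (\<integral>\<^sub>+\<eta>. enorm (U \<eta>) * ennreal (heat t (\<xi> - \<eta>)))"
        unfolding iV by (rule order_trans[OF norm_integral_le_nn_integral])
          (simp add: norm_mult ennreal_mult)
    qed simp
    also have "\<dots> = (\<integral>\<^sub>+\<xi>. \<integral>\<^sub>+\<eta>. ennreal (norm (U \<xi>) * norm (U \<eta>) * heat t (\<xi> - \<eta>)))"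
      by (subst nn_integral_cmult[symmetric]) (auto simp: ennreal_mult mult.assoc)
    also have "\<dots> \<le> (\<integral>\<^sub>+\<xi>. \<integral>\<^sub>+\<eta>. (ennreal ((norm (U \<xi>))\<^sup>2 / 2) * ennreal (heat t (\<xi> - \<eta>)) +
        ennreal ((norm (U \<eta>))\<^sup>2 / 2) * ennreal (heat t (\<xi> - \<eta>))))"
    proof (intro nn_integral_mono)
      fix \<xi> \<eta>
      have "norm (U \<xi>) * norm (U \<eta>) \<le> (norm (U \<xi>))\<^sup>2 / 2 + (norm (U \<eta>))\<^sup>2 / 2"
        using zero_le_power2[of "norm (U \<xi>) - norm (U \<eta>)"] by (simp add: power2_eq_square algebra_simps)
      then have "norm (U \<xi>) * norm (U \<eta>) * heat t (\<xi> - \<eta>) \<le> ((norm (U \<xi>))\<^sup>2 / 2 + (norm (U \<eta>))\<^sup>2 / 2) * heat t (\<xi> - \<eta>)"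
        by (intro mult_right_mono) auto
      then have "ennreal (norm (U \<xi>) * norm (U \<eta>) * heat t (\<xi> - \<eta>)) \<le> ennreal (((norm (U \<xi>))\<^sup>2 / 2 + (norm (U \<eta>))\<^sup>2 / 2) * heat t (\<xi> - \<eta>))"
        by (rule ennreal_leI)
      then show "ennreal (norm (U \<xi>) * norm (U \<eta>) * heat t (\<xi> - \<eta>)) \<le> ennreal ((norm (U \<xi>))\<^sup>2 / 2) * ennreal (heat t (\<xi> - \<eta>)) +
        ennreal ((norm (U \<eta>))\<^sup>2 / 2) * ennreal (heat t (\<xi> - \<eta>))"
        by (simp only: distrib_right ennreal_mult'[OF heat_nonneg] ennreal_mult''[OF heat_nonneg] ennreal_plus divide_nonneg_nonneg
          zero_le_power2 zero_le_numeral mult_nonneg_nonneg heat_nonneg)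
    qed
    also have "\<dots> = (\<integral>\<^sub>+\<xi>. \<integral>\<^sub>+\<eta>. ennreal ((norm (U \<xi>))\<^sup>2 / 2) * ennreal (heat t (\<xi> - \<eta>))) +
        (\<integral>\<^sub>+\<xi>. \<integral>\<^sub>+\<eta>. ennreal ((norm (U \<eta>))\<^sup>2 / 2) * ennreal (heat t (\<xi> - \<eta>)))"
      by (simp add: nn_integral_add)
    also have "(\<integral>\<^sub>+\<xi>. \<integral>\<^sub>+\<eta>. ennreal ((norm (U \<eta>))\<^sup>2 / 2) * ennreal (heat t (\<xi> - \<eta>))) =
      (\<integral>\<^sub>+\<eta>. \<integral>\<^sub>+\<xi>. ennreal ((norm (U \<eta>))\<^sup>2 / 2) * ennreal (heat t (\<eta> - \<xi>)))"
      by (subst lborel_pair.Fubini') (auto simp: heat_diff_commute)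
    also have "(\<integral>\<^sub>+\<xi>. \<integral>\<^sub>+\<eta>. ennreal ((norm (U \<xi>))\<^sup>2 / 2) * ennreal (heat t (\<xi> - \<eta>)))
       = (\<integral>\<^sub>+\<xi>. ennreal ((norm (U \<xi>))\<^sup>2 / 2))"
    proof (intro nn_integral_cong)
      fix \<xi> :: 'a
      have "(\<integral>\<^sub>+\<eta>. ennreal (heat t (\<xi> - \<eta>))) = (\<integral>\<^sub>+\<eta>. ennreal (heat t (\<eta>::'a)))"
        by (rule nn_integral_lborel_reflection[of "\<lambda>z. ennreal (heat t z)"]) simp
      then show "(\<integral>\<^sub>+\<eta>. ennreal ((norm (U \<xi>))\<^sup>2 / 2) * ennreal (heat t (\<xi> - \<eta>))) = ennreal ((norm (U \<xi>))\<^sup>2 / 2)"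
        by (simp add: nn_integral_cmult heat_nn_integral[OF t])
    qed
    also have "\<dots> + \<dots> = (\<integral>\<^sub>+\<xi>. ennreal ((norm (U \<xi>))\<^sup>2 / 2) + ennreal ((norm (U \<xi>))\<^sup>2 / 2))"
      by (subst nn_integral_add) auto
    also have "\<dots> = ?I" by (simp add: ennreal_plus[symmetric] del: ennreal_plus)
    finally show ?thesis .
  qed
  show ?thesis
  proof (rule nn_integral_le_of_tendsto[where u="\<lambda>n x. ennreal ((norm (ift U x))\<^sup>2 * gaussian (1 / real (Suc n)) x)"])
    have "(\<lambda>n. ennreal ((norm (ift U x))\<^sup>2 * gaussian (1 / real (Suc n)) x)) \<longlonglongrightarrow> ennreal ((norm (ift U x))\<^sup>2 * 1)" for x
      by (intro tendsto_ennrealI tendsto_mult tendsto_const gaussian_tendsto_1)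
    then show "AE x in lborel. (\<lambda>n. ennreal ((norm (ift U x))\<^sup>2 * gaussian (1 / real (Suc n)) x)) \<longlonglongrightarrow> nsq (ift U x)"
      by simp
  qed (auto intro!: weighted)
qed

lemma fourier_L2_le:
  fixes f :: "'a::euclidean_space \<Rightarrow> complex"
  assumes [measurable]: "f \<in> \<B>"
  shows "(\<integral>\<^sub>+\<xi>. nsq (fourier f \<xi>)) \<le> (\<integral>\<^sub>+x. nsq (f x))"
proof -
  have "(\<integral>\<^sub>+\<xi>. nsq (fourier f \<xi>)) = (\<integral>\<^sub>+\<xi>. nsq (ift f (0 - \<xi>)))"
    by (simp add: fourier_eq_ift)
  also have "\<dots> = (\<integral>\<^sub>+\<xi>. nsq (ift f \<xi>))"
    by (rule nn_integral_lborel_reflection) measurable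
  also have "\<dots> \<le> (\<integral>\<^sub>+x. nsq (f x))" by (rule ift_L2_le) simp
  finally show ?thesis .
qed

text \<open>Insert a Gaussian of parameter \<open>1 / (n + 1)\<close> into the inversion integral. By
  \<open>fourier_gaussian_mean\<close> the result is a mean of \<open>f\<close> near \<open>x\<close>, which tends to \<open>f x\<close> by continuity.\<close>

theorem fourier_inversion:
  fixes f :: "'a::euclidean_space \<Rightarrow> complex"
  assumes f: "integrable lborel f" and c: "continuous_on UNIV f" and b: "\<And>x. norm (f x) \<le> B"
    and i: "integrable lborel (fourier f)"
  shows "ift (fourier f) x = f x"
proof -
  have [measurable]: "f \<in> \<B>" "fourier f \<in> \<B>" using f i by auto
  let ?t = "\<lambda>n. 1 / real (Suc n)"
  have l1: "(\<lambda>n. ift (\<lambda>\<xi>. of_real (gaussian (?t n) \<xi>) * fourier f \<xi>) x) \<longlonglongrightarrow> ift (fourier f) x"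
    unfolding ift_def
  proof (rule integral_dominated_convergence[where w="\<lambda>\<xi>. norm (fourier f \<xi>)"])
    show "AE \<xi> in lborel. (\<lambda>n. complex_of_real (gaussian (?t n) \<xi>) * fourier f \<xi> * \<e> (x \<bullet> \<xi>)) \<longlonglongrightarrow> fourier f \<xi> * \<e> (x \<bullet> \<xi>)"
    proof (intro AE_I2)
      fix \<xi> :: 'a
      have "(\<lambda>n. complex_of_real (gaussian (?t n) \<xi>) * fourier f \<xi> * \<e> (x \<bullet> \<xi>)) \<longlonglongrightarrow> of_real 1 * fourier f \<xi> * \<e> (x \<bullet> \<xi>)"
        by (intro tendsto_mult tendsto_of_real gaussian_tendsto_1 tendsto_const)
      then show "(\<lambda>n. complex_of_real (gaussian (?t n) \<xi>) * fourier f \<xi> * \<e> (x \<bullet> \<xi>)) \<longlonglongrightarrow> fourier f \<xi> * \<e> (x \<bullet> \<xi>)" by simp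
    qed
    show "AE \<xi> in lborel. norm (complex_of_real (gaussian (?t n) \<xi>) * fourier f \<xi> * \<e> (x \<bullet> \<xi>)) \<le> norm (fourier f \<xi>)" for n
      by (intro AE_I2) (auto simp: norm_mult gaussian_le_1 intro!: mult_left_le_one_le)
  qed (use i in auto)
  have eq: "ift (\<lambda>\<xi>. of_real (gaussian t \<xi>) * fourier f \<xi>) x = (LINT u|lborel. f (x + sqrt t *\<^sub>R u) * of_real (heat 1 u))"
    if t: "t > 0" for t
  proof -
    have "ift (\<lambda>\<xi>. of_real (gaussian t \<xi>) * fourier f \<xi>) x = (LINT y|lborel. f y * of_real (heat t (y - x)))"
      by (rule fourier_gaussian_mean[OF t f])
    also have "\<dots> = (LINT z|lborel. f (x + z) * of_real (heat t ((x + z) - x)))"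
      by (rule integral_lborel_translation[symmetric]) measurable
    also have "\<dots> = (LINT z|lborel. f (x + z) * of_real (heat t z))" by simp
    also have "\<dots> = sqrt t ^ DIM('a) *\<^sub>R (LINT u|lborel. f (x + sqrt t *\<^sub>R u) * of_real (heat t (sqrt t *\<^sub>R u)))"
      by (rule integral_lborel_scale) (use t in auto)
    also have "\<dots> = (LINT u|lborel. f (x + sqrt t *\<^sub>R u) * of_real (heat 1 u))"
      unfolding integral_scaleR_right[symmetric]
    proof (intro LINT_cong refl)
      fix u :: 'a
      have "sqrt t ^ DIM('a) * heat t (sqrt t *\<^sub>R u) = heat 1 u"
        unfolding heat_def powr_half_dim[OF t] gaussian_def minus_divide_left[symmetric] powr_minus
        using t by (simp add: power_mult_distrib field_simps)
      then have "complex_of_real (sqrt t ^ DIM('a)) * of_real (heat t (sqrt t *\<^sub>R u)) = of_real (heat 1 u)"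
        by (metis of_real_mult)
      then show "sqrt t ^ DIM('a) *\<^sub>R (f (x + sqrt t *\<^sub>R u) * of_real (heat t (sqrt t *\<^sub>R u))) =
         f (x + sqrt t *\<^sub>R u) * of_real (heat 1 u)"
        unfolding scaleR_conv_of_real by (metis mult.left_commute)
    qed
    finally show ?thesis .
  qed
  have "(\<lambda>n. LINT u|lborel. f (x + sqrt (?t n) *\<^sub>R u) * of_real (heat 1 u)) \<longlonglongrightarrow> (LINT (u::'a)|lborel. f x * of_real (heat 1 u))"
  proof (rule integral_dominated_convergence[where w="\<lambda>u::'a. B * heat 1 u"])
    show "integrable lborel (\<lambda>u. B * heat 1 (u::'a))"
      using integrable_Re[OF heat_fourier(1)[of 1, where 'a='a]] by simp
    show "AE u in lborel. (\<lambda>n. f (x + sqrt (?t n) *\<^sub>R u) * of_real (heat 1 u)) \<longlonglongrightarrow> f x * of_real (heat 1 u)"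
    proof (intro AE_I2 tendsto_mult tendsto_const)
      fix u :: 'a
      have "(\<lambda>n. x + sqrt (?t n) *\<^sub>R u) \<longlonglongrightarrow> x + sqrt 0 *\<^sub>R u"
        by (intro tendsto_intros LIMSEQ_Suc[OF lim_1_over_n])
      then have "(\<lambda>n. x + sqrt (?t n) *\<^sub>R u) \<longlonglongrightarrow> x" by simp
      then show "(\<lambda>n. f (x + sqrt (?t n) *\<^sub>R u)) \<longlonglongrightarrow> f x"
        using c by (intro isCont_tendsto_compose[of x f]) (auto simp: continuous_on_eq_continuous_at)
    qed
    show "AE u in lborel. norm (f (x + sqrt (?t n) *\<^sub>R u) * of_real (heat 1 u)) \<le> B * heat 1 u" for n
      by (intro AE_I2) (auto simp: norm_mult intro!: mult_right_mono b)
  qed auto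
  also have "(LINT (u::'a)|lborel. f x * complex_of_real (heat 1 u)) = f x"
    using heat_fourier(2)[of 1 "0::'a"] by (simp add: gaussian_def)
  finally have "(\<lambda>n. LINT u|lborel. f (x + sqrt (?t n) *\<^sub>R u) * of_real (heat 1 u)) \<longlonglongrightarrow> f x" .
  moreover have "(LINT u|lborel. f (x + sqrt (?t n) *\<^sub>R u) * of_real (heat 1 u)) =
     ift (\<lambda>\<xi>. of_real (gaussian (?t n) \<xi>) * fourier f \<xi>) x" for n
    by (rule eq[symmetric]) simp
  ultimately show ?thesis using l1 LIMSEQ_unique by simp
qed

section \<open>The maximal function of the heat semigroup\<close>

lemma heat_le_heat:
  fixes z :: "'a::euclidean_space"
  assumes r: "0 < r" "r \<le> R" "R \<le> 2 * r"
  shows "heat r z \<le> 2 powr (real DIM('a) / 2) * heat R z"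
proof -
  have "r powr (- (real DIM('a) / 2)) \<le> (R / 2) powr (- (real DIM('a) / 2))"
    using r by (intro powr_mono2') auto
  also have "\<dots> = 2 powr (real DIM('a) / 2) * R powr (- (real DIM('a) / 2))"
    using r by (simp add: powr_divide powr_minus field_simps)
  finally have 1: "r powr (- (real DIM('a) / 2)) \<le> 2 powr (real DIM('a) / 2) * R powr (- (real DIM('a) / 2))" .
  have "pi * (1 / R) * (norm z)\<^sup>2 \<le> pi * (1 / r) * (norm z)\<^sup>2"
    using r by (intro mult_right_mono mult_left_mono divide_left_mono) auto
  then have 2: "gaussian (1/r) z \<le> gaussian (1/R) z" by (simp add: gaussian_def)
  show ?thesis unfolding heat_def minus_divide_left[symmetric]
    using mult_mono[OF 1 2] by (simp add: mult.assoc)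
qed

text \<open>Completing the square.\<close>

lemma heat_product:
  fixes a w :: "'a::euclidean_space"
  assumes r: "r > 0" and s: "s > 0"
  shows "heat r (a - w) * heat s w = heat (r + s) a * heat (r * s / (r + s)) (w - (s / (r + s)) *\<^sub>R a)"
proof -
  have pos: "r + s > 0" using r s by simp
  have powr: "r powr d * s powr d = (r + s) powr d * (r * s / (r + s)) powr d" for d
    using r s pos by (simp add: powr_mult[symmetric])
  let ?p = "a \<bullet> a" and ?q = "a \<bullet> w" and ?u = "w \<bullet> w"
  have "(norm (a - w))\<^sup>2 = ?p - 2 * ?q + ?u"
    by (simp add: power2_norm_eq_inner inner_diff inner_commute algebra_simps)
  moreover have "(norm (w - (s / (r + s)) *\<^sub>R a))\<^sup>2 = ?u - 2 * (s / (r + s)) * ?q + (s / (r + s))\<^sup>2 * ?p"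
    unfolding power2_norm_eq_inner by (simp add: inner_diff inner_commute algebra_simps power2_eq_square)
  moreover have "(?p - 2 * ?q + ?u) / r + ?u / s = ?p / (r + s) +
      (?u - 2 * (s / (r + s)) * ?q + (s / (r + s))\<^sup>2 * ?p) / (r * s / (r + s))" 
  proof -
    have "(p - 2 * q + u) / r + u / s = p / (r + s) +
      (u - 2 * (s / (r + s)) * q + (s / (r + s))\<^sup>2 * p) / (r * s / (r + s))" for p q u :: real
      using r s pos by (simp add: divide_simps power2_eq_square) algebra
    then show ?thesis .
  qed
  ultimately have e: "(norm (a - w))\<^sup>2 / r + (norm w)\<^sup>2 / s =
     (norm a)\<^sup>2 / (r + s) + (norm (w - (s / (r + s)) *\<^sub>R a))\<^sup>2 / (r * s / (r + s))"
    by (simp only: power2_norm_eq_inner[of a] power2_norm_eq_inner[of w])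
  have g: "gaussian (1 / r) (a - w) * gaussian (1 / s) w =
      gaussian (1 / (r + s)) a * gaussian (1 / (r * s / (r + s))) (w - (s / (r + s)) *\<^sub>R a)"
    unfolding gaussian_def exp_add[symmetric]
    using arg_cong[OF e, of "\<lambda>v. - pi * v"] by (simp add: algebra_simps)
  have "heat r (a - w) * heat s w = (r powr (- real DIM('a) / 2) * s powr (- real DIM('a) / 2)) *
     (gaussian (1 / r) (a - w) * gaussian (1 / s) w)" unfolding heat_def by (simp only: mult_ac)
  also have "\<dots> = heat (r + s) a * heat (r * s / (r + s)) (w - (s / (r + s)) *\<^sub>R a)"
    unfolding powr g unfolding heat_def by (simp only: mult_ac)
  finally show ?thesis .
qed

lemma heat_semigroup:
  fixes x y :: "'a::euclidean_space"
  assumes r: "r > 0" and s: "s > 0"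
  shows "(\<integral>\<^sub>+z. ennreal (heat r (x - z)) * ennreal (heat s (z - y))) = ennreal (heat (r + s) (x - y))"
proof -
  let ?c = "(s / (r + s)) *\<^sub>R (x - y)"
  have "(\<integral>\<^sub>+z. ennreal (heat r (x - z)) * ennreal (heat s (z - y))) =
    (\<integral>\<^sub>+w. ennreal (heat r (x - (y + w))) * ennreal (heat s (y + w - y)))"
    by (rule nn_integral_lborel_translation[symmetric, of "\<lambda>z. ennreal (heat r (x - z)) * ennreal (heat s (z - y))"]) measurable
  also have "\<dots> = (\<integral>\<^sub>+w. ennreal (heat (r + s) (x - y)) * ennreal (heat (r * s / (r + s)) (- ?c + w)))"
    using heat_product[OF r s, of "x - y"] by (simp add: ennreal_mult[symmetric] diff_diff_eq)
  also have "\<dots> = ennreal (heat (r + s) (x - y)) * (\<integral>\<^sub>+w. ennreal (heat (r * s / (r + s)) (- ?c + w)))"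
    by (rule nn_integral_cmult) measurable
  also have "(\<integral>\<^sub>+w. ennreal (heat (r * s / (r + s)) (- ?c + w))) = (\<integral>\<^sub>+w. ennreal (heat (r * s / (r + s)) (w::'a)))"
    by (rule nn_integral_lborel_translation[of "\<lambda>z. ennreal (heat (r * s / (r + s)) z)"]) measurable
  also have "\<dots> = 1" using r s by (intro heat_nn_integral) auto
  finally show ?thesis by simp
qed

definition heat_conv :: "real \<Rightarrow> ('a::euclidean_space \<Rightarrow> ennreal) \<Rightarrow> 'a \<Rightarrow> ennreal" where
  "heat_conv r f x = (\<integral>\<^sub>+y. ennreal (heat r (x - y)) * f y)"

lemma heat_conv_measurable [measurable]:
  assumes [measurable]: "f \<in> \<B>"
  shows "heat_conv r f \<in> \<B>"
  unfolding heat_conv_def by measurable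

lemma heat_conv_symmetric:
  assumes [measurable]: "f \<in> \<B>" "g \<in> \<B>"
  shows "(\<integral>\<^sub>+x. g x * heat_conv r f x) = (\<integral>\<^sub>+x. f x * heat_conv r g x)"
proof -
  have "(\<integral>\<^sub>+x. g x * heat_conv r f x) = (\<integral>\<^sub>+x. \<integral>\<^sub>+y. g x * (ennreal (heat r (x - y)) * f y))"
    unfolding heat_conv_def by (simp add: nn_integral_cmult)
  also have "\<dots> = (\<integral>\<^sub>+y. \<integral>\<^sub>+x. g x * (ennreal (heat r (x - y)) * f y))"
    by (subst lborel_pair.Fubini') auto
  also have "\<dots> = (\<integral>\<^sub>+y. \<integral>\<^sub>+x. f y * (ennreal (heat r (y - x)) * g x))"
    by (simp add: heat_diff_commute mult_ac)
  also have "\<dots> = (\<integral>\<^sub>+x. f x * heat_conv r g x)"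
    unfolding heat_conv_def by (simp add: nn_integral_cmult)
  finally show ?thesis .
qed

lemma heat_conv_heat_conv:
  assumes r: "r > 0" and s: "s > 0" and [measurable]: "f \<in> \<B>"
  shows "heat_conv r (heat_conv s f) x = heat_conv (r + s) f x"
proof -
  have "heat_conv r (heat_conv s f) x = (\<integral>\<^sub>+z. \<integral>\<^sub>+y. ennreal (heat r (x - z)) * (ennreal (heat s (z - y)) * f y))"
    unfolding heat_conv_def by (simp add: nn_integral_cmult)
  also have "\<dots> = (\<integral>\<^sub>+y. \<integral>\<^sub>+z. ennreal (heat r (x - z)) * (ennreal (heat s (z - y)) * f y))"
    by (subst lborel_pair.Fubini') auto
  also have "\<dots> = (\<integral>\<^sub>+y. (\<integral>\<^sub>+z. ennreal (heat r (x - z)) * ennreal (heat s (z - y))) * f y)"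
    by (simp add: nn_integral_multc[symmetric] mult.assoc)
  also have "\<dots> = heat_conv (r + s) f x"
    unfolding heat_semigroup[OF r s] heat_conv_def ..
  finally show ?thesis .
qed

lemma heat_conv_inner:
  assumes r: "r > 0" and s: "s > 0" and [measurable]: "f \<in> \<B>" "g \<in> \<B>"
  shows "(\<integral>\<^sub>+x. heat_conv r f x * heat_conv s g x) = (\<integral>\<^sub>+x. f x * heat_conv (r + s) g x)"
proof -
  have "(\<integral>\<^sub>+x. heat_conv r f x * heat_conv s g x) = (\<integral>\<^sub>+x. heat_conv s g x * heat_conv r f x)"
    by (simp add: mult.commute)
  also have "\<dots> = (\<integral>\<^sub>+x. f x * heat_conv r (heat_conv s g) x)"
    by (rule heat_conv_symmetric) measurable
  finally show ?thesis using heat_conv_heat_conv[OF r s, of g] by simp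
qed

lemma heat_conv_L2_le:
  fixes f :: "'a::euclidean_space \<Rightarrow> ennreal"
  assumes r: "r > 0" and [measurable]: "f \<in> \<B>"
  shows "(\<integral>\<^sub>+x. (heat_conv r f x)\<^sup>2) \<le> (\<integral>\<^sub>+x. (f x)\<^sup>2)"
proof -
  have one: "(\<integral>\<^sub>+y. ennreal (heat r (x - y))) = 1" for x :: 'a
    by (subst nn_integral_lborel_reflection[of "\<lambda>z. ennreal (heat r z)"]) (auto simp: heat_nn_integral[OF r])
  have pt: "(heat_conv r f x)\<^sup>2 \<le> heat_conv r (\<lambda>y. (f y)\<^sup>2) x" for x
  proof -
    have "(heat_conv r f x)\<^sup>2 \<le> (\<integral>\<^sub>+y. ennreal (heat r (x - y))) * (\<integral>\<^sub>+y. ennreal (heat r (x - y)) * (f y)\<^sup>2)"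
      unfolding heat_conv_def
      by (rule nn_integral_Cauchy_Schwarz_dominated) (auto simp: power2_eq_square mult_ac)
    then show ?thesis by (simp add: one heat_conv_def)
  qed
  have "(\<integral>\<^sub>+x. (heat_conv r f x)\<^sup>2) \<le> (\<integral>\<^sub>+x. 1 * heat_conv r (\<lambda>y. (f y)\<^sup>2) x)"
    using pt by (intro nn_integral_mono) simp
  also have "\<dots> = (\<integral>\<^sub>+x. (f x)\<^sup>2 * heat_conv r (\<lambda>_. 1) x)"
    by (rule heat_conv_symmetric) measurable
  also have "\<dots> = (\<integral>\<^sub>+x. (f x)\<^sup>2)" by (simp add: heat_conv_def one)
  finally show ?thesis .
qed

lemma heat_conv_sum:
  assumes "finite S" and [measurable]: "\<And>s. s \<in> S \<Longrightarrow> g s \<in> \<B>"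
  shows "heat_conv r (\<lambda>x. \<Sum>s\<in>S. g s x) x = (\<Sum>s\<in>S. heat_conv r (g s) x)"
  unfolding heat_conv_def sum_distrib_left by (rule nn_integral_sum) measurable

definition heat_max :: "real set \<Rightarrow> ('a::euclidean_space \<Rightarrow> ennreal) \<Rightarrow> 'a \<Rightarrow> ennreal" where
  "heat_max S f x = (SUP r\<in>S. heat_conv r f x)"

lemma heat_max_measurable:
  assumes "countable S" and [measurable]: "f \<in> \<B>"
  shows "heat_max S f \<in> \<B>"
  unfolding heat_max_def using assms(1) by (intro borel_measurable_SUP) auto

lemma heat_max_ge: "r \<in> S \<Longrightarrow> heat_conv r f x \<le> heat_max S f x"
  unfolding heat_max_def by (rule SUP_upper)

text \<open>The bound is first studied for finite sets of times, with a constant that may depend on their number.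
  The type argument carries the dimension.\<close>

definition heat_bound :: "nat \<Rightarrow> real \<Rightarrow> 'a::euclidean_space itself \<Rightarrow> bool" where
  "heat_bound L K _ \<longleftrightarrow> (\<forall>S. finite S \<and> S \<noteq> {} \<and> card S \<le> L \<and> S \<subseteq> {0<..} \<longrightarrow>
     (\<forall>f::'a \<Rightarrow> ennreal. f \<in> \<B> \<longrightarrow>
       (\<integral>\<^sub>+x. (heat_max S f x)\<^sup>2) \<le> ennreal K * (\<integral>\<^sub>+x. (f x)\<^sup>2)))"

lemma heat_bound_initial: "heat_bound L (real L) TYPE('a::euclidean_space)"
  unfolding heat_bound_def
proof (intro allI impI, elim conjE)
  fix S :: "real set" and f :: "'a \<Rightarrow> ennreal"
  assume S: "finite S" "S \<noteq> {}" "card S \<le> L" "S \<subseteq> {0<..}" and [measurable]: "f \<in> \<B>"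
  have "(heat_max S f x)\<^sup>2 \<le> (\<Sum>r\<in>S. (heat_conv r f x)\<^sup>2)" for x
  proof -
    obtain r where r: "r \<in> S" "heat_max S f x = heat_conv r f x"
      unfolding heat_max_def using S(1,2) by (metis (mono_tags) finite_imageI Max_Sup Max_in image_iff image_is_empty)
    show ?thesis unfolding r(2) using r(1) S(1) by (intro member_le_sum) auto
  qed
  then have "(\<integral>\<^sub>+x. (heat_max S f x)\<^sup>2) \<le> (\<integral>\<^sub>+x. (\<Sum>r\<in>S. (heat_conv r f x)\<^sup>2))"
    by (intro nn_integral_mono)
  also have "\<dots> = (\<Sum>r\<in>S. \<integral>\<^sub>+x. (heat_conv r f x)\<^sup>2)"
    by (rule nn_integral_sum) measurable
  also have "\<dots> \<le> (\<Sum>r\<in>S. \<integral>\<^sub>+x. (f x)\<^sup>2)"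
    using S by (intro sum_mono heat_conv_L2_le) auto
  also have "\<dots> = of_nat (card S) * (\<integral>\<^sub>+x. (f x)\<^sup>2)" by simp
  also have "\<dots> \<le> of_nat L * (\<integral>\<^sub>+x. (f x)\<^sup>2)"
    using S by (intro mult_right_mono) auto
  finally show "(\<integral>\<^sub>+x. (heat_max S f x)\<^sup>2) \<le> ennreal (real L) * (\<integral>\<^sub>+x. (f x)\<^sup>2)"
    by (simp add: ennreal_of_nat_eq_real_of_nat)
qed

text \<open>One of \<open>2 r\<close>, \<open>2 s\<close> lies between \<open>r + s\<close> and \<open>2 (r + s)\<close>, and the kernels of comparable
  times are comparable.\<close>

lemma heat_conv_sum_le:
  fixes g :: "'a::euclidean_space \<Rightarrow> ennreal"
  assumes r: "r > 0" and s: "s > 0" and [measurable]: "g \<in> \<B>"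
  shows "heat_conv (r + s) g x \<le> ennreal (2 powr (real DIM('a) / 2)) * (heat_conv (2 * r) g x + heat_conv (2 * s) g x)"
proof -
  let ?C = "2 powr (real DIM('a) / 2)"
  have "heat_conv (r + s) g x \<le> (\<integral>\<^sub>+y. ennreal ?C * (ennreal (heat (2 * r) (x - y)) * g y + ennreal (heat (2 * s) (x - y)) * g y))"
    unfolding heat_conv_def
  proof (intro nn_integral_mono)
    fix y
    have "heat (r + s) (x - y) \<le> ?C * (heat (2 * r) (x - y) + heat (2 * s) (x - y))"
    proof (cases "s \<le> r")
      case True
      then have "heat (r + s) (x - y) \<le> ?C * heat (2 * r) (x - y)" using r s by (intro heat_le_heat) auto
      also have "\<dots> \<le> ?C * (heat (2 * r) (x - y) + heat (2 * s) (x - y))" by (intro mult_left_mono) auto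
      finally show ?thesis .
    next
      case False
      then have "heat (r + s) (x - y) \<le> ?C * heat (2 * s) (x - y)" using r s by (intro heat_le_heat) auto
      also have "\<dots> \<le> ?C * (heat (2 * r) (x - y) + heat (2 * s) (x - y))" by (intro mult_left_mono) auto
      finally show ?thesis .
    qed
    then have "ennreal (heat (r + s) (x - y)) \<le> ennreal (?C * (heat (2 * r) (x - y) + heat (2 * s) (x - y)))"
      by (rule ennreal_leI)
    also have "\<dots> = ennreal ?C * (ennreal (heat (2 * r) (x - y)) + ennreal (heat (2 * s) (x - y)))"
      by (simp add: ennreal_mult)
    finally have "ennreal (heat (r + s) (x - y)) * g y \<le> ennreal ?C * (ennreal (heat (2 * r) (x - y)) + ennreal (heat (2 * s) (x - y))) * g y"
      by (intro mult_right_mono) auto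
    then show "ennreal (heat (r + s) (x - y)) * g y \<le> ennreal ?C * (ennreal (heat (2 * r) (x - y)) * g y + ennreal (heat (2 * s) (x - y)) * g y)"
      by (simp only: mult.assoc distrib_right)
  qed
  also have "\<dots> = ennreal ?C * (heat_conv (2 * r) g x + heat_conv (2 * s) g x)"
    unfolding heat_conv_def by (simp add: nn_integral_cmult nn_integral_add)
  finally show ?thesis .
qed

text \<open>Linearization and duality. Choose measurably a time \<open>r x\<close> at which the maximum \<open>g x\<close> is attained and
  let \<open>gr r\<close> be \<open>g\<close> restricted to the set where \<open>r\<close> is chosen. As heat operators are symmetric, the
  integral of \<open>g\<^sup>2\<close> is the pairing of \<open>f\<close> with the sum \<open>a\<close> of all \<open>heat_conv r (gr r)\<close>. Squaring \<open>a\<close>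
  and using the semigroup law produces \<open>heat_conv (r + s)\<close>, which \<open>heat_conv_sum_le\<close> replaces by
  operators depending on one of the two times only. So the square of \<open>a\<close> is controlled by the pairing of
  \<open>g\<close> with its own maximal function at the doubled times. If the constant \<open>K\<close> is admissible, then
  Cauchy--Schwarz gives a bound with \<open>sqrt K\<close>.\<close>

lemma heat_bound_improve:
  assumes K: "K > 0" and bd: "heat_bound L K TYPE('a::euclidean_space)"
  shows "heat_bound L (2 * 2 powr (real DIM('a) / 2) * sqrt K) TYPE('a)"
  unfolding heat_bound_def
proof (intro allI impI, elim conjE)
  fix S :: "real set" and f :: "'a \<Rightarrow> ennreal"
  assume S: "finite S" "S \<noteq> {}" "card S \<le> L" "S \<subseteq> {0<..}" and [measurable]: "f \<in> \<B>"
  let ?C = "2 powr (real DIM('a) / 2)"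
  define g where "g = heat_max S f"
  have gm[measurable]: "g \<in> \<B>"
    unfolding g_def by (intro heat_max_measurable) (auto intro: countable_finite S)
  \<comment> \<open>Ties are broken in favour of the smallest time, so that the sets partition the space.\<close>
  define E where "E r = {x. heat_conv r f x = g x \<and> (\<forall>r'\<in>S. r' < r \<longrightarrow> heat_conv r' f x \<noteq> g x)}" for r
  have Em: "E r \<in> sets borel" if "r \<in> S" for r
  proof -
    have "E r = {x \<in> space borel. heat_conv r f x = g x} \<inter> (\<Inter>r'\<in>{r'\<in>S. r' < r} \<union> {r}. {x \<in> space borel. r' = r \<or> heat_conv r' f x \<noteq> g x})"
      unfolding E_def by auto
    also have "\<dots> \<in> sets borel" using S(1) by (intro sets.Int sets.finite_INT) auto
    finally show ?thesis .
  qed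
  define gr where "gr r x = indicator (E r) x * g x" for r x
  have [measurable]: "gr r \<in> \<B>" if "r \<in> S" for r
    unfolding gr_def using Em[OF that] by measurable
  have one: "(\<Sum>r\<in>S. indicator (E r) x :: ennreal) = 1" for x
  proof -
    have "\<exists>r\<in>S. heat_conv r f x = g x"
      unfolding g_def heat_max_def using S(1,2) by (metis (mono_tags) finite_imageI Max_Sup Max_in image_iff image_is_empty)
    then have ne: "{r\<in>S. heat_conv r f x = g x} \<noteq> {}" by auto
    define r0 where "r0 = Min {r\<in>S. heat_conv r f x = g x}"
    have fin: "finite {r\<in>S. heat_conv r f x = g x}" using S(1) by simp
    have r0: "r0 \<in> S" "heat_conv r0 f x = g x" using Min_in[OF fin ne] unfolding r0_def by auto
    have le: "r0 \<le> r" if "r \<in> S" "heat_conv r f x = g x" for r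
      using Min_le[OF fin] that unfolding r0_def by auto
    have iff: "x \<in> E r \<longleftrightarrow> r = r0" if "r \<in> S" for r
      using r0 le that unfolding E_def by (auto simp: not_less[symmetric]) (metis le less_le_not_le order_le_less)+
    have "(\<Sum>r\<in>S. indicator (E r) x :: ennreal) = (\<Sum>r\<in>S. if r = r0 then 1 else 0)"
      by (intro sum.cong refl) (auto simp: iff indicator_def)
    also have "\<dots> = 1" using r0 S(1) by simp
    finally show ?thesis .
  qed
  have gsum: "(\<Sum>r\<in>S. gr r x) = g x" for x
    unfolding gr_def sum_distrib_right[symmetric] one by simp
  have g2: "(g x)\<^sup>2 = (\<Sum>r\<in>S. gr r x * heat_conv r f x)" for x
  proof -
    have "(\<Sum>r\<in>S. gr r x * heat_conv r f x) = (\<Sum>r\<in>S. indicator (E r) x * (g x)\<^sup>2)"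
      by (intro sum.cong refl) (auto simp: gr_def E_def indicator_def power2_eq_square)
    then show ?thesis unfolding sum_distrib_right[symmetric] one by simp
  qed
  define a where "a x = (\<Sum>r\<in>S. heat_conv r (gr r) x)" for x
  have [measurable]: "a \<in> \<B>" unfolding a_def by measurable
  let ?S2 = "\<integral>\<^sub>+x. (g x)\<^sup>2" and ?F = "\<integral>\<^sub>+x. (f x)\<^sup>2"
  have S2: "?S2 = (\<integral>\<^sub>+x. f x * a x)"
  proof -
    have "?S2 = (\<Sum>r\<in>S. \<integral>\<^sub>+x. gr r x * heat_conv r f x)"
      unfolding g2 by (rule nn_integral_sum) measurable
    also have "\<dots> = (\<Sum>r\<in>S. \<integral>\<^sub>+x. f x * heat_conv r (gr r) x)"
      by (intro sum.cong refl heat_conv_symmetric) measurable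
    also have "\<dots> = (\<integral>\<^sub>+x. f x * a x)"
      unfolding a_def sum_distrib_left by (rule nn_integral_sum[symmetric]) measurable
    finally show ?thesis .
  qed
  define M where "M = heat_max ((*) 2 ` S) g"
  have [measurable]: "M \<in> \<B>"
    unfolding M_def by (intro heat_max_measurable) (auto intro: countable_finite S)
  have Mge: "heat_conv (2 * r) g x \<le> M x" if "r \<in> S" for r x
    unfolding M_def by (intro heat_max_ge) (use that in auto)
  have diag: "(\<Sum>r\<in>S. \<integral>\<^sub>+x. gr r x * heat_conv (2 * r) g x) \<le> (\<integral>\<^sub>+x. g x * M x)"
  proof -
    have "(\<Sum>r\<in>S. \<integral>\<^sub>+x. gr r x * heat_conv (2 * r) g x) \<le> (\<Sum>r\<in>S. \<integral>\<^sub>+x. gr r x * M x)"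
      by (intro sum_mono nn_integral_mono mult_left_mono Mge) auto
    also have "\<dots> = (\<integral>\<^sub>+x. (\<Sum>r\<in>S. gr r x * M x))" by (rule nn_integral_sum[symmetric]) measurable
    also have "\<dots> = (\<integral>\<^sub>+x. g x * M x)" unfolding sum_distrib_right[symmetric] gsum ..
    finally show ?thesis .
  qed
  have d1: "(\<Sum>s\<in>S. \<integral>\<^sub>+x. gr r x * heat_conv (2 * r) (gr s) x) = (\<integral>\<^sub>+x. gr r x * heat_conv (2 * r) g x)" if "r \<in> S" for r
  proof -
    have "(\<Sum>s\<in>S. \<integral>\<^sub>+x. gr r x * heat_conv (2 * r) (gr s) x) = (\<integral>\<^sub>+x. (\<Sum>s\<in>S. gr r x * heat_conv (2 * r) (gr s) x))"
      using that by (intro nn_integral_sum[symmetric]) measurable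
    also have "\<dots> = (\<integral>\<^sub>+x. gr r x * heat_conv (2 * r) (\<lambda>x. \<Sum>s\<in>S. gr s x) x)"
      unfolding sum_distrib_left[symmetric] by (subst heat_conv_sum[OF S(1)]) auto
    finally show ?thesis unfolding gsum .
  qed
  have d2: "(\<Sum>r\<in>S. \<integral>\<^sub>+x. gr r x * heat_conv (2 * s) (gr s) x) = (\<integral>\<^sub>+x. gr s x * heat_conv (2 * s) g x)" if "s \<in> S" for s
  proof -
    have "(\<Sum>r\<in>S. \<integral>\<^sub>+x. gr r x * heat_conv (2 * s) (gr s) x) = (\<integral>\<^sub>+x. (\<Sum>r\<in>S. gr r x * heat_conv (2 * s) (gr s) x))"
      using that by (intro nn_integral_sum[symmetric]) measurable
    also have "\<dots> = (\<integral>\<^sub>+x. g x * heat_conv (2 * s) (gr s) x)"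
      unfolding sum_distrib_right[symmetric] gsum ..
    also have "\<dots> = (\<integral>\<^sub>+x. gr s x * heat_conv (2 * s) g x)"
      using that by (intro heat_conv_symmetric) measurable
    finally show ?thesis .
  qed
  have a2: "(\<integral>\<^sub>+x. (a x)\<^sup>2) \<le> ennreal (2 * ?C) * (\<integral>\<^sub>+x. g x * M x)"
  proof -
    have "(\<integral>\<^sub>+x. (a x)\<^sup>2) = (\<integral>\<^sub>+x. (\<Sum>r\<in>S. \<Sum>s\<in>S. heat_conv r (gr r) x * heat_conv s (gr s) x))"
      unfolding a_def power2_eq_square sum_product ..
    also have "\<dots> = (\<Sum>r\<in>S. \<integral>\<^sub>+x. (\<Sum>s\<in>S. heat_conv r (gr r) x * heat_conv s (gr s) x))"
      by (rule nn_integral_sum) measurable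
    also have "\<dots> = (\<Sum>r\<in>S. \<Sum>s\<in>S. \<integral>\<^sub>+x. heat_conv r (gr r) x * heat_conv s (gr s) x)"
      by (intro sum.cong refl nn_integral_sum) measurable
    also have "\<dots> = (\<Sum>r\<in>S. \<Sum>s\<in>S. \<integral>\<^sub>+x. gr r x * heat_conv (r + s) (gr s) x)"
      using S(4) by (intro sum.cong refl heat_conv_inner) auto
    also have "\<dots> \<le> (\<Sum>r\<in>S. \<Sum>s\<in>S. \<integral>\<^sub>+x. ennreal ?C * (gr r x * heat_conv (2 * r) (gr s) x + gr r x * heat_conv (2 * s) (gr s) x))"
    proof (intro sum_mono nn_integral_mono)
      fix r s x assume rs: "r \<in> S" "s \<in> S"
      have "gr r x * heat_conv (r + s) (gr s) x \<le> gr r x * (ennreal ?C * (heat_conv (2 * r) (gr s) x + heat_conv (2 * s) (gr s) x))"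
        using rs S(4) by (intro mult_left_mono heat_conv_sum_le) auto
      then show "gr r x * heat_conv (r + s) (gr s) x \<le> ennreal ?C * (gr r x * heat_conv (2 * r) (gr s) x + gr r x * heat_conv (2 * s) (gr s) x)"
        by (simp only: distrib_left mult.left_commute)
    qed
    also have "\<dots> = (\<Sum>r\<in>S. \<Sum>s\<in>S. ennreal ?C * ((\<integral>\<^sub>+x. gr r x * heat_conv (2 * r) (gr s) x) + (\<integral>\<^sub>+x. gr r x * heat_conv (2 * s) (gr s) x)))"
      by (intro sum.cong refl) (simp add: nn_integral_cmult nn_integral_add)
    also have "\<dots> = ennreal ?C * ((\<Sum>r\<in>S. \<Sum>s\<in>S. \<integral>\<^sub>+x. gr r x * heat_conv (2 * r) (gr s) x) + (\<Sum>r\<in>S. \<Sum>s\<in>S. \<integral>\<^sub>+x. gr r x * heat_conv (2 * s) (gr s) x))"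
      by (simp only: sum_distrib_left[symmetric] sum.distrib)
    also have "(\<Sum>r\<in>S. \<Sum>s\<in>S. \<integral>\<^sub>+x. gr r x * heat_conv (2 * r) (gr s) x) = (\<Sum>r\<in>S. \<integral>\<^sub>+x. gr r x * heat_conv (2 * r) g x)"
      by (intro sum.cong refl d1)
    also have "(\<Sum>r\<in>S. \<Sum>s\<in>S. \<integral>\<^sub>+x. gr r x * heat_conv (2 * s) (gr s) x) = (\<Sum>s\<in>S. \<Sum>r\<in>S. \<integral>\<^sub>+x. gr r x * heat_conv (2 * s) (gr s) x)"
      by (rule sum.swap)
    also have "\<dots> = (\<Sum>s\<in>S. \<integral>\<^sub>+x. gr s x * heat_conv (2 * s) g x)"
      by (intro sum.cong refl d2)
    also have "ennreal ?C * ((\<Sum>r\<in>S. \<integral>\<^sub>+x. gr r x * heat_conv (2 * r) g x) + (\<Sum>s\<in>S. \<integral>\<^sub>+x. gr s x * heat_conv (2 * s) g x))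
       \<le> ennreal ?C * ((\<integral>\<^sub>+x. g x * M x) + (\<integral>\<^sub>+x. g x * M x))"
      by (intro mult_left_mono add_mono diag) auto
    also have "\<dots> = ennreal (2 * ?C) * (\<integral>\<^sub>+x. g x * M x)"
      by (simp add: mult_2[symmetric] ennreal_mult mult_ac)
    finally show ?thesis .
  qed
  have M2: "(\<integral>\<^sub>+x. (M x)\<^sup>2) \<le> ennreal K * ?S2"
  proof -
    have "finite ((*) 2 ` S) \<and> (*) 2 ` S \<noteq> {} \<and> card ((*) 2 ` S) \<le> L \<and> (*) 2 ` S \<subseteq> {0::real<..}"
      using S card_image_le[OF S(1), of "(*) (2::real)"] by auto
    then show ?thesis using bd[unfolded heat_bound_def] gm unfolding M_def by blast
  qed
  have gM: "(\<integral>\<^sub>+x. g x * M x)\<^sup>2 \<le> ?S2 * (\<integral>\<^sub>+x. (M x)\<^sup>2)"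
    by (rule Cauchy_Schwarz_nn_integral) measurable
  have fa: "?S2\<^sup>2 \<le> ?F * (\<integral>\<^sub>+x. (a x)\<^sup>2)"
    unfolding S2 by (rule Cauchy_Schwarz_nn_integral) measurable
  have "?S2 \<le> ennreal (2 * ?C * sqrt K) * ?F"
  proof (cases "?F = \<infinity>")
    case True
    then show ?thesis using K by (simp add: ennreal_mult_top)
  next
    case False
    then obtain F where F: "?F = ennreal F" "F \<ge> 0" by (metis ennreal_cases infinity_ennreal_def)
    have "?S2 \<le> ennreal (real L) * ?F"
      using heat_bound_initial[of L, where 'a='a, unfolded heat_bound_def] S unfolding g_def by auto
    also have "\<dots> < \<infinity>" using F by (simp add: ennreal_mult_less_top)
    finally obtain s where s: "?S2 = ennreal s" "s \<ge> 0" by (metis ennreal_cases infinity_ennreal_def less_irrefl)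
    have "(\<integral>\<^sub>+x. g x * M x)\<^sup>2 \<le> ?S2 * (ennreal K * ?S2)"
      by (rule order_trans[OF gM]) (intro mult_left_mono M2, simp)
    also have "\<dots> = ennreal (s * (K * s))" using s K by (simp add: ennreal_mult)
    finally have q: "(\<integral>\<^sub>+x. g x * M x)\<^sup>2 \<le> ennreal (s * (K * s))" .
    then have "(\<integral>\<^sub>+x. g x * M x) \<noteq> \<infinity>" by (auto simp: power2_eq_square ennreal_top_mult top_unique)
    then obtain p where p: "(\<integral>\<^sub>+x. g x * M x) = ennreal p" "p \<ge> 0" by (metis ennreal_cases infinity_ennreal_def)
    have "ennreal (p\<^sup>2) \<le> ennreal (s * (K * s))" using q p by (simp add: ennreal_power)
    then have "p\<^sup>2 \<le> s * (K * s)" using s K by (subst (asm) ennreal_le_iff) auto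
    then have "p\<^sup>2 \<le> (sqrt K * s)\<^sup>2" using K by (simp add: power_mult_distrib power2_eq_square mult_ac)
    then have ps: "p \<le> sqrt K * s" using s K by (intro power2_le_imp_le[of p]) auto
    have "?S2\<^sup>2 \<le> ?F * (ennreal (2 * ?C) * ennreal p)"
      by (rule order_trans[OF fa]) (use a2 p in \<open>intro mult_left_mono, auto\<close>)
    then have "ennreal (s\<^sup>2) \<le> ennreal (F * (2 * ?C * p))" unfolding s F using s F p by (simp add: ennreal_power ennreal_mult)
    then have "s\<^sup>2 \<le> F * (2 * ?C * p)" using F p by (subst (asm) ennreal_le_iff) auto
    also have "\<dots> \<le> F * (2 * ?C * (sqrt K * s))" using F ps by (intro mult_left_mono) auto
    finally have "s * s \<le> (2 * ?C * sqrt K * F) * s" by (simp add: power2_eq_square mult_ac)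
    then have "s \<le> 2 * ?C * sqrt K * F"
      using s F K by (cases "s = 0") (auto dest: mult_right_le_imp_le)
    then have "ennreal s \<le> ennreal (2 * ?C * sqrt K * F)" by (rule ennreal_leI)
    then show ?thesis unfolding s F using F K by (simp add: ennreal_mult)
  qed
  then show "(\<integral>\<^sub>+x. (heat_max S f x)\<^sup>2) \<le> ennreal (2 * ?C * sqrt K) * ?F" unfolding g_def .
qed

text \<open>The fixed point of \<open>K \<mapsto> 2 C sqrt K\<close> is \<open>4 C\<^sup>2\<close>; the summand 1 makes the bound exceed the infimum
  of the admissible constants.\<close>

definition heat_const :: "'a::euclidean_space itself \<Rightarrow> real" where
  "heat_const _ = 4 * (2 powr (real DIM('a) / 2))\<^sup>2 + 1"

text \<open>The infimum \<open>k\<close> of the constants admissible for \<open>L\<close> times satisfies \<open>k \<le> 2 C sqrt k\<close> by the previous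
  improvement, which bounds it independently of \<open>L\<close>.\<close>

lemma heat_bound_uniform: "heat_bound L (heat_const TYPE('a::euclidean_space)) TYPE('a)"
proof -
  let ?C = "2 powr (real DIM('a) / 2)"
  define A where "A = {K. K > 0 \<and> heat_bound L K TYPE('a)}"
  have mono: "heat_bound L K' TYPE('a)" if "heat_bound L K TYPE('a)" "K \<le> K'" for K K'
    unfolding heat_bound_def
  proof (intro allI impI, elim conjE)
    fix S :: "real set" and f :: "'a \<Rightarrow> ennreal"
    assume "finite S" "S \<noteq> {}" "card S \<le> L" "S \<subseteq> {0<..}" "f \<in> \<B>"
    then have "(\<integral>\<^sub>+x. (heat_max S f x)\<^sup>2) \<le> ennreal K * (\<integral>\<^sub>+x. (f x)\<^sup>2)"
      using that(1) unfolding heat_bound_def by blast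
    also have "\<dots> \<le> ennreal K' * (\<integral>\<^sub>+x. (f x)\<^sup>2)"
      using that(2) by (intro mult_right_mono ennreal_leI) auto
    finally show "(\<integral>\<^sub>+x. (heat_max S f x)\<^sup>2) \<le> ennreal K' * (\<integral>\<^sub>+x. (f x)\<^sup>2)" .
  qed
  have ne: "A \<noteq> {}" using mono[OF heat_bound_initial, of "real L + 1"] unfolding A_def by (auto intro!: exI[of _ "real L + 1"])
  have bdd: "bdd_below A" by (rule bdd_belowI[of _ 0]) (auto simp: A_def)
  define k where "k = Inf A"
  have k0: "k \<ge> 0" unfolding k_def by (rule cInf_greatest[OF ne]) (auto simp: A_def)
  have step: "(k / (2 * ?C))\<^sup>2 \<le> K" if "K \<in> A" for K
  proof -
    have "2 * ?C * sqrt K \<in> A" using that heat_bound_improve[of K L, where 'a='a] unfolding A_def by auto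
    then have "k \<le> 2 * ?C * sqrt K" unfolding k_def by (rule cInf_lower[OF _ bdd])
    then have "k / (2 * ?C) \<le> sqrt K" by (simp add: divide_le_eq mult_ac)
    then have "(k / (2 * ?C))\<^sup>2 \<le> (sqrt K)\<^sup>2" using k0 by (intro power_mono) auto
    then show ?thesis using that by (simp add: A_def)
  qed
  have "(k / (2 * ?C))\<^sup>2 \<le> k" unfolding k_def[of] using step unfolding k_def by (intro cInf_greatest[OF ne])
  then have "k * k \<le> (4 * ?C\<^sup>2) * k" by (simp add: power_divide power_mult_distrib divide_le_eq power2_eq_square mult_ac)
  then have "k \<le> 4 * ?C\<^sup>2" using k0 by (cases "k = 0") (auto dest: mult_right_le_imp_le)
  then have "Inf A < heat_const TYPE('a)" unfolding heat_const_def k_def by linarith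
  then obtain K where "K \<in> A" "K < heat_const TYPE('a)" using cInf_lessD[OF ne] by blast
  then show ?thesis using mono[of K] unfolding A_def by auto
qed

definition dyadic_heat_max :: "('a::euclidean_space \<Rightarrow> ennreal) \<Rightarrow> 'a \<Rightarrow> ennreal" where
  "dyadic_heat_max f = heat_max (range (\<lambda>k::int. 2 powr of_int k)) f"

lemma dyadic_heat_max_measurable [measurable]:
  "f \<in> \<B> \<Longrightarrow> dyadic_heat_max f \<in> \<B>"
  unfolding dyadic_heat_max_def by (rule heat_max_measurable) auto

text \<open>Dyadic times suffice for all times, by comparability of the kernels.\<close>

lemma heat_conv_le_dyadic:
  fixes f :: "'a::euclidean_space \<Rightarrow> ennreal"
  assumes r: "r > 0" and [measurable]: "f \<in> \<B>"
  shows "heat_conv r f x \<le> ennreal (2 powr (real DIM('a) / 2)) * dyadic_heat_max f x"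
proof -
  define k where "k = \<lceil>log 2 r\<rceil>"
  let ?R = "2 powr real_of_int k"
  have "2 powr log 2 r \<le> ?R" unfolding k_def by (intro powr_mono) auto
  then have 1: "r \<le> ?R" using r by simp
  have "?R \<le> 2 powr (log 2 r + 1)" unfolding k_def by (intro powr_mono) linarith+
  then have 2: "?R \<le> 2 * r" using r by (simp add: powr_add)
  have "heat_conv r f x \<le> (\<integral>\<^sub>+y. ennreal (2 powr (real DIM('a) / 2)) * (ennreal (heat ?R (x - y)) * f y))"
    unfolding heat_conv_def
  proof (intro nn_integral_mono)
    fix y
    have "ennreal (heat r (x - y)) \<le> ennreal (2 powr (real DIM('a) / 2) * heat ?R (x - y))"
      by (intro ennreal_leI heat_le_heat r 1 2)
    then have "ennreal (heat r (x - y)) * f y \<le> ennreal (2 powr (real DIM('a) / 2) * heat ?R (x - y)) * f y"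
      by (intro mult_right_mono) auto
    then show "ennreal (heat r (x - y)) * f y \<le> ennreal (2 powr (real DIM('a) / 2)) * (ennreal (heat ?R (x - y)) * f y)"
      by (simp add: ennreal_mult mult.assoc)
  qed
  also have "\<dots> = ennreal (2 powr (real DIM('a) / 2)) * heat_conv ?R f x"
    unfolding heat_conv_def by (rule nn_integral_cmult) measurable
  also have "\<dots> \<le> ennreal (2 powr (real DIM('a) / 2)) * dyadic_heat_max f x"
    unfolding dyadic_heat_max_def by (intro mult_left_mono heat_max_ge) auto
  finally show ?thesis .
qed

theorem dyadic_heat_max_L2:
  fixes f :: "'a::euclidean_space \<Rightarrow> ennreal"
  assumes [measurable]: "f \<in> \<B>"
  shows "(\<integral>\<^sub>+x. (dyadic_heat_max f x)\<^sup>2) \<le> ennreal (heat_const TYPE('a)) * (\<integral>\<^sub>+x. (f x)\<^sup>2)"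
proof (rule nn_integral_le_of_tendsto)
  define S where "S n = (\<lambda>k::int. 2 powr real_of_int k) ` {- int n..int n}" for n
  have S: "finite (S n)" "S n \<noteq> {}" "S n \<subseteq> {0<..}" for n unfolding S_def by auto
  show "(\<lambda>x. (heat_max (S n) f x)\<^sup>2) \<in> borel_measurable lborel" for n
    using heat_max_measurable[OF countable_finite[OF S(1)], of f n] by simp
  show "(\<integral>\<^sub>+x. (heat_max (S n) f x)\<^sup>2) \<le> ennreal (heat_const TYPE('a)) * (\<integral>\<^sub>+x. (f x)\<^sup>2)" for n
    using heat_bound_uniform[of "card (S n)", where 'a='a, unfolded heat_bound_def] S by auto
  show "AE x in lborel. (\<lambda>n. (heat_max (S n) f x)\<^sup>2) \<longlonglongrightarrow> (dyadic_heat_max f x)\<^sup>2"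
  proof (intro AE_I2)
    fix x
    have mono: "incseq (\<lambda>n. heat_max (S n) f x)"
      unfolding heat_max_def S_def by (intro incseq_SucI SUP_subset_mono image_mono) auto
    have "(SUP n. heat_max (S n) f x) = dyadic_heat_max f x"
    proof -
      have U: "(\<Union>n. S n) = range (\<lambda>k::int. 2 powr real_of_int k)"
      proof safe
        fix k :: int
        have "2 powr real_of_int k \<in> S (nat \<bar>k\<bar>)" unfolding S_def by (intro imageI) auto
        then show "2 powr real_of_int k \<in> (\<Union>n. S n)" by blast
      qed (auto simp: S_def)
      show ?thesis unfolding dyadic_heat_max_def heat_max_def U[symmetric] by (simp add: SUP_UNION)
    qed
    with LIMSEQ_SUP[OF mono] have l: "(\<lambda>n. heat_max (S n) f x) \<longlonglongrightarrow> dyadic_heat_max f x" by simp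
    show "(\<lambda>n. (heat_max (S n) f x)\<^sup>2) \<longlonglongrightarrow> (dyadic_heat_max f x)\<^sup>2"
      unfolding power2_eq_square by (intro tendsto_mult_ennreal l) auto
  qed
qed

section \<open>Riesz means, their energies and square functions\<close>

definition pos_powr :: "real \<Rightarrow> real \<Rightarrow> real" where
  "pos_powr d r = (max 0 r) powr d"

lemma pos_powr_measurable [measurable (raw)]:
  "f \<in> borel_measurable M \<Longrightarrow> (\<lambda>x. pos_powr d (f x)) \<in> borel_measurable M"
  unfolding pos_powr_def by measurable

lemma pos_powr_nonneg [simp]: "pos_powr d r \<ge> 0" by (simp add: pos_powr_def)
lemma pos_powr_nonpos: "r \<le> 0 \<Longrightarrow> pos_powr d r = 0" by (simp add: pos_powr_def max_def)
lemma pos_powr_pos: "r > 0 \<Longrightarrow> pos_powr d r = r powr d" by (simp add: pos_powr_def max_def)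

text \<open>Up to the factor \<open>v powr d\<close> these are the Bochner--Riesz means of order \<open>d\<close> at radius \<open>sqrt v\<close>.\<close>

definition riesz :: "real \<Rightarrow> ('a::euclidean_space \<Rightarrow> complex) \<Rightarrow> real \<Rightarrow> 'a \<Rightarrow> complex" where
  "riesz d F v x = ift (\<lambda>\<xi>. of_real (pos_powr d (v - (norm \<xi>)\<^sup>2)) * F \<xi>) x"

lemma riesz_measurable [measurable (raw)]:
  assumes [measurable]: "F \<in> \<B>" "f \<in> borel_measurable N" "X \<in> borel_measurable N"
  shows "(\<lambda>p. riesz d F (f p) (X p)) \<in> borel_measurable N"
  unfolding riesz_def ift_def by measurable

lemma riesz_nonpos: "v \<le> 0 \<Longrightarrow> riesz d F v x = 0"
proof -
  assume v: "v \<le> 0"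
  have "pos_powr d (v - (norm \<xi>)\<^sup>2) = 0" for \<xi> :: 'a
    using v by (intro pos_powr_nonpos) (simp add: order_trans[OF v])
  then show ?thesis by (simp add: riesz_def ift_def)
qed

text \<open>For \<open>d < 0\<close> the symbols of the means are unbounded, but a truncated power of exponent \<open>d > -1/2\<close> is square
  integrable in \<open>v\<close>, so that quadratic averages can be estimated.\<close>

definition energy :: "real \<Rightarrow> ('a::euclidean_space \<Rightarrow> complex) \<Rightarrow> real \<Rightarrow> 'a \<Rightarrow> ennreal" where
  "energy d F \<tau> x = (\<integral>\<^sub>+v. indicator {0<..<\<tau>} v * nsq (riesz d F v x))"

lemma energy_measurable [measurable (raw)]:
  assumes [measurable]: "F \<in> \<B>" "f \<in> borel_measurable N" "X \<in> borel_measurable N"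
  shows "(\<lambda>p. energy d F (f p) (X p)) \<in> borel_measurable N"
proof -
  have "indicator {0<..<\<tau>} v = (if 0 < v \<and> v < \<tau> then 1 else 0 :: ennreal)" for \<tau> v :: real by (auto simp: indicator_def)
  then show ?thesis unfolding energy_def by simp
qed

lemma nn_integral_powr_0:
  assumes "p > -1" "\<tau> \<ge> 0"
  shows "(\<integral>\<^sub>+v. indicator {0<..<\<tau>} v * ennreal (v powr p)) = ennreal (\<tau> powr (p + 1) / (p + 1))"
proof -
  have "(\<integral>\<^sub>+v. indicator {0..\<tau>} v * ennreal (v powr p)) = ennreal (\<tau> powr (p + 1) / (p + 1))"
    using nn_integral_has_integral_lebesgue'[OF _ has_integral_powr_from_0[OF assms]] by (simp add: mult.commute)
  moreover have "(\<integral>\<^sub>+v. indicator {0..\<tau>} v * ennreal (v powr p)) = (\<integral>\<^sub>+v. indicator {0<..<\<tau>} v * ennreal (v powr p))"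
    using AE_lborel_singleton[of 0] AE_lborel_singleton[of \<tau>]
    by (intro nn_integral_cong_AE, eventually_elim) (auto simp: indicator_def)
  ultimately show ?thesis by simp
qed

lemma nn_integral_powr_inf:
  assumes "p > 1" "a > 0"
  shows "(\<integral>\<^sub>+v. indicator {a<..} v * ennreal (v powr (- p))) = ennreal (a powr (1 - p) / (p - 1))"
proof -
  have "(\<integral>\<^sub>+v. indicator {a..} v * ennreal (v powr (- p))) = ennreal (- (a powr (- p + 1)) / (- p + 1))"
    using nn_integral_has_integral_lebesgue'[OF _ has_integral_powr_to_inf[of "- p" a]] assms by (simp add: mult.commute)
  moreover have "(\<integral>\<^sub>+v. indicator {a..} v * ennreal (v powr (- p))) = (\<integral>\<^sub>+v. indicator {a<..} v * ennreal (v powr (- p)))"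
    using AE_lborel_singleton[of a]
    by (intro nn_integral_cong_AE, eventually_elim) (auto simp: indicator_def)
  moreover have "- (a powr (- p + 1)) / (- p + 1) = a powr (1 - p) / (p - 1)"
    using assms by (simp add: field_simps)
  ultimately show ?thesis by simp
qed

lemma nn_integral_pos_powr:
  assumes d: "d > -1/2" and a: "a \<ge> 0"
  shows "(\<integral>\<^sub>+v. indicator {0<..<\<tau>} v * ennreal ((pos_powr d (v - a))\<^sup>2))
     \<le> indicator {a<..} \<tau> * ennreal (\<tau> powr (2 * d + 1) / (2 * d + 1))"
proof (cases "a < \<tau>")
  case False
  then have z: "indicator {0<..<\<tau>} v * ennreal ((pos_powr d (v - a))\<^sup>2) = 0" for v
    by (cases "v < \<tau>") (auto simp: pos_powr_nonpos)
  show ?thesis by (simp only: z) simp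
next
  case True
  have "(\<integral>\<^sub>+v. indicator {0<..<\<tau>} v * ennreal ((pos_powr d (v - a))\<^sup>2))
    = (\<integral>\<^sub>+u. indicator {0<..<\<tau>} (a + u) * ennreal ((pos_powr d (a + u - a))\<^sup>2))"
    by (rule nn_integral_lborel_translation[symmetric]) measurable
  also have "\<dots> \<le> (\<integral>\<^sub>+u. indicator {0<..<\<tau> - a} u * ennreal (u powr (2 * d)))"
  proof (intro nn_integral_mono)
    fix u
    show "indicator {0<..<\<tau>} (a + u) * ennreal ((pos_powr d (a + u - a))\<^sup>2) \<le> indicator {0<..<\<tau> - a} u * ennreal (u powr (2 * d))"
      by (cases "u > 0") (auto simp: indicator_def pos_powr_pos pos_powr_nonpos power2_eq_square powr_add[symmetric])
  qed
  also have "\<dots> = ennreal ((\<tau> - a) powr (2 * d + 1) / (2 * d + 1))"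
    by (rule nn_integral_powr_0) (use d True in auto)
  also have "\<dots> \<le> ennreal (\<tau> powr (2 * d + 1) / (2 * d + 1))"
    using d True a by (intro ennreal_leI divide_right_mono powr_mono2) auto
  finally show ?thesis using True by simp
qed

text \<open>At frequency \<open>\<xi>\<close> this energy is of size \<open>(norm \<xi>) ^ 4 * \<tau> powr (2 * d + 1)\<close> and vanishes for
  \<open>\<tau> < (norm \<xi>)\<^sup>2\<close>, so the integral over \<open>\<tau>\<close> does not depend on the size of the frequency.\<close>

definition square_fun :: "real \<Rightarrow> ('a::euclidean_space \<Rightarrow> complex) \<Rightarrow> 'a \<Rightarrow> ennreal" where
  "square_fun d F x = (\<integral>\<^sub>+\<tau>. indicator {0<..} \<tau> * (ennreal (\<tau> powr (- (2 * d + 4))) *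
      energy d (\<lambda>\<xi>. of_real ((norm \<xi>)\<^sup>2) * F \<xi>) \<tau> x))"

lemma square_fun_measurable [measurable]:
  assumes [measurable]: "F \<in> \<B>"
  shows "square_fun d F \<in> \<B>"
  unfolding square_fun_def by measurable

lemma energy_integral_le:
  assumes d: "d > -1/2" and [measurable]: "F \<in> \<B>"
  shows "(\<integral>\<^sub>+x. energy d F \<tau> x) \<le>
    (\<integral>\<^sub>+\<xi>. nsq (F \<xi>) * (indicator {(norm \<xi>)\<^sup>2<..} \<tau> * ennreal (\<tau> powr (2 * d + 1) / (2 * d + 1))))"
proof -
  have "(\<integral>\<^sub>+x. energy d F \<tau> x) =
     (\<integral>\<^sub>+v. \<integral>\<^sub>+x. indicator {0<..<\<tau>} v * nsq (riesz d F v x))"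
    unfolding energy_def by (rule lborel_pair.Fubini') measurable
  also have "\<dots> \<le> (\<integral>\<^sub>+v. \<integral>\<^sub>+\<xi>. indicator {0<..<\<tau>} v * (ennreal ((pos_powr d (v - (norm \<xi>)\<^sup>2))\<^sup>2) * nsq (F \<xi>)))"
  proof (rule nn_integral_mono)
    fix v
    have "(\<integral>\<^sub>+x. nsq (riesz d F v x)) \<le>
       (\<integral>\<^sub>+\<xi>. nsq (of_real (pos_powr d (v - (norm \<xi>)\<^sup>2)) * F \<xi>))"
      unfolding riesz_def by (rule ift_L2_le) measurable
    also have "\<dots> = (\<integral>\<^sub>+\<xi>. ennreal ((pos_powr d (v - (norm \<xi>)\<^sup>2))\<^sup>2) * nsq (F \<xi>))"
      by (simp add: norm_mult power_mult_distrib ennreal_mult)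
    finally show "(\<integral>\<^sub>+x. indicator {0<..<\<tau>} v * nsq (riesz d F v x)) \<le>
      (\<integral>\<^sub>+\<xi>. indicator {0<..<\<tau>} v * (ennreal ((pos_powr d (v - (norm \<xi>)\<^sup>2))\<^sup>2) * nsq (F \<xi>)))"
      by (subst (1 2) nn_integral_cmult) (auto intro!: mult_left_mono)
  qed
  also have "\<dots> = (\<integral>\<^sub>+\<xi>. \<integral>\<^sub>+v. indicator {0<..<\<tau>} v * (ennreal ((pos_powr d (v - (norm \<xi>)\<^sup>2))\<^sup>2) * nsq (F \<xi>)))"
    by (rule lborel_pair.Fubini') measurable
  also have "\<dots> = (\<integral>\<^sub>+\<xi>. nsq (F \<xi>) * (\<integral>\<^sub>+v. indicator {0<..<\<tau>} v * ennreal ((pos_powr d (v - (norm \<xi>)\<^sup>2))\<^sup>2)))"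
    by (subst nn_integral_cmult[symmetric]) (auto simp: mult_ac)
  also have "\<dots> \<le> (\<integral>\<^sub>+\<xi>. nsq (F \<xi>) * (indicator {(norm \<xi>)\<^sup>2<..} \<tau> * ennreal (\<tau> powr (2 * d + 1) / (2 * d + 1))))"
    by (intro nn_integral_mono mult_left_mono nn_integral_pos_powr d) auto
  finally show ?thesis .
qed

text \<open>By Plancherel the integral of the energy is that of \<open>(norm \<xi>) ^ 4 * (norm (F \<xi>))\<^sup>2\<close> times at most
  \<open>\<tau> powr (2 * d + 1) / (2 * d + 1)\<close> on \<open>\<tau> > (norm \<xi>)\<^sup>2\<close>. It remains to integrate \<open>\<tau> powr (- 3)\<close>
  over this half-line, which cancels the factor \<open>(norm \<xi>) ^ 4\<close>.\<close>

theorem square_fun_integral_le: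
  fixes F :: "'a::euclidean_space \<Rightarrow> complex"
  assumes d: "d > -1/2" and [measurable]: "F \<in> \<B>"
  shows "(\<integral>\<^sub>+x. square_fun d F x) \<le> ennreal (1 / (2 * d + 1)) * (\<integral>\<^sub>+\<xi>. nsq (F \<xi>))"
proof -
  let ?F1 = "\<lambda>\<xi>::'a. of_real ((norm \<xi>)\<^sup>2) * F \<xi>"
  let ?c = "1 / (2 * d + 1)"
  have ind: "indicator {(norm \<xi>)\<^sup>2<..} \<tau> = (if (norm \<xi>)\<^sup>2 < \<tau> then 1 else 0 :: ennreal)" for \<xi> :: 'a and \<tau> :: real
    by (auto simp: indicator_def)
  have "(\<integral>\<^sub>+x. square_fun d F x) =
    (\<integral>\<^sub>+\<tau>. \<integral>\<^sub>+x. indicator {0<..} \<tau> * (ennreal (\<tau> powr (- (2 * d + 4))) * energy d ?F1 \<tau> x))"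
    unfolding square_fun_def by (rule lborel_pair.Fubini') measurable
  also have "\<dots> = (\<integral>\<^sub>+\<tau>. indicator {0<..} \<tau> * (ennreal (\<tau> powr (- (2 * d + 4))) * (\<integral>\<^sub>+x. energy d ?F1 \<tau> x)))"
    by (simp add: nn_integral_cmult)
  also have "\<dots> \<le> (\<integral>\<^sub>+\<tau>. indicator {0<..} \<tau> * (ennreal (\<tau> powr (- (2 * d + 4))) *
     (\<integral>\<^sub>+\<xi>. nsq (?F1 \<xi>) * (indicator {(norm \<xi>)\<^sup>2<..} \<tau> * ennreal (\<tau> powr (2 * d + 1) / (2 * d + 1))))))"
    by (intro nn_integral_mono mult_left_mono energy_integral_le d) auto
  also have "\<dots> = (\<integral>\<^sub>+\<tau>. \<integral>\<^sub>+\<xi>. indicator {0<..} \<tau> * (ennreal (\<tau> powr (- (2 * d + 4))) *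
     (nsq (?F1 \<xi>) * (indicator {(norm \<xi>)\<^sup>2<..} \<tau> * ennreal (\<tau> powr (2 * d + 1) / (2 * d + 1))))))"
    unfolding ind by (simp add: nn_integral_cmult)
  also have "\<dots> = (\<integral>\<^sub>+\<xi>. \<integral>\<^sub>+\<tau>. indicator {0<..} \<tau> * (ennreal (\<tau> powr (- (2 * d + 4))) *
     (nsq (?F1 \<xi>) * (indicator {(norm \<xi>)\<^sup>2<..} \<tau> * ennreal (\<tau> powr (2 * d + 1) / (2 * d + 1))))))"
    unfolding ind by (rule lborel_pair.Fubini') measurable
  also have "\<dots> \<le> (\<integral>\<^sub>+\<xi>. ennreal ?c * nsq (F \<xi>))"
  proof (intro nn_integral_mono)
    fix \<xi> :: 'a
    let ?a = "(norm \<xi>)\<^sup>2"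
    show "(\<integral>\<^sub>+\<tau>. indicator {0<..} \<tau> * (ennreal (\<tau> powr (- (2 * d + 4))) *
     (nsq (?F1 \<xi>) * (indicator {?a<..} \<tau> * ennreal (\<tau> powr (2 * d + 1) / (2 * d + 1))))))
       \<le> ennreal ?c * nsq (F \<xi>)"
    proof (cases "\<xi> = 0")
      case True then show ?thesis by simp
    next
      case False
      then have a: "?a > 0" by simp
      have "(\<integral>\<^sub>+\<tau>. indicator {0<..} \<tau> * (ennreal (\<tau> powr (- (2 * d + 4))) *
     (nsq (?F1 \<xi>) * (indicator {?a<..} \<tau> * ennreal (\<tau> powr (2 * d + 1) / (2 * d + 1))))))
        = (\<integral>\<^sub>+\<tau>. ennreal (?c * (?a\<^sup>2 * (norm (F \<xi>))\<^sup>2)) * (indicator {?a<..} \<tau> * ennreal (\<tau> powr (- 3))))"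
      proof (intro nn_integral_cong)
        fix \<tau> :: real
        show "indicator {0<..} \<tau> * (ennreal (\<tau> powr (- (2 * d + 4))) *
     (nsq (?F1 \<xi>) * (indicator {?a<..} \<tau> * ennreal (\<tau> powr (2 * d + 1) / (2 * d + 1))))) =
      ennreal (?c * (?a\<^sup>2 * (norm (F \<xi>))\<^sup>2)) * (indicator {?a<..} \<tau> * ennreal (\<tau> powr (- 3)))"
        proof (cases "?a < \<tau>")
          case True
          then have t: "\<tau> > 0" using a by linarith
          have e: "\<tau> powr (- (2 * d + 4)) * (?a\<^sup>2 * (norm (F \<xi>))\<^sup>2 * (\<tau> powr (2 * d + 1) / (2 * d + 1))) =
            ?c * (?a\<^sup>2 * (norm (F \<xi>))\<^sup>2) * (\<tau> powr (- (2 * d + 4)) * \<tau> powr (2 * d + 1))"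
            by simp
          also have "\<tau> powr (- (2 * d + 4)) * \<tau> powr (2 * d + 1) = \<tau> powr (- 3)"
            by (simp add: powr_add[symmetric])
          finally have e: "\<tau> powr (- (2 * d + 4)) * (?a\<^sup>2 * (norm (F \<xi>))\<^sup>2 * (\<tau> powr (2 * d + 1) / (2 * d + 1))) =
            ?c * (?a\<^sup>2 * (norm (F \<xi>))\<^sup>2) * \<tau> powr (- 3)" .
          have "(norm (?F1 \<xi>))\<^sup>2 = ?a\<^sup>2 * (norm (F \<xi>))\<^sup>2"
            by (simp add: norm_mult norm_power power_mult_distrib power_mult[symmetric])
          then show ?thesis using True t e d by (simp only: indicator_simps greaterThan_iff mult_1 ennreal_mult[symmetric]
            powr_ge_zero zero_le_power2 mult_nonneg_nonneg divide_nonneg_nonneg zero_le_one)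
        qed simp
      qed
      also have "\<dots> = ennreal (?c * (?a\<^sup>2 * (norm (F \<xi>))\<^sup>2)) * (\<integral>\<^sub>+\<tau>. indicator {?a<..} \<tau> * ennreal (\<tau> powr (- 3)))"
        by (rule nn_integral_cmult) measurable
      also have "\<dots> = ennreal (?c * (?a\<^sup>2 * (norm (F \<xi>))\<^sup>2)) * ennreal (?a powr (1 - 3) / (3 - 1))"
        by (subst nn_integral_powr_inf) (use a in auto)
      also have "\<dots> = ennreal (?c * (?a\<^sup>2 * (norm (F \<xi>))\<^sup>2) * (?a powr (1 - 3) / (3 - 1)))"
        by (rule ennreal_mult[symmetric]) (use d in auto)
      also have "\<dots> \<le> ennreal (?c * (norm (F \<xi>))\<^sup>2)"
      proof (rule ennreal_leI)
        have "?a powr (1 - 3) = inverse (?a powr 2)" using powr_minus[of ?a 2] by simp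
        then have "?a powr (1 - 3) = inverse (?a\<^sup>2)" using a powr_realpow[of ?a 2] by simp
        then have q: "?a\<^sup>2 * (?a powr (1 - 3)) = 1" using a by simp
        then have "?c * (?a\<^sup>2 * (norm (F \<xi>))\<^sup>2) * (?a powr (1 - 3) / (3 - 1)) = ?c * (norm (F \<xi>))\<^sup>2 * (1 / 2)"
        proof -
          have "A * (B * N) * (Q / (3 - 1)) = A * N * ((B * Q) / 2)" for A B N Q :: real by simp
          from this[of ?c "?a\<^sup>2" "(norm (F \<xi>))\<^sup>2" "?a powr (1 - 3)"] show ?thesis unfolding q .
        qed
        also have "\<dots> \<le> ?c * (norm (F \<xi>))\<^sup>2" by (intro mult_left_le) (use d in auto)
        finally show "?c * (?a\<^sup>2 * (norm (F \<xi>))\<^sup>2) * (?a powr (1 - 3) / (3 - 1)) \<le> ?c * (norm (F \<xi>))\<^sup>2" .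
      qed
      also have "ennreal (?c * (norm (F \<xi>))\<^sup>2) = ennreal ?c * nsq (F \<xi>)"
        by (rule ennreal_mult) (use d in auto)
      finally show ?thesis .
    qed
  qed
  also have "\<dots> = ennreal ?c * (\<integral>\<^sub>+\<xi>. nsq (F \<xi>))"
    by (rule nn_integral_cmult) measurable
  finally show ?thesis .
qed


section \<open>The maximal estimate for the energy\<close>

lemma ennreal_finiteE:
  assumes "x < \<infinity>" obtains c where "x = ennreal c" "c \<ge> 0"
  using assms by (metis ennreal_cases infinity_ennreal_def less_irrefl)

lemma powr_minus_exp_bound:
  fixes x d :: real
  assumes x: "0 \<le> x" "x \<le> 1/2"
  shows "\<bar>(1 - x) powr d - exp (- x)\<bar> \<le> (2 * \<bar>d\<bar> * exp \<bar>d\<bar> + 1) * x"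
proof -
  have l1: "ln (1 - x) \<le> 0" using x by simp
  have l2: "- (2 * x) \<le> ln (1 - x)"
  proof -
    have "ln (inverse (1 - x)) \<le> inverse (1 - x) - 1" using x by (intro ln_le_minus_one) auto
    then have "- ln (1 - x) \<le> inverse (1 - x) - 1" using x by (simp add: ln_inverse)
    also have "\<dots> = x * inverse (1 - x)" using x by (simp add: field_simps)
    also have "\<dots> \<le> x * 2" using x by (intro mult_left_mono) (auto simp: inverse_eq_divide divide_le_eq)
    finally show ?thesis by simp
  qed
  define y where "y = d * ln (1 - x)"
  have y: "\<bar>y\<bar> \<le> 2 * \<bar>d\<bar> * x"
  proof -
    have "\<bar>y\<bar> = \<bar>d\<bar> * \<bar>ln (1 - x)\<bar>" unfolding y_def by (rule abs_mult)
    also have "\<dots> \<le> \<bar>d\<bar> * (2 * x)" using l1 l2 by (intro mult_left_mono) auto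
    finally show ?thesis by simp
  qed
  also have "2 * \<bar>d\<bar> * x \<le> 2 * \<bar>d\<bar> * (1/2)" using x by (intro mult_left_mono) auto
  finally have yd: "\<bar>y\<bar> \<le> \<bar>d\<bar>" by simp
  have ey: "\<bar>exp y - 1\<bar> \<le> \<bar>y\<bar> * exp \<bar>y\<bar>"
  proof (cases "y \<ge> 0")
    case True
    have "1 - y \<le> exp (- y)" using exp_ge_add_one_self[of "- y"] by simp
    then have "(1 - y) * exp y \<le> exp (- y) * exp y" by (intro mult_right_mono) auto
    then have "exp y - 1 \<le> y * exp y" by (simp add: exp_minus algebra_simps)
    then show ?thesis using True by simp
  next
    case False
    have "1 - exp y \<le> - y" using exp_ge_add_one_self[of y] by linarith
    also have "\<dots> \<le> - y * exp (- y)" using False by (intro mult_le_cancel_left1[THEN iffD2]) auto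
    finally show ?thesis using False by simp
  qed
  also have "\<bar>y\<bar> * exp \<bar>y\<bar> \<le> (2 * \<bar>d\<bar> * x) * exp \<bar>d\<bar>"
    using y yd x by (intro mult_mono) auto
  finally have 1: "\<bar>exp y - 1\<bar> \<le> (2 * \<bar>d\<bar> * x) * exp \<bar>d\<bar>" .
  have "(1 - x) powr d = exp y" unfolding y_def powr_def using x by simp
  moreover have "\<bar>exp (- x) - 1\<bar> \<le> x"
    using exp_ge_add_one_self[of "- x"] x by simp
  ultimately have "\<bar>(1 - x) powr d - exp (- x)\<bar> \<le> (2 * \<bar>d\<bar> * x) * exp \<bar>d\<bar> + x"
    using 1 by linarith
  then show ?thesis by (simp add: algebra_simps)
qed

text \<open>Near \<open>u = 0\<close> the exponential decays, near \<open>u = 1\<close> the square of the truncated power is integrable because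
  \<open>d > -1/2\<close>, and for large \<open>u\<close> the difference is smaller than either term by a factor of order
  \<open>1 / u\<close>.\<close>

lemma nn_integral_powr_minus_exp_finite:
  assumes d: "d > -1/2"
  shows "(\<integral>\<^sub>+u. indicator {0<..} u * ennreal (u powr (- (2 * d + 1)) * (pos_powr d (u - 1) - u powr d * exp (- (1 / u)))\<^sup>2)) < \<infinity>"
proof -
  let ?f = "\<lambda>u. u powr (- (2 * d + 1)) * (pos_powr d (u - 1) - u powr d * exp (- (1 / u)))\<^sup>2"
  define L where "L = 2 * \<bar>d\<bar> * exp \<bar>d\<bar> + 1"
  have L: "L \<ge> 0" unfolding L_def by simp
  have e0: "u powr (- (2 * d + 1)) * (u powr d)\<^sup>2 = 1 / u" if "u > 0" for u :: real
  proof -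
    have "u powr (- (2 * d + 1)) * (u powr d)\<^sup>2 = u powr (-1)"
      unfolding power2_eq_square powr_add[symmetric] by simp
    then show ?thesis using that by (simp add: powr_minus inverse_eq_divide)
  qed
  have b1: "?f u \<le> 1" if u: "0 < u" "u \<le> 1" for u
  proof -
    have "?f u = u powr (- (2 * d + 1)) * (u powr d)\<^sup>2 * (exp (- (1 / u)))\<^sup>2"
      using u by (simp add: pos_powr_nonpos power_mult_distrib)
    also have "\<dots> = (1 / u) * exp (- (1 / u)) * exp (- (1 / u))" using e0 u by (simp add: power2_eq_square)
    also have "\<dots> \<le> 1 * 1"
    proof (intro mult_mono)
      have "1 / u \<le> exp (1 / u)" using exp_ge_add_one_self[of "1 / u"] by linarith
      then have "(1 / u) * exp (- (1 / u)) \<le> exp (1 / u) * exp (- (1 / u))" by (intro mult_right_mono) auto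
      then show "(1 / u) * exp (- (1 / u)) \<le> 1" by (simp add: exp_minus)
    qed (use u in auto)
    finally show ?thesis by simp
  qed
  have b2: "?f u \<le> 2 * (pos_powr d (u - 1))\<^sup>2 + 2" if u: "1 < u" for u
  proof -
    have sq: "(p - q)\<^sup>2 \<le> 2 * p\<^sup>2 + 2 * q\<^sup>2" for p q :: real
      using zero_le_power2[of "p + q"] by (simp add: power2_eq_square algebra_simps)
    have "?f u \<le> u powr (- (2 * d + 1)) * (2 * (pos_powr d (u - 1))\<^sup>2 + 2 * (u powr d * exp (- (1 / u)))\<^sup>2)"
      by (intro mult_left_mono sq) auto
    also have "\<dots> = u powr (- (2 * d + 1)) * (2 * (pos_powr d (u - 1))\<^sup>2) + 2 * (u powr (- (2 * d + 1)) * (u powr d)\<^sup>2) * (exp (- (1 / u)))\<^sup>2"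
      by (simp add: algebra_simps power_mult_distrib)
    also have "\<dots> \<le> 1 * (2 * (pos_powr d (u - 1))\<^sup>2) + 2 * 1 * 1"
    proof (intro add_mono mult_mono)
      have "u powr (- (2 * d + 1)) \<le> u powr 0" using u d by (intro powr_mono) auto
      then show "u powr (- (2 * d + 1)) \<le> 1" using u by simp
      show "u powr (- (2 * d + 1)) * (u powr d)\<^sup>2 \<le> 1" using e0[of u] u by simp
      show "(exp (- (1 / u)))\<^sup>2 \<le> 1" using u by (intro power_le_one) auto
    qed auto
    finally show ?thesis by simp
  qed
  have b3: "?f u \<le> L\<^sup>2 * u powr (- 3)" if u: "2 < u" for u
  proof -
    have "pos_powr d (u - 1) = (u * (1 - 1 / u)) powr d" using u by (simp add: pos_powr_pos algebra_simps)
    also have "\<dots> = u powr d * (1 - 1 / u) powr d" using u by (subst powr_mult) auto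
    finally have "?f u = u powr (- (2 * d + 1)) * (u powr d)\<^sup>2 * ((1 - 1/u) powr d - exp (- (1 / u)))\<^sup>2"
      by (simp add: power_mult_distrib right_diff_distrib[symmetric])
    also have "\<dots> = (1 / u) * \<bar>(1 - 1/u) powr d - exp (- (1 / u))\<bar>\<^sup>2" using e0 u by simp
    also have "\<dots> \<le> (1 / u) * (L * (1 / u))\<^sup>2"
      unfolding L_def using u by (intro mult_left_mono power_mono powr_minus_exp_bound) auto
    also have "\<dots> = L\<^sup>2 * (1 / u ^ 3)" using u by (simp add: power2_eq_square power3_eq_cube)
    also have "1 / u ^ 3 = u powr (- 3)"
      using u powr_realpow[of u 3] powr_minus[of u 3] by (simp add: divide_inverse)
    finally show ?thesis .
  qed
  have "(\<integral>\<^sub>+u. indicator {0<..} u * ennreal (?f u)) \<le>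
    (\<integral>\<^sub>+u. ennreal 1 * indicator {0..1} u + (ennreal 2 * (indicator {0<..<3} u * ennreal ((pos_powr d (u - 1))\<^sup>2)) + (ennreal 2 * indicator {0..2} u +
       ennreal (L\<^sup>2) * (indicator {2<..} u * ennreal (u powr (- 3))))))"
  proof (intro nn_integral_mono)
    fix u :: real
    consider "u \<le> 0" | "0 < u" "u \<le> 1" | "1 < u" "u \<le> 2" | "2 < u" by linarith
    then show "indicator {0<..} u * ennreal (?f u) \<le>
      ennreal 1 * indicator {0..1} u + (ennreal 2 * (indicator {0<..<3} u * ennreal ((pos_powr d (u - 1))\<^sup>2)) + (ennreal 2 * indicator {0..2} u +
       ennreal (L\<^sup>2) * (indicator {2<..} u * ennreal (u powr (- 3)))))"
    proof cases
      case 1 then show ?thesis by simp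
    next
      case 2
      have "indicator {0<..} u * ennreal (?f u) \<le> ennreal 1 * indicator {0..1} u"
        using 2 ennreal_leI[OF b1[OF 2]] by simp
      then show ?thesis by (rule order_trans) simp
    next
      case 3
      have "ennreal (?f u) \<le> ennreal (2 * (pos_powr d (u - 1))\<^sup>2 + 2)" by (rule ennreal_leI[OF b2[OF 3(1)]])
      also have "\<dots> = ennreal 2 * ennreal ((pos_powr d (u - 1))\<^sup>2) + ennreal 2" by (simp add: ennreal_mult)
      finally show ?thesis using 3 by simp
    next
      case 4
      have "ennreal (?f u) \<le> ennreal (L\<^sup>2 * u powr (- 3))" by (rule ennreal_leI[OF b3[OF 4]])
      also have "\<dots> = ennreal (L\<^sup>2) * ennreal (u powr (- 3))" by (simp add: ennreal_mult)
      finally have "indicator {0<..} u * ennreal (?f u) \<le> ennreal (L\<^sup>2) * (indicator {2<..} u * ennreal (u powr (- 3)))" using 4 by simp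
      then show ?thesis by (rule order_trans) (simp add: add_increasing)
    qed
  qed
  also have "\<dots> = ennreal 1 * emeasure lborel {0..1::real} + (ennreal 2 * (\<integral>\<^sub>+u. indicator {0<..<3} u * ennreal ((pos_powr d (u - 1))\<^sup>2))
     + (ennreal 2 * emeasure lborel {0..2::real} + ennreal (L\<^sup>2) * (\<integral>\<^sub>+u. indicator {2<..} u * ennreal (u powr (- 3)))))"
  proof -
    have add4: "(\<integral>\<^sub>+u. A u + (B u + (C u + D u))) =
      (\<integral>\<^sub>+u. A u) + ((\<integral>\<^sub>+u. B u) + ((\<integral>\<^sub>+u. C u) + (\<integral>\<^sub>+u. D u)))"
      if [measurable]: "A \<in> \<B>" "B \<in> \<B>" "C \<in> \<B>" "D \<in> \<B>"
      for A B C D :: "real \<Rightarrow> ennreal"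
      by (simp add: nn_integral_add)
    then show ?thesis by (intro trans[OF add4]) (auto simp: nn_integral_cmult nn_integral_cmult_indicator)
  qed
  also have "\<dots> < \<infinity>"
  proof -
    have "(\<integral>\<^sub>+u. indicator {0<..<3} u * ennreal ((pos_powr d (u - 1))\<^sup>2)) < \<infinity>"
      by (rule le_less_trans[OF nn_integral_pos_powr[OF d]]) (auto simp: ennreal_mult_less_top)
    moreover have "(\<integral>\<^sub>+u. indicator {2<..} u * ennreal (u powr (- 3))) < \<infinity>"
      by (subst nn_integral_powr_inf) auto
    ultimately show ?thesis by (simp add: ennreal_mult_less_top ennreal_add_less_top)
  qed
  finally show ?thesis .
qed

text \<open>The symbol of the Riesz mean minus that of a multiple of a heat operator which agrees with it at
  \<open>a = 0\<close>.\<close>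

definition riesz_heat_diff :: "real \<Rightarrow> real \<Rightarrow> real \<Rightarrow> real" where
  "riesz_heat_diff d v a = pos_powr d (v - a) - v powr d * exp (- (a / v))"

lemma riesz_heat_diff_measurable [measurable (raw)]:
  "f \<in> borel_measurable M \<Longrightarrow> g \<in> borel_measurable M \<Longrightarrow> (\<lambda>x. riesz_heat_diff d (f x) (g x)) \<in> borel_measurable M"
  unfolding riesz_heat_diff_def
  by (intro borel_measurable_diff borel_measurable_times borel_measurable_exp borel_measurable_uminus
    borel_measurable_divide pos_powr_measurable) auto

text \<open>The integral does not depend on \<open>a > 0\<close> by scaling, and it vanishes for \<open>a = 0\<close>.\<close>

lemma riesz_heat_diff_square_integral:
  assumes d: "d > -1/2"
  obtains c where "c \<ge> 0" "\<And>a. a \<ge> 0 \<Longrightarrow>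
    (\<integral>\<^sub>+v. indicator {0<..} v * ennreal (v powr (- (2 * d + 1)) * (riesz_heat_diff d v a)\<^sup>2)) \<le> ennreal c"
proof -
  let ?I = "\<lambda>a. \<integral>\<^sub>+v. indicator {0<..} v * ennreal (v powr (- (2 * d + 1)) * (riesz_heat_diff d v a)\<^sup>2)"
  have "?I 1 < \<infinity>" using nn_integral_powr_minus_exp_finite[OF d] by (simp only: riesz_heat_diff_def)
  then obtain c where c: "?I 1 = ennreal c" "c \<ge> 0" by (rule ennreal_finiteE)
  have "?I a \<le> ennreal c" if a: "a \<ge> 0" for a
  proof (cases "a = 0")
    case True
    have "indicator {0<..} v * ennreal (v powr (- (2 * d + 1)) * (riesz_heat_diff d v 0)\<^sup>2) = 0" for v
      by (cases "v > 0") (auto simp: riesz_heat_diff_def pos_powr_pos)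
    then have "?I 0 = (\<integral>\<^sub>+(v::real). 0)" by (intro nn_integral_cong)
    then show ?thesis using True by simp
  next
    case False
    with a have a: "a > 0" by simp
    have "?I a = ennreal \<bar>a\<bar> * (\<integral>\<^sub>+u. indicator {0<..} (0 + a * u) * ennreal ((0 + a * u) powr (- (2 * d + 1)) * (riesz_heat_diff d (0 + a * u) a)\<^sup>2))"
      by (rule nn_integral_real_affine) (use a in auto)
    also have "\<dots> = (\<integral>\<^sub>+u. ennreal \<bar>a\<bar> * (indicator {0<..} (0 + a * u) * ennreal ((0 + a * u) powr (- (2 * d + 1)) * (riesz_heat_diff d (0 + a * u) a)\<^sup>2)))"
      by (rule nn_integral_cmult[symmetric]) measurable
    also have "\<dots> = ?I 1"
    proof (intro nn_integral_cong)
      fix u :: real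
      show "ennreal \<bar>a\<bar> * (indicator {0<..} (0 + a * u) * ennreal ((0 + a * u) powr (- (2 * d + 1)) * (riesz_heat_diff d (0 + a * u) a)\<^sup>2)) =
         indicator {0<..} u * ennreal (u powr (- (2 * d + 1)) * (riesz_heat_diff d u 1)\<^sup>2)"
      proof (cases "u > 0")
        case True
        have "pos_powr d (a * u - a) = a powr d * pos_powr d (u - 1)"
        proof (cases "u > 1")
          case True
          then have "pos_powr d (a * u - a) = (a * (u - 1)) powr d" using a by (simp add: pos_powr_pos algebra_simps)
          then show ?thesis using True a by (simp add: pos_powr_pos powr_mult)
        next
          case False
          then have "a * u - a \<le> 0" using a by (simp add: mult_left_le)
          then show ?thesis using False by (simp add: pos_powr_nonpos)
        qed
        then have "riesz_heat_diff d (a * u) a = a powr d * riesz_heat_diff d u 1"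
          unfolding riesz_heat_diff_def using a True by (simp add: powr_mult algebra_simps)
        then have "a * ((a * u) powr (- (2 * d + 1)) * (riesz_heat_diff d (a * u) a)\<^sup>2) =
           (a powr 1 * a powr (- (2 * d + 1)) * (a powr d * a powr d)) * (u powr (- (2 * d + 1)) * (riesz_heat_diff d u 1)\<^sup>2)"
          using a True by (simp add: powr_mult power2_eq_square mult_ac)
        also have "a powr 1 * a powr (- (2 * d + 1)) * (a powr d * a powr d) = 1"
          unfolding powr_add[symmetric] using a by simp
        finally show ?thesis using a True by (simp add: ennreal_mult[symmetric])
      next
        case False
        then show ?thesis using a by (simp add: zero_less_mult_iff)
      qed
    qed
    finally show ?thesis using c by simp
  qed
  with c that show thesis by blast
qed

definition diff_op :: "real \<Rightarrow> ('a::euclidean_space \<Rightarrow> complex) \<Rightarrow> real \<Rightarrow> 'a \<Rightarrow> complex" where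
  "diff_op d F v x = ift (\<lambda>\<xi>. of_real (riesz_heat_diff d v ((norm \<xi>)\<^sup>2)) * F \<xi>) x"

lemma diff_op_measurable [measurable (raw)]:
  assumes [measurable]: "F \<in> \<B>" "f \<in> borel_measurable N" "X \<in> borel_measurable N"
  shows "(\<lambda>p. diff_op d F (f p) (X p)) \<in> borel_measurable N"
  unfolding diff_op_def ift_def by measurable

lemma diff_op_integral_le:
  assumes c: "\<And>a. a \<ge> 0 \<Longrightarrow>
    (\<integral>\<^sub>+v. indicator {0<..} v * ennreal (v powr (- (2 * d + 1)) * (riesz_heat_diff d v a)\<^sup>2)) \<le> ennreal c"
    and [measurable]: "F \<in> \<B>"
  shows "(\<integral>\<^sub>+x. (\<integral>\<^sub>+v. indicator {0<..} v * ennreal (v powr (- (2 * d + 1)) * (norm (diff_op d F v x))\<^sup>2)))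
     \<le> ennreal c * (\<integral>\<^sub>+\<xi>. nsq (F \<xi>))"
proof -
  let ?w = "\<lambda>v. indicator {0<..} v * ennreal (v powr (- (2 * d + 1)))"
  have "(\<integral>\<^sub>+x. (\<integral>\<^sub>+v. indicator {0<..} v * ennreal (v powr (- (2 * d + 1)) * (norm (diff_op d F v x))\<^sup>2)))
     = (\<integral>\<^sub>+v. (\<integral>\<^sub>+x. ?w v * nsq (diff_op d F v x)))"
    by (subst lborel_pair.Fubini') (simp_all add: ennreal_mult mult.assoc)
  also have "\<dots> \<le> (\<integral>\<^sub>+v. (\<integral>\<^sub>+\<xi>. ?w v * (ennreal ((riesz_heat_diff d v ((norm \<xi>)\<^sup>2))\<^sup>2) * nsq (F \<xi>))))"
  proof (rule nn_integral_mono)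
    fix v :: real
    have "(\<integral>\<^sub>+x. nsq (diff_op d F v x)) \<le>
       (\<integral>\<^sub>+\<xi>. nsq (of_real (riesz_heat_diff d v ((norm \<xi>)\<^sup>2)) * F \<xi>))"
      unfolding diff_op_def by (rule ift_L2_le) measurable
    also have "\<dots> = (\<integral>\<^sub>+\<xi>. ennreal ((riesz_heat_diff d v ((norm \<xi>)\<^sup>2))\<^sup>2) * nsq (F \<xi>))"
      by (simp add: norm_mult power_mult_distrib ennreal_mult)
    finally have "?w v * (\<integral>\<^sub>+x. nsq (diff_op d F v x)) \<le> ?w v * (\<integral>\<^sub>+\<xi>. ennreal ((riesz_heat_diff d v ((norm \<xi>)\<^sup>2))\<^sup>2) * nsq (F \<xi>))"
      by (intro mult_left_mono) auto
    then show "(\<integral>\<^sub>+x. ?w v * nsq (diff_op d F v x)) \<le>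
       (\<integral>\<^sub>+\<xi>. ?w v * (ennreal ((riesz_heat_diff d v ((norm \<xi>)\<^sup>2))\<^sup>2) * nsq (F \<xi>)))"
      by (subst (1 2) nn_integral_cmult) auto
  qed
  also have "\<dots> = (\<integral>\<^sub>+\<xi>. (\<integral>\<^sub>+v. ?w v * (ennreal ((riesz_heat_diff d v ((norm \<xi>)\<^sup>2))\<^sup>2) * nsq (F \<xi>))))"
    by (rule lborel_pair.Fubini') measurable
  also have "\<dots> = (\<integral>\<^sub>+\<xi>. (\<integral>\<^sub>+v. indicator {0<..} v * ennreal (v powr (- (2 * d + 1)) * (riesz_heat_diff d v ((norm \<xi>)\<^sup>2))\<^sup>2)) * nsq (F \<xi>))"
    by (subst nn_integral_multc[symmetric]) (simp_all add: ennreal_mult mult.assoc)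
  also have "\<dots> \<le> (\<integral>\<^sub>+\<xi>. ennreal c * nsq (F \<xi>))"
    by (intro nn_integral_mono mult_right_mono c) auto
  also have "\<dots> = ennreal c * (\<integral>\<^sub>+\<xi>. nsq (F \<xi>))" by (rule nn_integral_cmult) measurable
  finally show ?thesis .
qed

lemma norm_add_squared_le: "(norm (a + b))\<^sup>2 \<le> 2 * (norm a)\<^sup>2 + 2 * (norm b)\<^sup>2"
  for a b :: "'a::real_normed_vector"
proof -
  have "(norm (a + b))\<^sup>2 \<le> (norm a + norm b)\<^sup>2" by (intro power_mono norm_triangle_ineq) simp
  also have "\<dots> \<le> 2 * (norm a)\<^sup>2 + 2 * (norm b)\<^sup>2"
    using zero_le_power2[of "norm a - norm b"] by (simp add: power2_eq_square algebra_simps)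
  finally show ?thesis .
qed

text \<open>Compare the Riesz mean with \<open>v powr d\<close> times the heat operator of symbol \<open>exp (- (norm \<xi>)\<^sup>2 / v)\<close>.
  The latter is dominated by the heat maximal function of \<open>norm (g x)\<close>. The difference is controlled by its
  square function over all \<open>v\<close>, whose integral is bounded by Plancherel; on \<open>v < \<tau>\<close> the missing
  weight \<open>v powr (- (2 * d + 1))\<close> costs at most \<open>\<tau> powr (2 * d + 1)\<close>.\<close>

theorem energy_maximal:
  assumes d: "d > -1/2"
  obtains c where "c \<ge> 0"
    "\<And>g :: 'a::euclidean_space \<Rightarrow> complex. integrable lborel g \<Longrightarrow>
      \<exists>N \<in> \<B>.
        (\<forall>\<tau>>0. \<forall>x. energy d (fourier g) \<tau> x \<le> ennreal (\<tau> powr (2 * d + 1)) * N x) \<and>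
        (\<integral>\<^sub>+x. N x) \<le> ennreal c * (\<integral>\<^sub>+x. nsq (g x))"
proof -
  obtain c0 where c0: "c0 \<ge> 0" "\<And>a. a \<ge> 0 \<Longrightarrow>
    (\<integral>\<^sub>+v. indicator {0<..} v * ennreal (v powr (- (2 * d + 1)) * (riesz_heat_diff d v a)\<^sup>2)) \<le> ennreal c0"
    using riesz_heat_diff_square_integral[OF d] by blast
  let ?C = "2 powr (real DIM('a) / 2)"
  let ?K = "2 / (2 * d + 1) * ?C\<^sup>2"
  define c where "c = ?K * heat_const TYPE('a) + 2 * c0"
  have hc: "heat_const TYPE('a) \<ge> 0" by (simp add: heat_const_def)
  have K0: "?K \<ge> 0" using d by simp
  have "\<exists>N \<in> \<B>.
        (\<forall>\<tau>>0. \<forall>x. energy d (fourier g) \<tau> x \<le> ennreal (\<tau> powr (2 * d + 1)) * N x) \<and>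
        (\<integral>\<^sub>+x. N x) \<le> ennreal c * (\<integral>\<^sub>+x. nsq (g x))"
    if g: "integrable lborel g" for g :: "'a \<Rightarrow> complex"
  proof -
    have [measurable]: "g \<in> \<B>" using g by simp
    define F where "F = fourier g"
    have F[measurable]: "F \<in> \<B>" unfolding F_def fourier_eq_ift by measurable
    have Fb: "norm (F \<xi>) \<le> (LINT x|lborel. norm (g x))" for \<xi> unfolding F_def fourier_eq_ift by (rule ift_bound[OF g])
    define H where "H = dyadic_heat_max (\<lambda>x. enorm (g x))"
    have [measurable]: "H \<in> \<B>" unfolding H_def by measurable
    define D where "D x = (\<integral>\<^sub>+v. indicator {0<..} v * ennreal (v powr (- (2 * d + 1)) * (norm (diff_op d F v x))\<^sup>2))" for x
    have [measurable]: "D \<in> \<B>" unfolding D_def by measurable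
    define N where "N x = ennreal ?K * (H x)\<^sup>2 + 2 * D x" for x
    have N[measurable]: "N \<in> \<B>" unfolding N_def by measurable
    have pt: "nsq (riesz d F v x) \<le> ennreal (2 * (v powr (2 * d))) * (ennreal ?C * H x)\<^sup>2 + 2 * nsq (diff_op d F v x)"
      if v: "v > 0" for v x
    proof (cases "integrable lborel (\<lambda>\<xi>. of_real (pos_powr d (v - (norm \<xi>)\<^sup>2)) * F \<xi>)")
      case False
      then have "riesz d F v x = 0" unfolding riesz_def by (intro ift_not_integrable) measurable
      then show ?thesis by simp
    next
      case True
      \<comment> \<open>The parameter for which the Gaussian is \<open>exp (- (norm \<xi>)\<^sup>2 / v)\<close>.\<close>
      let ?t = "1 / (pi * v)"
      have t: "?t > 0" using v by simp
      define h where "h = ift (\<lambda>\<xi>. of_real (gaussian ?t \<xi>) * F \<xi>) x"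
      have gi: "integrable lborel (\<lambda>\<xi>. of_real (gaussian ?t \<xi>) * F \<xi>)"
        by (rule integrable_mult_bounded[OF gaussian_fourier(1)[OF t] _ Fb]) simp
      have ge: "exp (- ((norm \<xi>)\<^sup>2 / v)) = gaussian ?t \<xi>" for \<xi> :: 'a
        using v by (simp add: gaussian_def field_simps)
      have "diff_op d F v x = ift (\<lambda>\<xi>. of_real (pos_powr d (v - (norm \<xi>)\<^sup>2)) * F \<xi>) x - of_real (v powr d) * h"
      proof -
        have "diff_op d F v x = (LINT \<xi>|lborel. of_real (pos_powr d (v - (norm \<xi>)\<^sup>2)) * F \<xi> * \<e> (x \<bullet> \<xi>) -
           of_real (v powr d) * (of_real (gaussian ?t \<xi>) * F \<xi> * \<e> (x \<bullet> \<xi>)))"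
          unfolding diff_op_def ift_def riesz_heat_diff_def ge by (simp add: algebra_simps)
        also have "\<dots> = (LINT \<xi>|lborel. of_real (pos_powr d (v - (norm \<xi>)\<^sup>2)) * F \<xi> * \<e> (x \<bullet> \<xi>)) -
           (LINT \<xi>|lborel. of_real (v powr d) * (of_real (gaussian ?t \<xi>) * F \<xi> * \<e> (x \<bullet> \<xi>)))"
          by (intro Bochner_Integration.integral_diff integrable_mult_right integrable_mult_cis True gi) auto
        finally show ?thesis unfolding h_def ift_def by simp
      qed
      then have eq: "riesz d F v x = of_real (v powr d) * h + diff_op d F v x" unfolding riesz_def by simp
      have h: "enorm h \<le> ennreal ?C * H x"
      proof -
        have "h = (LINT y|lborel. g y * of_real (heat ?t (y - x)))"
          unfolding h_def F_def by (rule fourier_gaussian_mean[OF t g])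
        then have "enorm h \<le> (\<integral>\<^sub>+y. enorm (g y * of_real (heat ?t (y - x))))"
          using norm_integral_le_nn_integral by metis
        also have "\<dots> = heat_conv ?t (\<lambda>x. enorm (g x)) x"
          unfolding heat_conv_def by (simp add: norm_mult ennreal_mult heat_diff_commute[of _ x] mult.commute)
        also have "\<dots> \<le> ennreal ?C * H x"
          unfolding H_def by (rule heat_conv_le_dyadic[OF t]) measurable
        finally show ?thesis .
      qed
      have "(norm (riesz d F v x))\<^sup>2 \<le> 2 * (norm (of_real (v powr d) * h))\<^sup>2 + 2 * (norm (diff_op d F v x))\<^sup>2"
        unfolding eq by (rule norm_add_squared_le)
      also have "(norm (of_real (v powr d) * h))\<^sup>2 = v powr (2 * d) * (norm h)\<^sup>2"
        by (simp add: norm_mult power_mult_distrib power2_eq_square powr_add[symmetric])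
      finally have "nsq (riesz d F v x) \<le> ennreal (2 * (v powr (2 * d) * (norm h)\<^sup>2) + 2 * (norm (diff_op d F v x))\<^sup>2)"
        by (rule ennreal_leI)
      also have "\<dots> = ennreal (2 * (v powr (2 * d))) * (enorm h)\<^sup>2 + 2 * nsq (diff_op d F v x)"
        by (simp add: ennreal_mult ennreal_power mult.assoc)
      also have "\<dots> \<le> ennreal (2 * (v powr (2 * d))) * (ennreal ?C * H x)\<^sup>2 + 2 * nsq (diff_op d F v x)"
        by (intro add_mono mult_left_mono power_mono h) auto
      finally show ?thesis .
    qed
    have en: "energy d F \<tau> x \<le> ennreal (\<tau> powr (2 * d + 1)) * N x" if tau: "\<tau> > 0" for \<tau> x
    proof -
      have "energy d F \<tau> x \<le> (\<integral>\<^sub>+v. (ennreal 2 * (ennreal ?C * H x)\<^sup>2) * (indicator {0<..<\<tau>} v * ennreal (v powr (2 * d))) +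
         ennreal (\<tau> powr (2 * d + 1)) * (2 * (indicator {0<..} v * ennreal (v powr (- (2 * d + 1)) * (norm (diff_op d F v x))\<^sup>2))))"
        unfolding energy_def
      proof (intro nn_integral_mono)
        fix v :: real
        show "indicator {0<..<\<tau>} v * nsq (riesz d F v x) \<le>
          (ennreal 2 * (ennreal ?C * H x)\<^sup>2) * (indicator {0<..<\<tau>} v * ennreal (v powr (2 * d))) +
         ennreal (\<tau> powr (2 * d + 1)) * (2 * (indicator {0<..} v * ennreal (v powr (- (2 * d + 1)) * (norm (diff_op d F v x))\<^sup>2)))"
        proof (cases "0 < v \<and> v < \<tau>")
          case False
          then have "indicator {0<..<\<tau>} v = (0::ennreal)" by auto
          then show ?thesis by simp
        next
          case True
          have "1 \<le> (\<tau> / v) powr (2 * d + 1)" using True d by (intro ge_one_powr_ge_zero) auto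
          also have "(\<tau> / v) powr (2 * d + 1) = \<tau> powr (2 * d + 1) * v powr (- (2 * d + 1))"
            using True powr_minus_divide[of v "2 * d + 1"] by (simp add: powr_divide)
          finally have "1 * (norm (diff_op d F v x))\<^sup>2 \<le> \<tau> powr (2 * d + 1) * v powr (- (2 * d + 1)) * (norm (diff_op d F v x))\<^sup>2"
            by (intro mult_right_mono) auto
          then have "nsq (diff_op d F v x) \<le> ennreal (\<tau> powr (2 * d + 1) * (v powr (- (2 * d + 1)) * (norm (diff_op d F v x))\<^sup>2))"
            by (intro ennreal_leI) (simp add: mult.assoc)
          then have 1: "nsq (diff_op d F v x) \<le> ennreal (\<tau> powr (2 * d + 1)) * ennreal (v powr (- (2 * d + 1)) * (norm (diff_op d F v x))\<^sup>2)"
            by (simp add: ennreal_mult)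
          have "indicator {0<..<\<tau>} v * nsq (riesz d F v x) = nsq (riesz d F v x)" using True by simp
          also have "\<dots> \<le> ennreal (2 * (v powr (2 * d))) * (ennreal ?C * H x)\<^sup>2 + 2 * nsq (diff_op d F v x)"
            using True by (intro pt) auto
          also have "\<dots> \<le> ennreal (2 * (v powr (2 * d))) * (ennreal ?C * H x)\<^sup>2 + 2 * (ennreal (\<tau> powr (2 * d + 1)) * ennreal (v powr (- (2 * d + 1)) * (norm (diff_op d F v x))\<^sup>2))"
            by (intro add_left_mono mult_left_mono 1) auto
          also have "\<dots> = (ennreal 2 * (ennreal ?C * H x)\<^sup>2) * (indicator {0<..<\<tau>} v * ennreal (v powr (2 * d))) +
         ennreal (\<tau> powr (2 * d + 1)) * (2 * (indicator {0<..} v * ennreal (v powr (- (2 * d + 1)) * (norm (diff_op d F v x))\<^sup>2)))"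
          proof -
            have i1: "indicator {0<..<\<tau>} v = (1::ennreal)" "indicator {0<..} v = (1::ennreal)" using True by auto
            have "ennreal (2 * (v powr (2 * d))) = ennreal 2 * ennreal (v powr (2 * d))" by (rule ennreal_mult) auto
            then show ?thesis unfolding i1 mult_1 by (simp only: mult_ac)
          qed
          finally show ?thesis .
        qed
      qed
      also have "\<dots> = (ennreal 2 * (ennreal ?C * H x)\<^sup>2) * (\<integral>\<^sub>+v. indicator {0<..<\<tau>} v * ennreal (v powr (2 * d))) +
         ennreal (\<tau> powr (2 * d + 1)) * (2 * D x)"
        unfolding D_def by (simp add: nn_integral_add nn_integral_cmult)
      also have "(\<integral>\<^sub>+v. indicator {0<..<\<tau>} v * ennreal (v powr (2 * d))) = ennreal (\<tau> powr (2 * d + 1) / (2 * d + 1))"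
        by (rule nn_integral_powr_0) (use d tau in auto)
      also have "(ennreal 2 * (ennreal ?C * H x)\<^sup>2) * ennreal (\<tau> powr (2 * d + 1) / (2 * d + 1)) = ennreal (\<tau> powr (2 * d + 1)) * (ennreal ?K * (H x)\<^sup>2)"
      proof -
        have "ennreal 2 * (ennreal ?C)\<^sup>2 * ennreal (\<tau> powr (2 * d + 1) / (2 * d + 1)) = ennreal (2 * ?C\<^sup>2 * (\<tau> powr (2 * d + 1) / (2 * d + 1)))"
          using d by (simp only: ennreal_mult[symmetric] ennreal_power zero_le_power2 zero_le_numeral mult_nonneg_nonneg powr_ge_zero)
             (rule ennreal_mult[symmetric], auto)
        also have "2 * ?C\<^sup>2 * (\<tau> powr (2 * d + 1) / (2 * d + 1)) = \<tau> powr (2 * d + 1) * ?K" by simp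
        also have "ennreal \<dots> = ennreal (\<tau> powr (2 * d + 1)) * ennreal ?K" using K0 by (intro ennreal_mult) auto
        finally have e: "ennreal 2 * (ennreal ?C)\<^sup>2 * ennreal (\<tau> powr (2 * d + 1) / (2 * d + 1)) = ennreal (\<tau> powr (2 * d + 1)) * ennreal ?K" .
        have "(ennreal 2 * (ennreal ?C * H x)\<^sup>2) * ennreal (\<tau> powr (2 * d + 1) / (2 * d + 1)) =
           (ennreal 2 * (ennreal ?C)\<^sup>2 * ennreal (\<tau> powr (2 * d + 1) / (2 * d + 1))) * (H x)\<^sup>2"
          unfolding power_mult_distrib by (simp only: mult_ac)
        then show ?thesis unfolding e by (simp only: mult.assoc)
      qed
      finally show ?thesis unfolding N_def by (simp only: distrib_left)
    qed
    have Hint: "(\<integral>\<^sub>+x. (H x)\<^sup>2) \<le> ennreal (heat_const TYPE('a)) * (\<integral>\<^sub>+x. nsq (g x))"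
      unfolding H_def using dyadic_heat_max_L2[of "\<lambda>x. enorm (g x)"] by (simp add: ennreal_power)
    have Dint: "(\<integral>\<^sub>+x. D x) \<le> ennreal c0 * (\<integral>\<^sub>+x. nsq (g x))"
    proof -
      have "(\<integral>\<^sub>+x. D x) \<le> ennreal c0 * (\<integral>\<^sub>+\<xi>. nsq (F \<xi>))"
        unfolding D_def by (rule diff_op_integral_le[OF c0(2) F])
      also have "\<dots> \<le> ennreal c0 * (\<integral>\<^sub>+x. nsq (g x))"
        unfolding F_def by (intro mult_left_mono fourier_L2_le) auto
      finally show ?thesis .
    qed
    have "(\<integral>\<^sub>+x. N x) = ennreal ?K * (\<integral>\<^sub>+x. (H x)\<^sup>2) + 2 * (\<integral>\<^sub>+x. D x)"
      unfolding N_def by (simp add: nn_integral_add nn_integral_cmult)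
    also have "\<dots> \<le> ennreal ?K * (ennreal (heat_const TYPE('a)) * (\<integral>\<^sub>+x. nsq (g x))) + 2 * (ennreal c0 * (\<integral>\<^sub>+x. nsq (g x)))"
      by (intro add_mono mult_left_mono Hint Dint) auto
    also have "\<dots> = ennreal c * (\<integral>\<^sub>+x. nsq (g x))"
    proof -
      have "ennreal c = ennreal ?K * ennreal (heat_const TYPE('a)) + 2 * ennreal c0"
      proof -
        have "ennreal (K * h + 2 * b) = ennreal K * ennreal h + 2 * ennreal b" if "K \<ge> 0" "h \<ge> 0" "b \<ge> 0" for K h b :: real
          using that by (simp add: ennreal_mult ennreal_plus)
        from this[OF K0 hc c0(1)] show ?thesis unfolding c_def .
      qed
      then show ?thesis by (simp only: distrib_right mult.assoc)
    qed
    finally have Nint: "(\<integral>\<^sub>+x. N x) \<le> ennreal c * (\<integral>\<^sub>+x. nsq (g x))" .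
    show ?thesis using N en Nint unfolding F_def by blast
  qed
  moreover have "c \<ge> 0" unfolding c_def using K0 hc c0(1) d by (intro add_nonneg_nonneg mult_nonneg_nonneg) auto
  ultimately show thesis using that by blast
qed

section \<open>Bilinear forms with subordinated symbols\<close>

definition beta_const :: "real \<Rightarrow> real" where
  "beta_const d = Beta (d + 1) (d + 1)"

lemma beta_const_pos: "d > -1 \<Longrightarrow> beta_const d > 0"
  unfolding beta_const_def Beta_def by (intro divide_pos_pos mult_pos_pos Gamma_real_pos) auto

text \<open>A truncated power of \<open>\<tau> - a - b\<close> is a superposition of products of truncated powers of \<open>\<tau> - v - a\<close>
  and \<open>v - b\<close>. With \<open>a = (norm \<xi>)\<^sup>2\<close> and \<open>b = (norm \<eta>)\<^sup>2\<close> this decouples the two frequency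
  variables.\<close>

lemma beta_subordination:
  assumes d: "d > -1"
  shows "(\<integral>\<^sub>+v. ennreal (pos_powr d (\<tau> - v - a) * pos_powr d (v - b))) = ennreal (beta_const d * pos_powr (2 * d + 1) (\<tau> - a - b))"
proof (cases "\<tau> - a - b > 0")
  case False
  have z: "pos_powr d (\<tau> - v - a) * pos_powr d (v - b) = 0" for v
    using False by (cases "v > b") (auto simp: pos_powr_nonpos)
  show ?thesis unfolding z using False by (simp add: pos_powr_nonpos)
next
  case True
  define L where "L = \<tau> - a - b"
  have L: "L > 0" using True by (simp add: L_def)
  have "((\<lambda>t. t powr d * (1 - t) powr d) has_integral Beta (d + 1) (d + 1)) {0..1}"
    using has_integral_Beta_real[of "d + 1" "d + 1"] d by simp
  then have bi: "(\<integral>\<^sub>+u. ennreal (u powr d * (1 - u) powr d) * indicator {0..1} u) = ennreal (beta_const d)"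
    unfolding beta_const_def by (intro nn_integral_has_integral_lebesgue') auto
  have "(\<integral>\<^sub>+v. ennreal (pos_powr d (\<tau> - v - a) * pos_powr d (v - b)))
    = ennreal \<bar>L\<bar> * (\<integral>\<^sub>+u. ennreal (pos_powr d (\<tau> - (b + L * u) - a) * pos_powr d (b + L * u - b)))"
    by (rule nn_integral_real_affine) (use L in auto)
  also have "\<dots> = ennreal L * (\<integral>\<^sub>+u. ennreal (L powr (2 * d)) * (ennreal (u powr d * (1 - u) powr d) * indicator {0..1} u))"
  proof -
    have "ennreal (pos_powr d (\<tau> - (b + L * u) - a) * pos_powr d (b + L * u - b)) =
      ennreal (L powr (2 * d)) * (ennreal (u powr d * (1 - u) powr d) * indicator {0..1} u)" for u
    proof -
      have e1: "\<tau> - (b + L * u) - a = L * (1 - u)" unfolding L_def by (simp add: algebra_simps)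
      have e2: "b + L * u - b = L * u" by simp
      consider "u \<le> 0" | "u \<ge> 1" | "0 < u" "u < 1" by linarith
      then show ?thesis unfolding e1 e2
      proof cases
        case 1
        then have "L * u \<le> 0" using L by (simp add: mult_le_0_iff)
        then show "ennreal (pos_powr d (L * (1 - u)) * pos_powr d (L * u)) = ennreal (L powr (2 * d)) * (ennreal (u powr d * (1 - u) powr d) * indicator {0..1} u)"
          using 1 by (cases "u = 0") (auto simp: pos_powr_nonpos)
      next
        case 2
        then have "L * (1 - u) \<le> 0" using L by (simp add: mult_le_0_iff)
        then show "ennreal (pos_powr d (L * (1 - u)) * pos_powr d (L * u)) = ennreal (L powr (2 * d)) * (ennreal (u powr d * (1 - u) powr d) * indicator {0..1} u)"
          using 2 by (cases "u = 1") (auto simp: pos_powr_nonpos)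
      next
        case 3
        then have "pos_powr d (L * (1 - u)) * pos_powr d (L * u) = L powr (2 * d) * (u powr d * (1 - u) powr d)"
          using L powr_add[of L d d] by (simp add: pos_powr_pos powr_mult)
        then show "ennreal (pos_powr d (L * (1 - u)) * pos_powr d (L * u)) = ennreal (L powr (2 * d)) * (ennreal (u powr d * (1 - u) powr d) * indicator {0..1} u)"
          using 3 by (simp add: ennreal_mult)
      qed
    qed
    then show ?thesis using L by simp
  qed
  also have "\<dots> = ennreal L * (ennreal (L powr (2 * d)) * ennreal (beta_const d))"
    by (subst nn_integral_cmult) (auto simp: bi)
  also have "\<dots> = ennreal (beta_const d * L powr (2 * d + 1))"
    using L beta_const_pos[OF d] by (simp add: ennreal_mult[symmetric] powr_add mult_ac)
  finally show ?thesis using True by (simp add: pos_powr_pos L_def)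
qed

lemma beta_subordination_integral:
  assumes d: "d > -1"
  shows "(LINT v|lborel. complex_of_real (pos_powr d (\<tau> - v - a) * pos_powr d (v - b))) = of_real (beta_const d * pos_powr (2 * d + 1) (\<tau> - a - b))"
proof -
  have "(LINT v|lborel. pos_powr d (\<tau> - v - a) * pos_powr d (v - b)) = beta_const d * pos_powr (2 * d + 1) (\<tau> - a - b)"
    by (rule integral_eq_nn_integral[THEN trans]) (use beta_const_pos[OF d] in \<open>auto simp: beta_subordination[OF d]\<close>)
  then show ?thesis by (simp only: integral_complex_of_real)
qed

abbreviation LL :: "('a::euclidean_space \<times> 'b::euclidean_space) measure" where
  "LL \<equiv> lborel \<Otimes>\<^sub>M lborel"

definition bilin_form :: "('a::euclidean_space \<times> 'a \<Rightarrow> complex) \<Rightarrow> 'a \<Rightarrow> complex" where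
  "bilin_form K x = (LINT z|LL. K z * \<e> (x \<bullet> (fst z + snd z)))"

text \<open>The symbol is written as an integral over \<open>\<tau>\<close> and \<open>v\<close> by means of the Beta integral. After Fubini, which
  is justified by \<open>fin\<close>, the inner form is the product of a Riesz mean of \<open>F\<close> and one of \<open>G\<close>.\<close>

lemma riesz_bilinear_bound:
  fixes F G :: "'a::euclidean_space \<Rightarrow> complex" and w :: "real \<Rightarrow> complex"
  assumes d: "d > -1" and [measurable]: "F \<in> \<B>" "G \<in> \<B>" "w \<in> \<B>"
    and fin: "(\<integral>\<^sup>+z. ennreal (norm (F (fst z)) * norm (G (snd z))) *
       (\<integral>\<^sub>+\<tau>. enorm (w \<tau>) * ennreal (pos_powr (2 * d + 1) (\<tau> - (norm (fst z))\<^sup>2 - (norm (snd z))\<^sup>2))) \<partial>LL) < \<infinity>"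
  shows "ennreal (beta_const d * norm (bilin_form (\<lambda>z. (LINT \<tau>|lborel. w \<tau> * of_real (pos_powr (2 * d + 1) (\<tau> - (norm (fst z))\<^sup>2 - (norm (snd z))\<^sup>2))) * F (fst z) * G (snd z)) x))
    \<le> (\<integral>\<^sub>+\<tau>. enorm (w \<tau>) * (\<integral>\<^sub>+v. enorm (riesz d F (\<tau> - v) x) * enorm (riesz d G v x)))"
proof -
  let ?B = "beta_const d"
  have B: "?B > 0" by (rule beta_const_pos[OF d])
  interpret Q: pair_sigma_finite "LL :: ('a \<times> 'a) measure" "LL :: (real \<times> real) measure"
    by (intro pair_sigma_finite.intro lborel_pair.P.sigma_finite_measure_axioms)
  define k where "k z p = complex_of_real (pos_powr d (fst p - snd p - (norm (fst z))\<^sup>2) * pos_powr d (snd p - (norm (snd z))\<^sup>2))"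
    for z :: "'a \<times> 'a" and p :: "real \<times> real"
  define e where "e z = \<e> (x \<bullet> (fst z + snd z))" for z :: "'a \<times> 'a"
  define Psi where "Psi z p = w (fst p) * k z p * (F (fst z) * G (snd z) * e z)" for z p
  have [measurable]: "case_prod k \<in> borel_measurable (LL \<Otimes>\<^sub>M LL)" unfolding k_def by measurable
  have [measurable]: "e \<in> borel_measurable LL" unfolding e_def by measurable
  have Pm[measurable]: "case_prod Psi \<in> borel_measurable (LL \<Otimes>\<^sub>M LL)" unfolding Psi_def by measurable
  have nPsi: "norm (Psi z (\<tau>, v)) = norm (w \<tau>) * (pos_powr d (\<tau> - v - (norm (fst z))\<^sup>2) * pos_powr d (v - (norm (snd z))\<^sup>2)) * (norm (F (fst z)) * norm (G (snd z)))" for z \<tau> v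
    unfolding Psi_def k_def e_def by (simp add: norm_mult)
  have int: "integrable (LL \<Otimes>\<^sub>M LL) (case_prod Psi)"
  proof (rule integrableI_bounded)
    have "(\<integral>\<^sup>+q. enorm (case_prod Psi q) \<partial>(LL \<Otimes>\<^sub>M LL)) = (\<integral>\<^sup>+z. \<integral>\<^sup>+p. enorm (Psi z p) \<partial>LL \<partial>LL)"
      by (subst lborel_pair.P.nn_integral_fst[symmetric]) auto
    also have "\<dots> = (\<integral>\<^sup>+z. (\<integral>\<^sub>+\<tau>. \<integral>\<^sub>+v. enorm (Psi z (\<tau>, v))) \<partial>LL)"
    proof (rule nn_integral_cong)
      fix z :: "'a \<times> 'a" assume "z \<in> space LL"
      then have "(\<lambda>p. enorm (Psi z p)) \<in> borel_measurable LL" by measurable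
      from lborel.nn_integral_fst[OF this] show "(\<integral>\<^sup>+p. enorm (Psi z p) \<partial>LL) = (\<integral>\<^sub>+\<tau>. \<integral>\<^sub>+v. enorm (Psi z (\<tau>, v)))"
        by simp
    qed
    also have "\<dots> = (\<integral>\<^sup>+z. ennreal ?B * (ennreal (norm (F (fst z)) * norm (G (snd z))) *
       (\<integral>\<^sub>+\<tau>. enorm (w \<tau>) * ennreal (pos_powr (2 * d + 1) (\<tau> - (norm (fst z))\<^sup>2 - (norm (snd z))\<^sup>2)))) \<partial>LL)"
    proof (rule nn_integral_cong)
      fix z :: "'a \<times> 'a"
      let ?c = "ennreal (norm (F (fst z)) * norm (G (snd z)))"
      have "(\<integral>\<^sub>+v. enorm (Psi z (\<tau>, v))) = ennreal ?B * (?c * (enorm (w \<tau>) * ennreal (pos_powr (2 * d + 1) (\<tau> - (norm (fst z))\<^sup>2 - (norm (snd z))\<^sup>2))))" for \<tau>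
      proof -
        have "(\<integral>\<^sub>+v. enorm (Psi z (\<tau>, v))) = (\<integral>\<^sub>+v. (?c * enorm (w \<tau>)) * ennreal (pos_powr d (\<tau> - v - (norm (fst z))\<^sup>2) * pos_powr d (v - (norm (snd z))\<^sup>2)))"
          unfolding nPsi by (intro nn_integral_cong) (simp add: ennreal_mult mult_ac)
        also have "\<dots> = (?c * enorm (w \<tau>)) * (\<integral>\<^sub>+v. ennreal (pos_powr d (\<tau> - v - (norm (fst z))\<^sup>2) * pos_powr d (v - (norm (snd z))\<^sup>2)))"
          by (rule nn_integral_cmult) measurable
        also have "\<dots> = (?c * enorm (w \<tau>)) * (ennreal ?B * ennreal (pos_powr (2 * d + 1) (\<tau> - (norm (fst z))\<^sup>2 - (norm (snd z))\<^sup>2)))"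
          unfolding beta_subordination[OF d] using B by (simp add: ennreal_mult)
        finally show ?thesis by (simp only: mult_ac)
      qed
      then show "(\<integral>\<^sub>+\<tau>. \<integral>\<^sub>+v. enorm (Psi z (\<tau>, v))) = ennreal ?B * (?c *
       (\<integral>\<^sub>+\<tau>. enorm (w \<tau>) * ennreal (pos_powr (2 * d + 1) (\<tau> - (norm (fst z))\<^sup>2 - (norm (snd z))\<^sup>2))))"
        by (simp add: nn_integral_cmult)
    qed
    also have "\<dots> = ennreal ?B * (\<integral>\<^sup>+z. (ennreal (norm (F (fst z)) * norm (G (snd z))) *
       (\<integral>\<^sub>+\<tau>. enorm (w \<tau>) * ennreal (pos_powr (2 * d + 1) (\<tau> - (norm (fst z))\<^sup>2 - (norm (snd z))\<^sup>2)))) \<partial>LL)"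
      by (rule nn_integral_cmult) measurable
    also have "\<dots> < \<infinity>" using fin by (simp add: ennreal_mult_less_top)
    finally show "(\<integral>\<^sup>+q. enorm (case_prod Psi q) \<partial>(LL \<Otimes>\<^sub>M LL)) < \<infinity>" .
  qed measurable
  let ?mu = "\<lambda>z. (LINT \<tau>|lborel. w \<tau> * complex_of_real (pos_powr (2 * d + 1) (\<tau> - (norm (fst z))\<^sup>2 - (norm (snd z))\<^sup>2)))"
  have left: "(LINT z|LL. LINT p|LL. Psi z p) = of_real ?B * bilin_form (\<lambda>z. ?mu z * F (fst z) * G (snd z)) x"
  proof -
    have "(LINT z|LL. LINT p|LL. Psi z p) = (LINT z|LL. of_real ?B * (?mu z * F (fst z) * G (snd z) * e z))"
    proof (rule integral_cong_AE)
      show "AE z in LL. (LINT p|LL. Psi z p) = of_real ?B * (?mu z * F (fst z) * G (snd z) * e z)"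
        using Q.AE_integrable_fst[OF int]
      proof eventually_elim
        case (elim z)
        have "(LINT p|LL. Psi z p) = (LINT \<tau>|lborel. LINT v|lborel. Psi z (\<tau>, v))"
          using lborel_pair.integral_fst'[OF elim] by simp
        also have "\<dots> = (LINT \<tau>|lborel. w \<tau> * of_real (?B * pos_powr (2 * d + 1) (\<tau> - (norm (fst z))\<^sup>2 - (norm (snd z))\<^sup>2)) * (F (fst z) * G (snd z) * e z))"
          unfolding Psi_def k_def fst_conv snd_conv
          by (simp only: integral_mult_left_zero integral_mult_right_zero beta_subordination_integral[OF d])
        also have "\<dots> = of_real ?B * (?mu z * F (fst z) * G (snd z) * e z)"
          unfolding integral_mult_left_zero[symmetric] integral_mult_right_zero[symmetric]
          by (intro LINT_cong refl) (simp add: mult_ac)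
        finally show ?case .
      qed
    qed measurable
    then show ?thesis unfolding bilin_form_def e_def by simp
  qed
  have right: "(LINT p|LL. LINT z|LL. Psi z p) = (LINT p|LL. w (fst p) * (riesz d F (fst p - snd p) x * riesz d G (snd p) x))"
  proof (rule integral_cong_AE)
    show "AE p in LL. (LINT z|LL. Psi z p) = w (fst p) * (riesz d F (fst p - snd p) x * riesz d G (snd p) x)"
      using Q.AE_integrable_snd[OF int]
    proof eventually_elim
      case (elim p)
      let ?f = "\<lambda>\<xi>. of_real (pos_powr d (fst p - snd p - (norm \<xi>)\<^sup>2)) * F \<xi> * \<e> (x \<bullet> \<xi>)"
      let ?g = "\<lambda>\<eta>. of_real (pos_powr d (snd p - (norm \<eta>)\<^sup>2)) * G \<eta> * \<e> (x \<bullet> \<eta>)"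
      have "(LINT z|LL. Psi z p) = (LINT \<xi>|lborel. LINT \<eta>|lborel. Psi (\<xi>, \<eta>) p)"
        using lborel_pair.integral_fst'[OF elim] by simp
      also have "\<dots> = (LINT \<xi>|lborel. LINT \<eta>|lborel. w (fst p) * (?f \<xi> * ?g \<eta>))"
        unfolding Psi_def k_def e_def fst_conv snd_conv
        by (intro LINT_cong refl) (simp add: inner_add_right distrib_left cis_mult[symmetric] mult_ac)
      also have "\<dots> = w (fst p) * (riesz d F (fst p - snd p) x * riesz d G (snd p) x)"
        by (simp only: integral_mult_left_zero integral_mult_right_zero riesz_def ift_def)
      finally show ?case .
    qed
  qed measurable
  have "ennreal (?B * norm (bilin_form (\<lambda>z. ?mu z * F (fst z) * G (snd z)) x)) = enorm (LINT z|LL. LINT p|LL. Psi z p)"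
    unfolding left using B by (simp add: norm_mult)
  also have "(LINT z|LL. LINT p|LL. Psi z p) = (LINT p|LL. LINT z|LL. Psi z p)"
    by (rule Q.Fubini_integral[OF int, symmetric])
  also have "enorm \<dots> \<le> (\<integral>\<^sup>+p. enorm (w (fst p) * (riesz d F (fst p - snd p) x * riesz d G (snd p) x)) \<partial>LL)"
    unfolding right by (rule norm_integral_le_nn_integral)
  also have "\<dots> = (\<integral>\<^sub>+\<tau>. \<integral>\<^sub>+v. enorm (w \<tau> * (riesz d F (\<tau> - v) x * riesz d G v x)))"
    by (subst lborel.nn_integral_fst[symmetric]) auto
  also have "\<dots> = (\<integral>\<^sub>+\<tau>. enorm (w \<tau>) * (\<integral>\<^sub>+v. enorm (riesz d F (\<tau> - v) x) * enorm (riesz d G v x)))"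
    by (simp add: norm_mult ennreal_mult nn_integral_cmult)
  finally show ?thesis .
qed

text \<open>Cauchy--Schwarz in \<open>v\<close>; both factors vanish unless \<open>0 < v < \<tau>\<close>.\<close>

lemma riesz_convolution_energy:
  fixes F G :: "'a::euclidean_space \<Rightarrow> complex"
  assumes [measurable]: "F \<in> \<B>" "G \<in> \<B>"
  shows "(\<integral>\<^sub>+v. enorm (riesz d F (\<tau> - v) x) * enorm (riesz d G v x))\<^sup>2 \<le> energy d F \<tau> x * energy d G \<tau> x"
proof -
  have "(\<integral>\<^sub>+v. enorm (riesz d F (\<tau> - v) x) * enorm (riesz d G v x))\<^sup>2 \<le>
    (\<integral>\<^sub>+v. indicator {0<..<\<tau>} (\<tau> - v) * nsq (riesz d F (\<tau> - v) x)) *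
    (\<integral>\<^sub>+v. indicator {0<..<\<tau>} v * nsq (riesz d G v x))"
  proof (rule nn_integral_Cauchy_Schwarz_dominated)
    fix v
    show "(enorm (riesz d F (\<tau> - v) x) * enorm (riesz d G v x))\<^sup>2 \<le>
      (indicator {0<..<\<tau>} (\<tau> - v) * nsq (riesz d F (\<tau> - v) x)) * (indicator {0<..<\<tau>} v * nsq (riesz d G v x))"
      by (cases "0 < v \<and> v < \<tau>") (auto simp: power_mult_distrib ennreal_power not_less riesz_nonpos)
  qed measurable
  also have "(\<integral>\<^sub>+v. indicator {0<..<\<tau>} (\<tau> - v) * nsq (riesz d F (\<tau> - v) x)) = energy d F \<tau> x"
    unfolding energy_def by (rule nn_integral_lborel_reflection) measurable
  finally show ?thesis unfolding energy_def .
qed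

lemma riesz_convolution_nonpos:
  "\<tau> \<le> 0 \<Longrightarrow> enorm (riesz d F (\<tau> - v) x) * enorm (riesz d G v x) = 0"
  by (cases "v \<le> 0") (auto simp: riesz_nonpos)

text \<open>If the density is integrable with the weight that the energies produce, then maximal functions alone
  control the form. This serves the low frequencies.\<close>

lemma bilinear_estimate_L1:
  fixes F G :: "'a::euclidean_space \<Rightarrow> complex" and w :: "real \<Rightarrow> complex"
  assumes d: "d > -1/2" and F: "integrable lborel F" and G: "integrable lborel G" and [measurable]: "w \<in> \<B>"
    and W: "(\<integral>\<^sub>+\<tau>. indicator {0<..} \<tau> * ennreal (\<tau> powr (2 * d + 1) * norm (w \<tau>))) = ennreal W"
    and NF: "\<And>\<tau>. \<tau> > 0 \<Longrightarrow> energy d F \<tau> x \<le> ennreal (\<tau> powr (2 * d + 1)) * NF"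
    and NG: "\<And>\<tau>. \<tau> > 0 \<Longrightarrow> energy d G \<tau> x \<le> ennreal (\<tau> powr (2 * d + 1)) * NG"
  shows "(ennreal (beta_const d * norm (bilin_form (\<lambda>z. (LINT \<tau>|lborel. w \<tau> * of_real (pos_powr (2 * d + 1) (\<tau> - (norm (fst z))\<^sup>2 - (norm (snd z))\<^sup>2))) * F (fst z) * G (snd z)) x)))\<^sup>2
    \<le> (ennreal W)\<^sup>2 * (NF * NG)"
proof -
  have [measurable]: "F \<in> \<B>" "G \<in> \<B>" using F G by auto
  let ?X = "\<lambda>\<tau>. \<integral>\<^sub>+v. enorm (riesz d F (\<tau> - v) x) * enorm (riesz d G v x)"
  let ?W = "\<lambda>\<tau>. indicator {0<..} \<tau> * ennreal (\<tau> powr (2 * d + 1) * norm (w \<tau>))"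
  have fin: "(\<integral>\<^sup>+z. ennreal (norm (F (fst z)) * norm (G (snd z))) *
       (\<integral>\<^sub>+\<tau>. enorm (w \<tau>) * ennreal (pos_powr (2 * d + 1) (\<tau> - (norm (fst z))\<^sup>2 - (norm (snd z))\<^sup>2))) \<partial>LL) < \<infinity>"
  proof -
    have "(\<integral>\<^sup>+z. ennreal (norm (F (fst z)) * norm (G (snd z))) *
       (\<integral>\<^sub>+\<tau>. enorm (w \<tau>) * ennreal (pos_powr (2 * d + 1) (\<tau> - (norm (fst z))\<^sup>2 - (norm (snd z))\<^sup>2))) \<partial>LL)
      \<le> (\<integral>\<^sup>+z. ennreal (norm (F (fst z)) * norm (G (snd z))) * (\<integral>\<^sub>+\<tau>. ?W \<tau>) \<partial>LL)"
    proof (rule nn_integral_mono, rule mult_left_mono, rule nn_integral_mono)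
      fix z :: "'a \<times> 'a" and \<tau> :: real
      let ?r = "\<tau> - (norm (fst z))\<^sup>2 - (norm (snd z))\<^sup>2"
      show "enorm (w \<tau>) * ennreal (pos_powr (2 * d + 1) ?r) \<le> ?W \<tau>"
      proof (cases "?r > 0")
        case True
        then have t: "\<tau> > 0" using zero_le_power2[of "norm (fst z)"] zero_le_power2[of "norm (snd z)"] by linarith
        have "?r \<le> \<tau>" using zero_le_power2[of "norm (fst z)"] zero_le_power2[of "norm (snd z)"] by linarith
        then have "pos_powr (2 * d + 1) ?r \<le> \<tau> powr (2 * d + 1)" using True d by (simp add: pos_powr_pos powr_mono2)
        then have "pos_powr (2 * d + 1) ?r * norm (w \<tau>) \<le> \<tau> powr (2 * d + 1) * norm (w \<tau>)" by (intro mult_right_mono) auto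
        then have "ennreal (pos_powr (2 * d + 1) ?r * norm (w \<tau>)) \<le> ennreal (\<tau> powr (2 * d + 1) * norm (w \<tau>))" by (rule ennreal_leI)
        then show ?thesis using t by (simp add: ennreal_mult mult.commute)
      next
        case False then show ?thesis by (simp add: pos_powr_nonpos)
      qed
    qed simp
    also have "\<dots> = (\<integral>\<^sup>+z. ennreal (norm (F (fst z)) * norm (G (snd z))) \<partial>LL) * ennreal W"
      unfolding W by (rule nn_integral_multc) measurable
    also have "(\<integral>\<^sup>+z. ennreal (norm (F (fst z)) * norm (G (snd z))) \<partial>LL) = (\<integral>\<^sub>+\<xi>. \<integral>\<^sub>+\<eta>. ennreal (norm (F \<xi>) * norm (G \<eta>)))"
      by (subst lborel.nn_integral_fst[symmetric]) auto
    also have "\<dots> * ennreal W < \<infinity>" using nn_integral_product_finite[OF F G] by (simp add: ennreal_mult_less_top)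
    finally show ?thesis .
  qed
  have "(ennreal (beta_const d * norm (bilin_form (\<lambda>z. (LINT \<tau>|lborel. w \<tau> * of_real (pos_powr (2 * d + 1) (\<tau> - (norm (fst z))\<^sup>2 - (norm (snd z))\<^sup>2))) * F (fst z) * G (snd z)) x)))\<^sup>2
     \<le> (\<integral>\<^sub>+\<tau>. enorm (w \<tau>) * ?X \<tau>)\<^sup>2"
    by (intro power_mono riesz_bilinear_bound fin) (use d in auto)
  also have "\<dots> \<le> (\<integral>\<^sub>+\<tau>. ?W \<tau>) * (\<integral>\<^sub>+\<tau>. ?W \<tau> * (NF * NG))"
  proof (rule nn_integral_Cauchy_Schwarz_dominated)
    fix \<tau> :: real
    show "(enorm (w \<tau>) * ?X \<tau>)\<^sup>2 \<le> ?W \<tau> * (?W \<tau> * (NF * NG))"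
    proof (cases "\<tau> > 0")
      case False then show ?thesis by (simp add: riesz_convolution_nonpos)
    next
      case True
      have "(?X \<tau>)\<^sup>2 \<le> (ennreal (\<tau> powr (2 * d + 1)) * NF) * (ennreal (\<tau> powr (2 * d + 1)) * NG)"
        by (rule order_trans[OF riesz_convolution_energy]) (auto intro!: mult_mono NF NG True)
      then have "(enorm (w \<tau>))\<^sup>2 * (?X \<tau>)\<^sup>2 \<le> (enorm (w \<tau>))\<^sup>2 * ((ennreal (\<tau> powr (2 * d + 1)) * NF) * (ennreal (\<tau> powr (2 * d + 1)) * NG))"
        by (intro mult_left_mono) auto
      also have "\<dots> = ?W \<tau> * (?W \<tau> * (NF * NG))" using True by (simp add: ennreal_mult power2_eq_square mult_ac)
      finally show ?thesis by (simp only: power_mult_distrib)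
    qed
  qed measurable
  also have "(\<integral>\<^sub>+\<tau>. ?W \<tau> * (NF * NG)) = ennreal W * (NF * NG)"
    unfolding W[symmetric] by (rule nn_integral_multc) measurable
  finally show ?thesis unfolding W by (simp only: power2_eq_square mult.assoc)
qed

text \<open>Cauchy--Schwarz after splitting \<open>\<tau> powr (4 * d + 2)\<close> into \<open>\<tau> powr (4 * d + 5) * \<tau> powr (- 3)\<close>: the
  integral of the second factor over \<open>\<tau> > t\<close> is \<open>1 / (2 t\<^sup>2)\<close>, which absorbs the factor \<open>t\<close>.\<close>

lemma subordination_weight_bound:
  fixes w :: "real \<Rightarrow> complex"
  assumes d: "d > -1/2" and [measurable]: "w \<in> \<B>" and t: "t \<ge> 0"
  shows "(\<integral>\<^sub>+\<tau>. ennreal (t * norm (w \<tau>) * pos_powr (2 * d + 1) (\<tau> - t)))\<^sup>2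
    \<le> (\<integral>\<^sub>+\<tau>. indicator {0<..} \<tau> * ennreal (\<tau> powr (4 * d + 5) * (norm (w \<tau>))\<^sup>2))"
proof (cases "t = 0")
  case True then show ?thesis by simp
next
  case False
  with t have t: "t > 0" by simp
  let ?W = "\<lambda>\<tau>. indicator {0<..} \<tau> * ennreal (\<tau> powr (4 * d + 5) * (norm (w \<tau>))\<^sup>2)"
  have "(\<integral>\<^sub>+\<tau>. ennreal (t * norm (w \<tau>) * pos_powr (2 * d + 1) (\<tau> - t)))\<^sup>2
    \<le> (\<integral>\<^sub>+\<tau>. ?W \<tau>) * (\<integral>\<^sub>+\<tau>. ennreal (t\<^sup>2) * (indicator {t<..} \<tau> * ennreal (\<tau> powr (- 3))))"
  proof (rule nn_integral_Cauchy_Schwarz_dominated)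
    fix \<tau> :: real
    show "(ennreal (t * norm (w \<tau>) * pos_powr (2 * d + 1) (\<tau> - t)))\<^sup>2 \<le> ?W \<tau> * (ennreal (t\<^sup>2) * (indicator {t<..} \<tau> * ennreal (\<tau> powr (- 3))))"
    proof (cases "\<tau> > t")
      case False then show ?thesis by (simp add: pos_powr_nonpos)
    next
      case True
      have "pos_powr (2 * d + 1) (\<tau> - t) \<le> \<tau> powr (2 * d + 1)" using True t d by (simp add: pos_powr_pos powr_mono2)
      then have "(pos_powr (2 * d + 1) (\<tau> - t))\<^sup>2 \<le> (\<tau> powr (2 * d + 1))\<^sup>2" by (intro power_mono) auto
      also have "\<dots> = \<tau> powr (4 * d + 5) * \<tau> powr (- 3)"
        unfolding power2_eq_square powr_add[symmetric] by (rule arg_cong[where f="\<lambda>a. \<tau> powr a"]) simp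
      finally have "(t * norm (w \<tau>))\<^sup>2 * (pos_powr (2 * d + 1) (\<tau> - t))\<^sup>2 \<le> (t * norm (w \<tau>))\<^sup>2 * (\<tau> powr (4 * d + 5) * \<tau> powr (- 3))"
        by (intro mult_left_mono) auto
      then have "(t * norm (w \<tau>) * pos_powr (2 * d + 1) (\<tau> - t))\<^sup>2 \<le> (\<tau> powr (4 * d + 5) * (norm (w \<tau>))\<^sup>2) * (t\<^sup>2 * \<tau> powr (- 3))"
        by (simp add: power_mult_distrib mult_ac)
      then have "ennreal ((t * norm (w \<tau>) * pos_powr (2 * d + 1) (\<tau> - t))\<^sup>2) \<le> ennreal ((\<tau> powr (4 * d + 5) * (norm (w \<tau>))\<^sup>2) * (t\<^sup>2 * \<tau> powr (- 3)))"
        by (rule ennreal_leI)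
      moreover have "(ennreal (t * norm (w \<tau>) * pos_powr (2 * d + 1) (\<tau> - t)))\<^sup>2 = ennreal ((t * norm (w \<tau>) * pos_powr (2 * d + 1) (\<tau> - t))\<^sup>2)"
        using t by (intro ennreal_power) auto
      ultimately show ?thesis using True t by (simp add: ennreal_mult)
    qed
  qed measurable
  also have "(\<integral>\<^sub>+\<tau>. ennreal (t\<^sup>2) * (indicator {t<..} \<tau> * ennreal (\<tau> powr (- 3)))) = ennreal (t\<^sup>2) * ennreal (t powr (1 - 3) / (3 - 1))"
    by (subst nn_integral_cmult, measurable, subst nn_integral_powr_inf) (use t in auto)
  also have "\<dots> = ennreal (t\<^sup>2 * (t powr (1 - 3) / (3 - 1)))" by (rule ennreal_mult[symmetric]) auto
  also have "t\<^sup>2 * (t powr (1 - 3) / (3 - 1)) = 1/2"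
  proof -
    have "t powr (1 - 3) = inverse (t\<^sup>2)" using powr_minus[of t 2] powr_realpow[of t 2] t by simp
    then show ?thesis using t by simp
  qed
  also have "(\<integral>\<^sub>+\<tau>. ?W \<tau>) * ennreal (1/2) \<le> (\<integral>\<^sub>+\<tau>. ?W \<tau>) * ennreal 1" by (intro mult_left_mono ennreal_leI) auto
  finally show ?thesis by simp
qed

text \<open>A superposition of truncated powers, with the exponent that the Beta integral produces from two powers of
  exponent \<open>d\<close>.\<close>

definition subord :: "real \<Rightarrow> (real \<Rightarrow> complex) \<Rightarrow> real \<Rightarrow> complex" where
  "subord d w t = (LINT \<tau>|lborel. w \<tau> * of_real (pos_powr (2 * d + 1) (\<tau> - t)))"

lemma norm_prod_square: "(norm z)\<^sup>2 = (norm (fst z))\<^sup>2 + (norm (snd z))\<^sup>2"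
  by (simp add: norm_prod_def)

lemma subord_prod: "(LINT \<tau>|lborel. w \<tau> * of_real (pos_powr (2 * d + 1) (\<tau> - (norm (fst z))\<^sup>2 - (norm (snd z))\<^sup>2))) = subord d w ((norm z)\<^sup>2)"
  unfolding subord_def norm_prod_square by (simp only: diff_diff_eq)

lemma subord_measurable [measurable (raw)]:
  assumes [measurable]: "w \<in> \<B>" "f \<in> borel_measurable N"
  shows "(\<lambda>x. subord d w (f x)) \<in> borel_measurable N"
  unfolding subord_def by measurable

lemma norm_measurable_LL [measurable]: "(\<lambda>z. norm z) \<in> borel_measurable (LL :: ('a::euclidean_space \<times> 'b::euclidean_space) measure)"
  unfolding norm_prod_def by measurable

lemma nn_integral_LL_product:
  assumes [measurable]: "F \<in> \<B>" "G \<in> \<B>"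
  shows "(\<integral>\<^sup>+z. ennreal (norm (F (fst z)) * norm (G (snd z))) \<partial>LL) = (\<integral>\<^sub>+\<xi>. \<integral>\<^sub>+\<eta>. ennreal (norm (F \<xi>) * norm (G \<eta>)))"
  by (subst lborel.nn_integral_fst[symmetric]) auto

lemma subord_bound:
  assumes d: "d > -1/2" and w[measurable]: "w \<in> \<B>"
    and W: "(\<integral>\<^sub>+\<tau>. indicator {0<..} \<tau> * ennreal (\<tau> powr (4 * d + 5) * (norm (w \<tau>))\<^sup>2)) = ennreal W" "W \<ge> 0"
    and t: "t \<ge> 0"
  shows "norm (t * subord d w t) \<le> sqrt W"
proof -
  have "enorm (of_real t * subord d w t) \<le> (\<integral>\<^sub>+\<tau>. ennreal (t * norm (w \<tau>) * pos_powr (2 * d + 1) (\<tau> - t)))"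
    unfolding subord_def integral_mult_right_zero[symmetric]
    by (rule order_trans[OF norm_integral_le_nn_integral]) (use t in \<open>simp add: norm_mult mult.assoc\<close>)
  then have "(enorm (of_real t * subord d w t))\<^sup>2 \<le> (\<integral>\<^sub>+\<tau>. ennreal (t * norm (w \<tau>) * pos_powr (2 * d + 1) (\<tau> - t)))\<^sup>2"
    by (intro power_mono) auto
  also have "\<dots> \<le> ennreal W" using subordination_weight_bound[OF d w t] unfolding W .
  finally have "nsq (of_real t * subord d w t) \<le> ennreal W" by (simp add: ennreal_power)
  then have "(norm (of_real t * subord d w t))\<^sup>2 \<le> W" using W(2) by (simp add: ennreal_le_iff)
  then show ?thesis by (simp add: real_le_rsqrt)
qed

text \<open>If only a weighted square integral of the density is available, then Cauchy--Schwarz in \<open>\<tau>\<close> leaves a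
  weighted integral of the product of the two energies. One energy, majorized by \<open>N\<close>, is constant in \<open>\<tau>\<close>
  after normalization; the other, \<open>e\<close>, remains under the integral. The hypothesis \<open>bnd\<close> gives absolute
  convergence.\<close>

lemma bilinear_estimate_L2:
  fixes F G F1 G1 :: "'a::euclidean_space \<Rightarrow> complex" and w :: "real \<Rightarrow> complex"
  assumes d: "d > -1/2" and F: "integrable lborel F" and G: "integrable lborel G" and w[measurable]: "w \<in> \<B>"
    and W: "(\<integral>\<^sub>+\<tau>. indicator {0<..} \<tau> * ennreal (\<tau> powr (4 * d + 5) * (norm (w \<tau>))\<^sup>2)) = ennreal W"
    and F1[measurable]: "F1 \<in> \<B>" and G1[measurable]: "G1 \<in> \<B>"
    and bnd: "\<And>\<xi> \<eta>. norm (F1 \<xi>) * norm (G1 \<eta>) \<le> ((norm \<xi>)\<^sup>2 + (norm \<eta>)\<^sup>2) * (norm (F \<xi>) * norm (G \<eta>))"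
    and e[measurable]: "e \<in> \<B>"
    and E: "\<And>\<tau>. \<tau> > 0 \<Longrightarrow> energy d F1 \<tau> x * energy d G1 \<tau> x \<le> ennreal (\<tau> powr (2 * d + 1)) * (N * e \<tau>)"
  shows "integrable LL (\<lambda>z. subord d w ((norm z)\<^sup>2) * F1 (fst z) * G1 (snd z))"
    and "(ennreal (beta_const d * norm (bilin_form (\<lambda>z. subord d w ((norm z)\<^sup>2) * F1 (fst z) * G1 (snd z)) x)))\<^sup>2
    \<le> ennreal W * (N * (\<integral>\<^sub>+\<tau>. indicator {0<..} \<tau> * (ennreal (\<tau> powr (- (2 * d + 4))) * e \<tau>)))"
proof -
  have [measurable]: "F \<in> \<B>" "G \<in> \<B>" using F G by auto
  let ?X = "\<lambda>\<tau>. \<integral>\<^sub>+v. enorm (riesz d F1 (\<tau> - v) x) * enorm (riesz d G1 v x)"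
  let ?W = "\<lambda>\<tau>. indicator {0<..} \<tau> * ennreal (\<tau> powr (4 * d + 5) * (norm (w \<tau>))\<^sup>2)"
  let ?V = "\<lambda>z::'a \<times> 'a. \<integral>\<^sub>+\<tau>. enorm (w \<tau>) * ennreal (pos_powr (2 * d + 1) (\<tau> - (norm (fst z))\<^sup>2 - (norm (snd z))\<^sup>2))"
  have fin: "(\<integral>\<^sup>+z. ennreal (norm (F1 (fst z)) * norm (G1 (snd z))) * ?V z \<partial>LL) < \<infinity>"
  proof -
    have "(\<integral>\<^sup>+z. ennreal (norm (F1 (fst z)) * norm (G1 (snd z))) * ?V z \<partial>LL)
      \<le> (\<integral>\<^sup>+z. ennreal (norm (F (fst z)) * norm (G (snd z))) * (1 + ennreal W) \<partial>LL)"
    proof (rule nn_integral_mono)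
      fix z :: "'a \<times> 'a"
      let ?t = "(norm (fst z))\<^sup>2 + (norm (snd z))\<^sup>2"
      have "ennreal (norm (F1 (fst z)) * norm (G1 (snd z))) \<le> ennreal (norm (F (fst z)) * norm (G (snd z))) * ennreal ?t"
      proof -
        have "ennreal (norm (F (fst z)) * norm (G (snd z))) * ennreal ?t = ennreal (norm (F (fst z)) * norm (G (snd z)) * ?t)"
          by (rule ennreal_mult[symmetric]) auto
        then show ?thesis using ennreal_leI[OF bnd[of "fst z" "snd z"]] by (simp only: mult.commute)
      qed
      then have "ennreal (norm (F1 (fst z)) * norm (G1 (snd z))) * ?V z \<le> ennreal (norm (F (fst z)) * norm (G (snd z))) * ennreal ?t * ?V z"
        by (intro mult_right_mono) auto
      also have "\<dots> = ennreal (norm (F (fst z)) * norm (G (snd z))) * (ennreal ?t * ?V z)" by (rule mult.assoc)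
      also have "ennreal ?t * ?V z = (\<integral>\<^sub>+\<tau>. ennreal (?t * norm (w \<tau>) * pos_powr (2 * d + 1) (\<tau> - ?t)))"
        by (subst nn_integral_cmult[symmetric]) (auto simp: ennreal_mult mult.assoc diff_diff_eq)
      also have "\<dots> \<le> 1 + (\<dots>)\<^sup>2"
      proof -
        have "y \<le> 1 + y\<^sup>2" for y :: ennreal
        proof (cases "y \<le> 1")
          case True then show ?thesis by (simp add: add_increasing2)
        next
          case False
          then have "y * 1 \<le> y * y" by (intro mult_left_mono) auto
          then show ?thesis by (simp add: power2_eq_square add_increasing)
        qed
        then show ?thesis .
      qed
      also have "\<dots> \<le> 1 + ennreal W"
        using subordination_weight_bound[OF d w, of ?t] unfolding W by (intro add_left_mono) auto
      finally show "ennreal (norm (F1 (fst z)) * norm (G1 (snd z))) * ?V z \<le> ennreal (norm (F (fst z)) * norm (G (snd z))) * (1 + ennreal W)"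
        by (simp add: mult_left_mono)
    qed
    also have "\<dots> = (\<integral>\<^sup>+z. ennreal (norm (F (fst z)) * norm (G (snd z))) \<partial>LL) * (1 + ennreal W)"
      by (rule nn_integral_multc) measurable
    also have "\<dots> < \<infinity>" using nn_integral_product_finite[OF F G] by (subst nn_integral_LL_product) (auto simp: ennreal_mult_less_top)
    finally show ?thesis .
  qed
  show "integrable LL (\<lambda>z. subord d w ((norm z)\<^sup>2) * F1 (fst z) * G1 (snd z))"
  proof (rule integrableI_bounded)
    have "(\<integral>\<^sup>+z. enorm (subord d w ((norm z)\<^sup>2) * F1 (fst z) * G1 (snd z)) \<partial>LL) \<le>
      (\<integral>\<^sup>+z. ennreal (norm (F1 (fst z)) * norm (G1 (snd z))) * ?V z \<partial>LL)"
    proof (rule nn_integral_mono)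
      fix z :: "'a \<times> 'a"
      have "enorm (subord d w ((norm z)\<^sup>2)) \<le> ?V z"
        unfolding subord_prod[symmetric] by (rule order_trans[OF norm_integral_le_nn_integral]) (simp add: norm_mult ennreal_mult)
      then have "ennreal (norm (F1 (fst z)) * norm (G1 (snd z))) * enorm (subord d w ((norm z)\<^sup>2)) \<le> ennreal (norm (F1 (fst z)) * norm (G1 (snd z))) * ?V z"
        by (intro mult_left_mono) auto
      then show "enorm (subord d w ((norm z)\<^sup>2) * F1 (fst z) * G1 (snd z)) \<le> ennreal (norm (F1 (fst z)) * norm (G1 (snd z))) * ?V z"
        by (simp add: norm_mult ennreal_mult mult_ac)
    qed
    with fin show "(\<integral>\<^sup>+z. enorm (subord d w ((norm z)\<^sup>2) * F1 (fst z) * G1 (snd z)) \<partial>LL) < \<infinity>" by (rule le_less_trans[rotated])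
  qed measurable
  have "(ennreal (beta_const d * norm (bilin_form (\<lambda>z. subord d w ((norm z)\<^sup>2) * F1 (fst z) * G1 (snd z)) x)))\<^sup>2
     \<le> (\<integral>\<^sub>+\<tau>. enorm (w \<tau>) * ?X \<tau>)\<^sup>2"
    unfolding subord_prod[symmetric]
    by (intro power_mono riesz_bilinear_bound fin) (use d in auto)
  also have "\<dots> \<le> (\<integral>\<^sub>+\<tau>. ?W \<tau>) * (\<integral>\<^sub>+\<tau>. N * (indicator {0<..} \<tau> * (ennreal (\<tau> powr (- (2 * d + 4))) * e \<tau>)))"
  proof (rule nn_integral_Cauchy_Schwarz_dominated)
    fix \<tau> :: real
    show "(enorm (w \<tau>) * ?X \<tau>)\<^sup>2 \<le> ?W \<tau> * (N * (indicator {0<..} \<tau> * (ennreal (\<tau> powr (- (2 * d + 4))) * e \<tau>)))"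
    proof (cases "\<tau> > 0")
      case False then show ?thesis by (simp add: riesz_convolution_nonpos)
    next
      case True
      have "(?X \<tau>)\<^sup>2 \<le> ennreal (\<tau> powr (2 * d + 1)) * (N * e \<tau>)"
        by (rule order_trans[OF riesz_convolution_energy]) (auto intro!: E True)
      also have "\<tau> powr (2 * d + 1) = \<tau> powr (4 * d + 5) * \<tau> powr (- (2 * d + 4))"
        unfolding powr_add[symmetric] by (rule arg_cong[where f="\<lambda>a. \<tau> powr a"]) simp
      finally have "(enorm (w \<tau>))\<^sup>2 * (?X \<tau>)\<^sup>2 \<le> (enorm (w \<tau>))\<^sup>2 * (ennreal (\<tau> powr (4 * d + 5) * \<tau> powr (- (2 * d + 4))) * (N * e \<tau>))"
        by (intro mult_left_mono) auto
      also have "\<dots> = ?W \<tau> * (N * (indicator {0<..} \<tau> * (ennreal (\<tau> powr (- (2 * d + 4))) * e \<tau>)))"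
        using True by (simp add: ennreal_mult ennreal_power mult_ac)
      finally show ?thesis by (simp only: power_mult_distrib)
    qed
  qed measurable
  also have "(\<integral>\<^sub>+\<tau>. N * (indicator {0<..} \<tau> * (ennreal (\<tau> powr (- (2 * d + 4))) * e \<tau>))) =
     N * (\<integral>\<^sub>+\<tau>. indicator {0<..} \<tau> * (ennreal (\<tau> powr (- (2 * d + 4))) * e \<tau>))"
    by (rule nn_integral_cmult) measurable
  finally show "(ennreal (beta_const d * norm (bilin_form (\<lambda>z. subord d w ((norm z)\<^sup>2) * F1 (fst z) * G1 (snd z)) x)))\<^sup>2
    \<le> ennreal W * (N * (\<integral>\<^sub>+\<tau>. indicator {0<..} \<tau> * (ennreal (\<tau> powr (- (2 * d + 4))) * e \<tau>)))"
    unfolding W .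
qed

text \<open>The factor \<open>t = (norm \<xi>)\<^sup>2 + (norm \<eta>)\<^sup>2\<close> of the symbol is split into its two summands. In each of the
  two forms one function acquires the Laplacian factor, so its energy integrates to a square function, while the
  energy of the other is bounded by its maximal function.\<close>

theorem bilinear_square_function_estimate:
  fixes F G :: "'a::euclidean_space \<Rightarrow> complex" and w :: "real \<Rightarrow> complex"
  assumes d: "d > -1/2" and F: "integrable lborel F" and G: "integrable lborel G" and w[measurable]: "w \<in> \<B>"
    and W: "(\<integral>\<^sub>+\<tau>. indicator {0<..} \<tau> * ennreal (\<tau> powr (4 * d + 5) * (norm (w \<tau>))\<^sup>2)) = ennreal W"
    and NF: "\<And>\<tau>. \<tau> > 0 \<Longrightarrow> energy d F \<tau> x \<le> ennreal (\<tau> powr (2 * d + 1)) * NF"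
    and NG: "\<And>\<tau>. \<tau> > 0 \<Longrightarrow> energy d G \<tau> x \<le> ennreal (\<tau> powr (2 * d + 1)) * NG"
    and M: "\<And>t. t \<ge> 0 \<Longrightarrow> M t = of_real t * subord d w t"
  shows "(ennreal (beta_const d * norm (bilin_form (\<lambda>z. M ((norm z)\<^sup>2) * F (fst z) * G (snd z)) x)))\<^sup>2
    \<le> 2 * ennreal W * (square_fun d F x * NG + NF * square_fun d G x)"
proof -
  have [measurable]: "F \<in> \<B>" "G \<in> \<B>" using F G by auto
  let ?B = "beta_const d"
  have B: "?B > 0" using d by (intro beta_const_pos) auto
  let ?F1 = "\<lambda>\<xi>. of_real ((norm \<xi>)\<^sup>2) * F \<xi>" and ?G1 = "\<lambda>\<xi>. of_real ((norm \<xi>)\<^sup>2) * G \<xi>"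
  let ?K1 = "\<lambda>z. subord d w ((norm z)\<^sup>2) * ?F1 (fst z) * G (snd z)"
  let ?K2 = "\<lambda>z. subord d w ((norm z)\<^sup>2) * F (fst z) * ?G1 (snd z)"
  have b1: "norm (?F1 \<xi>) * norm (G \<eta>) \<le> ((norm \<xi>)\<^sup>2 + (norm \<eta>)\<^sup>2) * (norm (F \<xi>) * norm (G \<eta>))" for \<xi> \<eta>
    by (simp add: norm_mult norm_power mult.assoc mult_right_mono)
  have b2: "norm (F \<xi>) * norm (?G1 \<eta>) \<le> ((norm \<xi>)\<^sup>2 + (norm \<eta>)\<^sup>2) * (norm (F \<xi>) * norm (G \<eta>))" for \<xi> \<eta>
  proof -
    have "norm (F \<xi>) * norm (?G1 \<eta>) = (norm \<eta>)\<^sup>2 * (norm (F \<xi>) * norm (G \<eta>))" by (simp add: norm_mult norm_power mult_ac)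
    also have "\<dots> \<le> ((norm \<xi>)\<^sup>2 + (norm \<eta>)\<^sup>2) * (norm (F \<xi>) * norm (G \<eta>))" by (intro mult_right_mono) auto
    finally show ?thesis .
  qed
  have E1: "energy d ?F1 \<tau> x * energy d G \<tau> x \<le> ennreal (\<tau> powr (2 * d + 1)) * (NG * energy d ?F1 \<tau> x)" if "\<tau> > 0" for \<tau>
  proof -
    have "energy d ?F1 \<tau> x * energy d G \<tau> x \<le> energy d ?F1 \<tau> x * (ennreal (\<tau> powr (2 * d + 1)) * NG)"
      by (intro mult_left_mono NG that) simp
    then show ?thesis by (simp only: mult_ac)
  qed
  have E2: "energy d F \<tau> x * energy d ?G1 \<tau> x \<le> ennreal (\<tau> powr (2 * d + 1)) * (NF * energy d ?G1 \<tau> x)" if "\<tau> > 0" for \<tau>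
  proof -
    have "energy d F \<tau> x * energy d ?G1 \<tau> x \<le> (ennreal (\<tau> powr (2 * d + 1)) * NF) * energy d ?G1 \<tau> x"
      by (intro mult_right_mono NF that) simp
    then show ?thesis by (simp only: mult_ac)
  qed
  have m1: "?F1 \<in> \<B>" "?G1 \<in> \<B>" by measurable
  have m2: "(\<lambda>\<tau>. energy d ?F1 \<tau> x) \<in> \<B>" "(\<lambda>\<tau>. energy d ?G1 \<tau> x) \<in> \<B>" by measurable
  note i1 = bilinear_estimate_L2[OF d F G w W m1(1) \<open>G \<in> \<B>\<close> b1 m2(1) E1]
  note i2 = bilinear_estimate_L2[OF d F G w W \<open>F \<in> \<B>\<close> m1(2) b2 m2(2) E2]
  have "bilin_form (\<lambda>z. M ((norm z)\<^sup>2) * F (fst z) * G (snd z)) x = bilin_form ?K1 x + bilin_form ?K2 x"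
  proof -
    have "bilin_form (\<lambda>z. M ((norm z)\<^sup>2) * F (fst z) * G (snd z)) x =
      (LINT z|LL. ?K1 z * \<e> (x \<bullet> (fst z + snd z)) + ?K2 z * \<e> (x \<bullet> (fst z + snd z)))"
      unfolding bilin_form_def
    proof (intro LINT_cong refl)
      fix z :: "'a \<times> 'a"
      have "M ((norm z)\<^sup>2) = of_real ((norm (fst z))\<^sup>2 + (norm (snd z))\<^sup>2) * subord d w ((norm z)\<^sup>2)"
        by (subst M) (simp_all add: norm_prod_square)
      then show "M ((norm z)\<^sup>2) * F (fst z) * G (snd z) * \<e> (x \<bullet> (fst z + snd z)) =
        ?K1 z * \<e> (x \<bullet> (fst z + snd z)) + ?K2 z * \<e> (x \<bullet> (fst z + snd z))"
        by (simp add: algebra_simps)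
    qed
    also have "\<dots> = bilin_form ?K1 x + bilin_form ?K2 x"
      unfolding bilin_form_def by (intro Bochner_Integration.integral_add integrable_mult_cis i1(1) i2(1)) auto
    finally show ?thesis .
  qed
  then have "(?B * norm (bilin_form (\<lambda>z. M ((norm z)\<^sup>2) * F (fst z) * G (snd z)) x))\<^sup>2 = ?B\<^sup>2 * (norm (bilin_form ?K1 x + bilin_form ?K2 x))\<^sup>2"
    by (simp add: power_mult_distrib)
  also have "\<dots> \<le> ?B\<^sup>2 * (2 * (norm (bilin_form ?K1 x))\<^sup>2 + 2 * (norm (bilin_form ?K2 x))\<^sup>2)"
    by (intro mult_left_mono norm_add_squared_le) auto
  also have "\<dots> = 2 * (?B * norm (bilin_form ?K1 x))\<^sup>2 + 2 * (?B * norm (bilin_form ?K2 x))\<^sup>2"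
    by (simp add: power_mult_distrib algebra_simps)
  finally have "ennreal ((?B * norm (bilin_form (\<lambda>z. M ((norm z)\<^sup>2) * F (fst z) * G (snd z)) x))\<^sup>2) \<le>
    ennreal (2 * (?B * norm (bilin_form ?K1 x))\<^sup>2 + 2 * (?B * norm (bilin_form ?K2 x))\<^sup>2)" by (rule ennreal_leI)
  also have "\<dots> = 2 * (ennreal (?B * norm (bilin_form ?K1 x)))\<^sup>2 + 2 * (ennreal (?B * norm (bilin_form ?K2 x)))\<^sup>2"
  proof -
    have "ennreal (2 * p\<^sup>2 + 2 * q\<^sup>2) = 2 * (ennreal p)\<^sup>2 + 2 * (ennreal q)\<^sup>2" if "p \<ge> 0" "q \<ge> 0" for p q :: real
      using that by (simp add: ennreal_mult ennreal_power)
    then show ?thesis using B by simp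
  qed
  also have "\<dots> \<le> 2 * (ennreal W * (NG * square_fun d F x)) + 2 * (ennreal W * (NF * square_fun d G x))"
    unfolding square_fun_def by (intro add_mono mult_left_mono i1(2) i2(2)) auto
  also have "\<dots> = 2 * ennreal W * (square_fun d F x * NG + NF * square_fun d G x)"
    by (simp only: distrib_left mult_ac)
  finally show ?thesis using B by (simp add: ennreal_power)
qed

section \<open>Fourier transforms of derivatives\<close>

text \<open>The integral of \<open>V (x + t *\<^sub>R b)\<close> does not depend on \<open>t\<close>, while its increment over unit time is an average of
  translates of \<open>V'\<close>.\<close>

lemma integral_directional_derivative_zero:
  fixes V V' :: "'a::euclidean_space \<Rightarrow> complex"
  assumes V: "integrable lborel V" and V': "integrable lborel V'"
    and c: "\<And>x. continuous_on UNIV (\<lambda>t::real. V' (x + t *\<^sub>R b))"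
    and deriv: "\<And>x t. ((\<lambda>t. V (x + t *\<^sub>R b)) has_vector_derivative V' (x + t *\<^sub>R b)) (at t)"
  shows "(LINT x|lborel. V' x) = 0"
proof -
  have [measurable]: "V \<in> \<B>" "V' \<in> \<B>" using V V' by auto
  let ?I = "indicator {0..1} :: real \<Rightarrow> real"
  have ftc: "(LINT t|lborel. ?I t *\<^sub>R V' (x + t *\<^sub>R b)) = V (b + x) - V x" for x
    using integral_FTC_atLeastAtMost[of 0 1 "\<lambda>t. V (x + t *\<^sub>R b)" "\<lambda>t. V' (x + t *\<^sub>R b)"]
      deriv[THEN has_vector_derivative_at_within] continuous_on_subset[OF c subset_UNIV] by (simp add: add.commute)
  have fin: "(\<integral>\<^sub>+t. \<integral>\<^sub>+x. enorm (?I t *\<^sub>R V' (x + t *\<^sub>R b))) < \<infinity>"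
  proof -
    have "(\<integral>\<^sub>+x. enorm (?I t *\<^sub>R V' (x + t *\<^sub>R b))) = indicator {0..1} t * (\<integral>\<^sub>+x. enorm (V' x))" for t
    proof -
      have "(\<integral>\<^sub>+x. enorm (?I t *\<^sub>R V' (x + t *\<^sub>R b))) = indicator {0..1} t * (\<integral>\<^sub>+x. enorm (V' (t *\<^sub>R b + x)))"
        by (subst nn_integral_cmult[symmetric]) (auto simp: indicator_def add.commute intro!: nn_integral_cong)
      also have "(\<integral>\<^sub>+x. enorm (V' (t *\<^sub>R b + x))) = (\<integral>\<^sub>+x. enorm (V' x))"
        by (rule nn_integral_lborel_translation[of "\<lambda>x. enorm (V' x)"]) measurable
      finally show ?thesis .
    qed
    then show ?thesis using nn_integral_norm_finite[OF V'] by (simp add: nn_integral_multc)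
  qed
  have "0 = (LINT x|lborel. V (b + x)) - (LINT x|lborel. V x)"
    by (simp add: integral_lborel_translation)
  also have "\<dots> = (LINT x|lborel. V (b + x) - V x)"
    by (rule Bochner_Integration.integral_diff[symmetric, OF integrable_lborel_translation[OF V] V])
  also have "\<dots> = (LINT x|lborel. LINT t|lborel. ?I t *\<^sub>R V' (x + t *\<^sub>R b))" unfolding ftc ..
  also have "\<dots> = (LINT t|lborel. LINT x|lborel. ?I t *\<^sub>R V' (x + t *\<^sub>R b))"
    by (rule Fubini_lborel[OF _ fin, symmetric]) measurable
  also have "\<dots> = (LINT t|lborel. ?I t *\<^sub>R (LINT x|lborel. V' x))"
  proof -
    have "(LINT x|lborel. V' (x + t *\<^sub>R b)) = (LINT x|lborel. V' x)" for t
      using integral_lborel_translation[of V' "t *\<^sub>R b"] by (simp add: add.commute)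
    then show ?thesis by simp
  qed
  also have "\<dots> = (LINT x|lborel. V' x)" by (subst integral_scaleR_left) auto
  finally show ?thesis by simp
qed

lemma has_vector_derivative_cis_linear:
  "((\<lambda>t. cis (k * t + c)) has_vector_derivative of_real k * \<i> * cis (k * t + c)) (at t)"
proof -
  have "((\<lambda>t. complex_of_real (k * t + c)) has_vector_derivative of_real k) (at t)"
    by (intro has_vector_derivative_of_real) (auto intro!: derivative_eq_intros)
  then have 1: "((\<lambda>t. \<i> * complex_of_real (k * t + c)) has_vector_derivative \<i> * of_real k) (at t)"
    by (rule has_vector_derivative_mult_right)
  have 2: "(exp has_field_derivative exp (\<i> * complex_of_real (k * t + c))) (at (\<i> * complex_of_real (k * t + c)))"
    by (rule DERIV_exp)
  from field_vector_diff_chain_at[OF 1 2] show ?thesis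
    by (simp add: cis_conv_exp comp_def mult_ac)
qed

text \<open>Apply the previous lemma to \<open>f\<close> times a character.\<close>

lemma fourier_directional_derivative:
  fixes f u :: "'a::euclidean_space \<Rightarrow> complex"
  assumes f: "integrable lborel f" and u: "integrable lborel u"
    and c: "continuous_on UNIV u"
    and deriv: "\<And>x t. ((\<lambda>t. f (x + t *\<^sub>R b)) has_vector_derivative u (x + t *\<^sub>R b)) (at t)"
  shows "fourier u \<xi> = 2 * of_real pi * \<i> * of_real (\<xi> \<bullet> b) * fourier f \<xi>"
proof -
  let ?k = "2 * of_real pi * \<i> * of_real (\<xi> \<bullet> b) :: complex"
  let ?e = "\<lambda>x. cis (- 2 * pi * (x \<bullet> \<xi>))"
  let ?V = "\<lambda>x. f x * ?e x"
  let ?V' = "\<lambda>x. u x * ?e x - ?k * (f x * ?e x)"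
  have i1: "integrable lborel ?V" by (rule integrable_mult_cis[OF f]) measurable
  have i2: "integrable lborel (\<lambda>x. u x * ?e x)" by (rule integrable_mult_cis[OF u]) measurable
  have "(LINT x|lborel. ?V' x) = 0"
  proof (rule integral_directional_derivative_zero[OF i1])
    show "integrable lborel ?V'" by (intro Bochner_Integration.integrable_diff integrable_mult_right i1 i2)
    show "continuous_on UNIV (\<lambda>t. ?V' (x + t *\<^sub>R b))" for x
    proof -
      have "continuous_on UNIV (\<lambda>t. f (x + t *\<^sub>R b))"
        by (intro continuous_at_imp_continuous_on ballI has_vector_derivative_continuous[OF deriv])
      moreover have "continuous_on UNIV (\<lambda>t. u (x + t *\<^sub>R b))"
        by (intro continuous_on_compose2[OF c]) (auto intro!: continuous_intros)
      ultimately show ?thesis by (intro continuous_intros)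
    qed
    show "((\<lambda>t. ?V (x + t *\<^sub>R b)) has_vector_derivative ?V' (x + t *\<^sub>R b)) (at t)" for x t
    proof -
      have e: "?e (x + t *\<^sub>R b) = cis ((- 2 * pi * (\<xi> \<bullet> b)) * t + (- 2 * pi * (x \<bullet> \<xi>)))" for t
        by (rule arg_cong[where f=cis]) (simp add: inner_add_left inner_commute algebra_simps)
      have "((\<lambda>t. f (x + t *\<^sub>R b) * cis ((- 2 * pi * (\<xi> \<bullet> b)) * t + (- 2 * pi * (x \<bullet> \<xi>)))) has_vector_derivative
        f (x + t *\<^sub>R b) * (of_real (- 2 * pi * (\<xi> \<bullet> b)) * \<i> * cis ((- 2 * pi * (\<xi> \<bullet> b)) * t + (- 2 * pi * (x \<bullet> \<xi>)))) +
        u (x + t *\<^sub>R b) * cis ((- 2 * pi * (\<xi> \<bullet> b)) * t + (- 2 * pi * (x \<bullet> \<xi>)))) (at t)"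
        by (rule has_vector_derivative_mult[OF deriv has_vector_derivative_cis_linear])
      then show ?thesis unfolding e by (simp add: algebra_simps)
    qed
  qed
  then have "(LINT x|lborel. u x * ?e x) = ?k * (LINT x|lborel. f x * ?e x)"
    using i1 i2 by (subst (asm) Bochner_Integration.integral_diff) auto
  then show ?thesis unfolding fourier_eq_cis .
qed

section \<open>Schwartz functions\<close>

lemma iter_partial_append: "iter_partial (bs @ cs) f = iter_partial bs (iter_partial cs f)"
  by (induction bs) auto

lemma schwartz_differentiable: "schwartz f \<Longrightarrow> set bs \<subseteq> Basis \<Longrightarrow> iter_partial bs f differentiable (at x)"
  unfolding schwartz_def by blast

lemma schwartz_decay:
  assumes "schwartz f" "set bs \<subseteq> Basis"
  obtains C where "\<And>x. norm x ^ k * norm (iter_partial bs f x) \<le> C"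
  using assms unfolding schwartz_def by meson

lemma schwartz_iter_partial:
  assumes f: "schwartz f" and cs: "set cs \<subseteq> Basis"
  shows "schwartz (iter_partial cs f)"
  unfolding schwartz_def iter_partial_append[symmetric]
  using f cs unfolding schwartz_def by simp

lemma iter_partial_add:
  assumes "\<And>bs x. set bs \<subseteq> Basis \<Longrightarrow> iter_partial bs f differentiable (at x)"
    and "\<And>bs x. set bs \<subseteq> Basis \<Longrightarrow> iter_partial bs g differentiable (at x)"
    and "set bs \<subseteq> Basis"
  shows "iter_partial bs (\<lambda>x. f x + g x) = (\<lambda>x. iter_partial bs f x + iter_partial bs g x)"
  using assms(3)
proof (induction bs)
  case (Cons b bs)
  show ?case
  proof
    fix x
    have "((\<lambda>x. iter_partial bs f x + iter_partial bs g x) has_derivative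
      (\<lambda>h. frechet_derivative (iter_partial bs f) (at x) h + frechet_derivative (iter_partial bs g) (at x) h)) (at x)"
      using assms(1,2) Cons.prems by (intro has_derivative_add) (auto simp: frechet_derivative_works[symmetric])
    from frechet_derivative_at[OF this, symmetric]
    show "iter_partial (b # bs) (\<lambda>x. f x + g x) x = iter_partial (b # bs) f x + iter_partial (b # bs) g x"
      using Cons by simp
  qed
qed simp

lemma iter_partial_cmult:
  assumes "\<And>bs x. set bs \<subseteq> Basis \<Longrightarrow> iter_partial bs f differentiable (at x)" and "set bs \<subseteq> Basis"
  shows "iter_partial bs (\<lambda>x. c * f x) = (\<lambda>x. c * iter_partial bs f x)"
  using assms(2)
proof (induction bs)
  case (Cons b bs)
  show ?case
  proof
    fix x
    have "((\<lambda>x. c * iter_partial bs f x) has_derivative (\<lambda>h. c * frechet_derivative (iter_partial bs f) (at x) h)) (at x)"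
      using assms(1) Cons.prems by (intro has_derivative_mult_right) (auto simp: frechet_derivative_works[symmetric])
    from frechet_derivative_at[OF this, symmetric]
    show "iter_partial (b # bs) (\<lambda>x. c * f x) x = c * iter_partial (b # bs) f x"
      using Cons by simp
  qed
qed simp

lemma schwartz_add:
  assumes f: "schwartz f" and g: "schwartz g"
  shows "schwartz (\<lambda>x. f x + g x)"
  unfolding schwartz_def
proof (intro allI impI conjI)
  fix bs :: "'a list" assume bs: "set bs \<subseteq> Basis"
  have eq: "iter_partial bs (\<lambda>x. f x + g x) = (\<lambda>x. iter_partial bs f x + iter_partial bs g x)"
    using schwartz_differentiable[OF f] schwartz_differentiable[OF g] bs by (rule iter_partial_add)
  show "iter_partial bs (\<lambda>x. f x + g x) differentiable (at x)" for x
    unfolding eq by (intro differentiable_add schwartz_differentiable f g bs)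
  fix k
  obtain C where C: "\<And>x. norm x ^ k * norm (iter_partial bs f x) \<le> C" using schwartz_decay[OF f bs] by blast
  obtain D where D: "\<And>x. norm x ^ k * norm (iter_partial bs g x) \<le> D" using schwartz_decay[OF g bs] by blast
  have "norm x ^ k * norm (iter_partial bs f x + iter_partial bs g x) \<le> C + D" for x
  proof -
    have "norm x ^ k * norm (iter_partial bs f x + iter_partial bs g x) \<le> norm x ^ k * (norm (iter_partial bs f x) + norm (iter_partial bs g x))"
      by (intro mult_left_mono norm_triangle_ineq) auto
    then show ?thesis using C[of x] D[of x] by (simp add: distrib_left)
  qed
  then show "\<exists>C. \<forall>x. norm x ^ k * norm (iter_partial bs (\<lambda>x. f x + g x) x) \<le> C" unfolding eq by blast
qed

lemma schwartz_cmult: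
  assumes f: "schwartz f"
  shows "schwartz (\<lambda>x. c * f x)"
  unfolding schwartz_def
proof (intro allI impI conjI)
  fix bs :: "'a list" assume bs: "set bs \<subseteq> Basis"
  have eq: "iter_partial bs (\<lambda>x. c * f x) = (\<lambda>x. c * iter_partial bs f x)"
    using schwartz_differentiable[OF f] bs by (rule iter_partial_cmult)
  show "iter_partial bs (\<lambda>x. c * f x) differentiable (at x)" for x
    unfolding eq by (intro differentiable_mult schwartz_differentiable f bs) auto
  fix k
  obtain C where C: "\<And>x. norm x ^ k * norm (iter_partial bs f x) \<le> C" using schwartz_decay[OF f bs] by blast
  have "norm x ^ k * norm (c * iter_partial bs f x) \<le> norm c * C" for x
    using mult_left_mono[OF C[of x], of "norm c"] by (simp add: norm_mult mult_ac)
  then show "\<exists>C. \<forall>x. norm x ^ k * norm (iter_partial bs (\<lambda>x. c * f x) x) \<le> C" unfolding eq by blast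
qed

lemma schwartz_diff: "schwartz f \<Longrightarrow> schwartz g \<Longrightarrow> schwartz (\<lambda>x. f x - g x)"
  using schwartz_add[of f "\<lambda>x. (-1) * g x"] schwartz_cmult[of g "-1"] by simp

lemma schwartz_continuous: "schwartz f \<Longrightarrow> continuous_on S f"
  using schwartz_differentiable[of f "[]"]
  by (auto intro!: continuous_at_imp_continuous_on differentiable_imp_continuous_within)

lemma schwartz_measurable: "schwartz f \<Longrightarrow> f \<in> \<B>"
  using schwartz_continuous[of f UNIV] by (rule borel_measurable_continuous_onI)

lemma schwartz_bounded: assumes "schwartz f" obtains C where "\<And>x. norm (f x) \<le> C"
  using schwartz_decay[OF assms, of "[]" 0] by auto

lemma integrable_inverse_quadratic: "integrable lborel (\<lambda>t::real. 1 / (1 + t\<^sup>2))"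
proof (rule integrableI_bounded)
  have "(\<integral>\<^sub>+(t::real). enorm (1 / (1 + t\<^sup>2))) \<le> (\<integral>\<^sub>+t. (indicator {-1..1} t + (indicator {1<..} t * ennreal (t powr (- 2)) + indicator {1<..} (0 - t) * ennreal ((0 - t) powr (- 2)))))"
  proof (intro nn_integral_mono)
    fix t :: real
    have sq: "1 / (1 + t\<^sup>2) \<le> s powr (- 2)" if "s > 1" "s\<^sup>2 = t\<^sup>2" for s
    proof -
      have "s powr (- 2) = 1 / s\<^sup>2" using that powr_realpow[of s 2] by (simp add: powr_minus divide_inverse)
      moreover have "t\<^sup>2 > 0" using that by (metis order.strict_trans zero_less_one zero_less_power)
      then have "1 / (1 + t\<^sup>2) \<le> 1 / t\<^sup>2" by (intro frac_le) auto
      ultimately show ?thesis using that(2) by metis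
    qed
    consider "\<bar>t\<bar> \<le> 1" | "t > 1" | "t < -1" by linarith
    then show "enorm (1 / (1 + t\<^sup>2)) \<le> indicator {-1..1} t + (indicator {1<..} t * ennreal (t powr (- 2)) + indicator {1<..} (0 - t) * ennreal ((0 - t) powr (- 2)))"
    proof cases
      case 1
      then have "enorm (1 / (1 + t\<^sup>2)) \<le> indicator {-1..1} t"
        using divide_le_eq_1_pos[of "1 + t\<^sup>2" 1] by (auto simp: abs_le_iff add_pos_nonneg)
      then show ?thesis by (rule order_trans) simp
    next
      case 2
      then show ?thesis using sq[of t] by (simp add: ennreal_leI)
    next
      case 3
      then show ?thesis using sq[of "- t"] by (simp add: ennreal_leI)
    qed
  qed
  also have "\<dots> = emeasure lborel {-1..1::real} + ((\<integral>\<^sub>+t. indicator {1<..} t * ennreal (t powr (- 2))) + (\<integral>\<^sub>+t. indicator {1<..} (0 - t) * ennreal ((0 - t) powr (- 2))))"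
    by (simp add: nn_integral_add)
  also have "(\<integral>\<^sub>+t. indicator {1<..} (0 - t) * ennreal ((0 - t) powr (- 2))) = (\<integral>\<^sub>+t. indicator {1<..} t * ennreal (t powr (- 2)))"
    by (rule nn_integral_lborel_reflection[of "\<lambda>t. indicator {1<..} t * ennreal (t powr (- 2))" 0]) measurable
  also have "(\<integral>\<^sub>+t. indicator {1<..} t * ennreal (t powr (- 2))) = ennreal (1 powr (1 - 2) / (2 - 1))"
    by (rule nn_integral_powr_inf) auto
  also have "emeasure lborel {-1..1::real} + (ennreal (1 powr (1 - 2) / (2 - 1)) + ennreal (1 powr (1 - 2) / (2 - 1))) < \<infinity>" by simp
  finally show "(\<integral>\<^sub>+(t::real). enorm (1 / (1 + t\<^sup>2))) < \<infinity>" .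
qed simp

text \<open>A product over coordinates, so that integrability follows from the one-dimensional case, and the decay of a
  Fourier transform can be proved one coordinate at a time.\<close>

definition quad_weight :: "'a::euclidean_space set \<Rightarrow> 'a \<Rightarrow> real" where
  "quad_weight S x = (\<Prod>b\<in>S. 1 + (x \<bullet> b)\<^sup>2)"

lemma quad_weight_pos: "quad_weight S x > 0"
  unfolding quad_weight_def by (intro prod_pos) (auto intro: add_pos_nonneg)

lemma integrable_of_quad_weight:
  fixes f :: "'a::euclidean_space \<Rightarrow> complex"
  assumes [measurable]: "f \<in> \<B>" and C: "\<And>x. norm (f x) * quad_weight Basis x \<le> C"
  shows "integrable lborel f"
proof (rule Bochner_Integration.integrable_bound)
  have "integrable lborel (\<lambda>t::real. complex_of_real (1 / (1 + t\<^sup>2)))"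
    by (rule integrable_of_real[OF integrable_inverse_quadratic])
  from integral_lborel_prod(1)[of "\<lambda>_ t. complex_of_real (1 / (1 + t\<^sup>2))", OF this]
  show "integrable lborel (\<lambda>x::'a. complex_of_real C * (\<Prod>b\<in>Basis. complex_of_real (1 / (1 + (x \<bullet> b)\<^sup>2))))"
    by (intro integrable_mult_right)
  show "AE x in lborel. norm (f x) \<le> norm (complex_of_real C * (\<Prod>b\<in>Basis. complex_of_real (1 / (1 + (x \<bullet> b)\<^sup>2))))"
  proof (intro AE_I2)
    fix x :: 'a
    have "(\<Prod>b\<in>Basis. complex_of_real (1 / (1 + (x \<bullet> b)\<^sup>2))) = of_real (1 / quad_weight Basis x)"
      unfolding quad_weight_def of_real_prod[symmetric] by (simp add: prod_dividef)
    moreover have "norm (f x) \<le> C * (1 / quad_weight Basis x)"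
      using C[of x] quad_weight_pos[of Basis x] by (simp add: field_simps)
    moreover have "C * (1 / quad_weight Basis x) \<le> norm (complex_of_real C * of_real (1 / quad_weight Basis x))"
      by (simp only: of_real_mult[symmetric] norm_of_real abs_ge_self)
    ultimately show "norm (f x) \<le> norm (complex_of_real C * (\<Prod>b\<in>Basis. complex_of_real (1 / (1 + (x \<bullet> b)\<^sup>2))))" by simp
  qed
qed measurable

lemma schwartz_quad_weight:
  fixes f :: "'a::euclidean_space \<Rightarrow> complex"
  assumes f: "schwartz f"
  obtains C where "\<And>x. norm (f x) * quad_weight Basis x \<le> C"
proof -
  let ?n = "DIM('a)"
  obtain C0 where C0: "\<And>x. norm (f x) \<le> C0" using schwartz_bounded[OF f] by blast
  obtain C1 where C1: "\<And>x. norm x ^ (2 * ?n) * norm (f x) \<le> C1" using schwartz_decay[OF f, of "[]" "2 * ?n"] by auto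
  have "norm (f x) * quad_weight Basis x \<le> 2 ^ ?n * (C0 + C1)" for x
  proof -
    have "quad_weight Basis x \<le> (\<Prod>b\<in>(Basis::'a set). 1 + (norm x)\<^sup>2)"
      unfolding quad_weight_def
    proof (rule prod_mono)
      fix b :: 'a assume b: "b \<in> Basis"
      have "(x \<bullet> b)\<^sup>2 \<le> (norm x)\<^sup>2" using Basis_le_norm[OF b, of x] by (metis abs_ge_zero power2_abs power_mono)
      then show "0 \<le> 1 + (x \<bullet> b)\<^sup>2 \<and> 1 + (x \<bullet> b)\<^sup>2 \<le> 1 + (norm x)\<^sup>2" by simp
    qed
    also have "\<dots> = (1 + (norm x)\<^sup>2) ^ ?n" by simp
    also have "\<dots> \<le> (2 * max 1 ((norm x)\<^sup>2)) ^ ?n" by (intro power_mono) auto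
    also have "\<dots> = 2 ^ ?n * (max 1 ((norm x)\<^sup>2)) ^ ?n" by (rule power_mult_distrib)
    also have "(max 1 ((norm x)\<^sup>2)) ^ ?n \<le> 1 + norm x ^ (2 * ?n)"
      by (cases "1 \<le> (norm x)\<^sup>2") (auto simp: max_def power_mult)
    finally have q: "quad_weight Basis x \<le> 2 ^ ?n * (1 + norm x ^ (2 * ?n))" by simp
    then have "norm (f x) * quad_weight Basis x \<le> norm (f x) * (2 ^ ?n * (1 + norm x ^ (2 * ?n)))"
      by (intro mult_left_mono) auto
    also have "\<dots> = 2 ^ ?n * (norm (f x) + norm x ^ (2 * ?n) * norm (f x))" by (simp add: algebra_simps)
    also have "\<dots> \<le> 2 ^ ?n * (C0 + C1)" by (intro mult_left_mono add_mono C0 C1) auto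
    finally show ?thesis .
  qed
  then show thesis by (rule that)
qed

lemma schwartz_integrable: "schwartz f \<Longrightarrow> integrable lborel f"
  by (metis schwartz_quad_weight integrable_of_quad_weight schwartz_measurable)

lemma schwartz_partial_deriv:
  assumes f: "schwartz f" and b: "b \<in> Basis"
  shows "((\<lambda>t. f (x + t *\<^sub>R b)) has_vector_derivative iter_partial [b] f (x + t *\<^sub>R b)) (at t)"
proof -
  have d: "(f has_derivative frechet_derivative f (at (x + t *\<^sub>R b))) (at (x + t *\<^sub>R b))"
    using schwartz_differentiable[OF f, of "[]"] by (simp add: frechet_derivative_works[symmetric])
  have "((\<lambda>t. x + t *\<^sub>R b) has_derivative (\<lambda>h. h *\<^sub>R b)) (at t)"
    by (auto intro!: derivative_eq_intros)
  from diff_chain_at[OF this d]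
  have "((\<lambda>t. f (x + t *\<^sub>R b)) has_derivative (\<lambda>h. frechet_derivative f (at (x + t *\<^sub>R b)) (h *\<^sub>R b))) (at t)"
    by (simp add: comp_def)
  moreover have "frechet_derivative f (at (x + t *\<^sub>R b)) (h *\<^sub>R b) = h *\<^sub>R frechet_derivative f (at (x + t *\<^sub>R b)) b" for h
    using d by (intro linear_cmul has_derivative_linear)
  ultimately show ?thesis by (simp add: has_vector_derivative_def)
qed

lemma schwartz_fourier_partial:
  assumes f: "schwartz f" and b: "b \<in> Basis"
  shows "fourier (iter_partial [b] f) \<xi> = 2 * of_real pi * \<i> * of_real (\<xi> \<bullet> b) * fourier f \<xi>"
proof -
  have s: "schwartz (iter_partial [b] f)" using b by (intro schwartz_iter_partial f) simp
  show ?thesis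
    by (rule fourier_directional_derivative[OF schwartz_integrable[OF f] schwartz_integrable[OF s] schwartz_continuous[OF s]
       schwartz_partial_deriv[OF f b]])
qed

lemma fourier_bounded:
  assumes "integrable lborel f" shows "norm (fourier f \<xi>) \<le> (LINT x|lborel. norm (f x))"
  unfolding fourier_eq_ift by (rule ift_bound[OF assms])

lemma fourier_measurable [measurable]:
  assumes "f \<in> \<B>" shows "fourier f \<in> \<B>"
  unfolding fourier_eq_ift[abs_def] by (rule measurable_compose[OF _ ift_measurable[OF assms]]) simp

lemma schwartz_fourier_decay:
  fixes f :: "'a::euclidean_space \<Rightarrow> complex"
  assumes "finite S" "S \<subseteq> Basis" "schwartz f"
  shows "\<exists>C. \<forall>\<xi>. norm (fourier f \<xi>) * quad_weight S \<xi> \<le> C"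
  using assms
proof (induction S arbitrary: f)
  case empty
  then show ?case using fourier_bounded[OF schwartz_integrable[OF empty.prems(2)]] by (auto simp: quad_weight_def)
next
  case (insert b S)
  let ?g = "iter_partial [b] (iter_partial [b] f)"
  have b: "b \<in> Basis" "S \<subseteq> Basis" using insert.prems by auto
  have g1: "schwartz (iter_partial [b] f)" using b by (intro schwartz_iter_partial insert.prems) simp
  have g: "schwartz ?g" using b by (intro schwartz_iter_partial g1) simp
  obtain C1 where C1: "\<And>\<xi>. norm (fourier f \<xi>) * quad_weight S \<xi> \<le> C1" using insert.IH[OF b(2) insert.prems(2)] by blast
  obtain C2 where C2: "\<And>\<xi>. norm (fourier ?g \<xi>) * quad_weight S \<xi> \<le> C2" using insert.IH[OF b(2) g] by blast
  have "norm (fourier f \<xi>) * quad_weight (insert b S) \<xi> \<le> C1 + C2" for \<xi>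
  proof -
    have "norm (fourier ?g \<xi>) = (2 * pi)\<^sup>2 * ((\<xi> \<bullet> b)\<^sup>2 * norm (fourier f \<xi>))"
      unfolding schwartz_fourier_partial[OF g1 b(1)] schwartz_fourier_partial[OF insert.prems(2) b(1)]
      by (simp add: norm_mult power2_eq_square mult_ac)
    moreover have "1 * ((\<xi> \<bullet> b)\<^sup>2 * norm (fourier f \<xi>)) \<le> (2 * pi)\<^sup>2 * ((\<xi> \<bullet> b)\<^sup>2 * norm (fourier f \<xi>))"
      using pi_ge_two by (intro mult_right_mono one_le_power) auto
    ultimately have "(\<xi> \<bullet> b)\<^sup>2 * norm (fourier f \<xi>) \<le> norm (fourier ?g \<xi>)" by simp
    then have "(\<xi> \<bullet> b)\<^sup>2 * norm (fourier f \<xi>) * quad_weight S \<xi> \<le> norm (fourier ?g \<xi>) * quad_weight S \<xi>"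
      using quad_weight_pos[of S \<xi>] by (intro mult_right_mono) auto
    moreover have "norm (fourier f \<xi>) * quad_weight (insert b S) \<xi> = norm (fourier f \<xi>) * quad_weight S \<xi> + (\<xi> \<bullet> b)\<^sup>2 * norm (fourier f \<xi>) * quad_weight S \<xi>"
      unfolding quad_weight_def using insert.hyps by (simp add: algebra_simps)
    ultimately show ?thesis using C1[of \<xi>] C2[of \<xi>] by linarith
  qed
  then show ?case by blast
qed

lemma schwartz_fourier_integrable:
  assumes f: "schwartz f" shows "integrable lborel (fourier f)"
proof -
  obtain C where "\<And>\<xi>. norm (fourier f \<xi>) * quad_weight Basis \<xi> \<le> C"
    using schwartz_fourier_decay[OF finite_Basis order_refl f] by blast
  then show ?thesis using schwartz_measurable[OF f] by (intro integrable_of_quad_weight) auto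
qed

lemma schwartz_inversion:
  assumes f: "schwartz f" shows "ift (fourier f) x = f x"
proof -
  obtain C where "\<And>x. norm (f x) \<le> C" using schwartz_bounded[OF f] by blast
  then show ?thesis
    by (intro fourier_inversion schwartz_integrable f schwartz_continuous schwartz_fourier_integrable)
qed

lemma schwartz_L2:
  assumes f: "schwartz f" shows "integrable lborel (\<lambda>x. (norm (f x))\<^sup>2)"
proof -
  obtain C where C: "\<And>x. norm (f x) \<le> C" using schwartz_bounded[OF f] by blast
  note schwartz_measurable[OF f, measurable]
  have "integrable lborel (\<lambda>x. f x * cnj (f x))"
    by (rule integrable_mult_bounded[OF schwartz_integrable[OF f], where B=C]) (auto simp: C)
  then have "integrable lborel (\<lambda>x. complex_of_real ((norm (f x))\<^sup>2))" unfolding complex_norm_square .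
  from integrable_Re[OF this] show ?thesis by simp
qed

lemma real_polynomial_function_derivative:
  fixes p :: "'a::euclidean_space \<Rightarrow> real"
  assumes "real_polynomial_function p"
  shows "\<exists>p'. (\<forall>x. (p has_derivative p' x) (at x)) \<and> (\<forall>b. real_polynomial_function (\<lambda>x. p' x b))"
  using assms
proof induction
  case (linear f)
  then show ?case by (intro exI[of _ "\<lambda>_. f"]) (auto intro: bounded_linear_imp_has_derivative)
next
  case (const c)
  then show ?case by (intro exI[of _ "\<lambda>_ _. 0"]) auto
next
  case (add f g)
  then obtain f' g' where "\<forall>x. (f has_derivative f' x) (at x)" "\<forall>b. real_polynomial_function (\<lambda>x. f' x b)"
    "\<forall>x. (g has_derivative g' x) (at x)" "\<forall>b. real_polynomial_function (\<lambda>x. g' x b)" by blast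
  then show ?case by (intro exI[of _ "\<lambda>x h. f' x h + g' x h"]) (auto intro!: has_derivative_add)
next
  case (mult f g)
  then obtain f' g' where "\<forall>x. (f has_derivative f' x) (at x)" "\<forall>b. real_polynomial_function (\<lambda>x. f' x b)"
    "\<forall>x. (g has_derivative g' x) (at x)" "\<forall>b. real_polynomial_function (\<lambda>x. g' x b)" by blast
  then show ?case using mult(1,2) by (intro exI[of _ "\<lambda>x h. f x * g' x h + f' x h * g x"]) (auto intro!: has_derivative_mult real_polynomial_function.intros(3,4))
qed

lemma real_polynomial_function_growth:
  fixes p :: "'a::euclidean_space \<Rightarrow> real"
  assumes "real_polynomial_function p"
  shows "\<exists>C k. C \<ge> 0 \<and> (\<forall>x. \<bar>p x\<bar> \<le> C * (1 + norm x) ^ k)"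
  using assms
proof induction
  case (linear f)
  then interpret bounded_linear f .
  obtain K where K: "K > 0" "\<And>x. norm (f x) \<le> norm x * K" using pos_bounded by blast
  have "\<bar>f x\<bar> \<le> K * (1 + norm x) ^ 1" for x using K(1) K(2)[of x] by (simp add: algebra_simps)
  then show ?case using K(1) by (intro exI[of _ K] exI[of _ 1]) auto
next
  case (const c)
  show ?case by (intro exI[of _ "\<bar>c\<bar>"] exI[of _ 0]) auto
next
  case (add f g)
  then obtain C k D l where *: "C \<ge> 0" "\<And>x. \<bar>f x\<bar> \<le> C * (1 + norm x) ^ k" "D \<ge> 0" "\<And>x. \<bar>g x\<bar> \<le> D * (1 + norm x) ^ l" by blast
  have "\<bar>f x + g x\<bar> \<le> (C + D) * (1 + norm x) ^ (k + l)" for x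
  proof -
    have "(1 + norm x) ^ k \<le> (1 + norm x) ^ (k + l)" "(1 + norm x) ^ l \<le> (1 + norm x) ^ (k + l)" by (intro power_increasing; simp)+
    then have "C * (1 + norm x) ^ k + D * (1 + norm x) ^ l \<le> C * (1 + norm x) ^ (k + l) + D * (1 + norm x) ^ (k + l)"
      using * by (intro add_mono mult_left_mono) auto
    then show ?thesis using *(2)[of x] *(4)[of x] by (simp add: algebra_simps)
  qed
  then show ?case using * by (intro exI[of _ "C + D"] exI[of _ "k + l"]) auto
next
  case (mult f g)
  then obtain C k D l where *: "C \<ge> 0" "\<And>x. \<bar>f x\<bar> \<le> C * (1 + norm x) ^ k" "D \<ge> 0" "\<And>x. \<bar>g x\<bar> \<le> D * (1 + norm x) ^ l" by blast
  have "\<bar>f x * g x\<bar> \<le> (C * D) * (1 + norm x) ^ (k + l)" for x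
  proof -
    have "\<bar>f x * g x\<bar> \<le> (C * (1 + norm x) ^ k) * (D * (1 + norm x) ^ l)"
      unfolding abs_mult using * by (intro mult_mono) auto
    then show ?thesis by (simp add: power_add mult_ac)
  qed
  then show ?case using * by (intro exI[of _ "C * D"] exI[of _ "k + l"]) auto
qed

lemma polynomial_times_gaussian_bounded:
  fixes c :: real
  assumes c: "c > 0" and r: "r \<ge> 0"
  shows "(1 + r) ^ m * exp (- (c * r\<^sup>2)) \<le> exp ((real m)\<^sup>2 / (4 * c))"
proof -
  have "(1 + r) ^ m \<le> (exp r) ^ m" using r by (intro power_mono exp_ge_add_one_self) auto
  also have "\<dots> = exp (real m * r)" by (rule exp_of_nat_mult[symmetric])
  finally have "(1 + r) ^ m * exp (- (c * r\<^sup>2)) \<le> exp (real m * r) * exp (- (c * r\<^sup>2))" by (intro mult_right_mono) auto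
  also have "\<dots> = exp (real m * r - c * r\<^sup>2)" by (simp add: exp_add[symmetric])
  also have "\<dots> \<le> exp ((real m)\<^sup>2 / (4 * c))"
  proof -
    have "0 \<le> (2 * c * r - real m)\<^sup>2" by simp
    then have "4 * c * (real m * r - c * r\<^sup>2) \<le> (real m)\<^sup>2" by (simp add: power2_eq_square algebra_simps)
    then show ?thesis using c by (simp add: pos_le_divide_eq mult.commute)
  qed
  finally show ?thesis .
qed

text \<open>Partial derivatives stay within this class, and the quadratic lower bound for \<open>Q\<close> beats every polynomial.
  Functions of this form are the explicit supply of Schwartz functions: Gaussians and the smooth approximations
  of boxes.\<close>

theorem schwartz_exp_polynomial:
  fixes p Q :: "'a::euclidean_space \<Rightarrow> real"
  assumes p: "real_polynomial_function p" and Q: "real_polynomial_function Q"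
    and c: "c > 0" and conf: "\<And>x. Q x \<ge> c * (norm x)\<^sup>2 - K"
  shows "schwartz (\<lambda>x. complex_of_real (p x * exp (- Q x)))"
proof -
  obtain Q' where Q': "\<And>x. (Q has_derivative Q' x) (at x)" "\<And>b. real_polynomial_function (\<lambda>x. Q' x b)"
    using real_polynomial_function_derivative[OF Q] by blast
  have deriv: "\<exists>q'. (\<forall>b. real_polynomial_function (\<lambda>x. q' x b)) \<and>
     (\<forall>x. ((\<lambda>x. complex_of_real (q x * exp (- Q x))) has_derivative (\<lambda>h. complex_of_real (q' x h * exp (- Q x)))) (at x))"
    if q: "real_polynomial_function q" for q
  proof -
    obtain r where r: "\<And>x. (q has_derivative r x) (at x)" "\<And>b. real_polynomial_function (\<lambda>x. r x b)"
      using real_polynomial_function_derivative[OF q] by blast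
    have "real_polynomial_function (\<lambda>x. r x b + (-1) * (q x * Q' x b))" for b
      by (intro real_polynomial_function.intros(2-4) r Q' q)
    moreover have "((\<lambda>x. complex_of_real (q x * exp (- Q x))) has_derivative (\<lambda>h. complex_of_real ((r x h + (-1) * (q x * Q' x h)) * exp (- Q x)))) (at x)" for x
      by (intro has_derivative_of_real) (auto intro!: derivative_eq_intros r Q' simp: algebra_simps)
    ultimately show ?thesis by (intro exI[of _ "\<lambda>x h. r x h + (-1) * (q x * Q' x h)"]) blast
  qed
  have iter: "\<exists>q. real_polynomial_function q \<and> iter_partial bs (\<lambda>x. complex_of_real (p x * exp (- Q x))) = (\<lambda>x. complex_of_real (q x * exp (- Q x)))" for bs
  proof (induction bs)
    case Nil then show ?case using p by auto
  next
    case (Cons b bs)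
    then obtain q where q: "real_polynomial_function q" "iter_partial bs (\<lambda>x. complex_of_real (p x * exp (- Q x))) = (\<lambda>x. complex_of_real (q x * exp (- Q x)))" by blast
    obtain q' where q': "\<And>b. real_polynomial_function (\<lambda>x. q' x b)"
     "\<And>x. ((\<lambda>x. complex_of_real (q x * exp (- Q x))) has_derivative (\<lambda>h. complex_of_real (q' x h * exp (- Q x)))) (at x)"
      using deriv[OF q(1)] by blast
    have "iter_partial (b # bs) (\<lambda>x. complex_of_real (p x * exp (- Q x))) = (\<lambda>x. complex_of_real (q' x b * exp (- Q x)))"
      unfolding iter_partial.simps q(2) frechet_derivative_at[OF q'(2), symmetric] ..
    with q'(1) show ?case by blast
  qed
  show ?thesis unfolding schwartz_def
  proof (intro allI impI conjI)
    fix bs :: "'a list" assume "set bs \<subseteq> Basis"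
    obtain q where q: "real_polynomial_function q" "iter_partial bs (\<lambda>x. complex_of_real (p x * exp (- Q x))) = (\<lambda>x. complex_of_real (q x * exp (- Q x)))"
      using iter by blast
    show "iter_partial bs (\<lambda>x. complex_of_real (p x * exp (- Q x))) differentiable at x" for x
      unfolding q(2) using deriv[OF q(1)] unfolding differentiable_def by blast
    fix k
    obtain C l where C: "C \<ge> 0" "\<And>x. \<bar>q x\<bar> \<le> C * (1 + norm x) ^ l" using real_polynomial_function_growth[OF q(1)] by blast
    have "norm x ^ k * norm (complex_of_real (q x * exp (- Q x))) \<le> C * exp K * exp ((real (k + l))\<^sup>2 / (4 * c))" for x
    proof -
      have "norm x ^ k * norm (complex_of_real (q x * exp (- Q x))) = norm x ^ k * (\<bar>q x\<bar> * exp (- Q x))"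
        by (simp only: norm_of_real abs_mult abs_exp_cancel)
      also have "\<dots> \<le> (1 + norm x) ^ k * ((C * (1 + norm x) ^ l) * exp (K - c * (norm x)\<^sup>2))"
        using conf[of x] by (intro mult_mono power_mono C) (auto simp: C)
      also have "\<dots> = C * exp K * ((1 + norm x) ^ (k + l) * exp (- (c * (norm x)\<^sup>2)))"
        by (simp add: power_add exp_diff exp_minus divide_inverse mult_ac)
      also have "\<dots> \<le> C * exp K * exp ((real (k + l))\<^sup>2 / (4 * c))"
        using C c by (intro mult_left_mono polynomial_times_gaussian_bounded) auto
      finally show ?thesis .
    qed
    then show "\<exists>C. \<forall>x. norm x ^ k * norm (iter_partial bs (\<lambda>x. complex_of_real (p x * exp (- Q x))) x) \<le> C"
      unfolding q(2) by blast
  qed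
qed

section \<open>Finite order smoothness\<close>

text \<open>Membership in \<open>C\<^sup>k\<close> with one-sided derivatives at boundary points of \<open>S\<close>. A finite order permits proofs by
  induction on \<open>k\<close>.\<close>

primrec k_smooth :: "nat \<Rightarrow> real set \<Rightarrow> (real \<Rightarrow> complex) \<Rightarrow> bool" where
  "k_smooth 0 S f = continuous_on S f"
| "k_smooth (Suc k) S f = (\<exists>f'. (\<forall>t\<in>S. (f has_vector_derivative f' t) (at t within S)) \<and> k_smooth k S f')"

lemma k_smooth_continuous: "k_smooth k S f \<Longrightarrow> continuous_on S f"
  by (cases k) (auto intro: continuous_on_vector_derivative)

lemma k_smooth_SucI:
  "(\<And>t. t \<in> S \<Longrightarrow> (f has_vector_derivative f' t) (at t within S)) \<Longrightarrow> k_smooth k S f' \<Longrightarrow> k_smooth (Suc k) S f"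
  by auto

lemma k_smooth_Suc_imp: "k_smooth (Suc k) S f \<Longrightarrow> k_smooth k S f"
proof (induction k arbitrary: f)
  case 0 then show ?case using k_smooth_continuous[OF 0] by simp
next
  case (Suc k)
  then obtain f' where f': "\<forall>t\<in>S. (f has_vector_derivative f' t) (at t within S)" "k_smooth (Suc k) S f'"
    unfolding k_smooth.simps(2)[of "Suc k"] by blast
  then show ?case using Suc.IH[OF f'(2)] by (intro k_smooth_SucI) auto
qed

lemma k_smooth_cong:
  assumes "\<And>t. t \<in> S \<Longrightarrow> f t = g t" "k_smooth k S f" shows "k_smooth k S g"
proof (cases k)
  case 0 with assms show ?thesis using continuous_on_cong[of S S f g] by simp
next
  case (Suc m)
  with assms obtain f' where f': "\<forall>t\<in>S. (f has_vector_derivative f' t) (at t within S)" "k_smooth m S f'" by auto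
  have "(g has_vector_derivative f' t) (at t within S)" if "t \<in> S" for t
    using f'(1) that assms(1) by (intro has_vector_derivative_transform[of t S g f]) auto
  then show ?thesis unfolding Suc by (rule k_smooth_SucI[OF _ f'(2)])
qed

lemma k_smooth_subset: "k_smooth k S f \<Longrightarrow> T \<subseteq> S \<Longrightarrow> k_smooth k T f"
proof (induction k arbitrary: f)
  case 0 then show ?case by (auto intro: continuous_on_subset)
next
  case (Suc k)
  then obtain f' where f': "\<forall>t\<in>S. (f has_vector_derivative f' t) (at t within S)" "k_smooth k S f'" by auto
  have "(f has_vector_derivative f' t) (at t within T)" if "t \<in> T" for t
    by (rule has_vector_derivative_within_subset[of f _ _ S]) (use f'(1) Suc.prems(2) that in auto)
  then show ?case using Suc.IH[OF f'(2) Suc.prems(2)] by (rule k_smooth_SucI)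
qed

lemma k_smooth_add: "k_smooth k S f \<Longrightarrow> k_smooth k S g \<Longrightarrow> k_smooth k S (\<lambda>t. f t + g t)"
proof (induction k arbitrary: f g)
  case 0 then show ?case by (auto intro: continuous_on_add)
next
  case (Suc k)
  then obtain f' g' where "\<forall>t\<in>S. (f has_vector_derivative f' t) (at t within S)" "k_smooth k S f'"
    "\<forall>t\<in>S. (g has_vector_derivative g' t) (at t within S)" "k_smooth k S g'" by auto
  with Suc.IH show ?case by (auto intro!: exI[of _ "\<lambda>t. f' t + g' t"] has_vector_derivative_add)
qed

lemma k_smooth_mult: "k_smooth k S f \<Longrightarrow> k_smooth k S g \<Longrightarrow> k_smooth k S (\<lambda>t. f t * g t)"
proof (induction k arbitrary: f g)
  case 0 then show ?case by (auto intro: continuous_on_mult)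
next
  case (Suc k)
  then obtain f' g' where *: "\<forall>t\<in>S. (f has_vector_derivative f' t) (at t within S)" "k_smooth k S f'"
    "\<forall>t\<in>S. (g has_vector_derivative g' t) (at t within S)" "k_smooth k S g'" by auto
  have "k_smooth k S (\<lambda>t. f t * g' t + f' t * g t)"
    using Suc * by (intro k_smooth_add Suc.IH) (auto intro: k_smooth_Suc_imp simp del: k_smooth.simps)
  with * show ?case by (auto intro!: exI[of _ "\<lambda>t. f t * g' t + f' t * g t"] has_vector_derivative_mult)
qed

lemma k_smooth_const: "k_smooth k S (\<lambda>_. c)"
  by (induction k arbitrary: c) (auto intro!: exI[of _ "\<lambda>_. 0"])

lemma smooth_on_halfline_k_smooth:
  assumes "smooth_on_halfline h" shows "k_smooth k {0..} h"
proof -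
  obtain D where D: "\<forall>t\<ge>0. D 0 t = h t" "\<forall>k. \<forall>t\<ge>0. (D k has_vector_derivative D (Suc k) t) (at t within {0..})"
    using assms unfolding smooth_on_halfline_def by blast
  have "k_smooth k {0..} (D i)" for i
  proof (induction k arbitrary: i)
    case 0
    show ?case using D(2) by (auto intro: continuous_on_vector_derivative)
  next
    case (Suc k)
    then show ?case using D(2) by (auto intro!: exI[of _ "D (Suc i)"])
  qed
  then show ?thesis using D(1) by (auto intro: k_smooth_cong[of _ "D 0"])
qed

lemma k_smooth_scale:
  assumes c: "c > 0"
  shows "k_smooth k {0<..} f \<Longrightarrow> k_smooth k {0<..} (\<lambda>t. f (c * t))"
proof (induction k arbitrary: f)
  case 0
  have "continuous_on {0<..} (\<lambda>t. f (c * t))"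
    by (rule continuous_on_compose2[of "{0<..}" f]) (use 0 c in \<open>auto intro!: continuous_intros\<close>)
  then show ?case by simp
next
  case (Suc k)
  then obtain f' where f': "\<forall>t\<in>{0<..}. (f has_vector_derivative f' t) (at t within {0<..})" "k_smooth k {0<..} f'" by auto
  have "((\<lambda>t. f (c * t)) has_vector_derivative of_real c * f' (c * t)) (at t within {0<..})" if t: "t > 0" for t
  proof -
    have 1: "((\<lambda>t. c * t) has_vector_derivative c) (at t)" by (auto intro!: derivative_eq_intros)
    have "(f has_vector_derivative f' (c * t)) (at (c * t))"
      using f'(1) c t by (simp add: at_within_open[of _ "{0<..}"])
    from vector_diff_chain_at[OF 1 this] have "((\<lambda>t. f (c * t)) has_vector_derivative of_real c * f' (c * t)) (at t)"
      by (simp add: comp_def scaleR_conv_of_real)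
    then show ?thesis by (rule has_vector_derivative_at_within)
  qed
  moreover have "k_smooth k {0<..} (\<lambda>t. of_real c * f' (c * t))"
    by (intro k_smooth_mult k_smooth_const Suc.IH f')
  ultimately show ?case by (intro k_smooth_SucI) auto
qed

lemma k_smooth_inverse: "k_smooth k {0<..} (\<lambda>t. 1 / of_real t)"
proof (induction k)
  case 0
  show ?case by (auto intro!: continuous_intros)
next
  case (Suc k)
  have "((\<lambda>t. 1 / complex_of_real t) has_vector_derivative (- 1) * (1 / of_real t * (1 / of_real t))) (at t within {0<..})" if "t > 0" for t
  proof -
    have "((\<lambda>z. 1 / z) has_field_derivative (- 1) * (1 / of_real t * (1 / of_real t))) (at (complex_of_real t))"
      using that by (auto intro!: derivative_eq_intros simp: field_simps)
    from has_vector_derivative_real_field[OF this] show ?thesis by (rule has_vector_derivative_at_within)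
  qed
  then have d: "\<And>t. t \<in> {0<..} \<Longrightarrow> ((\<lambda>t. 1 / complex_of_real t) has_vector_derivative (- 1) * (1 / of_real t * (1 / of_real t))) (at t within {0<..})"
    unfolding greaterThan_iff .
  have "k_smooth k {0<..} (\<lambda>t. (- 1) * (1 / of_real t * (1 / of_real t)))"
    by (intro k_smooth_mult k_smooth_const Suc)
  with d show ?case by (rule k_smooth_SucI)
qed

lemma k_smooth_extend_zero:
  assumes a: "0 < a"
  shows "k_smooth k {0<..} f \<Longrightarrow> (\<And>t. 0 < t \<Longrightarrow> t \<notin> {a..B} \<Longrightarrow> f t = 0) \<Longrightarrow> k_smooth k UNIV (\<lambda>t. if t > 0 then f t else 0)"
proof (induction k arbitrary: f)
  case 0
  have "continuous_on ({..<a} \<union> {0<..}) (\<lambda>t. if t > 0 then f t else 0)"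
  proof (rule continuous_on_open_Un)
    show "continuous_on {..<a} (\<lambda>t. if t > 0 then f t else 0)"
      by (rule continuous_on_eq[of _ "\<lambda>_. 0"]) (use 0 in auto)
    show "continuous_on {0<..} (\<lambda>t. if t > 0 then f t else 0)"
      by (rule continuous_on_eq[of _ f]) (use 0 in auto)
  qed auto
  moreover have "{..<a} \<union> {0<..} = UNIV" using a by auto
  ultimately show ?case by simp
next
  case (Suc k)
  then obtain f' where f': "\<forall>t\<in>{0<..}. (f has_vector_derivative f' t) (at t within {0<..})" "k_smooth k {0<..} f'" by auto
  have f'a: "(f has_vector_derivative f' t) (at t)" if "t > 0" for t
    using f'(1) that by (simp add: at_within_open[of _ "{0<..}"])
  have z: "f' t = 0" if "0 < t" "t \<notin> {a..B}" for t
  proof -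
    have "(f has_vector_derivative 0) (at t)"
    proof (rule has_vector_derivative_transform_within_open[of "\<lambda>_. 0" 0 t "{0<..} - {a..B}"])
      show "open ({0<..} - {a..B})" by (intro open_Diff) auto
    qed (use that Suc.prems in auto)
    with f'a[OF that(1)] show ?thesis by (rule vector_derivative_unique_at)
  qed
  have "((\<lambda>t. if t > 0 then f t else 0) has_vector_derivative (if t > 0 then f' t else 0)) (at t)" for t
  proof (cases "t > 0")
    case True
    have "((\<lambda>t. if t > 0 then f t else 0) has_vector_derivative f' t) (at t)"
      by (rule has_vector_derivative_transform_within_open[OF f'a[OF True], of "{0<..}"]) (use True in auto)
    then show ?thesis using True by simp
  next
    case False
    have "((\<lambda>t. if t > 0 then f t else 0) has_vector_derivative 0) (at t)"
      by (rule has_vector_derivative_transform_within_open[of "\<lambda>_. 0" 0 t "{..<a}"]) (use False a Suc.prems in auto)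
    then show ?thesis using False by simp
  qed
  moreover have "k_smooth k UNIV (\<lambda>t. if t > 0 then f' t else 0)" by (rule Suc.IH[OF f'(2) z])
  ultimately show ?case by (auto intro!: exI[of _ "\<lambda>t. if t > 0 then f' t else 0"])
qed

section \<open>Fourier transforms of smooth functions with compact support\<close>

lemma integrable_compact_support:
  fixes f :: "real \<Rightarrow> complex"
  assumes c: "continuous_on UNIV f" and z: "\<And>t. t \<notin> {a..b} \<Longrightarrow> f t = 0"
  shows "integrable lborel f"
proof -
  have "integrable lborel (\<lambda>t. indicator {a..b} t *\<^sub>R f t)"
    by (intro borel_integrable_compact compact_Icc continuous_on_subset[OF c]) auto
  also have "(\<lambda>t. indicator {a..b} t *\<^sub>R f t) = f" using z by (auto simp: indicator_def)
  finally show ?thesis .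
qed

lemma bounded_compact_support:
  fixes f :: "real \<Rightarrow> complex"
  assumes c: "continuous_on UNIV f" and z: "\<And>t. t \<notin> {a..b} \<Longrightarrow> f t = 0"
  obtains C where "\<And>t. norm (f t) \<le> C"
proof -
  have "bounded (f ` {a..b})"
    by (intro compact_imp_bounded compact_continuous_image continuous_on_subset[OF c]) auto
  then obtain C where C: "\<And>t. t \<in> {a..b} \<Longrightarrow> norm (f t) \<le> C" "C > 0" unfolding bounded_pos by blast
  have "norm (f t) \<le> C" for t using C z[of t] by (cases "t \<in> {a..b}") auto
  then show thesis by (rule that)
qed

lemma k_smooth_fourier_deriv:
  assumes "k_smooth (N + k) UNIV f" "\<And>t. t \<notin> {a..b} \<Longrightarrow> f t = 0"
  shows "\<exists>g. k_smooth k UNIV g \<and> (\<forall>t. t \<notin> {a..b} \<longrightarrow> g t = 0) \<and>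
    (\<forall>\<nu>. fourier g \<nu> = (2 * of_real pi * \<i> * of_real \<nu>) ^ N * fourier f \<nu>)"
  using assms
proof (induction N arbitrary: f)
  case 0
  then show ?case by (intro exI[of _ f]) auto
next
  case (Suc N)
  then obtain f' where f': "\<And>t. (f has_vector_derivative f' t) (at t)" "k_smooth (N + k) UNIV f'" by auto
  have z: "f' t = 0" if "t \<notin> {a..b}" for t
  proof -
    have "(f has_vector_derivative 0) (at t)"
      by (rule has_vector_derivative_transform_within_open[of "\<lambda>_. 0" 0 t "- {a..b}"]) (use that Suc.prems in auto)
    with f'(1) show ?thesis by (rule vector_derivative_unique_at)
  qed
  have cf': "continuous_on UNIV f'" by (rule k_smooth_continuous[OF f'(2)])
  have cf: "continuous_on UNIV f" by (rule k_smooth_continuous[OF Suc.prems(1)])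
  have F: "fourier f' \<nu> = 2 * of_real pi * \<i> * of_real \<nu> * fourier f \<nu>" for \<nu>
  proof -
    have "fourier f' \<nu> = 2 * of_real pi * \<i> * of_real (\<nu> \<bullet> 1) * fourier f \<nu>"
    proof (rule fourier_directional_derivative[OF integrable_compact_support[OF cf Suc.prems(2)] integrable_compact_support[OF cf' z] cf'])
      fix x t :: real
      have 1: "((\<lambda>t. x + t *\<^sub>R 1) has_vector_derivative 1) (at t)" by (auto intro!: derivative_eq_intros)
      from vector_diff_chain_at[OF 1 f'(1)] show "((\<lambda>t. f (x + t *\<^sub>R 1)) has_vector_derivative f' (x + t *\<^sub>R 1)) (at t)"
        by (simp add: comp_def)
    qed
    then show ?thesis by simp
  qed
  from Suc.IH[OF f'(2) z] obtain g where g: "k_smooth k UNIV g" "\<forall>t. t \<notin> {a..b} \<longrightarrow> g t = 0"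
    "\<forall>\<nu>. fourier g \<nu> = (2 * of_real pi * \<i> * of_real \<nu>) ^ N * fourier f' \<nu>" by blast
  then show ?case by (intro exI[of _ g]) (simp add: F mult_ac)
qed

lemma k_smooth_fourier_decay:
  assumes "k_smooth N UNIV f" "\<And>t. t \<notin> {a..b} \<Longrightarrow> f t = 0"
  obtains C where "\<And>\<nu>. \<bar>\<nu>\<bar> ^ N * norm (fourier f \<nu>) \<le> C"
proof -
  obtain g where g: "k_smooth 0 UNIV g" "\<And>t. t \<notin> {a..b} \<Longrightarrow> g t = 0"
    "\<And>\<nu>. fourier g \<nu> = (2 * of_real pi * \<i> * of_real \<nu>) ^ N * fourier f \<nu>"
    using k_smooth_fourier_deriv[of N 0 f a b] assms by auto
  have gi: "integrable lborel g" using g by (intro integrable_compact_support[of _ a b]) auto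
  have "\<bar>\<nu>\<bar> ^ N * norm (fourier f \<nu>) \<le> (LINT x|lborel. norm (g x))" for \<nu>
  proof -
    have "\<bar>\<nu>\<bar> ^ N * norm (fourier f \<nu>) \<le> (2 * pi * \<bar>\<nu>\<bar>) ^ N * norm (fourier f \<nu>)"
      using pi_ge_two mult_right_mono[of 1 "2 * pi" "\<bar>\<nu>\<bar>"] by (intro mult_right_mono power_mono) auto
    also have "\<dots> = norm (fourier g \<nu>)" unfolding g(3) by (simp add: norm_mult norm_power)
    also have "\<dots> \<le> (LINT x|lborel. norm (g x))" by (rule fourier_bounded[OF gi])
    finally show ?thesis .
  qed
  then show thesis by (rule that)
qed

section \<open>The Fourier transform of the Gamma kernel\<close>

definition gamma_kernel :: "real \<Rightarrow> real \<Rightarrow> real \<Rightarrow> complex" where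
  "gamma_kernel g e x = of_real (pos_powr (g - 1) x * exp (- (e * x)))"

lemma gamma_kernel_measurable [measurable]: "gamma_kernel g e \<in> \<B>"
  unfolding gamma_kernel_def by measurable

text \<open>Euler's integral, after scaling by \<open>e\<close>.\<close>

lemma gamma_kernel_nn_integral:
  assumes g: "g > 0" and e: "e > 0"
  shows "(\<integral>\<^sub>+x. ennreal (pos_powr (g - 1) x * exp (- (e * x)))) = ennreal (e powr (- g) * Gamma g)"
proof -
  have "(\<integral>\<^sub>+x. ennreal (pos_powr (g - 1) x * exp (- (e * x)))) =
    ennreal \<bar>1 / e\<bar> * (\<integral>\<^sub>+y. ennreal (pos_powr (g - 1) (0 + 1 / e * y) * exp (- (e * (0 + 1 / e * y)))))"
    by (rule nn_integral_real_affine) (use e in auto)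
  also have "\<dots> = ennreal (1 / e) * (\<integral>\<^sub>+y. ennreal (e powr (1 - g)) * ennreal (indicator {0..} y * y powr (g - 1) / exp y))"
  proof -
    have "ennreal (pos_powr (g - 1) (0 + 1 / e * y) * exp (- (e * (0 + 1 / e * y)))) = ennreal (e powr (1 - g)) * ennreal (indicator {0..} y * y powr (g - 1) / exp y)" for y
    proof (cases "y > 0")
      case True
      have "pos_powr (g - 1) (1 / e * y) = e powr (1 - g) * y powr (g - 1)"
      proof -
        have "e powr (1 - g) = 1 / e powr (g - 1)" using powr_minus_divide[of e "g - 1"] by simp
        then show ?thesis using True e by (simp add: pos_powr_pos powr_divide)
      qed
      then show ?thesis using True e by (simp add: ennreal_mult[symmetric] exp_minus divide_inverse mult_ac)
    next
      case False
      then have "1 / e * y \<le> 0" using e by (simp add: divide_nonpos_pos)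
      then show ?thesis using False by (cases "y = 0") (auto simp: pos_powr_nonpos)
    qed
    then show ?thesis using e by simp
  qed
  also have "\<dots> = ennreal (1 / e) * (ennreal (e powr (1 - g)) * ennreal (Gamma g))"
    by (subst nn_integral_cmult) (auto simp: Gamma_conv_nn_integral_real[OF g])
  also have "\<dots> = ennreal (1 / e * (e powr (1 - g) * Gamma g))"
    using g e by (simp add: ennreal_mult[symmetric])
  also have "1 / e * (e powr (1 - g) * Gamma g) = e powr (- g) * Gamma g"
    using e by (simp add: powr_diff powr_minus field_simps)
  finally show ?thesis .
qed

lemma gamma_kernel_integrable:
  assumes g: "g > 0" and e: "e > 0"
  shows "integrable lborel (gamma_kernel g e)"
proof (rule integrableI_bounded)
  have "(\<integral>\<^sub>+x. enorm (gamma_kernel g e x)) = (\<integral>\<^sub>+x. ennreal (pos_powr (g - 1) x * exp (- (e * x))))"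
    unfolding gamma_kernel_def norm_of_real by simp
  then show "(\<integral>\<^sub>+x. enorm (gamma_kernel g e x)) < \<infinity>"
    unfolding gamma_kernel_nn_integral[OF assms] by simp
qed measurable

lemma gamma_kernel_fourier_0:
  assumes g: "g > 0" and e: "e > 0"
  shows "fourier (gamma_kernel g e) 0 = of_real (e powr (- g) * Gamma g)"
proof -
  have "(LINT x|lborel. pos_powr (g - 1) x * exp (- (e * x))) = e powr (- g) * Gamma g"
    using g by (intro integral_eq_nn_integral[THEN trans]) (auto simp: gamma_kernel_nn_integral[OF assms])
  then show ?thesis unfolding fourier_eq_cis gamma_kernel_def by (simp del: of_real_mult)
qed

lemma cis_remainder_bounds:
  fixes b :: real
  shows "norm (cis b - 1 - \<i> * of_real b) \<le> 2 * \<bar>b\<bar>" and "norm (cis b - 1 - \<i> * of_real b) \<le> b\<^sup>2 / 2"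
proof -
  have eq: "iexp b - (\<Sum>k\<le>1. (\<i> * of_real b) ^ k / fact k) = cis b - 1 - \<i> * of_real b"
    by (simp add: cis_conv_exp)
  show "norm (cis b - 1 - \<i> * of_real b) \<le> 2 * \<bar>b\<bar>"
    using iexp_approx2[of b 1] unfolding eq by simp
  show "norm (cis b - 1 - \<i> * of_real b) \<le> b\<^sup>2 / 2"
    using iexp_approx1[of b 1] unfolding eq by (simp add: power2_eq_square)
qed

text \<open>The remainder in the difference quotient of the exponential, the factor that must tend to 0 when
  differentiating under the integral sign.\<close>

definition cis_quotient :: "real \<Rightarrow> real \<Rightarrow> complex" where
  "cis_quotient h x = (cis (- 2 * pi * (x * h)) - 1 - \<i> * of_real (- 2 * pi * (x * h))) / of_real h"

lemma cis_quotient_measurable [measurable]: "cis_quotient h \<in> \<B>"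
  unfolding cis_quotient_def by measurable

lemma cis_quotient_bound: "h \<noteq> 0 \<Longrightarrow> norm (cis_quotient h x) \<le> 4 * pi * \<bar>x\<bar>"
  using cis_remainder_bounds(1)[of "- 2 * pi * (x * h)"]
  unfolding cis_quotient_def norm_divide norm_of_real by (simp add: divide_le_eq abs_mult mult_ac)

lemma cis_quotient_tendsto:
  assumes H: "H \<longlonglongrightarrow> 0" "\<And>n. H n \<noteq> 0"
  shows "(\<lambda>n. cis_quotient (H n) x) \<longlonglongrightarrow> 0"
proof (rule Lim_null_comparison)
  have "norm (cis_quotient (H n) x) \<le> (2 * pi * x)\<^sup>2 / 2 * \<bar>H n\<bar>" for n
  proof -
    have "norm (cis_quotient (H n) x) \<le> (- 2 * pi * (x * H n))\<^sup>2 / 2 / \<bar>H n\<bar>"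
      unfolding cis_quotient_def norm_divide norm_of_real
      by (intro divide_right_mono cis_remainder_bounds(2)) simp
    also have "(- 2 * pi * (x * H n))\<^sup>2 / 2 / \<bar>H n\<bar> = (2 * pi * x)\<^sup>2 / 2 * \<bar>H n\<bar>"
    proof -
      have sq: "(- 2 * pi * (x * H n))\<^sup>2 = (2 * pi * x)\<^sup>2 * (\<bar>H n\<bar> * \<bar>H n\<bar>)"
        by (simp add: power2_eq_square)
      have gen: "X * (a * a) / 2 / a = X / 2 * a" if "a \<noteq> 0" for X a :: real using that by simp
      show ?thesis unfolding sq by (rule gen) (use H(2)[of n] in simp)
    qed
    finally show ?thesis .
  qed
  then show "\<forall>\<^sub>F n in sequentially. norm (cis_quotient (H n) x) \<le> (2 * pi * x)\<^sup>2 / 2 * \<bar>H n\<bar>" by simp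
  show "(\<lambda>n. (2 * pi * x)\<^sup>2 / 2 * \<bar>H n\<bar>) \<longlonglongrightarrow> 0"
    by (intro tendsto_mult_right_zero tendsto_rabs_zero H)
qed

lemma fourier_difference:
  fixes f :: "real \<Rightarrow> complex"
  assumes f: "integrable lborel f" and xf: "integrable lborel (\<lambda>x. of_real x * f x)" and h: "h \<noteq> 0"
  shows "fourier f (\<xi> + h) - fourier f \<xi> - of_real h * (- 2 * of_real pi * \<i> * fourier (\<lambda>x. of_real x * f x) \<xi>)
    = of_real h * (LINT x|lborel. f x * cis (- 2 * pi * (x * \<xi>)) * cis_quotient h x)"
proof -
  let ?a = "\<lambda>x. f x * cis (- 2 * pi * (x * (\<xi> + h)))"
  let ?b = "\<lambda>x. f x * cis (- 2 * pi * (x * \<xi>))"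
  let ?c = "\<lambda>x. of_real h * (- 2 * of_real pi * \<i>) * (of_real x * f x * cis (- 2 * pi * (x * \<xi>)))"
  have i: "integrable lborel ?a" "integrable lborel ?b" by (rule integrable_mult_cis[OF f], measurable)+
  have ic: "integrable lborel ?c" by (intro integrable_mult_right integrable_mult_cis xf) measurable
  have "fourier f (\<xi> + h) - fourier f \<xi> - of_real h * (- 2 * of_real pi * \<i> * fourier (\<lambda>x. of_real x * f x) \<xi>)
    = integral\<^sup>L lborel ?a - integral\<^sup>L lborel ?b - integral\<^sup>L lborel ?c"
    unfolding fourier_eq_cis integral_mult_right_zero by simp
  also have "\<dots> = (LINT x|lborel. ?a x - ?b x - ?c x)"
    using i ic by (simp only: Bochner_Integration.integral_diff Bochner_Integration.integrable_diff)
  also have "\<dots> = (LINT x|lborel. of_real h * (f x * cis (- 2 * pi * (x * \<xi>)) * cis_quotient h x))"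
  proof (intro LINT_cong refl)
    fix x
    have "cis (- 2 * pi * (x * (\<xi> + h))) = cis (- 2 * pi * (x * \<xi>)) * cis (- 2 * pi * (x * h))"
      unfolding cis_mult by (simp add: algebra_simps)
    moreover have "of_real h * (f x * cis (- 2 * pi * (x * \<xi>)) * cis_quotient h x) =
        f x * cis (- 2 * pi * (x * \<xi>)) * (cis (- 2 * pi * (x * h)) - 1 - \<i> * of_real (- 2 * pi * (x * h)))"
      using h unfolding cis_quotient_def by simp
    ultimately show "?a x - ?b x - ?c x = of_real h * (f x * cis (- 2 * pi * (x * \<xi>)) * cis_quotient h x)"
      by (simp add: algebra_simps)
  qed
  finally show ?thesis by simp
qed

lemma fourier_has_vector_derivative:
  fixes f :: "real \<Rightarrow> complex"
  assumes f: "integrable lborel f" and xf: "integrable lborel (\<lambda>x. of_real x * f x)"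
  shows "(fourier f has_vector_derivative (- 2 * of_real pi * \<i> * fourier (\<lambda>x. of_real x * f x) \<xi>)) (at \<xi>)"
proof -
  have [measurable]: "f \<in> \<B>" using f by simp
  let ?D = "- 2 * of_real pi * \<i> * fourier (\<lambda>x. of_real x * f x) \<xi>"
  let ?J = "\<lambda>h. LINT x|lborel. f x * cis (- 2 * pi * (x * \<xi>)) * cis_quotient h x"
  have J: "(\<lambda>n. ?J (H n)) \<longlonglongrightarrow> 0" if H: "H \<longlonglongrightarrow> 0" "\<And>n. H n \<noteq> 0" for H :: "nat \<Rightarrow> real"
  proof -
    have "(\<lambda>n. ?J (H n)) \<longlonglongrightarrow> (LINT x|(lborel::real measure). 0)"
    proof (rule integral_dominated_convergence[where w="\<lambda>x. 4 * pi * norm (of_real x * f x)"])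
      show "AE x in lborel. (\<lambda>n. f x * cis (- 2 * pi * (x * \<xi>)) * cis_quotient (H n) x) \<longlonglongrightarrow> 0"
        by (intro AE_I2 tendsto_mult_right_zero cis_quotient_tendsto[OF H])
      show "AE x in lborel. norm (f x * cis (- 2 * pi * (x * \<xi>)) * cis_quotient (H n) x) \<le> 4 * pi * norm (of_real x * f x)" for n
      proof (intro AE_I2)
        fix x
        have "norm (f x) * norm (cis_quotient (H n) x) \<le> norm (f x) * (4 * pi * \<bar>x\<bar>)"
          by (intro mult_left_mono cis_quotient_bound H) auto
        then show "norm (f x * cis (- 2 * pi * (x * \<xi>)) * cis_quotient (H n) x) \<le> 4 * pi * norm (of_real x * f x)"
          by (simp add: norm_mult mult_ac)
      qed
      show "integrable lborel (\<lambda>x. 4 * pi * norm (of_real x * f x))"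
        by (intro integrable_mult_right integrable_norm xf)
    qed measurable
    then show ?thesis by simp
  qed
  have "((\<lambda>h. norm (fourier f (\<xi> + h) - fourier f \<xi> - h *\<^sub>R ?D) / norm h) \<longlongrightarrow> 0) (at 0)"
    unfolding tendsto_at_iff_sequentially
  proof (intro allI impI)
    fix H :: "nat \<Rightarrow> real" assume "\<forall>i. H i \<in> UNIV - {0}" and H1: "H \<longlonglongrightarrow> 0"
    then have H2: "\<And>n. H n \<noteq> 0" by auto
    have "norm (fourier f (\<xi> + H n) - fourier f \<xi> - H n *\<^sub>R ?D) / norm (H n) = norm (?J (H n))" for n
      unfolding scaleR_conv_of_real fourier_difference[OF f xf H2] using H2[of n] by (simp add: norm_mult)
    then show "((\<lambda>h. norm (fourier f (\<xi> + h) - fourier f \<xi> - h *\<^sub>R ?D) / norm h) \<circ> H) \<longlonglongrightarrow> 0"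
      unfolding comp_def using tendsto_norm_zero[OF J[OF H1 H2]] by simp
  qed
  then show ?thesis unfolding has_vector_derivative_def has_derivative_at
    using bounded_linear_scaleR_left by blast
qed

lemma gamma_kernel_Suc: "of_real x * gamma_kernel g e x = gamma_kernel (g + 1) e x"
proof (cases "x > 0")
  case True
  then have "x * x powr (g - 1) = x powr g" using powr_add[of x 1 "g - 1"] by simp
  then have "x * (x powr (g - 1) * exp (- (e * x))) = x powr g * exp (- (e * x))" by (simp only: mult.assoc[symmetric])
  then have "complex_of_real (x * (x powr (g - 1) * exp (- (e * x)))) = of_real (x powr g * exp (- (e * x)))" by (rule arg_cong)
  then show ?thesis using True by (simp add: gamma_kernel_def pos_powr_pos)
next
  case False then show ?thesis by (simp add: gamma_kernel_def pos_powr_nonpos)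
qed

lemma pos_powr_has_derivative:
  assumes g: "g > 1"
  shows "(pos_powr g has_real_derivative g * pos_powr (g - 1) x) (at x)"
proof (cases "x = 0")
  case False
  then consider "x > 0" | "x < 0" by linarith
  then show ?thesis
  proof cases
    case 1
    have "((\<lambda>x. x powr g) has_real_derivative g * x powr (g - 1)) (at x)"
      using 1 by (auto intro!: derivative_eq_intros)
    then show ?thesis
      using 1 has_field_derivative_transform_within_open[of "\<lambda>x. x powr g" _ x "{0<..}" "pos_powr g"]
      by (simp add: pos_powr_pos)
  next
    case 2
    have "((\<lambda>x. 0::real) has_real_derivative 0) (at x)" by simp
    then show ?thesis
      using 2 has_field_derivative_transform_within_open[of "\<lambda>x. 0" 0 x "{..<0}" "pos_powr g"]
      by (simp add: pos_powr_nonpos)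
  qed
next
  case True
  have "(\<lambda>h. (pos_powr g (0 + h) - pos_powr g 0) / h) \<midarrow>0\<rightarrow> 0"
  proof (rule Lim_null_comparison)
    show "\<forall>\<^sub>F h in at 0. norm ((pos_powr g (0 + h) - pos_powr g 0) / h) \<le> \<bar>h\<bar> powr (g - 1)"
    proof (intro always_eventually allI)
      fix h :: real
      show "norm ((pos_powr g (0 + h) - pos_powr g 0) / h) \<le> \<bar>h\<bar> powr (g - 1)"
      proof (cases "h > 0")
        case True then show ?thesis by (simp add: pos_powr_pos pos_powr_nonpos powr_diff)
      next
        case False
        then have "pos_powr g (0 + h) - pos_powr g 0 = 0" by (simp add: pos_powr_nonpos)
        then show ?thesis by simp
      qed
    qed
    show "((\<lambda>h. \<bar>h\<bar> powr (g - 1)) \<longlongrightarrow> 0) (at (0::real))"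
    proof -
      have "((\<lambda>h. \<bar>h\<bar> powr (g - 1)) \<longlongrightarrow> \<bar>0::real\<bar> powr (g - 1)) (at (0::real))"
        using g by (intro tendsto_powr' tendsto_rabs tendsto_ident_at tendsto_const) auto
      then show ?thesis by simp
    qed
  qed
  then have "(pos_powr g has_real_derivative 0) (at 0)" by (simp only: DERIV_def)
  then show ?thesis using True by (simp add: pos_powr_nonpos)
qed

lemma pos_powr_continuous: "g > 0 \<Longrightarrow> continuous_on S (pos_powr g)"
  unfolding pos_powr_def by (intro continuous_on_powr' continuous_intros) auto

lemma gamma_kernel_has_derivative:
  assumes g: "g > 1"
  shows "(gamma_kernel (g + 1) e has_vector_derivative of_real g * gamma_kernel g e x - of_real e * gamma_kernel (g + 1) e x) (at x)"
proof -
  have "((\<lambda>x. exp (- (e * x))) has_real_derivative (- e) * exp (- (e * x))) (at x)"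
    by (auto intro!: derivative_eq_intros)
  from DERIV_mult[OF pos_powr_has_derivative[OF g] this]
  have "((\<lambda>x. pos_powr g x * exp (- (e * x))) has_real_derivative g * (pos_powr (g - 1) x * exp (- (e * x))) - e * (pos_powr g x * exp (- (e * x)))) (at x)"
    by (rule DERIV_cong) (simp add: algebra_simps)
  from has_vector_derivative_of_real[OF this] show ?thesis
    unfolding gamma_kernel_def by simp
qed

text \<open>The Fourier transform of the first-order linear differential equation of the kernel.\<close>

lemma gamma_kernel_fourier_step:
  assumes g: "g > 1" and e: "e > 0"
  shows "of_real g * fourier (gamma_kernel g e) \<xi> = (of_real e + 2 * of_real pi * \<i> * of_real \<xi>) * fourier (gamma_kernel (g + 1) e) \<xi>"
proof -
  let ?u = "\<lambda>x. of_real g * gamma_kernel g e x - of_real e * gamma_kernel (g + 1) e x"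
  have i1: "integrable lborel (gamma_kernel g e)" and i2: "integrable lborel (gamma_kernel (g + 1) e)"
    using g e by (auto intro!: gamma_kernel_integrable)
  have iu: "integrable lborel ?u" by (intro Bochner_Integration.integrable_diff integrable_mult_right i1 i2)
  have "fourier ?u \<xi> = 2 * of_real pi * \<i> * of_real (\<xi> \<bullet> 1) * fourier (gamma_kernel (g + 1) e) \<xi>"
  proof (rule fourier_directional_derivative[OF i2 iu])
    show "continuous_on UNIV ?u"
      unfolding gamma_kernel_def using g by (intro continuous_intros pos_powr_continuous) auto
    fix x t :: real
    have 1: "((\<lambda>t. x + t *\<^sub>R 1) has_vector_derivative 1) (at t)" by (auto intro!: derivative_eq_intros)
    from vector_diff_chain_at[OF 1 gamma_kernel_has_derivative[OF g]]
    show "((\<lambda>t. gamma_kernel (g + 1) e (x + t *\<^sub>R 1)) has_vector_derivative ?u (x + t *\<^sub>R 1)) (at t)"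
      by (simp add: comp_def)
  qed
  moreover have "fourier ?u \<xi> = of_real g * fourier (gamma_kernel g e) \<xi> - of_real e * fourier (gamma_kernel (g + 1) e) \<xi>"
  proof -
    have "fourier ?u \<xi> = (LINT x|lborel. of_real g * (gamma_kernel g e x * cis (- 2 * pi * (x \<bullet> \<xi>))) - of_real e * (gamma_kernel (g + 1) e x * cis (- 2 * pi * (x \<bullet> \<xi>))))"
      unfolding fourier_eq_cis by (simp add: algebra_simps)
    also have "\<dots> = (LINT x|lborel. of_real g * (gamma_kernel g e x * cis (- 2 * pi * (x \<bullet> \<xi>)))) - (LINT x|lborel. of_real e * (gamma_kernel (g + 1) e x * cis (- 2 * pi * (x \<bullet> \<xi>))))"
      by (intro Bochner_Integration.integral_diff integrable_mult_right integrable_mult_cis i1 i2) auto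
    finally show ?thesis unfolding fourier_eq_cis integral_mult_right_zero .
  qed
  ultimately show ?thesis by (simp add: algebra_simps)
qed

text \<open>The transform satisfies a first-order linear differential equation, because its derivative is a multiple of the
  transform of the next kernel. Hence its quotient by the claimed power is constant, and it is evaluated at
  \<open>\<xi> = 0\<close>.\<close>

theorem gamma_kernel_fourier:
  assumes g: "g > 1" and e: "e > 0"
  shows "fourier (gamma_kernel g e) \<xi> = of_real (Gamma g) * (of_real e + 2 * of_real pi * \<i> * of_real \<xi>) powr (- of_real g)"
proof -
  let ?z = "\<lambda>\<xi>::real. of_real e + 2 * of_real pi * \<i> * of_real \<xi> :: complex"
  define A where "A \<xi> = fourier (gamma_kernel g e) \<xi> * ?z \<xi> powr of_real g" for \<xi>
  have zn: "?z \<xi> \<notin> \<real>\<^sub>\<le>\<^sub>0" for \<xi> using e by (auto simp: complex_nonpos_Reals_iff)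
  have z0: "?z \<xi> \<noteq> 0" for \<xi> using zn[of \<xi>] by auto
  have i1: "integrable lborel (gamma_kernel g e)" and i2: "integrable lborel (gamma_kernel (g + 1) e)"
    using g e by (auto intro!: gamma_kernel_integrable)
  have "(A has_vector_derivative 0) (at \<xi>)" for \<xi>
  proof -
    have d1: "(fourier (gamma_kernel g e) has_vector_derivative - 2 * of_real pi * \<i> * fourier (gamma_kernel (g + 1) e) \<xi>) (at \<xi>)"
      using fourier_has_vector_derivative[OF i1, of \<xi>] i2 unfolding gamma_kernel_Suc by simp
    have "((\<lambda>\<xi>. complex_of_real \<xi>) has_vector_derivative 1) (at \<xi>)"
      using has_vector_derivative_of_real[of "\<lambda>x. x" 1 "at \<xi>"] by simp
    from has_vector_derivative_add[OF has_vector_derivative_const has_vector_derivative_mult_right[OF this]]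
    have z1: "(?z has_vector_derivative 2 * of_real pi * \<i>) (at \<xi>)" by simp
    have d2: "((\<lambda>\<xi>. ?z \<xi> powr of_real g) has_vector_derivative (2 * of_real pi * \<i>) * (of_real g * ?z \<xi> powr (of_real g - 1))) (at \<xi>)"
      using field_vector_diff_chain_at[OF z1 has_field_derivative_powr[OF zn]] by (simp add: comp_def)
    have pw: "?z \<xi> powr of_real g = ?z \<xi> * ?z \<xi> powr (of_real g - 1)"
      using powr_add[of "?z \<xi>" 1 "of_real g - 1"] z0[of \<xi>] by simp
    have "fourier (gamma_kernel g e) \<xi> * ((2 * of_real pi * \<i>) * (of_real g * ?z \<xi> powr (of_real g - 1))) +
      (- 2 * of_real pi * \<i> * fourier (gamma_kernel (g + 1) e) \<xi>) * ?z \<xi> powr of_real g =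
      (2 * of_real pi * \<i>) * ?z \<xi> powr (of_real g - 1) * (of_real g * fourier (gamma_kernel g e) \<xi> - ?z \<xi> * fourier (gamma_kernel (g + 1) e) \<xi>)"
    proof -
      have "p * (c * (G * w)) + (- 2 * of_real pi * \<i> * q) * (z * w) = c * w * (G * p - z * q)"
        if "c = 2 * of_real pi * \<i>" for p c G w q z :: complex
        unfolding that by (simp add: algebra_simps)
      then show ?thesis unfolding pw by blast
    qed
    also have "\<dots> = 0" using gamma_kernel_fourier_step[OF g e, of \<xi>] by simp
    finally have zero: "fourier (gamma_kernel g e) \<xi> * ((2 * of_real pi * \<i>) * (of_real g * ?z \<xi> powr (of_real g - 1))) +
      (- 2 * of_real pi * \<i> * fourier (gamma_kernel (g + 1) e) \<xi>) * ?z \<xi> powr of_real g = 0" .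
    show ?thesis using has_vector_derivative_mult[OF d1 d2] unfolding A_def zero .
  qed
  then obtain c where "\<And>x. A x = c"
    using has_vector_derivative_zero_constant[of UNIV A] by auto
  then have "A \<xi> = A 0" by simp
  also have "A 0 = of_real (Gamma g)"
  proof -
    have "A 0 = of_real (e powr (- g) * Gamma g) * of_real (e powr g)"
      unfolding A_def using e g by (simp add: gamma_kernel_fourier_0 powr_of_real)
    also have "\<dots> = of_real (Gamma g)" using e by (simp add: powr_minus)
    finally show ?thesis .
  qed
  finally have eq: "fourier (gamma_kernel g e) \<xi> * ?z \<xi> powr of_real g = of_real (Gamma g)"
    unfolding A_def .
  have "?z \<xi> powr of_real g \<noteq> 0" using z0[of \<xi>] by (simp only: powr_eq_0_iff) simp
  then show ?thesis unfolding eq[symmetric] powr_minus by simp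
qed

section \<open>Uniqueness of Fourier transforms\<close>

text \<open>The positive and the negative part have the same mass and, after normalization, the same characteristic
  function, so Levy's uniqueness theorem applies.\<close>

lemma real_fourier_zero_imp_zero:
  fixes R :: "real \<Rightarrow> real"
  assumes R: "integrable lborel R" and z: "\<And>t. (LINT x|lborel. complex_of_real (R x) * iexp (t * x)) = 0"
  shows "AE x in lborel. R x = 0"
proof -
  define P where "P x = max 0 (R x)" for x
  define Q where "Q x = max 0 (- R x)" for x
  have P: "integrable lborel P" and Q: "integrable lborel Q" unfolding P_def Q_def using R by auto
  have [measurable]: "P \<in> \<B>" "Q \<in> \<B>" using P Q by auto
  have P0: "\<And>x. P x \<ge> 0" and Q0: "\<And>x. Q x \<ge> 0" unfolding P_def Q_def by auto
  have RPQ: "R x = P x - Q x" for x unfolding P_def Q_def by auto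
  have iP: "integrable lborel (\<lambda>x. complex_of_real (P x) * iexp (t * x))" and iQ: "integrable lborel (\<lambda>x. complex_of_real (Q x) * iexp (t * x))" for t
    using integrable_mult_cis[OF integrable_of_real[OF P], of "\<lambda>x. t * x"] integrable_mult_cis[OF integrable_of_real[OF Q], of "\<lambda>x. t * x"]
    by (simp_all add: cis_conv_exp)
  have eq: "(LINT x|lborel. complex_of_real (P x) * iexp (t * x)) = (LINT x|lborel. complex_of_real (Q x) * iexp (t * x))" for t
    using z[of t] Bochner_Integration.integral_diff[OF iP iQ, of t t] unfolding RPQ by (simp add: algebra_simps)
  define c where "c = (LINT x|lborel. P x)"
  have cQ: "c = (LINT x|lborel. Q x)"
  proof -
    have "complex_of_real c = complex_of_real (LINT x|lborel. Q x)"
      using eq[of 0] unfolding c_def by simp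
    then show ?thesis by (simp only: of_real_eq_iff)
  qed
  have c0: "c \<ge> 0" unfolding c_def by (intro integral_nonneg_AE) (auto simp: P0)
  show ?thesis
  proof (cases "c = 0")
    case True
    have "AE x in lborel. P x = 0" using True integral_nonneg_eq_0_iff_AE[OF P] P0 unfolding c_def by auto
    moreover have "AE x in lborel. Q x = 0" using True integral_nonneg_eq_0_iff_AE[OF Q] Q0 unfolding cQ by auto
    ultimately show ?thesis by eventually_elim (simp add: RPQ)
  next
    case False
    with c0 have c: "c > 0" by simp
    have dist: "real_distribution (density lborel (\<lambda>x. ennreal (P x / c)))"
      if P: "integrable lborel P" and P0: "\<And>x. P x \<ge> 0" and cP: "(LINT x|lborel. P x) = c" for P :: "real \<Rightarrow> real"
    proof -
      have "(\<integral>\<^sub>+x. ennreal (P x / c)) = ennreal (LINT x|lborel. P x / c)"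
        using P P0 c by (intro nn_integral_eq_integral) auto
      also have "\<dots> = 1" using cP c by simp
      finally have "prob_space (density lborel (\<lambda>x. ennreal (P x / c)))"
        using P by (intro prob_spaceI) (simp add: emeasure_density)
      then show ?thesis by (simp add: real_distribution_def real_distribution_axioms_def)
    qed
    have ch: "char (density lborel (\<lambda>x. ennreal (P x / c))) t = (LINT x|lborel. complex_of_real (P x) * iexp (t * x)) / c"
      if P: "integrable lborel P" and P0: "\<And>x. P x \<ge> 0" for P :: "real \<Rightarrow> real" and t
    proof -
      have [measurable]: "P \<in> \<B>" using P by simp
      have "char (density lborel (\<lambda>x. ennreal (P x / c))) t = (LINT x|lborel. (P x / c) *\<^sub>R iexp (t * x))"
        unfolding char_def using P0 c by (subst integral_density) auto
      also have "\<dots> = (LINT x|lborel. complex_of_real (P x) * iexp (t * x) / c)"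
        by (simp add: scaleR_conv_of_real)
      finally show ?thesis by simp
    qed
    have "density lborel (\<lambda>x. ennreal (P x / c)) = density lborel (\<lambda>x. ennreal (Q x / c))"
      by (rule Levy_uniqueness[OF dist[OF P P0 c_def[symmetric]] dist[OF Q Q0 cQ[symmetric]]])
        (intro ext, simp only: ch[OF P P0] ch[OF Q Q0] eq)
    then have "AE x in lborel. ennreal (P x / c) = ennreal (Q x / c)"
      by (intro sigma_finite_measure.density_unique[OF sigma_finite_lborel]) auto
    then show ?thesis
    proof eventually_elim
      case (elim x)
      then have "P x / c = Q x / c" using P0 Q0 c by (simp add: ennreal_inj)
      then show ?case using c by (simp add: RPQ)
    qed
  qed
qed

lemma complex_fourier_zero_imp_zero:
  fixes E :: "real \<Rightarrow> complex"
  assumes E: "integrable lborel E" and z: "\<And>t. (LINT x|lborel. E x * cis (t * x)) = 0"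
  shows "AE x in lborel. E x = 0"
proof -
  have i1: "integrable lborel (\<lambda>x. E x * cis (t * x))" for t by (rule integrable_mult_cis[OF E]) measurable
  have i2: "integrable lborel (\<lambda>x. cnj (E x) * cis (t * x))" for t
    by (rule integrable_mult_cis) (use E in auto)
  have z': "(LINT x|lborel. cnj (E x) * cis (t * x)) = 0" for t
  proof -
    have "(LINT x|lborel. cnj (E x) * cis (t * x)) = (LINT x|lborel. cnj (E x * cis (- t * x)))"
      by (intro LINT_cong refl) (simp add: cis_cnj)
    also have "\<dots> = cnj (LINT x|lborel. E x * cis (- t * x))" by (rule Bochner_Integration.integral_cnj)
    finally show ?thesis unfolding z by simp
  qed
  have "AE x in lborel. Re (E x) = 0"
  proof (rule real_fourier_zero_imp_zero[OF integrable_Re[OF E]])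
    fix t
    have "(LINT x|lborel. complex_of_real (Re (E x)) * iexp (t * x)) = (LINT x|lborel. (1/2) * (E x * cis (t * x) + cnj (E x) * cis (t * x)))"
    proof (intro LINT_cong refl)
      fix x
      have "complex_of_real (Re (E x)) = (1/2) * (E x + cnj (E x))" by (simp add: complex_eq_iff)
      then show "complex_of_real (Re (E x)) * iexp (t * x) = (1/2) * (E x * cis (t * x) + cnj (E x) * cis (t * x))"
        by (simp add: cis_conv_exp algebra_simps)
    qed
    also have "\<dots> = (1/2) * ((LINT x|lborel. E x * cis (t * x)) + (LINT x|lborel. cnj (E x) * cis (t * x)))"
      unfolding integral_mult_right_zero by (subst Bochner_Integration.integral_add[OF i1 i2]) simp
    finally show "(LINT x|lborel. complex_of_real (Re (E x)) * iexp (t * x)) = 0" unfolding z z' by simp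
  qed
  moreover have "AE x in lborel. Im (E x) = 0"
  proof (rule real_fourier_zero_imp_zero[OF integrable_Im[OF E]])
    fix t
    have "(LINT x|lborel. complex_of_real (Im (E x)) * iexp (t * x)) = (LINT x|lborel. (- \<i> / 2) * (E x * cis (t * x) - cnj (E x) * cis (t * x)))"
    proof (intro LINT_cong refl)
      fix x
      have "complex_of_real (Im (E x)) = (- \<i> / 2) * (E x - cnj (E x))" by (simp add: complex_eq_iff)
      then show "complex_of_real (Im (E x)) * iexp (t * x) = (- \<i> / 2) * (E x * cis (t * x) - cnj (E x) * cis (t * x))"
        unfolding cis_conv_exp by (simp only: mult.assoc left_diff_distrib)
    qed
    also have "\<dots> = (- \<i> / 2) * ((LINT x|lborel. E x * cis (t * x)) - (LINT x|lborel. cnj (E x) * cis (t * x)))"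
      unfolding integral_mult_right_zero by (subst Bochner_Integration.integral_diff[OF i1 i2]) simp
    finally show "(LINT x|lborel. complex_of_real (Im (E x)) * iexp (t * x)) = 0" unfolding z z' by simp
  qed
  ultimately show ?thesis by eventually_elim (simp add: complex_eq_iff)
qed

lemma schwartz_gaussian_translate: "schwartz (\<lambda>\<nu>::real. complex_of_real (gaussian 1 (\<nu> - c)))"
proof -
  have lin: "real_polynomial_function (\<lambda>\<nu>::real. \<nu> + (- c))"
    by (intro real_polynomial_function.intros bounded_linear_ident)
  have "real_polynomial_function (\<lambda>\<nu>::real. pi * ((\<nu> + (- c)) * (\<nu> + (- c))))"
    by (intro real_polynomial_function.intros(2,4) lin)
  moreover have "pi * ((\<nu> + (- c)) * (\<nu> + (- c))) \<ge> pi / 2 * (norm \<nu>)\<^sup>2 - pi * c\<^sup>2" for \<nu> :: real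
  proof -
    have "0 \<le> (\<nu> - 2 * c)\<^sup>2" by simp
    then have "\<nu>\<^sup>2 / 2 - c\<^sup>2 \<le> (\<nu> + (- c)) * (\<nu> + (- c))" by (simp add: power2_eq_square algebra_simps)
    then have "pi * (\<nu>\<^sup>2 / 2 - c\<^sup>2) \<le> pi * ((\<nu> + (- c)) * (\<nu> + (- c)))" by (intro mult_left_mono) auto
    then show ?thesis by (simp add: right_diff_distrib)
  qed
  ultimately have "schwartz (\<lambda>\<nu>. complex_of_real (1 * exp (- (pi * ((\<nu> + (- c)) * (\<nu> + (- c)))))))"
    by (intro schwartz_exp_polynomial[of "\<lambda>_. 1" _ "pi/2" "pi * c\<^sup>2"] real_polynomial_function.intros(2)) auto
  then show ?thesis by (simp add: gaussian_def power2_eq_square)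
qed

lemma fourier_gaussian_translate:
  "fourier (\<lambda>\<nu>::real. complex_of_real (gaussian 1 (\<nu> - c))) t = of_real (gaussian 1 t) * cis ((- 2 * pi * c) * t)"
proof -
  have "fourier (\<lambda>\<nu>::real. complex_of_real (gaussian 1 (\<nu> - c))) t = (LINT x|lborel. complex_of_real (gaussian 1 ((c + x) - c)) * cis (- 2 * pi * ((c + x) * t)))"
    unfolding fourier_eq_cis using integral_lborel_translation[of "\<lambda>x. complex_of_real (gaussian 1 (x - c)) * cis (- 2 * pi * (x * t))" c] by simp
  also have "\<dots> = (LINT x|lborel. cis ((- 2 * pi * c) * t) * (of_real (gaussian 1 x) * \<e> (x \<bullet> (- t))))"
  proof (intro LINT_cong refl)
    fix x :: real
    have "cis (- 2 * pi * ((c + x) * t)) = cis ((- 2 * pi * c) * t) * \<e> (x \<bullet> (- t))"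
      unfolding cis_mult by (simp add: algebra_simps)
    then show "complex_of_real (gaussian 1 ((c + x) - c)) * cis (- 2 * pi * ((c + x) * t)) = cis ((- 2 * pi * c) * t) * (of_real (gaussian 1 x) * \<e> (x \<bullet> (- t)))"
      by simp
  qed
  also have "\<dots> = cis ((- 2 * pi * c) * t) * of_real (gaussian 1 (- t))"
    unfolding integral_mult_right_zero gaussian_1_fourier ..
  finally show ?thesis by (simp add: gaussian_def)
qed

lemma has_distr_fourier_measurable:
  assumes "has_distr_fourier g G" shows "g \<in> \<B>"
proof -
  have "integrable lborel (\<lambda>t. g t * of_real (gaussian 1 (t - 0)))"
    using assms schwartz_gaussian_translate[of 0] unfolding has_distr_fourier_def by blast
  then have [measurable]: "(\<lambda>t. g t * of_real (gaussian 1 (t - 0))) \<in> \<B>" by auto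
  have "(\<lambda>t. (g t * of_real (gaussian 1 (t - 0))) * of_real (1 / gaussian 1 t)) \<in> \<B>" by measurable
  moreover have "(g t * of_real (gaussian 1 (t - 0))) * of_real (1 / gaussian 1 t) = g t" for t
  proof -
    have "complex_of_real (gaussian 1 t) \<noteq> 0" using gaussian_pos[of 1 t] by (metis less_irrefl of_real_eq_0_iff)
    then show ?thesis by simp
  qed
  ultimately show ?thesis by simp
qed

text \<open>Testing against translated Gaussians shows that \<open>g - g'\<close> times a Gaussian is an integrable function with
  vanishing Fourier transform.\<close>

theorem has_distr_fourier_unique:
  assumes g: "has_distr_fourier g G" and g': "has_distr_fourier g' G"
  shows "AE t in lborel. g t = g' t"
proof -
  define E where "E t = (g t - g' t) * of_real (gaussian 1 t)" for t
  have i: "integrable lborel (\<lambda>t. g t * of_real (gaussian 1 t))" "integrable lborel (\<lambda>t. g' t * of_real (gaussian 1 t))"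
  proof -
    have "schwartz (\<lambda>t::real. complex_of_real (gaussian 1 t))" using schwartz_gaussian_translate[of 0] by simp
    then show "integrable lborel (\<lambda>t. g t * of_real (gaussian 1 t))" "integrable lborel (\<lambda>t. g' t * of_real (gaussian 1 t))"
      using g g' unfolding has_distr_fourier_def by blast+
  qed
  have E: "integrable lborel E" unfolding E_def left_diff_distrib by (intro Bochner_Integration.integrable_diff i)
  have "(LINT t|lborel. E t * cis (s * t)) = 0" for s
  proof -
    define c where "c = - s / (2 * pi)"
    let ?psi = "\<lambda>\<nu>::real. complex_of_real (gaussian 1 (\<nu> - c))"
    have s: "- 2 * pi * c = s" unfolding c_def by simp
    have "(LINT t|lborel. g t * fourier ?psi t) = (LINT \<nu>|lborel. G \<nu> * ?psi \<nu>)"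
      using g schwartz_gaussian_translate[of c] unfolding has_distr_fourier_def by blast
    also have "\<dots> = (LINT t|lborel. g' t * fourier ?psi t)"
      using g' schwartz_gaussian_translate[of c] unfolding has_distr_fourier_def by simp
    finally have eq: "(LINT t|lborel. (g t * of_real (gaussian 1 t)) * cis (s * t)) = (LINT t|lborel. (g' t * of_real (gaussian 1 t)) * cis (s * t))"
      unfolding fourier_gaussian_translate s by (simp only: mult.assoc)
    have "(LINT t|lborel. E t * cis (s * t)) = (LINT t|lborel. (g t * of_real (gaussian 1 t)) * cis (s * t) - (g' t * of_real (gaussian 1 t)) * cis (s * t))"
      unfolding E_def by (simp only: left_diff_distrib)
    also have "\<dots> = (LINT t|lborel. (g t * of_real (gaussian 1 t)) * cis (s * t)) - (LINT t|lborel. (g' t * of_real (gaussian 1 t)) * cis (s * t))"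
      by (intro Bochner_Integration.integral_diff integrable_mult_cis i) measurable
    finally show ?thesis unfolding eq by simp
  qed
  from complex_fourier_zero_imp_zero[OF E this] show ?thesis
  proof eventually_elim
    case (elim t)
    have "complex_of_real (gaussian 1 t) \<noteq> 0" using gaussian_pos[of 1 t] by (metis less_irrefl of_real_eq_0_iff)
    then show ?case using elim by (simp add: E_def)
  qed
qed

lemma has_distr_fourier_ift:
  fixes G :: "real \<Rightarrow> complex"
  assumes G: "integrable lborel G"
  shows "has_distr_fourier (ift G) G"
  unfolding has_distr_fourier_def
proof (intro allI impI conjI)
  fix \<psi> :: "real \<Rightarrow> complex" assume psi: "schwartz \<psi>"
  have [measurable]: "G \<in> \<B>" "\<psi> \<in> \<B>" using G schwartz_measurable[OF psi] by auto
  obtain C where C: "\<And>x. norm (\<psi> x) \<le> C" using schwartz_bounded[OF psi] by blast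
  show "integrable lborel (\<lambda>\<nu>. G \<nu> * \<psi> \<nu>)" by (rule integrable_mult_bounded[OF G, where B=C]) (auto simp: C)
  have "integrable lborel (\<lambda>t. \<psi> t * ift G t)"
    by (rule integrable_mult_bounded[OF schwartz_integrable[OF psi] _ ift_bound[OF G]]) auto
  then show "integrable lborel (\<lambda>t. ift G t * \<psi> t)" by (simp only: mult.commute)
  show "(LINT t|lborel. ift G t * fourier \<psi> t) = (LINT \<nu>|lborel. G \<nu> * \<psi> \<nu>)"
    unfolding fourier_multiplication_formula[OF G schwartz_fourier_integrable[OF psi]] schwartz_inversion[OF psi] ..
qed

section \<open>The subordination formula\<close>

text \<open>The multiplier of \<open>- d/dt\<close>. The sign is the reason why the subordination formula below integrates over
  \<open>s > t\<close>.\<close>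

abbreviation frac_symbol :: "real \<Rightarrow> complex" where
  "frac_symbol \<nu> \<equiv> - 2 * of_real pi * \<i> * of_real \<nu>"

lemma frac_symbol_not_nonpos: "\<nu> \<noteq> 0 \<Longrightarrow> frac_symbol \<nu> \<notin> \<real>\<^sub>\<le>\<^sub>0"
  by (auto simp: complex_nonpos_Reals_iff)

lemma norm_frac_symbol_powr: "norm (frac_symbol \<nu> powr of_real b) = (2 * pi * \<bar>\<nu>\<bar>) powr b"
  by (subst norm_powr_real_powr') (auto simp: norm_mult)

lemma frac_symbol_powr_measurable [measurable]:
  assumes "b > 0" shows "(\<lambda>\<nu>. frac_symbol \<nu> powr of_real b) \<in> \<B>"
proof (rule borel_measurable_continuous_onI)
  show "continuous_on UNIV (\<lambda>\<nu>. frac_symbol \<nu> powr of_real b)"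
  proof (intro continuous_at_imp_continuous_on ballI, unfold isCont_def)
    fix \<nu> :: real
    show "((\<lambda>\<nu>. frac_symbol \<nu> powr of_real b) \<longlongrightarrow> frac_symbol \<nu> powr of_real b) (at \<nu>)"
      using assms frac_symbol_not_nonpos[of \<nu>] by (intro tendsto_powr_complex' tendsto_intros) auto
  qed
qed

lemma integrable_fourier_times_power:
  assumes sm: "\<And>k. k_smooth k UNIV h" and z: "\<And>t. t \<notin> {a..B} \<Longrightarrow> h t = 0"
    and [measurable]: "p \<in> \<B>" and p: "\<And>\<nu>. norm (p \<nu> :: complex) \<le> C * (1 + \<bar>\<nu>\<bar> ^ N)" "C \<ge> 0"
  shows "integrable lborel (\<lambda>\<nu>. p \<nu> * fourier h \<nu>)"
proof -
  have hc: "continuous_on UNIV h" using k_smooth_continuous[OF sm[of 0]] .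
  have hi: "integrable lborel h" by (rule integrable_compact_support[OF hc z])
  have [measurable]: "h \<in> \<B>" using hi by simp
  obtain C0 where C0: "\<And>\<nu>. norm (fourier h \<nu>) \<le> C0" using fourier_bounded[OF hi] by blast
  obtain C1 where C1: "\<And>\<nu>. \<bar>\<nu>\<bar> ^ 2 * norm (fourier h \<nu>) \<le> C1" using k_smooth_fourier_decay[OF sm z] by metis
  obtain C2 where C2: "\<And>\<nu>. \<bar>\<nu>\<bar> ^ N * norm (fourier h \<nu>) \<le> C2" using k_smooth_fourier_decay[OF sm z] by metis
  obtain C3 where C3: "\<And>\<nu>. \<bar>\<nu>\<bar> ^ (N + 2) * norm (fourier h \<nu>) \<le> C3" using k_smooth_fourier_decay[OF sm z] by metis
  show ?thesis
  proof (rule integrable_of_quad_weight)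
    fix \<nu> :: real
    have q: "quad_weight Basis \<nu> = 1 + \<bar>\<nu>\<bar> ^ 2" by (simp add: quad_weight_def)
    have "norm (p \<nu> * fourier h \<nu>) * quad_weight Basis \<nu> \<le> (C * (1 + \<bar>\<nu>\<bar> ^ N)) * norm (fourier h \<nu>) * (1 + \<bar>\<nu>\<bar> ^ 2)"
      unfolding q norm_mult by (intro mult_right_mono p) auto
    also have "\<dots> = C * (norm (fourier h \<nu>) + \<bar>\<nu>\<bar> ^ 2 * norm (fourier h \<nu>) + \<bar>\<nu>\<bar> ^ N * norm (fourier h \<nu>) + \<bar>\<nu>\<bar> ^ (N + 2) * norm (fourier h \<nu>))"
      by (simp add: algebra_simps power_add power2_eq_square)
    also have "\<dots> \<le> C * (C0 + C1 + C2 + C3)" by (intro mult_left_mono add_mono C0 C1 C2 C3 p(2))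
    finally show "norm (p \<nu> * fourier h \<nu>) * quad_weight Basis \<nu> \<le> C * (C0 + C1 + C2 + C3)" .
  qed measurable
qed

lemma ift_modulation: "ift (\<lambda>\<nu>. U \<nu> * \<e> (s * \<nu>)) x = ift U (x + s)" for x s :: real
  unfolding ift_def by (intro LINT_cong refl) (simp add: mult.assoc cis_mult algebra_simps)

lemma ift_gamma_kernel:
  assumes "g > 1" "e > 0"
  shows "ift (gamma_kernel g e) \<nu> = of_real (Gamma g) * (of_real e + frac_symbol \<nu>) powr (- of_real g)"
  using gamma_kernel_fourier[OF assms, of "- \<nu>"] unfolding fourier_eq_ift by simp

lemma norm_shifted_symbol_powr:
  assumes e: "e > 0" and nu: "\<nu> \<noteq> 0" and g: "g \<ge> 0"
  shows "norm ((of_real e + frac_symbol \<nu>) powr (- of_real g)) \<le> (2 * pi * \<bar>\<nu>\<bar>) powr (- g)"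
proof -
  have "norm ((of_real e + frac_symbol \<nu>) powr (- of_real g)) = norm (of_real e + frac_symbol \<nu>) powr (- g)"
    using norm_powr_real_powr'[of "of_real (- g)"] by simp
  also have "\<dots> \<le> (2 * pi * \<bar>\<nu>\<bar>) powr (- g)"
  proof (rule powr_mono2')
    have "\<bar>Im (of_real e + frac_symbol \<nu>)\<bar> \<le> norm (of_real e + frac_symbol \<nu>)" by (rule abs_Im_le_cmod)
    then show "2 * pi * \<bar>\<nu>\<bar> \<le> norm (of_real e + frac_symbol \<nu>)" by (simp add: abs_mult)
  qed (use nu g in auto)
  finally show ?thesis .
qed

lemma shifted_symbol_tendsto:
  assumes nu: "\<nu> \<noteq> 0"
  shows "(\<lambda>n. (of_real (1 / real (Suc n)) + frac_symbol \<nu>) powr (- of_real g)) \<longlonglongrightarrow> frac_symbol \<nu> powr (- of_real g)"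
proof (rule tendsto_powr_complex)
  have "(\<lambda>n. complex_of_real (1 / real (Suc n))) \<longlonglongrightarrow> of_real 0"
    by (intro tendsto_of_real LIMSEQ_Suc[OF lim_1_over_n])
  from tendsto_add[OF this tendsto_const[of "frac_symbol \<nu>"]]
  show "(\<lambda>n. of_real (1 / real (Suc n)) + frac_symbol \<nu>) \<longlonglongrightarrow> frac_symbol \<nu>" by simp
qed (use frac_symbol_not_nonpos[OF nu] in auto)

lemma shifted_symbol_measurable [measurable]:
  assumes "e > 0" shows "(\<lambda>\<nu>. (of_real e + frac_symbol \<nu>) powr b) \<in> \<B>"
proof (rule borel_measurable_continuous_onI)
  have n: "of_real e + frac_symbol \<nu> \<notin> \<real>\<^sub>\<le>\<^sub>0" for \<nu> using assms by (auto simp: complex_nonpos_Reals_iff)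
  show "continuous_on UNIV (\<lambda>\<nu>. (of_real e + frac_symbol \<nu>) powr b)"
  proof (intro continuous_at_imp_continuous_on ballI, unfold isCont_def)
    fix \<nu> :: real
    show "((\<lambda>\<nu>. (of_real e + frac_symbol \<nu>) powr b) \<longlongrightarrow> (of_real e + frac_symbol \<nu>) powr b) (at \<nu>)"
      by (rule tendsto_powr_complex[OF n]) (intro tendsto_intros)+
  qed
qed

context
  fixes h :: "real \<Rightarrow> complex" and a B \<beta> :: real
  assumes sm: "\<And>k. k_smooth k UNIV h" and zero: "\<And>t. t \<notin> {a..B} \<Longrightarrow> h t = 0" and beta: "\<beta> > 1"
begin

definition frac_transform :: "real \<Rightarrow> complex" where
  "frac_transform \<nu> = frac_symbol \<nu> powr of_real \<beta> * fourier h \<nu>"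

lemma h_integrable: "integrable lborel h"
  by (rule integrable_compact_support[OF k_smooth_continuous[OF sm[of 0]] zero])

lemma h_inversion: "ift (fourier h) t = h t"
proof -
  obtain C where "\<And>t. norm (h t) \<le> C" using bounded_compact_support[OF k_smooth_continuous[OF sm[of 0]] zero] by blast
  moreover have "integrable lborel (fourier h)"
    using integrable_fourier_times_power[OF sm zero, where p="\<lambda>_. 1" and C=1 and N=0] by simp
  ultimately show ?thesis by (intro fourier_inversion h_integrable k_smooth_continuous[OF sm[of 0]])
qed

lemma frac_transform_integrable: "integrable lborel frac_transform"
proof -
  define N where "N = nat \<lceil>\<beta>\<rceil>"
  have N: "\<beta> \<le> real N" unfolding N_def by linarith
  have "norm (frac_symbol \<nu> powr of_real \<beta>) \<le> (2 * pi) powr \<beta> * (1 + \<bar>\<nu>\<bar> ^ N)" for \<nu>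
  proof -
    have "\<bar>\<nu>\<bar> powr \<beta> \<le> 1 + \<bar>\<nu>\<bar> ^ N"
    proof (cases "\<bar>\<nu>\<bar> \<le> 1")
      case True
      then have "\<bar>\<nu>\<bar> powr \<beta> \<le> 1" using beta by (intro powr_le1) auto
      then show ?thesis by (simp add: add_increasing2)
    next
      case False
      then have "\<bar>\<nu>\<bar> powr \<beta> \<le> \<bar>\<nu>\<bar> powr real N" using N by (intro powr_mono) auto
      then show ?thesis using False by (simp add: powr_realpow)
    qed
    then show ?thesis unfolding norm_frac_symbol_powr by (simp add: powr_mult)
  qed
  then show ?thesis unfolding frac_transform_def[abs_def] using beta
    by (intro integrable_fourier_times_power[OF sm zero, where C="(2 * pi) powr \<beta>" and N=N] frac_symbol_powr_measurable) auto
qed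

text \<open>The fractional derivative does not extend the support to the right. Write \<open>\<beta> = N - g\<close>: an \<open>N\<close>-fold derivative
  \<open>k\<close> of \<open>h\<close> is supported to the left of \<open>B\<close>, and the negative power is the limit of transforms of Gamma
  kernels, that is of averages of \<open>k\<close> over \<open>[s, \<infinity>)\<close>.\<close>

lemma frac_inverse_zero:
  assumes s: "s \<ge> B"
  shows "ift frac_transform s = 0"
proof -
  \<comment> \<open>The summand 2 makes the order \<open>N - \<beta>\<close> of the remaining fractional integral exceed 1.\<close>
  define N where "N = nat \<lceil>\<beta>\<rceil> + 2"
  define g where "g = real N - \<beta>"
  have g: "g > 1" unfolding g_def N_def by linarith
  obtain k where k: "k_smooth 2 UNIV k" "\<And>t. t \<notin> {a..B} \<Longrightarrow> k t = 0" "\<And>\<nu>. fourier k \<nu> = (2 * of_real pi * \<i> * of_real \<nu>) ^ N * fourier h \<nu>"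
    using k_smooth_fourier_deriv[OF sm[of "N + 2"] zero] by blast
  have kc: "continuous_on UNIV k" by (rule k_smooth_continuous[OF k(1)])
  have ki: "integrable lborel k" by (rule integrable_compact_support[OF kc k(2)])
  have [measurable]: "fourier k \<in> \<B>" "fourier h \<in> \<B>" using ki h_integrable by auto
  have Fki: "integrable lborel (fourier k)"
    unfolding k(3)[abs_def]
  proof (rule integrable_fourier_times_power[OF sm zero, where C="(2 * pi) ^ N" and N=N])
    show "norm ((2 * complex_of_real pi * \<i> * complex_of_real \<nu>) ^ N) \<le> (2 * pi) ^ N * (1 + \<bar>\<nu>\<bar> ^ N)" for \<nu>
      by (simp add: norm_power norm_mult power_mult_distrib)
  qed auto
  obtain Ck where Ck: "\<And>t. norm (k t) \<le> Ck" using bounded_compact_support[OF kc k(2)] by blast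
  have kinv: "ift (fourier k) t = k t" for t by (rule fourier_inversion[OF ki kc Ck Fki])
  let ?e = "\<lambda>n. 1 / real (Suc n)"
  let ?I = "\<lambda>n. LINT \<nu>|lborel. (- 1) ^ N * fourier k \<nu> * (of_real (?e n) + frac_symbol \<nu>) powr (- of_real g) * \<e> (s * \<nu>)"
  have I0: "?I n = 0" for n
  proof -
    have e: "?e n > 0" by simp
    have kg: "integrable lborel (gamma_kernel g (?e n))" using g e by (intro gamma_kernel_integrable) auto
    have fm: "integrable lborel (\<lambda>\<nu>. fourier k \<nu> * \<e> (s * \<nu>))" by (rule integrable_mult_cis[OF Fki]) measurable
    have "of_real (Gamma g) * ?I n = (LINT \<nu>|lborel. (- 1) ^ N * ((fourier k \<nu> * \<e> (s * \<nu>)) * ift (gamma_kernel g (?e n)) \<nu>))"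
      unfolding ift_gamma_kernel[OF g e] integral_mult_right_zero[symmetric]
      by (intro LINT_cong refl) (simp only: mult_ac)
    also have "\<dots> = (- 1) ^ N * (LINT x|lborel. ift (\<lambda>\<nu>. fourier k \<nu> * \<e> (s * \<nu>)) x * gamma_kernel g (?e n) x)"
      unfolding integral_mult_right_zero fourier_multiplication_formula[OF fm kg] ..
    also have "\<dots> = (- 1) ^ N * (LINT x|(lborel::real measure). 0)"
    proof (intro arg_cong2[of _ _ _ _ "(*)"] refl LINT_cong)
      fix x :: real
      show "ift (\<lambda>\<nu>. fourier k \<nu> * \<e> (s * \<nu>)) x * gamma_kernel g (?e n) x = 0"
        unfolding ift_modulation kinv using k(2)[of "x + s"] s
        by (cases "x > 0") (auto simp: gamma_kernel_def pos_powr_nonpos)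
    qed
    finally have "of_real (Gamma g) * ?I n = 0" by simp
    moreover have "complex_of_real (Gamma g) \<noteq> 0" using g Gamma_real_pos[of g] by (simp add: less_imp_neq[symmetric])
    ultimately show ?thesis by (simp only: mult_eq_0_iff) auto
  qed
  have "?I \<longlonglongrightarrow> ift frac_transform s"
    unfolding ift_def
  proof (rule integral_dominated_convergence[where w="\<lambda>\<nu>. norm (frac_transform \<nu>)"])
    have ne0: "AE \<nu> in lborel. \<nu> \<noteq> (0::real)" using AE_lborel_singleton[of 0] .
    have sym: "(- 1) ^ N * (2 * complex_of_real pi * \<i> * complex_of_real \<nu>) ^ N = frac_symbol \<nu> ^ N" for \<nu>
      by (simp add: power_mult_distrib[symmetric])
    have split: "frac_symbol \<nu> ^ N * frac_symbol \<nu> powr (- of_real g) = frac_symbol \<nu> powr of_real \<beta>" if "\<nu> \<noteq> 0" for \<nu>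
    proof -
      have n0: "frac_symbol \<nu> \<noteq> 0" using that by simp
      have "frac_symbol \<nu> ^ N = frac_symbol \<nu> powr of_nat N" using n0 by (simp add: powr_nat')
      then have "frac_symbol \<nu> ^ N * frac_symbol \<nu> powr (- of_real g) = frac_symbol \<nu> powr (of_nat N + (- of_real g))"
        unfolding powr_add by simp
      also have "of_nat N + (- complex_of_real g) = of_real \<beta>" unfolding g_def by simp
      finally show ?thesis .
    qed
    show "AE \<nu> in lborel. (\<lambda>n. (- 1) ^ N * fourier k \<nu> * (of_real (?e n) + frac_symbol \<nu>) powr (- of_real g) * \<e> (s * \<nu>))
       \<longlonglongrightarrow> frac_transform \<nu> * \<e> (s \<bullet> \<nu>)"
      using ne0
    proof eventually_elim
      case (elim \<nu>)
      have "(\<lambda>n. (- 1) ^ N * fourier k \<nu> * (of_real (?e n) + frac_symbol \<nu>) powr (- of_real g) * \<e> (s * \<nu>))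
       \<longlonglongrightarrow> (- 1) ^ N * fourier k \<nu> * frac_symbol \<nu> powr (- of_real g) * \<e> (s * \<nu>)"
        by (intro tendsto_mult tendsto_const shifted_symbol_tendsto elim)
      also have "(- 1) ^ N * fourier k \<nu> * frac_symbol \<nu> powr (- of_real g) * \<e> (s * \<nu>) =
        ((- 1) ^ N * (2 * complex_of_real pi * \<i> * complex_of_real \<nu>) ^ N) * frac_symbol \<nu> powr (- of_real g) * fourier h \<nu> * \<e> (s * \<nu>)"
        unfolding k(3) by (simp only: mult_ac)
      also have "\<dots> = frac_transform \<nu> * \<e> (s \<bullet> \<nu>)"
        unfolding sym split[OF elim] frac_transform_def by simp
      finally show ?case .
    qed
    show "AE \<nu> in lborel. norm ((- 1) ^ N * fourier k \<nu> * (of_real (?e n) + frac_symbol \<nu>) powr (- of_real g) * \<e> (s * \<nu>)) \<le> norm (frac_transform \<nu>)" for n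
      using ne0
    proof eventually_elim
      case (elim \<nu>)
      have "norm ((- 1) ^ N * fourier k \<nu> * (of_real (?e n) + frac_symbol \<nu>) powr (- of_real g) * \<e> (s * \<nu>)) =
        norm (frac_symbol \<nu> ^ N) * norm (fourier h \<nu>) * norm ((of_real (?e n) + frac_symbol \<nu>) powr (- of_real g))"
        unfolding k(3) sym[symmetric] by (simp add: norm_mult)
      also have "\<dots> \<le> norm (frac_symbol \<nu> ^ N) * norm (fourier h \<nu>) * (2 * pi * \<bar>\<nu>\<bar>) powr (- g)"
        using elim g by (intro mult_left_mono norm_shifted_symbol_powr) auto
      also have "(2 * pi * \<bar>\<nu>\<bar>) powr (- g) = norm (frac_symbol \<nu> powr (- of_real g))"
        using norm_frac_symbol_powr[of \<nu> "- g"] by simp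
      also have "norm (frac_symbol \<nu> ^ N) * norm (fourier h \<nu>) * norm (frac_symbol \<nu> powr (- of_real g)) = norm (frac_transform \<nu>)"
        unfolding frac_transform_def split[OF elim, symmetric] norm_mult by (simp only: mult_ac)
      finally show ?case .
    qed
    show "integrable lborel (\<lambda>\<nu>. norm (frac_transform \<nu>))" using frac_transform_integrable by simp
    show "(\<lambda>\<nu>. frac_transform \<nu> * \<e> (s \<bullet> \<nu>)) \<in> borel_measurable lborel"
      using borel_measurable_integrable[OF frac_transform_integrable] by measurable
    show "(\<lambda>\<nu>. (- 1) ^ N * fourier k \<nu> * (of_real (?e n) + frac_symbol \<nu>) powr (- of_real g) * \<e> (s * \<nu>)) \<in> borel_measurable lborel" for n
      using shifted_symbol_measurable[of "?e n" "- of_real g"] by measurable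
  qed
  then show ?thesis unfolding I0 by (simp add: LIMSEQ_const_iff)
qed

text \<open>Fractional integration inverts the fractional derivative: the damped kernel \<open>gamma_kernel \<beta> e\<close> has transform
  \<open>Gamma \<beta>\<close> times a power of \<open>e + frac_symbol \<nu>\<close>, and as \<open>e\<close> tends to 0 this power cancels the one in
  \<open>frac_transform\<close>. On the other side the damping can be removed because the fractional derivative vanishes to
  the right of \<open>B\<close>.\<close>

lemma frac_inverse_subordination:
  "(LINT s|lborel. ift frac_transform s * of_real (pos_powr (\<beta> - 1) (s - t))) = of_real (Gamma \<beta>) * h t"
proof -
  note frac_transform_integrable[THEN borel_measurable_integrable, measurable]
  have [measurable]: "h \<in> \<B>" using h_integrable by simp
  let ?e = "\<lambda>n. 1 / real (Suc n)"
  let ?L = "\<lambda>n. LINT s|lborel. ift frac_transform s * gamma_kernel \<beta> (?e n) (s - t)"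
  have Leq: "?L n = (LINT \<nu>|lborel. of_real (Gamma \<beta>) * (frac_transform \<nu> * (of_real (?e n) + frac_symbol \<nu>) powr (- of_real \<beta>) * \<e> (t * \<nu>)))" for n
  proof -
    have e: "?e n > 0" by simp
    have gi: "integrable lborel (gamma_kernel \<beta> (?e n))" using beta by (intro gamma_kernel_integrable) auto
    have gt: "integrable lborel (\<lambda>s. gamma_kernel \<beta> (?e n) (s - t))"
      using integrable_lborel_translation[OF gi, of "- t"] by (simp add: algebra_simps)
    have "?L n = (LINT \<nu>|lborel. frac_transform \<nu> * ift (\<lambda>s. gamma_kernel \<beta> (?e n) (s - t)) \<nu>)"
      by (rule fourier_multiplication_formula[OF frac_transform_integrable gt])
    also have "\<dots> = (LINT \<nu>|lborel. of_real (Gamma \<beta>) * (frac_transform \<nu> * (of_real (?e n) + frac_symbol \<nu>) powr (- of_real \<beta>) * \<e> (t * \<nu>)))"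
    proof (intro LINT_cong refl)
      fix \<nu> :: real
      have "ift (\<lambda>s. gamma_kernel \<beta> (?e n) (s - t)) \<nu> = (LINT s|lborel. gamma_kernel \<beta> (?e n) ((t + s) - t) * \<e> (\<nu> \<bullet> (t + s)))"
        unfolding ift_def by (rule integral_lborel_translation[symmetric]) measurable
      also have "\<dots> = (LINT s|lborel. \<e> (t * \<nu>) * (gamma_kernel \<beta> (?e n) s * \<e> (\<nu> \<bullet> s)))"
      proof (intro LINT_cong refl)
        fix s
        have "\<e> (\<nu> \<bullet> (t + s)) = \<e> (t * \<nu>) * \<e> (\<nu> \<bullet> s)"
          unfolding cis_mult by (simp add: algebra_simps)
        then show "gamma_kernel \<beta> (?e n) ((t + s) - t) * \<e> (\<nu> \<bullet> (t + s)) = \<e> (t * \<nu>) * (gamma_kernel \<beta> (?e n) s * \<e> (\<nu> \<bullet> s))"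
          by simp
      qed
      also have "\<dots> = \<e> (t * \<nu>) * ift (gamma_kernel \<beta> (?e n)) \<nu>"
        unfolding ift_def by simp
      finally show "frac_transform \<nu> * ift (\<lambda>s. gamma_kernel \<beta> (?e n) (s - t)) \<nu> =
        of_real (Gamma \<beta>) * (frac_transform \<nu> * (of_real (?e n) + frac_symbol \<nu>) powr (- of_real \<beta>) * \<e> (t * \<nu>))"
        unfolding ift_gamma_kernel[OF beta e] by (simp only: mult_ac)
    qed
    finally show ?thesis .
  qed
  have ne0: "AE \<nu> in lborel. \<nu> \<noteq> (0::real)" using AE_lborel_singleton[of 0] .
  have inv: "frac_transform \<nu> * frac_symbol \<nu> powr (- of_real \<beta>) = fourier h \<nu>" if "\<nu> \<noteq> 0" for \<nu>
  proof -
    have "frac_symbol \<nu> powr of_real \<beta> * frac_symbol \<nu> powr (- of_real \<beta>) = frac_symbol \<nu> powr (of_real \<beta> + (- of_real \<beta>))"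
      by (rule powr_add[symmetric])
    also have "\<dots> = 1" using that by simp
    finally show ?thesis unfolding frac_transform_def by (metis (no_types, lifting) mult.commute mult.left_commute mult_1_right)
  qed
  have l1: "(\<lambda>n. LINT \<nu>|lborel. of_real (Gamma \<beta>) * (frac_transform \<nu> * (of_real (?e n) + frac_symbol \<nu>) powr (- of_real \<beta>) * \<e> (t * \<nu>)))
    \<longlonglongrightarrow> (LINT \<nu>|lborel. of_real (Gamma \<beta>) * (fourier h \<nu> * \<e> (t * \<nu>)))"
  proof (rule integral_dominated_convergence[where w="\<lambda>\<nu>. norm (of_real (Gamma \<beta>) * fourier h \<nu>)"])
    show "AE \<nu> in lborel. (\<lambda>n. of_real (Gamma \<beta>) * (frac_transform \<nu> * (of_real (?e n) + frac_symbol \<nu>) powr (- of_real \<beta>) * \<e> (t * \<nu>)))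
      \<longlonglongrightarrow> of_real (Gamma \<beta>) * (fourier h \<nu> * \<e> (t * \<nu>))"
      using ne0
    proof eventually_elim
      case (elim \<nu>)
      show ?case unfolding inv[OF elim, symmetric]
        by (intro tendsto_mult tendsto_const shifted_symbol_tendsto elim)
    qed
    show "AE \<nu> in lborel. norm (of_real (Gamma \<beta>) * (frac_transform \<nu> * (of_real (?e n) + frac_symbol \<nu>) powr (- of_real \<beta>) * \<e> (t * \<nu>)))
      \<le> norm (of_real (Gamma \<beta>) * fourier h \<nu>)" for n
      using ne0
    proof eventually_elim
      case (elim \<nu>)
      have "norm ((of_real (?e n) + frac_symbol \<nu>) powr (- of_real \<beta>)) \<le> norm (frac_symbol \<nu> powr (- of_real \<beta>))"
        using norm_shifted_symbol_powr[of "?e n" \<nu> \<beta>] norm_frac_symbol_powr[of \<nu> "- \<beta>"] elim beta by simp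
      then have "norm (frac_transform \<nu>) * norm ((of_real (?e n) + frac_symbol \<nu>) powr (- of_real \<beta>)) \<le> norm (frac_transform \<nu>) * norm (frac_symbol \<nu> powr (- of_real \<beta>))"
        by (intro mult_left_mono) auto
      also have "\<dots> = norm (fourier h \<nu>)" unfolding norm_mult[symmetric] inv[OF elim] ..
      finally have "norm (complex_of_real (Gamma \<beta>)) * (norm (frac_transform \<nu>) * norm ((of_real (?e n) + frac_symbol \<nu>) powr (- of_real \<beta>))) \<le> norm (complex_of_real (Gamma \<beta>)) * norm (fourier h \<nu>)"
        by (intro mult_left_mono) auto
      then show ?case by (simp only: norm_mult norm_cis mult_1_right)
    qed
    have Fhi: "integrable lborel (fourier h)"
      using integrable_fourier_times_power[OF sm zero, where p="\<lambda>_. 1" and C=1 and N=0] by simp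
    then show "integrable lborel (\<lambda>\<nu>. norm (of_real (Gamma \<beta>) * fourier h \<nu>))" by (intro integrable_norm integrable_mult_right)
    show "(\<lambda>\<nu>. of_real (Gamma \<beta>) * (frac_transform \<nu> * (of_real (?e n) + frac_symbol \<nu>) powr (- of_real \<beta>) * \<e> (t * \<nu>))) \<in> borel_measurable lborel" for n
      using shifted_symbol_measurable[of "?e n" "- of_real \<beta>"] by measurable
    show "(\<lambda>\<nu>. of_real (Gamma \<beta>) * (fourier h \<nu> * \<e> (t * \<nu>))) \<in> borel_measurable lborel" by measurable
  qed
  have R: "(LINT \<nu>|lborel. of_real (Gamma \<beta>) * (fourier h \<nu> * \<e> (t * \<nu>))) = of_real (Gamma \<beta>) * h t"
    unfolding integral_mult_right_zero using h_inversion[of t] unfolding ift_def by simp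
  define Cb where "Cb = (LINT \<nu>|lborel. norm (frac_transform \<nu>))"
  have Cb: "norm (ift frac_transform s) \<le> Cb" for s unfolding Cb_def by (rule ift_bound[OF frac_transform_integrable])
  have dom: "norm (ift frac_transform s) * pos_powr (\<beta> - 1) (s - t) \<le> indicator {t..B} s * (Cb * (B - t) powr (\<beta> - 1))" for s
  proof (cases "t < s \<and> s < B")
    case True
    then have "pos_powr (\<beta> - 1) (s - t) \<le> (B - t) powr (\<beta> - 1)" using beta by (simp add: pos_powr_pos powr_mono2)
    then have "norm (ift frac_transform s) * pos_powr (\<beta> - 1) (s - t) \<le> Cb * (B - t) powr (\<beta> - 1)"
      using order_trans[OF norm_ge_zero Cb] by (intro mult_mono Cb) auto
    then show ?thesis using True by simp
  next
    case False
    then have "norm (ift frac_transform s) * pos_powr (\<beta> - 1) (s - t) = 0"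
      using frac_inverse_zero[of s] by (cases "t < s") (auto simp: pos_powr_nonpos)
    moreover have "0 \<le> indicator {t..B} s * (Cb * (B - t) powr (\<beta> - 1))"
      using order_trans[OF norm_ge_zero Cb] by (intro mult_nonneg_nonneg) auto
    ultimately show ?thesis by linarith
  qed
  have l2: "?L \<longlonglongrightarrow> (LINT s|lborel. ift frac_transform s * of_real (pos_powr (\<beta> - 1) (s - t)))"
  proof (rule integral_dominated_convergence[where w="\<lambda>s. indicator {t..B} s * (Cb * (B - t) powr (\<beta> - 1))"])
    show "AE s in lborel. (\<lambda>n. ift frac_transform s * gamma_kernel \<beta> (?e n) (s - t)) \<longlonglongrightarrow> ift frac_transform s * of_real (pos_powr (\<beta> - 1) (s - t))"
    proof (intro AE_I2 tendsto_mult tendsto_const)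
      fix s
      have "(\<lambda>n. pos_powr (\<beta> - 1) (s - t) * exp (- (?e n * (s - t)))) \<longlonglongrightarrow> pos_powr (\<beta> - 1) (s - t) * exp (- (0 * (s - t)))"
        by (intro tendsto_intros LIMSEQ_Suc[OF lim_1_over_n])
      then have "(\<lambda>n. pos_powr (\<beta> - 1) (s - t) * exp (- (?e n * (s - t)))) \<longlonglongrightarrow> pos_powr (\<beta> - 1) (s - t)" by simp
      then show "(\<lambda>n. gamma_kernel \<beta> (?e n) (s - t)) \<longlonglongrightarrow> of_real (pos_powr (\<beta> - 1) (s - t))"
        unfolding gamma_kernel_def by (rule tendsto_of_real)
    qed
    show "AE s in lborel. norm (ift frac_transform s * gamma_kernel \<beta> (?e n) (s - t)) \<le> indicator {t..B} s * (Cb * (B - t) powr (\<beta> - 1))" for n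
    proof (intro AE_I2)
      fix s
      have "norm (gamma_kernel \<beta> (?e n) (s - t)) \<le> pos_powr (\<beta> - 1) (s - t)"
      proof (cases "s > t")
        case True
        then have "pos_powr (\<beta> - 1) (s - t) * exp (- (?e n * (s - t))) \<le> pos_powr (\<beta> - 1) (s - t) * 1" by (intro mult_left_mono) auto
        then show ?thesis unfolding gamma_kernel_def norm_of_real by simp
      next
        case False then show ?thesis by (simp add: gamma_kernel_def pos_powr_nonpos)
      qed
      then have "norm (ift frac_transform s) * norm (gamma_kernel \<beta> (?e n) (s - t)) \<le> norm (ift frac_transform s) * pos_powr (\<beta> - 1) (s - t)"
        by (intro mult_left_mono) auto
      then show "norm (ift frac_transform s * gamma_kernel \<beta> (?e n) (s - t)) \<le> indicator {t..B} s * (Cb * (B - t) powr (\<beta> - 1))"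
        unfolding norm_mult using dom[of s] by linarith
    qed
    show "integrable lborel (\<lambda>s. indicator {t..B} s * (Cb * (B - t) powr (\<beta> - 1)))"
      by (intro integrable_mult_left integrable_real_indicator) (auto simp: emeasure_lborel_Icc_eq)
  qed measurable
  show ?thesis using LIMSEQ_unique[OF l2] l1 unfolding Leq R by blast
qed

text \<open>By uniqueness the choice made in \<open>frac_deriv\<close> is almost everywhere the continuous representative.\<close>

theorem frac_deriv_subordination:
  shows "frac_deriv \<beta> h \<in> \<B>"
    and "(LINT s|lborel. frac_deriv \<beta> h s * of_real (pos_powr (\<beta> - 1) (s - t))) = of_real (Gamma \<beta>) * h t"
proof -
  have ex: "has_distr_fourier (ift frac_transform) frac_transform"
    by (rule has_distr_fourier_ift[OF frac_transform_integrable])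
  have fd: "has_distr_fourier (frac_deriv \<beta> h) frac_transform"
    unfolding frac_deriv_def frac_transform_def[abs_def, symmetric] by (rule someI[of "\<lambda>g. has_distr_fourier g frac_transform", OF ex])
  show m: "frac_deriv \<beta> h \<in> \<B>" by (rule has_distr_fourier_measurable[OF fd])
  note m[measurable] frac_transform_integrable[THEN borel_measurable_integrable, measurable]
  have "AE s in lborel. frac_deriv \<beta> h s = ift frac_transform s" by (rule has_distr_fourier_unique[OF fd ex])
  then have "(LINT s|lborel. frac_deriv \<beta> h s * of_real (pos_powr (\<beta> - 1) (s - t))) = (LINT s|lborel. ift frac_transform s * of_real (pos_powr (\<beta> - 1) (s - t)))"
    by (intro integral_cong_AE) (auto elim!: eventually_mono)
  then show "(LINT s|lborel. frac_deriv \<beta> h s * of_real (pos_powr (\<beta> - 1) (s - t))) = of_real (Gamma \<beta>) * h t"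
    unfolding frac_inverse_subordination .
qed

end

section \<open>Density of Schwartz functions in \<open>L\<^sup>2\<close>\<close>

definition nrm2 :: "('a::euclidean_space \<Rightarrow> complex) \<Rightarrow> ennreal" where
  "nrm2 f = (\<integral>\<^sub>+x. nsq (f x))"

lemma nrm2_add_le:
  assumes [measurable]: "f \<in> \<B>" "g \<in> \<B>"
  shows "nrm2 (\<lambda>x. f x + g x) \<le> 2 * nrm2 f + 2 * nrm2 g"
proof -
  have "nrm2 (\<lambda>x. f x + g x) \<le> (\<integral>\<^sub>+x. 2 * nsq (f x) + 2 * nsq (g x))"
    unfolding nrm2_def
  proof (intro nn_integral_mono)
    fix x
    have "nsq (f x + g x) \<le> ennreal (2 * (norm (f x))\<^sup>2 + 2 * (norm (g x))\<^sup>2)"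
      by (rule ennreal_leI[OF norm_add_squared_le])
    then show "nsq (f x + g x) \<le> 2 * nsq (f x) + 2 * nsq (g x)"
      by (simp add: ennreal_mult)
  qed
  also have "\<dots> = 2 * nrm2 f + 2 * nrm2 g" unfolding nrm2_def by (simp add: nn_integral_add nn_integral_cmult)
  finally show ?thesis .
qed

lemma nrm2_cmult:
  assumes [measurable]: "f \<in> \<B>"
  shows "nrm2 (\<lambda>x. c * f x) = nsq c * nrm2 f"
  unfolding nrm2_def by (simp add: norm_mult power_mult_distrib ennreal_mult nn_integral_cmult)

text \<open>The class of functions that can be approximated is closed under sums, multiples and limits; it is enlarged from
  boxes to measurable sets, to simple functions and to all square-integrable functions.\<close>

definition schwartz_approx :: "('a::euclidean_space \<Rightarrow> complex) \<Rightarrow> bool" where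
  "schwartz_approx f \<longleftrightarrow> f \<in> \<B> \<and> (\<forall>e>0. \<exists>s. schwartz s \<and> nrm2 (\<lambda>x. f x - s x) < ennreal e)"

lemma schwartz_approx_add:
  assumes f: "schwartz_approx f" and g: "schwartz_approx g"
  shows "schwartz_approx (\<lambda>x. f x + g x)"
  unfolding schwartz_approx_def
proof (intro conjI allI impI)
  have m[measurable]: "f \<in> \<B>" "g \<in> \<B>" using f g by (auto simp: schwartz_approx_def)
  show "(\<lambda>x. f x + g x) \<in> \<B>" by measurable
  fix e :: real assume e: "e > 0"
  obtain s where s: "schwartz s" "nrm2 (\<lambda>x. f x - s x) < ennreal (e / 4)" using f e unfolding schwartz_approx_def by (metis divide_pos_pos zero_less_numeral)
  obtain t where t: "schwartz t" "nrm2 (\<lambda>x. g x - t x) < ennreal (e / 4)" using g e unfolding schwartz_approx_def by (metis divide_pos_pos zero_less_numeral)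
  note [measurable] = schwartz_measurable[OF s(1)] schwartz_measurable[OF t(1)]
  have "nrm2 (\<lambda>x. (f x + g x) - (s x + t x)) = nrm2 (\<lambda>x. (f x - s x) + (g x - t x))" by (simp add: algebra_simps)
  also have "\<dots> \<le> 2 * nrm2 (\<lambda>x. f x - s x) + 2 * nrm2 (\<lambda>x. g x - t x)" by (rule nrm2_add_le) measurable
  also have "\<dots> < 2 * ennreal (e/4) + 2 * ennreal (e/4)"
    by (intro add_strict_mono ennreal_mult_strict_left_mono s t) auto
  also have "\<dots> = ennreal e" using e by (simp add: ennreal_mult[symmetric] ennreal_plus[symmetric] ennreal_numeral[symmetric] del: ennreal_plus ennreal_numeral)
  finally show "\<exists>s. schwartz s \<and> nrm2 (\<lambda>x. (f x + g x) - s x) < ennreal e"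
    using schwartz_add[OF s(1) t(1)] by blast
qed

lemma schwartz_approx_limit:
  assumes f[measurable]: "f \<in> \<B>"
    and u: "\<And>n. schwartz_approx (u n)" and l: "(\<lambda>n. nrm2 (\<lambda>x. f x - u n x)) \<longlonglongrightarrow> 0"
  shows "schwartz_approx f"
  unfolding schwartz_approx_def
proof (intro conjI allI impI f)
  fix e :: real assume e: "e > 0"
  have "\<forall>\<^sub>F n in sequentially. nrm2 (\<lambda>x. f x - u n x) < ennreal (e / 4)"
    using l e by (intro order_tendstoD(2)) auto
  then obtain n where n: "nrm2 (\<lambda>x. f x - u n x) < ennreal (e / 4)" by (auto simp: eventually_sequentially)
  have [measurable]: "u n \<in> \<B>" using u[of n] by (auto simp: schwartz_approx_def)
  obtain s where s: "schwartz s" "nrm2 (\<lambda>x. u n x - s x) < ennreal (e / 4)" using u[of n] e unfolding schwartz_approx_def by (metis divide_pos_pos zero_less_numeral)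
  note [measurable] = schwartz_measurable[OF s(1)]
  have "nrm2 (\<lambda>x. f x - s x) = nrm2 (\<lambda>x. (f x - u n x) + (u n x - s x))" by simp
  also have "\<dots> \<le> 2 * nrm2 (\<lambda>x. f x - u n x) + 2 * nrm2 (\<lambda>x. u n x - s x)" by (rule nrm2_add_le) measurable
  also have "\<dots> < 2 * ennreal (e/4) + 2 * ennreal (e/4)"
    by (intro add_strict_mono ennreal_mult_strict_left_mono s n) auto
  also have "\<dots> = ennreal e" using e by (simp add: ennreal_mult[symmetric] ennreal_plus[symmetric] ennreal_numeral[symmetric] del: ennreal_plus ennreal_numeral)
  finally show "\<exists>s. schwartz s \<and> nrm2 (\<lambda>x. f x - s x) < ennreal e" using s(1) by blast
qed

lemma schwartz_approx_cmult:
  assumes f: "schwartz_approx f"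
  shows "schwartz_approx (\<lambda>x. c * f x)"
  unfolding schwartz_approx_def
proof (intro conjI allI impI)
  have [measurable]: "f \<in> \<B>" using f by (auto simp: schwartz_approx_def)
  show "(\<lambda>x. c * f x) \<in> \<B>" by measurable
  fix e :: real assume e: "e > 0"
  define K where "K = (norm c)\<^sup>2 + 1"
  have K: "K > 0" unfolding K_def by (simp add: add_nonneg_pos)
  obtain s where s: "schwartz s" "nrm2 (\<lambda>x. f x - s x) < ennreal (e / K)" using f e K unfolding schwartz_approx_def by (meson divide_pos_pos)
  note [measurable] = schwartz_measurable[OF s(1)]
  have "nrm2 (\<lambda>x. c * f x - c * s x) = nsq c * nrm2 (\<lambda>x. f x - s x)"
    by (subst nrm2_cmult[symmetric]) (auto simp: algebra_simps)
  also have "\<dots> \<le> ennreal K * nrm2 (\<lambda>x. f x - s x)" unfolding K_def by (intro mult_right_mono ennreal_leI) auto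
  also have "\<dots> < ennreal K * ennreal (e / K)" using s K by (intro ennreal_mult_strict_left_mono) auto
  also have "\<dots> = ennreal e" using e K by (simp add: ennreal_mult[symmetric])
  finally show "\<exists>s. schwartz s \<and> nrm2 (\<lambda>x. c * f x - s x) < ennreal e" using schwartz_cmult[OF s(1)] by blast
qed

lemma schwartz_approx_schwartz: assumes "schwartz s" shows "schwartz_approx s"
  unfolding schwartz_approx_def using assms schwartz_measurable[OF assms] by (auto intro!: exI[of _ s] simp: nrm2_def)

lemma schwartz_approx_zero: "schwartz_approx (\<lambda>_. 0)"
proof -
  have "real_polynomial_function (\<lambda>x::'a. \<Sum>b\<in>Basis. (x \<bullet> b) * (x \<bullet> b))"
    by (intro real_polynomial_function_sum real_polynomial_function.intros bounded_linear_inner_left) auto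
  moreover have "(\<Sum>b\<in>Basis. (x \<bullet> b) * (x \<bullet> b)) \<ge> 1 * (norm x)\<^sup>2 - 0" for x :: 'a
    by (subst power2_norm_eq_inner, subst euclidean_inner) simp
  ultimately have "schwartz (\<lambda>x::'a. complex_of_real (1 * exp (- (\<Sum>b\<in>Basis. (x \<bullet> b) * (x \<bullet> b)))))"
    by (intro schwartz_exp_polynomial[of "\<lambda>_. 1" _ 1 0] real_polynomial_function.intros(2)) auto
  from schwartz_approx_schwartz[OF schwartz_cmult[OF this, of 0]] show ?thesis by simp
qed

lemma schwartz_approx_sum: "finite S \<Longrightarrow> (\<And>i. i \<in> S \<Longrightarrow> schwartz_approx (f i)) \<Longrightarrow> schwartz_approx (\<lambda>x. \<Sum>i\<in>S. f i x)"
  by (induction S rule: finite_induct) (auto intro: schwartz_approx_zero schwartz_approx_add)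

lemma nrm2_dominated_convergence:
  assumes [measurable]: "f \<in> \<B>" "\<And>n. u n \<in> \<B>" "w \<in> \<B>"
    and w: "(\<integral>\<^sub>+x. ennreal (w x)) < \<infinity>"
    and dom: "\<And>n. AE x in lborel. (norm (f x - u n x))\<^sup>2 \<le> w x"
    and lim: "AE x in lborel. (\<lambda>n. u n x) \<longlonglongrightarrow> f x"
  shows "(\<lambda>n. nrm2 (\<lambda>x. f x - u n x)) \<longlonglongrightarrow> 0"
proof -
  have "(\<lambda>n. \<integral>\<^sub>+x. nsq (f x - u n x)) \<longlonglongrightarrow> (\<integral>\<^sub>+(x::'a). 0)"
  proof (rule nn_integral_dominated_convergence[where w="\<lambda>x. ennreal (w x)"])
    show "AE x in lborel. nsq (f x - u n x) \<le> ennreal (w x)" for n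
      using dom[of n] by eventually_elim (rule ennreal_leI)
    show "AE x in lborel. (\<lambda>n. nsq (f x - u n x)) \<longlonglongrightarrow> 0"
      using lim
    proof eventually_elim
      case (elim x)
      have "(\<lambda>n. nsq (f x - u n x)) \<longlonglongrightarrow> nsq (f x - f x)"
        by (intro tendsto_ennrealI tendsto_power tendsto_norm tendsto_diff tendsto_const elim)
      then show ?case by simp
    qed
  qed (use w in auto)
  then show ?thesis unfolding nrm2_def by simp
qed

text \<open>A sum of large even powers tends to 0 inside the box and to infinity outside, so \<open>exp (- box_bump c r n x)\<close>
  tends to the indicator of the box with centre \<open>c\<close> and half side lengths \<open>r \<bullet> b\<close>.\<close>

definition box_bump :: "'a::euclidean_space \<Rightarrow> 'a \<Rightarrow> nat \<Rightarrow> 'a \<Rightarrow> real" where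
  "box_bump c r n x = (\<Sum>b\<in>Basis. ((x \<bullet> b - c \<bullet> b) * (1 / (r \<bullet> b))) ^ (2 * Suc n))"

lemma power_ge_quadratic: "(y::real) ^ (2 * Suc n) \<ge> y\<^sup>2 - 1"
proof (cases "y\<^sup>2 \<le> 1")
  case True then show ?thesis by (metis diff_ge_0_iff_ge diff_le_0_iff_le dual_order.trans even_mult_iff even_numeral zero_le_even_power)
next
  case False
  then have "(y\<^sup>2) ^ 1 \<le> (y\<^sup>2) ^ Suc n" by (intro power_increasing) auto
  moreover have "y ^ (2 * Suc n) = (y\<^sup>2) ^ Suc n" by (rule power_mult)
  ultimately show ?thesis by simp
qed

lemma box_bump_lower:
  assumes r: "\<And>b. b \<in> Basis \<Longrightarrow> r \<bullet> b > 0"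
  obtains k K where "k > 0" "\<And>n x. box_bump c r n x \<ge> k * (norm (x::'a::euclidean_space))\<^sup>2 - K"
proof -
  define R where "R = Max ((\<lambda>b. r \<bullet> b) ` Basis)"
  have R: "r \<bullet> b \<le> R" if "b \<in> Basis" for b unfolding R_def using that by (intro Max_ge) auto
  obtain b0 :: 'a where b0: "b0 \<in> Basis" using nonempty_Basis by blast
  have R0: "R > 0" using r[OF b0] R[OF b0] by linarith
  define k where "k = 1 / (2 * R\<^sup>2)"
  define K where "K = (\<Sum>b\<in>Basis. (c \<bullet> b)\<^sup>2 / R\<^sup>2 + 1)"
  have "box_bump c r n x \<ge> k * (norm x)\<^sup>2 - K" for n and x :: 'a
  proof -
    have "k * (norm x)\<^sup>2 - K = (\<Sum>b\<in>Basis. k * (x \<bullet> b)\<^sup>2 - ((c \<bullet> b)\<^sup>2 / R\<^sup>2 + 1))"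
      unfolding K_def sum_subtractf sum_distrib_left[symmetric]
      by (subst power2_norm_eq_inner, subst euclidean_inner) (simp add: power2_eq_square)
    also have "\<dots> \<le> box_bump c r n x"
      unfolding box_bump_def
    proof (rule sum_mono)
      fix b :: 'a assume b: "b \<in> Basis"
      let ?y = "(x \<bullet> b - c \<bullet> b) * (1 / (r \<bullet> b))"
      have "(x \<bullet> b)\<^sup>2 \<le> 2 * (x \<bullet> b - c \<bullet> b)\<^sup>2 + 2 * (c \<bullet> b)\<^sup>2"
        using zero_le_power2[of "x \<bullet> b - 2 * (c \<bullet> b)"] by (simp add: power2_eq_square algebra_simps)
      then have "k * (x \<bullet> b)\<^sup>2 \<le> k * (2 * (x \<bullet> b - c \<bullet> b)\<^sup>2 + 2 * (c \<bullet> b)\<^sup>2)"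
        using R0 unfolding k_def by (intro mult_left_mono) auto
      also have "\<dots> = (x \<bullet> b - c \<bullet> b)\<^sup>2 / R\<^sup>2 + (c \<bullet> b)\<^sup>2 / R\<^sup>2" unfolding k_def using R0 by (simp add: field_simps)
      also have "(x \<bullet> b - c \<bullet> b)\<^sup>2 / R\<^sup>2 \<le> (x \<bullet> b - c \<bullet> b)\<^sup>2 / (r \<bullet> b)\<^sup>2"
        using r[OF b] R[OF b] by (intro divide_left_mono power_mono) auto
      also have "(x \<bullet> b - c \<bullet> b)\<^sup>2 / (r \<bullet> b)\<^sup>2 = ?y\<^sup>2" by (simp add: power_divide power_mult_distrib)
      finally have "k * (x \<bullet> b)\<^sup>2 - ((c \<bullet> b)\<^sup>2 / R\<^sup>2 + 1) \<le> ?y\<^sup>2 - 1" by simp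
      also have "\<dots> \<le> ?y ^ (2 * Suc n)" by (rule power_ge_quadratic)
      finally show "k * (x \<bullet> b)\<^sup>2 - ((c \<bullet> b)\<^sup>2 / R\<^sup>2 + 1) \<le> ?y ^ (2 * Suc n)" .
    qed
    finally show ?thesis .
  qed
  moreover have "k > 0" using R0 by (simp add: k_def)
  ultimately show thesis using that by blast
qed

lemma box_bump_schwartz:
  fixes c r :: "'a::euclidean_space"
  assumes r: "\<And>b. b \<in> Basis \<Longrightarrow> r \<bullet> b > 0"
  shows "schwartz (\<lambda>x. complex_of_real (exp (- box_bump c r n x)))"
proof -
  obtain k K where kK: "k > 0" "\<And>n x. box_bump c r n x \<ge> k * (norm x)\<^sup>2 - K" using box_bump_lower[OF r] by blast
  have "real_polynomial_function (\<lambda>x. ((x \<bullet> b + - (c \<bullet> b)) * (1 / (r \<bullet> b))) ^ (2 * Suc n))" for b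
    by (intro real_polynomial_function_power real_polynomial_function.intros bounded_linear_inner_left)
  then have "real_polynomial_function (box_bump c r n)"
    unfolding box_bump_def[abs_def] by (intro real_polynomial_function_sum) auto
  from schwartz_exp_polynomial[of "\<lambda>_. 1", OF real_polynomial_function.intros(2) this kK]
  show ?thesis by simp
qed

lemma box_bump_tendsto:
  fixes c r :: "'a::euclidean_space"
  assumes r: "\<And>b. b \<in> Basis \<Longrightarrow> r \<bullet> b > 0" and ne: "\<And>b. b \<in> Basis \<Longrightarrow> \<bar>x \<bullet> b - c \<bullet> b\<bar> \<noteq> r \<bullet> b"
  shows "(\<lambda>n. exp (- box_bump c r n x)) \<longlonglongrightarrow> indicator (box (c - r) (c + r)) x"
proof -
  let ?y = "\<lambda>b. (x \<bullet> b - c \<bullet> b) * (1 / (r \<bullet> b))"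
  have y: "\<bar>?y b\<bar> < 1 \<longleftrightarrow> \<bar>x \<bullet> b - c \<bullet> b\<bar> < r \<bullet> b" "\<bar>?y b\<bar> \<noteq> 1" if "b \<in> Basis" for b
    using r[OF that] ne[OF that] by (auto simp: abs_mult field_simps)
  show ?thesis
  proof (cases "x \<in> box (c - r) (c + r)")
    case True
    then have "\<bar>?y b\<bar> < 1" if "b \<in> Basis" for b
      using that y(1)[OF that] by (auto simp: mem_box inner_diff_left inner_add_left abs_less_iff dest!: bspec[OF _ that])
    then have "(\<lambda>n. ((?y b)\<^sup>2) ^ Suc n) \<longlonglongrightarrow> 0" if "b \<in> Basis" for b
      using that by (intro LIMSEQ_Suc LIMSEQ_power_zero) (auto simp: abs_square_less_1)
    then have "(\<lambda>n. \<Sum>b\<in>Basis. ((?y b)\<^sup>2) ^ Suc n) \<longlonglongrightarrow> (\<Sum>b\<in>(Basis::'a set). 0)"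
      by (intro tendsto_sum) auto
    then have "(\<lambda>n. box_bump c r n x) \<longlonglongrightarrow> 0"
      unfolding box_bump_def power_mult by simp
    then have "(\<lambda>n. exp (- box_bump c r n x)) \<longlonglongrightarrow> exp (- 0)" by (intro tendsto_exp tendsto_minus)
    then show ?thesis using True by simp
  next
    case False
    then obtain b where b: "b \<in> Basis" "\<not> (\<bar>x \<bullet> b - c \<bullet> b\<bar> < r \<bullet> b)"
      by (auto simp: mem_box inner_diff_left inner_add_left abs_less_iff)
    then have "\<bar>?y b\<bar> > 1" using y[OF b(1)] by linarith
    then have gt: "(?y b)\<^sup>2 > 1" by (metis abs_ge_zero less_1_mult power2_abs power2_eq_square)
    have "filterlim (\<lambda>n. ((?y b)\<^sup>2) ^ Suc n) at_top sequentially"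
    proof (rule filterlim_at_infinity_imp_filterlim_at_top)
      show "filterlim (\<lambda>n. ((?y b)\<^sup>2) ^ Suc n) at_infinity sequentially"
        by (rule filterlim_compose[OF filterlim_realpow_sequentially_gt1 filterlim_Suc]) (use gt in simp)
      show "\<forall>\<^sub>F n in sequentially. 0 < ((?y b)\<^sup>2) ^ Suc n" by (rule always_eventually, rule allI, rule zero_less_power) (use gt in linarith)
    qed
    moreover have "((?y b)\<^sup>2) ^ Suc n \<le> box_bump c r n x" for n
      unfolding box_bump_def power_mult using b(1) by (intro member_le_sum) auto
    ultimately have "filterlim (\<lambda>n. box_bump c r n x) at_top sequentially"
      by (elim filterlim_at_top_mono) auto
    then have "(\<lambda>n. exp (- box_bump c r n x)) \<longlonglongrightarrow> 0"
      by (intro filterlim_compose[OF exp_at_bot]) (simp add: filterlim_uminus_at_bot)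
    then show ?thesis using False by simp
  qed
qed

lemma schwartz_approx_box:
  fixes l u :: "'a::euclidean_space"
  shows "schwartz_approx (\<lambda>x. indicator (box l u) x)"
proof (cases "box l u = {}")
  case True then show ?thesis using schwartz_approx_zero by simp
next
  case False
  then have lu: "\<And>b. b \<in> Basis \<Longrightarrow> l \<bullet> b < u \<bullet> b" by (simp add: box_ne_empty)
  define c where "c = (1/2) *\<^sub>R (l + u)"
  define r where "r = (1/2) *\<^sub>R (u - l)"
  have r: "\<And>b. b \<in> Basis \<Longrightarrow> r \<bullet> b > 0" using lu by (simp add: r_def inner_diff_left)
  have box: "box (c - r) (c + r) = box l u"
    unfolding c_def r_def by (simp add: algebra_simps scaleR_add_left[symmetric])
  obtain k K where kK: "k > 0" "\<And>n x. box_bump c r n x \<ge> k * (norm x)\<^sup>2 - K" using box_bump_lower[OF r] by blast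
  let ?u = "\<lambda>n x. complex_of_real (exp (- box_bump c r n x))"
  \<comment> \<open>Dominates the squared difference for all \<open>n\<close> at once, by \<open>box_bump_lower\<close>.\<close>
  let ?w = "\<lambda>x::'a. 2 * indicator (box l u) x + 2 * (exp K)\<^sup>2 * gaussian (2 * k / pi) x :: real"
  show ?thesis
  proof (rule schwartz_approx_limit[of _ ?u])
    show "schwartz_approx (?u n)" for n by (intro schwartz_approx_schwartz box_bump_schwartz r)
    show "(\<lambda>n. nrm2 (\<lambda>x. indicator (box l u) x - ?u n x)) \<longlonglongrightarrow> 0"
    proof (rule nrm2_dominated_convergence[where w="?w"])
      show "?u n \<in> \<B>" for n by (intro schwartz_measurable box_bump_schwartz r)
      show "(\<integral>\<^sub>+x. ennreal (?w x)) < \<infinity>"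
      proof -
        have "integrable lborel (\<lambda>x::'a. gaussian (2 * k / pi) x)"
          using integrable_Re[OF gaussian_fourier(1)[of "2 * k / pi", where 'a='a]] kK by simp
        moreover have "integrable lborel (\<lambda>x. indicator (box l u) x :: real)"
          by (intro integrable_real_indicator) (auto simp: emeasure_lborel_box_eq)
        ultimately have "integrable lborel ?w" by (intro Bochner_Integration.integrable_add integrable_mult_right)
        from nn_integral_norm_finite[OF this] show ?thesis
          by (simp add: abs_of_nonneg)
      qed
      show "AE x in lborel. (norm (indicator (box l u) x - ?u n x))\<^sup>2 \<le> ?w x" for n
      proof (intro AE_I2)
        fix x :: 'a
        have "exp (- box_bump c r n x) \<le> exp (K - k * (norm x)\<^sup>2)" using kK(2)[of x n] by simp
        then have "(exp (- box_bump c r n x))\<^sup>2 \<le> (exp (K - k * (norm x)\<^sup>2))\<^sup>2" by (intro power_mono) auto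
        also have "\<dots> = (exp K)\<^sup>2 * gaussian (2 * k / pi) x"
        proof -
          have "gaussian (2 * k / pi) x = exp (- (2 * (k * (norm x)\<^sup>2)))" by (simp add: gaussian_def)
          then show ?thesis by (simp add: exp_double[symmetric] exp_add[symmetric] right_diff_distrib)
        qed
        finally have 1: "(exp (- box_bump c r n x))\<^sup>2 \<le> (exp K)\<^sup>2 * gaussian (2 * k / pi) x" .
        have "(norm (indicator (box l u) x - ?u n x))\<^sup>2 \<le> 2 * (norm (indicator (box l u) x :: complex))\<^sup>2 + 2 * (norm (- ?u n x))\<^sup>2"
          using norm_add_squared_le[of "indicator (box l u) x" "- ?u n x"] by simp
        also have "(norm (indicator (box l u) x :: complex))\<^sup>2 = indicator (box l u) x" by (simp add: indicator_def)
        also have "(norm (- ?u n x))\<^sup>2 = (exp (- box_bump c r n x))\<^sup>2" by simp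
        finally show "(norm (indicator (box l u) x - ?u n x))\<^sup>2 \<le> ?w x" using 1 by simp
      qed
      have "AE x in lborel. x \<bullet> b \<noteq> t" if "b \<in> Basis" for b :: 'a and t
      proof -
        have "{x. x \<bullet> b = t} \<in> null_sets lborel"
          using negligible_standard_hyperplane[OF that, of t] by (simp add: negligible_iff_null_sets null_sets_completion_iff)
        then show ?thesis by (rule AE_I') auto
      qed note hyper = this
      have "AE x in lborel. \<forall>b\<in>Basis. x \<bullet> b \<noteq> c \<bullet> b + r \<bullet> b \<and> x \<bullet> b \<noteq> c \<bullet> b - r \<bullet> b"
        by (intro AE_finite_allI) (auto intro: hyper)
      then show "AE x in lborel. (\<lambda>n. ?u n x) \<longlonglongrightarrow> indicator (box l u) x"
      proof eventually_elim
        case (elim x)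
        have "\<bar>x \<bullet> b - c \<bullet> b\<bar> \<noteq> r \<bullet> b" if "b \<in> Basis" for b
          using elim that by (auto simp: abs_if split: if_splits)
        then have "(\<lambda>n. exp (- box_bump c r n x)) \<longlonglongrightarrow> indicator (box l u) x"
          using box_bump_tendsto[OF r, of x c] unfolding box by blast
        then have "(\<lambda>n. ?u n x) \<longlonglongrightarrow> of_real (indicator (box l u) x)" by (rule tendsto_of_real)
        then show ?case by (simp only: of_real_indicator)
      qed
    qed auto
  qed auto
qed

text \<open>Induction over the sigma-algebra generated by the boxes, an intersection-stable family. Intersecting with a fixed
  box keeps all measures finite.\<close>

lemma schwartz_approx_indicator_in_box:
  fixes A :: "'a::euclidean_space set"
  assumes A: "A \<in> sets borel"
  shows "schwartz_approx (\<lambda>x. indicator (A \<inter> box l u) x)"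
proof -
  let ?G = "range (\<lambda>(a, b). box a b :: 'a set)"
  have A: "A \<in> sigma_sets UNIV ?G" using A unfolding borel_eq_box by simp
  have sub: "sigma_sets UNIV ?G = sets borel" unfolding borel_eq_box by simp
  have st: "Int_stable ?G"
  proof (rule Int_stableI)
    fix X Y assume "X \<in> ?G" "Y \<in> ?G"
    then obtain a b c d where "X = box a b" "Y = box c d" by auto
    then have "X \<inter> Y = box (\<Sum>i\<in>Basis. max (a \<bullet> i) (c \<bullet> i) *\<^sub>R i) (\<Sum>i\<in>Basis. min (b \<bullet> i) (d \<bullet> i) *\<^sub>R i)"
      by (simp only: box_Int_box)
    then show "X \<inter> Y \<in> ?G" by auto
  qed
  show ?thesis
  proof (rule sigma_sets_induct_disjoint[OF st _ A, where P="\<lambda>A. schwartz_approx (\<lambda>x. indicator (A \<inter> box l u) x)"], goal_cases sub basic empty compl union)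
    case sub show ?case by simp
  next
    case (basic X)
    then obtain Y where "X \<inter> box l u = Y" "Y \<in> ?G" using st unfolding Int_stable_def by (metis (mono_tags, lifting) case_prod_conv rangeI)
    then show ?case using schwartz_approx_box by auto
  next
    case empty then show ?case using schwartz_approx_zero by simp
  next
    case (compl X)
    have "(\<lambda>x. indicator ((UNIV - X) \<inter> box l u) x :: complex) = (\<lambda>x. indicator (box l u) x + (-1) * indicator (X \<inter> box l u) x)"
      by (auto simp: indicator_def fun_eq_iff)
    then show ?case using schwartz_approx_add[OF schwartz_approx_box schwartz_approx_cmult[OF compl(2)], of l u "-1"] by simp
  next
    case (union X)
    have Xm[measurable]: "X i \<in> sets borel" for i using union(2) sub by auto
    let ?u = "\<lambda>n x. \<Sum>i<n. indicator (X i \<inter> box l u) x :: complex"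
    have u: "?u n x = indicator ((\<Union>i<n. X i) \<inter> box l u) x" for n x
    proof -
      have "disjoint_family_on (\<lambda>i. X i \<inter> box l u) {..<n}" using union(1) unfolding disjoint_family_on_def by blast
      then have "indicator (\<Union>i<n. X i \<inter> box l u) x = ?u n x" by (intro indicator_UN_disjoint) auto
      moreover have "(\<Union>i<n. X i \<inter> box l u) = (\<Union>i<n. X i) \<inter> box l u" by blast
      ultimately show ?thesis by simp
    qed
    show ?case
    proof (rule schwartz_approx_limit[of _ ?u])
      show "schwartz_approx (?u n)" for n using union(3) by (intro schwartz_approx_sum) auto
      show "(\<lambda>x. indicator (\<Union> (range X) \<inter> box l u) x :: complex) \<in> \<B>" by measurable
      show "(\<lambda>n. nrm2 (\<lambda>x. indicator (\<Union> (range X) \<inter> box l u) x - ?u n x)) \<longlonglongrightarrow> 0"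
      proof (rule nrm2_dominated_convergence[where w="indicator (box l u)"])
        show "(\<integral>\<^sub>+x. ennreal (indicator (box l u) x)) < \<infinity>"
          by (simp add: ennreal_indicator emeasure_lborel_box_eq)
        show "AE x in lborel. (norm (indicator (\<Union> (range X) \<inter> box l u) x - ?u n x))\<^sup>2 \<le> indicator (box l u) x" for n
          unfolding u by (intro AE_I2) (auto simp: indicator_def)
        show "AE x in lborel. (\<lambda>n. ?u n x) \<longlonglongrightarrow> indicator (\<Union> (range X) \<inter> box l u) x"
        proof (intro AE_I2)
          fix x
          show "(\<lambda>n. ?u n x) \<longlonglongrightarrow> indicator (\<Union> (range X) \<inter> box l u) x"
          proof (cases "x \<in> \<Union> (range X) \<inter> box l u")
            case True
            then obtain i where i: "x \<in> X i" "x \<in> box l u" by auto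
            have "\<forall>\<^sub>F n in sequentially. ?u n x = 1"
              using eventually_gt_at_top[of i] unfolding u by eventually_elim (use i in \<open>auto simp: indicator_def\<close>)
            then show ?thesis using True by (simp add: tendsto_eventually)
          next
            case False
            then have "?u n x = 0" for n unfolding u by (auto simp: indicator_def)
            then show ?thesis using False by simp
          qed
        qed
      qed (unfold u, auto)
    qed
  qed
qed

lemma schwartz_approx_indicator:
  fixes A :: "'a::euclidean_space set"
  assumes A[measurable]: "A \<in> sets borel" and fin: "emeasure lborel A < \<infinity>"
  shows "schwartz_approx (\<lambda>x. indicator A x)"
proof (rule schwartz_approx_limit)
  let ?b = "\<lambda>n. box (- real n *\<^sub>R One) (real n *\<^sub>R One) :: 'a set"
  show "schwartz_approx (\<lambda>x. indicator (A \<inter> ?b n) x)" for n by (rule schwartz_approx_indicator_in_box[OF A])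
  show "(\<lambda>n. nrm2 (\<lambda>x. indicator A x - indicator (A \<inter> ?b n) x)) \<longlonglongrightarrow> 0"
  proof (rule nrm2_dominated_convergence[where w="indicator A"])
    show "(\<integral>\<^sub>+x. ennreal (indicator A x)) < \<infinity>" using fin by (simp add: ennreal_indicator)
    show "AE x in lborel. (norm (indicator A x - indicator (A \<inter> ?b n) x :: complex))\<^sup>2 \<le> indicator A x" for n
      by (intro AE_I2) (auto simp: indicator_def)
    show "AE x in lborel. (\<lambda>n. indicator (A \<inter> ?b n) x :: complex) \<longlonglongrightarrow> indicator A x"
    proof (intro AE_I2)
      fix x :: 'a
      have "x \<in> (\<Union>i::nat. box (- (real i *\<^sub>R One)) (real i *\<^sub>R One))" unfolding UN_box_eq_UNIV by simp
      then obtain N where N: "x \<in> ?b N" by auto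
      have "\<forall>\<^sub>F n in sequentially. (indicator (A \<inter> ?b n) x :: complex) = indicator A x"
        using eventually_ge_at_top[of N]
      proof eventually_elim
        case (elim n)
        have "x \<in> ?b n" using N elim by (auto simp: mem_box)
        then show ?case by (simp add: indicator_def)
      qed
      then show "(\<lambda>n. indicator (A \<inter> ?b n) x :: complex) \<longlonglongrightarrow> indicator A x" by (rule tendsto_eventually)
    qed
  qed auto
qed auto

theorem schwartz_dense:
  fixes f :: "'a::euclidean_space \<Rightarrow> complex"
  assumes f[measurable]: "f \<in> \<B>" and fin: "nrm2 f < \<infinity>"
  shows "schwartz_approx f"
proof -
  obtain s where s: "\<And>i. simple_function borel (s i)" "\<And>x. (\<lambda>i. s i x) \<longlonglongrightarrow> f x" "\<And>i x. norm (s i x) \<le> 2 * norm (f x)"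
    using borel_measurable_implies_sequence_metric[OF f, of 0] by (auto simp: dist_norm)
  have sm[measurable]: "s i \<in> \<B>" for i using s(1) by (rule borel_measurable_simple_function)
  have sa: "schwartz_approx (s i)" for i
  proof -
    have fr: "finite (range (s i))" using simple_functionD(1)[OF s(1)[of i]] by simp
    have rep: "s i = (\<lambda>x. \<Sum>y\<in>range (s i) - {0}. y * indicator (s i -` {y}) x)"
    proof
      fix x
      have "(\<Sum>y\<in>range (s i) - {0}. y * indicator (s i -` {y}) x) = (\<Sum>y\<in>range (s i) - {0}. if y = s i x then y else 0)"
        by (intro sum.cong refl) (auto simp: indicator_def)
      also have "\<dots> = s i x" using fr by (subst sum.delta) auto
      finally show "s i x = (\<Sum>y\<in>range (s i) - {0}. y * indicator (s i -` {y}) x)" by simp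
    qed
    have "schwartz_approx (\<lambda>x. \<Sum>y\<in>range (s i) - {0}. y * indicator (s i -` {y}) x)"
    proof (intro schwartz_approx_sum schwartz_approx_cmult schwartz_approx_indicator)
      show "finite (range (s i) - {0})" using fr by simp
      fix y assume y: "y \<in> range (s i) - {0}"
      have m: "s i -` {y} \<inter> space borel \<in> sets borel" by measurable
      then show A: "s i -` {y} \<in> sets borel" by simp
      show "emeasure lborel (s i -` {y}) < \<infinity>"
      proof -
        have "ennreal ((norm y)\<^sup>2 / 4) * emeasure lborel (s i -` {y}) = (\<integral>\<^sub>+x. ennreal ((norm y)\<^sup>2 / 4) * indicator (s i -` {y}) x)"
          using A by (subst nn_integral_cmult_indicator) auto
        also have "\<dots> \<le> nrm2 f"
          unfolding nrm2_def
        proof (intro nn_integral_mono)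
          fix x
          show "ennreal ((norm y)\<^sup>2 / 4) * indicator (s i -` {y}) x \<le> nsq (f x)"
          proof (cases "s i x = y")
            case True
            then have "norm y \<le> 2 * norm (f x)" using s(3)[of i x] by simp
            then have "(norm y)\<^sup>2 \<le> (2 * norm (f x))\<^sup>2" by (intro power_mono) auto
            then have "(norm y)\<^sup>2 / 4 \<le> (norm (f x))\<^sup>2" by (simp add: power_mult_distrib)
            then show ?thesis using True by (simp add: ennreal_leI)
          qed simp
        qed
        finally have le: "ennreal ((norm y)\<^sup>2 / 4) * emeasure lborel (s i -` {y}) < \<infinity>" using fin by (rule le_less_trans)
        have "ennreal ((norm y)\<^sup>2 / 4) \<noteq> 0" using y by (simp add: ennreal_eq_0_iff)
        then show ?thesis using le by (auto simp: ennreal_mult_less_top)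
      qed
    qed
    then show ?thesis unfolding rep[symmetric] .
  qed
  show ?thesis
  proof (rule schwartz_approx_limit[OF f sa])
    show "(\<lambda>n. nrm2 (\<lambda>x. f x - s n x)) \<longlonglongrightarrow> 0"
    proof (rule nrm2_dominated_convergence[where w="\<lambda>x. 9 * (norm (f x))\<^sup>2"])
      have "(\<integral>\<^sub>+x. ennreal (9 * (norm (f x))\<^sup>2)) = ennreal 9 * nrm2 f"
        unfolding nrm2_def by (simp add: ennreal_mult nn_integral_cmult)
      then show "(\<integral>\<^sub>+x. ennreal (9 * (norm (f x))\<^sup>2)) < \<infinity>" using fin by (simp add: ennreal_mult_less_top)
      show "AE x in lborel. (norm (f x - s n x))\<^sup>2 \<le> 9 * (norm (f x))\<^sup>2" for n
      proof (intro AE_I2)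
        fix x
        have "norm (f x - s n x) \<le> 3 * norm (f x)" using norm_triangle_ineq4[of "f x" "s n x"] s(3)[of n x] by simp
        then have "(norm (f x - s n x))\<^sup>2 \<le> (3 * norm (f x))\<^sup>2" by (intro power_mono) auto
        then show "(norm (f x - s n x))\<^sup>2 \<le> 9 * (norm (f x))\<^sup>2" by (simp add: power_mult_distrib)
      qed
    qed (use s(2) in auto)
  qed
qed

section \<open>Extension from Schwartz functions\<close>

lemma L2_fun_iff: "L2_fun f \<longleftrightarrow> f \<in> \<B> \<and> nrm2 f < \<infinity>"
  unfolding L2_fun_def nrm2_def integrable_iff_bounded by auto

lemma nrm2_eq: assumes "L2_fun f" shows "nrm2 f = ennreal ((L2_norm f)\<^sup>2)"
proof -
  have "nrm2 f = ennreal (LINT x|lborel. (norm (f x))\<^sup>2)"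
    unfolding nrm2_def using assms unfolding L2_fun_def by (intro nn_integral_eq_integral) auto
  moreover have "0 \<le> (LINT x|lborel. (norm (f x))\<^sup>2)" by (intro integral_nonneg_AE) auto
  ultimately show ?thesis unfolding L2_norm_def by simp
qed

lemma L2_fun_schwartz: "schwartz f \<Longrightarrow> L2_fun f"
  unfolding L2_fun_def using schwartz_L2 schwartz_measurable by auto

lemma nrm2_minus_commute: "nrm2 (\<lambda>x. f x - g x) = nrm2 (\<lambda>x. g x - f x)"
  unfolding nrm2_def by (simp add: norm_minus_commute)

lemma L2_fun_add: assumes "L2_fun f" "L2_fun g" shows "L2_fun (\<lambda>x. f x + g x)"
proof -
  have [measurable]: "f \<in> \<B>" "g \<in> \<B>" using assms by (auto simp: L2_fun_iff)
  have "nrm2 (\<lambda>x. f x + g x) \<le> 2 * nrm2 f + 2 * nrm2 g" by (rule nrm2_add_le) measurable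
  also have "\<dots> < \<infinity>" using assms by (simp add: L2_fun_iff ennreal_mult_less_top)
  finally show ?thesis by (simp add: L2_fun_iff)
qed

lemma L2_fun_cmult: assumes "L2_fun f" shows "L2_fun (\<lambda>x. c * f x)"
proof -
  have [measurable]: "f \<in> \<B>" using assms by (auto simp: L2_fun_iff)
  show ?thesis using assms by (simp add: L2_fun_iff nrm2_cmult ennreal_mult_less_top)
qed

text \<open>The rate \<open>(1/4) ^ k\<close> makes the errors in \<open>L\<^sup>1\<close> of order \<open>(1/2) ^ k\<close>, hence summable, and so gives
  convergence almost everywhere without passing to subsequences.\<close>

definition approx_seq :: "('a::euclidean_space \<Rightarrow> complex) \<Rightarrow> nat \<Rightarrow> 'a \<Rightarrow> complex" where
  "approx_seq f = (SOME a. \<forall>k. schwartz (a k) \<and> nrm2 (\<lambda>x. f x - a k x) \<le> ennreal ((1/4) ^ k))"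

lemma approx_seq:
  assumes "L2_fun f"
  shows "schwartz (approx_seq f k)" "nrm2 (\<lambda>x. f x - approx_seq f k x) \<le> ennreal ((1/4) ^ k)"
proof -
  have "\<exists>s. schwartz s \<and> nrm2 (\<lambda>x. f x - s x) \<le> ennreal ((1/4) ^ k)" for k
    using schwartz_dense[of f] assms unfolding L2_fun_iff schwartz_approx_def
    by (meson less_imp_le zero_less_power divide_pos_pos zero_less_one zero_less_numeral)
  then have "\<exists>a. \<forall>k. schwartz (a k) \<and> nrm2 (\<lambda>x. f x - a k x) \<le> ennreal ((1/4) ^ k)" by metis
  from someI_ex[OF this] show "schwartz (approx_seq f k)" "nrm2 (\<lambda>x. f x - approx_seq f k x) \<le> ennreal ((1/4) ^ k)"
    unfolding approx_seq_def[symmetric] by auto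
qed

lemma nrm2_add_bounds:
  assumes "f \<in> \<B>" "g \<in> \<B>" "nrm2 f \<le> ennreal a" "nrm2 g \<le> ennreal b" "a \<ge> 0" "b \<ge> 0"
  shows "nrm2 (\<lambda>x. f x + g x) \<le> ennreal (2 * a + 2 * b)"
proof -
  have "nrm2 (\<lambda>x. f x + g x) \<le> 2 * nrm2 f + 2 * nrm2 g" by (rule nrm2_add_le[OF assms(1,2)])
  also have "\<dots> \<le> 2 * ennreal a + 2 * ennreal b" by (intro add_mono mult_left_mono assms) auto
  also have "\<dots> = ennreal (2 * a + 2 * b)" using assms by (simp add: ennreal_mult)
  finally show ?thesis .
qed

lemma approx_seq_nrm2:
  assumes f: "L2_fun f"
  shows "nrm2 (approx_seq f k) \<le> ennreal (2 * (L2_norm f)\<^sup>2 + 2 * (1/4) ^ k)"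
proof -
  have [measurable]: "f \<in> \<B>" "approx_seq f k \<in> \<B>"
    using f approx_seq(1)[OF f] by (auto simp: L2_fun_iff intro: schwartz_measurable)
  have "nrm2 (\<lambda>x. f x + (approx_seq f k x - f x)) \<le> ennreal (2 * (L2_norm f)\<^sup>2 + 2 * (1/4) ^ k)"
    using approx_seq(2)[OF f, of k] nrm2_eq[OF f] nrm2_minus_commute[of f "approx_seq f k"] by (intro nrm2_add_bounds) auto
  then show ?thesis by simp
qed

text \<open>What the extension argument needs to know about an operator. A sublinear operator has no extension by
  continuity as a linear one has, but sublinearity and homogeneity bound the difference of two values by the
  operator applied to a difference.\<close>

locale schwartz_sublinear =
  fixes S :: "('a::euclidean_space \<Rightarrow> complex) \<Rightarrow> ('a \<Rightarrow> complex) \<Rightarrow> 'a \<Rightarrow> ennreal" and K :: real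
  assumes meas: "\<And>f g. schwartz f \<Longrightarrow> schwartz g \<Longrightarrow> S f g \<in> \<B>"
    and fin: "\<And>f g x. schwartz f \<Longrightarrow> schwartz g \<Longrightarrow> S f g x < \<infinity>"
    and sub1: "\<And>f f' g x. schwartz f \<Longrightarrow> schwartz f' \<Longrightarrow> schwartz g \<Longrightarrow> S (\<lambda>y. f y + f' y) g x \<le> S f g x + S f' g x"
    and sub2: "\<And>f f' g x. schwartz f \<Longrightarrow> schwartz f' \<Longrightarrow> schwartz g \<Longrightarrow> S g (\<lambda>y. f y + f' y) x \<le> S g f x + S g f' x"
    and hom1: "\<And>c f g x. schwartz f \<Longrightarrow> schwartz g \<Longrightarrow> S (\<lambda>y. c * f y) g x = enorm c * S f g x"
    and hom2: "\<And>c f g x. schwartz f \<Longrightarrow> schwartz g \<Longrightarrow> S f (\<lambda>y. c * g y) x = enorm c * S f g x"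
    and K: "K \<ge> 0"
    and bound: "\<And>f g. schwartz f \<Longrightarrow> schwartz g \<Longrightarrow> (\<integral>\<^sub>+x. S f g x)\<^sup>2 \<le> ennreal K * (nrm2 f * nrm2 g)"
begin

lemma swapped: "schwartz_sublinear (\<lambda>f g. S g f) K"
proof (unfold_locales, goal_cases)
  case (8 f g)
  then show ?case using bound[of g f] by (simp add: mult.commute)
qed (rule meas fin sub1 sub2 hom1 hom2 K; assumption)+

definition R :: "('a \<Rightarrow> complex) \<Rightarrow> ('a \<Rightarrow> complex) \<Rightarrow> 'a \<Rightarrow> real" where
  "R f g x = enn2real (S f g x)"

lemma R: "schwartz f \<Longrightarrow> schwartz g \<Longrightarrow> S f g x = ennreal (R f g x)"
  unfolding R_def using fin[of f g x] by simp

lemma R_nonneg [simp]: "R f g x \<ge> 0" by (simp add: R_def)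

lemma R_measurable: "schwartz f \<Longrightarrow> schwartz g \<Longrightarrow> R f g \<in> \<B>"
  unfolding R_def[abs_def] using meas by simp

lemma R_sub1: assumes "schwartz f" "schwartz f'" "schwartz g" shows "R (\<lambda>y. f y + f' y) g x \<le> R f g x + R f' g x"
  using sub1[OF assms, of x] assms by (simp add: R schwartz_add ennreal_plus[symmetric] del: ennreal_plus)

lemma R_sub2: assumes "schwartz f" "schwartz f'" "schwartz g" shows "R g (\<lambda>y. f y + f' y) x \<le> R g f x + R g f' x"
  using sub2[OF assms, of x] assms by (simp add: R schwartz_add ennreal_plus[symmetric] del: ennreal_plus)

lemma R_hom1: assumes "schwartz f" "schwartz g" shows "R (\<lambda>y. c * f y) g x = norm c * R f g x"
  unfolding R_def hom1[OF assms] by (simp add: enn2real_mult)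

lemma R_hom2: assumes "schwartz f" "schwartz g" shows "R f (\<lambda>y. c * g y) x = norm c * R f g x"
  unfolding R_def hom2[OF assms] by (simp add: enn2real_mult)

lemma R_diff1:
  assumes "schwartz f" "schwartz f'" "schwartz g"
  shows "\<bar>R f g x - R f' g x\<bar> \<le> R (\<lambda>y. f y - f' y) g x"
proof -
  have 1: "R f g x \<le> R (\<lambda>y. f y - f' y) g x + R f' g x"
    using R_sub1[OF schwartz_diff[OF assms(1,2)] assms(2,3), of x] by simp
  have "R f' g x \<le> R (\<lambda>y. (-1) * (f y - f' y)) g x + R f g x"
    using R_sub1[OF schwartz_cmult[OF schwartz_diff[OF assms(1,2)], of "-1"] assms(1,3), of x] by simp
  then have 2: "R f' g x \<le> R (\<lambda>y. f y - f' y) g x + R f g x"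
    unfolding R_hom1[OF schwartz_diff[OF assms(1,2)] assms(3)] by simp
  show ?thesis using 1 2 by linarith
qed

lemma R_diff2:
  assumes "schwartz g" "schwartz g'" "schwartz f"
  shows "\<bar>R f g x - R f g' x\<bar> \<le> R f (\<lambda>y. g y - g' y) x"
proof -
  have 1: "R f g x \<le> R f (\<lambda>y. g y - g' y) x + R f g' x"
    using R_sub2[OF schwartz_diff[OF assms(1,2)] assms(2,3), of x] by simp
  have "R f g' x \<le> R f (\<lambda>y. (-1) * (g y - g' y)) x + R f g x"
    using R_sub2[OF schwartz_cmult[OF schwartz_diff[OF assms(1,2)], of "-1"] assms(1,3), of x] by simp
  then have 2: "R f g' x \<le> R f (\<lambda>y. g y - g' y) x + R f g x"
    unfolding R_hom2[OF assms(3) schwartz_diff[OF assms(1,2)]] by simp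
  show ?thesis using 1 2 by linarith
qed

lemma R_integral_le:
  assumes f: "schwartz f" and g: "schwartz g" and a: "nrm2 f \<le> ennreal a" "a \<ge> 0" and b: "nrm2 g \<le> ennreal b" "b \<ge> 0"
  shows "(\<integral>\<^sub>+x. ennreal (R f g x)) \<le> ennreal (sqrt (K * (a * b)))"
proof -
  have "(\<integral>\<^sub>+x. S f g x)\<^sup>2 \<le> ennreal K * (ennreal a * ennreal b)"
    by (rule order_trans[OF bound[OF f g]]) (intro mult_left_mono mult_mono a b, auto)
  also have "\<dots> = ennreal (K * (a * b))" using K a b by (simp add: ennreal_mult)
  finally have sq: "(\<integral>\<^sub>+x. S f g x)\<^sup>2 \<le> ennreal (K * (a * b))" .
  then have "(\<integral>\<^sub>+x. S f g x) \<noteq> \<infinity>" by (auto simp: power2_eq_square ennreal_top_mult top_unique)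
  then obtain p where p: "(\<integral>\<^sub>+x. S f g x) = ennreal p" "p \<ge> 0" by (metis ennreal_cases infinity_ennreal_def)
  have "p\<^sup>2 \<le> K * (a * b)" using sq K a b unfolding p(1) by (simp add: ennreal_power p ennreal_le_iff)
  then have "p \<le> sqrt (K * (a * b))" by (rule real_le_rsqrt)
  then show ?thesis using p by (simp add: R[OF f g, symmetric] ennreal_leI)
qed

text \<open>The integrals of the terms are summable by the bound of the operator.\<close>

lemma AE_summable:
  assumes u: "\<And>k. schwartz (u k)" and v: "\<And>k. schwartz (v k)"
    and a: "\<And>k. nrm2 (u k) \<le> ennreal (a k)" "\<And>k. a k \<ge> 0" and b: "\<And>k. nrm2 (v k) \<le> ennreal (b k)" "\<And>k. b k \<ge> 0"
    and ab: "\<And>k. a k * b k \<le> C * (1/4) ^ k"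
  shows "AE x in lborel. summable (\<lambda>k. R (u k) (v k) x)"
proof -
  have [measurable]: "R (u k) (v k) \<in> \<B>" for k by (intro R_measurable u v)
  have C: "C \<ge> 0" using order_trans[OF mult_nonneg_nonneg[OF a(2)[of 0] b(2)[of 0]] ab[of 0]] by simp
  have le: "(\<integral>\<^sub>+x. ennreal (R (u k) (v k) x)) \<le> ennreal (sqrt (K * C) * (1/2) ^ k)" for k
  proof -
    have "sqrt (K * (a k * b k)) \<le> sqrt (K * (C * (1/4) ^ k))" using K ab by (intro real_sqrt_le_mono mult_left_mono) auto
    also have "K * (C * (1/4) ^ k) = (K * C) * ((1/2) ^ k)\<^sup>2" by (simp add: power_mult[symmetric] power2_eq_square power_mult_distrib[symmetric])
    also have "sqrt \<dots> = sqrt (K * C) * (1/2) ^ k" by (simp only: real_sqrt_mult real_sqrt_abs) simp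
    finally show ?thesis
      using R_integral_le[OF u v a b, of k k] by (meson ennreal_leI order_trans)
  qed
  have "(\<integral>\<^sub>+x. (\<Sum>k. ennreal (R (u k) (v k) x))) = (\<Sum>k. \<integral>\<^sub>+x. ennreal (R (u k) (v k) x))"
    by (rule nn_integral_suminf) measurable
  also have "\<dots> \<le> (\<Sum>k. ennreal (sqrt (K * C) * (1/2) ^ k))" by (intro suminf_le le) auto
  also have "\<dots> < \<infinity>"
  proof -
    have "summable (\<lambda>k. sqrt (K * C) * (1/2 :: real) ^ k)" by (intro summable_mult summable_geometric) simp
    then show ?thesis using K C by (subst suminf_ennreal2) auto
  qed
  finally have "AE x in lborel. (\<Sum>k. ennreal (R (u k) (v k) x)) \<noteq> \<infinity>" by (intro nn_integral_PInf_AE) auto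
  then show ?thesis by eventually_elim (intro summable_suminf_not_top, auto)
qed

text \<open>A limit along one fixed sequence of approximants, so that the extension is a function of \<open>f\<close> and \<open>g\<close>. Where
  the limit fails to exist, on a null set, the value is unspecified.\<close>

definition T :: "('a \<Rightarrow> complex) \<Rightarrow> ('a \<Rightarrow> complex) \<Rightarrow> 'a \<Rightarrow> real" where
  "T f g x = lim (\<lambda>k. R (approx_seq f k) (approx_seq g k) x)"

lemma bounded_approx: "L2_fun f \<Longrightarrow> nrm2 (approx_seq f k) \<le> ennreal (2 * (L2_norm f)\<^sup>2 + 2)"
  by (rule order_trans[OF approx_seq_nrm2 ennreal_leI]) (auto simp: power_le_one)

lemma approx_measurable: "L2_fun f \<Longrightarrow> approx_seq f k \<in> \<B>"
  by (intro schwartz_measurable approx_seq)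

lemma approx_increment:
  assumes f: "L2_fun f" shows "nrm2 (\<lambda>x. approx_seq f (Suc k) x - approx_seq f k x) \<le> ennreal (4 * (1/4) ^ k)"
proof -
  have [measurable]: "f \<in> \<B>" "\<And>k. approx_seq f k \<in> \<B>"
    using f approx_measurable[OF f] by (auto simp: L2_fun_iff)
  have 1: "nrm2 (\<lambda>x. approx_seq f (Suc k) x - f x) \<le> ennreal ((1/4) ^ Suc k)"
    using approx_seq(2)[OF f, of "Suc k"] nrm2_minus_commute[of f] by simp
  have "nrm2 (\<lambda>x. (approx_seq f (Suc k) x - f x) + (f x - approx_seq f k x)) \<le> ennreal (2 * (1/4) ^ Suc k + 2 * (1/4) ^ k)"
    by (rule nrm2_add_bounds[OF _ _ 1 approx_seq(2)[OF f, of k]]) auto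
  also have "\<dots> \<le> ennreal (4 * (1/4) ^ k)" by (intro ennreal_leI) simp
  finally show ?thesis by simp
qed

lemma T_lim:
  assumes f: "L2_fun f" and g: "L2_fun g"
  shows "AE x in lborel. (\<lambda>k. R (approx_seq f k) (approx_seq g k) x) \<longlonglongrightarrow> T f g x"
proof -
  let ?a = "approx_seq f" and ?b = "approx_seq g"
  have sa: "schwartz (?a k)" and sb: "schwartz (?b k)" for k using approx_seq f g by auto
  have s1: "AE x in lborel. summable (\<lambda>k. R (\<lambda>y. ?a (Suc k) y - ?a k y) (?b (Suc k)) x)"
    by (rule AE_summable[OF schwartz_diff[OF sa sa] sb approx_increment[OF f] _ bounded_approx[OF g], where C="4 * (2 * (L2_norm g)\<^sup>2 + 2)"]) auto
  have s2: "AE x in lborel. summable (\<lambda>k. R (?a k) (\<lambda>y. ?b (Suc k) y - ?b k y) x)"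
    by (rule AE_summable[OF sa schwartz_diff[OF sb sb] bounded_approx[OF f] _ approx_increment[OF g], where C="4 * (2 * (L2_norm f)\<^sup>2 + 2)"]) auto
  show ?thesis using s1 s2
  proof eventually_elim
    case (elim x)
    let ?r = "\<lambda>k. R (?a k) (?b k) x"
    have "\<bar>?r (Suc k) - ?r k\<bar> \<le> R (\<lambda>y. ?a (Suc k) y - ?a k y) (?b (Suc k)) x + R (?a k) (\<lambda>y. ?b (Suc k) y - ?b k y) x" for k
      using R_diff1[OF sa sa sb, of "Suc k" "Suc k" x k] R_diff2[OF sb sb sa, of k "Suc k" x k] by linarith
    then have "summable (\<lambda>k. ?r (Suc k) - ?r k)"
      by (intro summable_comparison_test[OF _ summable_add[OF elim]]) auto
    then have "(\<lambda>n. \<Sum>k<n. ?r (Suc k) - ?r k) \<longlonglongrightarrow> (\<Sum>k. ?r (Suc k) - ?r k)" by (rule summable_LIMSEQ)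
    then have "(\<lambda>n. ?r n - ?r 0) \<longlonglongrightarrow> (\<Sum>k. ?r (Suc k) - ?r k)" unfolding sum_lessThan_telescope[of ?r] .
    from tendsto_add[OF this tendsto_const[of "?r 0"]] have "convergent ?r" by (auto simp: convergent_def)
    then show ?case unfolding T_def by (rule convergent_LIMSEQ_iff[THEN iffD1])
  qed
qed

lemma T_schwartz:
  assumes f: "schwartz f" and g: "schwartz g"
  shows "AE x in lborel. S f g x = ennreal (T f g x)"
proof -
  let ?a = "approx_seq f" and ?b = "approx_seq g"
  have F: "L2_fun f" and G: "L2_fun g" using L2_fun_schwartz f g by auto
  have sa: "schwartz (?a k)" and sb: "schwartz (?b k)" for k using approx_seq F G by auto
  have s1: "AE x in lborel. summable (\<lambda>k. R (\<lambda>y. f y - ?a k y) (?b k) x)"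
    by (rule AE_summable[OF schwartz_diff[OF f sa] sb approx_seq(2)[OF F] _ bounded_approx[OF G], where C="2 * (L2_norm g)\<^sup>2 + 2"]) auto
  have s2: "AE x in lborel. summable (\<lambda>k. R f (\<lambda>y. g y - ?b k y) x)"
    by (rule AE_summable[OF f schwartz_diff[OF g sb] eq_refl[OF nrm2_eq[OF F]] _ approx_seq(2)[OF G], where C="(L2_norm f)\<^sup>2"]) auto
  show ?thesis using s1 s2 T_lim[OF F G]
  proof eventually_elim
    case (elim x)
    have "(\<lambda>k. R (\<lambda>y. f y - ?a k y) (?b k) x + R f (\<lambda>y. g y - ?b k y) x) \<longlonglongrightarrow> 0 + 0"
      by (intro tendsto_add summable_LIMSEQ_zero elim)
    then have lim: "(\<lambda>k. R (\<lambda>y. f y - ?a k y) (?b k) x + R f (\<lambda>y. g y - ?b k y) x) \<longlonglongrightarrow> 0" by simp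
    have "norm (R f g x - R (?a k) (?b k) x) \<le> R (\<lambda>y. f y - ?a k y) (?b k) x + R f (\<lambda>y. g y - ?b k y) x" for k
      using R_diff1[OF f sa sb, of k x k] R_diff2[OF g sb f, of x k] by simp
    then have "(\<lambda>k. R f g x - R (?a k) (?b k) x) \<longlonglongrightarrow> 0"
      by (rule Lim_null_comparison[OF always_eventually[OF allI] lim])
    from tendsto_diff[OF tendsto_const[of "R f g x"] this]
    have "(\<lambda>k. R (?a k) (?b k) x) \<longlonglongrightarrow> R f g x" by simp
    then have "T f g x = R f g x" using elim(3) LIMSEQ_unique by blast
    then show ?case using R[OF f g, of x] by simp
  qed
qed

lemma T_bound:
  assumes f: "L2_fun f" and g: "L2_fun g"
  shows "AE x in lborel. 0 \<le> T f g x" and "integrable lborel (T f g)"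
    and "(LINT x|lborel. \<bar>T f g x\<bar>) \<le> 2 * sqrt K * L2_norm f * L2_norm g"
proof -
  let ?a = "approx_seq f" and ?b = "approx_seq g"
  have sa: "schwartz (?a k)" and sb: "schwartz (?b k)" for k using approx_seq f g by auto
  have Rm[measurable]: "R (?a k) (?b k) \<in> \<B>" for k by (intro R_measurable sa sb)
  have Tm[measurable]: "T f g \<in> \<B>"
    unfolding T_def[abs_def] by (intro borel_measurable_lim_metric Rm)
  show nn: "AE x in lborel. 0 \<le> T f g x"
    using T_lim[OF f g] by eventually_elim (rule LIMSEQ_le_const, auto)
  let ?B = "\<lambda>m. sqrt (K * ((2 * (L2_norm f)\<^sup>2 + 2 * (1/4) ^ m) * (2 * (L2_norm g)\<^sup>2 + 2 * (1/4) ^ m)))"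
  have le: "(\<integral>\<^sub>+x. enorm (T f g x)) \<le> ennreal (?B m)" for m
  proof (rule nn_integral_le_of_tendsto[where u="\<lambda>k x. ennreal (R (?a (k + m)) (?b (k + m)) x)"])
    show "AE x in lborel. (\<lambda>k. ennreal (R (?a (k + m)) (?b (k + m)) x)) \<longlonglongrightarrow> enorm (T f g x)"
      using T_lim[OF f g] nn
    proof eventually_elim
      case (elim x)
      show ?case using LIMSEQ_ignore_initial_segment[OF elim(1), of m] elim(2) by (simp add: tendsto_ennrealI)
    qed
    fix k
    have "(1/4::real) ^ (k + m) \<le> (1/4) ^ m" by (intro power_decreasing) auto
    then have le: "2 * c + 2 * (1/4) ^ (k + m) \<le> 2 * c + 2 * (1/4 :: real) ^ m" for c by simp
    have "nrm2 (?a (k + m)) \<le> ennreal (2 * (L2_norm f)\<^sup>2 + 2 * (1/4) ^ m)" "nrm2 (?b (k + m)) \<le> ennreal (2 * (L2_norm g)\<^sup>2 + 2 * (1/4) ^ m)"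
      by (rule order_trans[OF approx_seq_nrm2[OF f] ennreal_leI[OF le]], rule order_trans[OF approx_seq_nrm2[OF g] ennreal_leI[OF le]])
    then show "(\<integral>\<^sub>+x. ennreal (R (?a (k + m)) (?b (k + m)) x)) \<le> ennreal (?B m)"
      by (intro R_integral_le sa sb) auto
  qed measurable
  show int: "integrable lborel (T f g)"
    using le_less_trans[OF le[of 0] ennreal_less_top] by (intro integrableI_bounded) auto
  have L: "(LINT x|lborel. \<bar>T f g x\<bar>) \<le> ?B m" for m
  proof -
    have "ennreal (LINT x|lborel. \<bar>T f g x\<bar>) = (\<integral>\<^sub>+x. enorm (T f g x))"
      using int by (subst nn_integral_eq_integral) auto
    also have "\<dots> \<le> ennreal (?B m)" by (rule le)
    finally show ?thesis using K by (subst (asm) ennreal_le_iff) auto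
  qed
  have "?B \<longlonglongrightarrow> sqrt (K * ((2 * (L2_norm f)\<^sup>2 + 2 * 0) * (2 * (L2_norm g)\<^sup>2 + 2 * 0)))"
    by (intro tendsto_intros LIMSEQ_power_zero) auto
  then have "(LINT x|lborel. \<bar>T f g x\<bar>) \<le> sqrt (K * ((2 * (L2_norm f)\<^sup>2 + 2 * 0) * (2 * (L2_norm g)\<^sup>2 + 2 * 0)))"
    using L by (intro LIMSEQ_le_const) auto
  also have "\<dots> = 2 * sqrt K * L2_norm f * L2_norm g"
  proof -
    have "0 \<le> L2_norm h" for h :: "'a \<Rightarrow> complex" unfolding L2_norm_def by (intro real_sqrt_ge_zero integral_nonneg_AE) auto
    moreover have "K * ((2 * (L2_norm f)\<^sup>2 + 2 * 0) * (2 * (L2_norm g)\<^sup>2 + 2 * 0)) = K * (2 * (L2_norm f * L2_norm g))\<^sup>2" by (simp add: power2_eq_square)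
    ultimately show ?thesis by (simp add: real_sqrt_mult)
  qed
  finally show "(LINT x|lborel. \<bar>T f g x\<bar>) \<le> 2 * sqrt K * L2_norm f * L2_norm g" .
qed

text \<open>The chosen approximants of a sum are not the sums of the approximants, but they differ by little enough to be
  summable. The same argument proves homogeneity.\<close>

lemma T_sub1:
  assumes f: "L2_fun f" and f': "L2_fun f'" and g: "L2_fun g"
  shows "AE x in lborel. T (\<lambda>y. f y + f' y) g x \<le> T f g x + T f' g x"
proof -
  let ?a = "approx_seq f" and ?a' = "approx_seq f'" and ?b = "approx_seq g" and ?c = "approx_seq (\<lambda>y. f y + f' y)"
  have ff: "L2_fun (\<lambda>y. f y + f' y)" by (rule L2_fun_add[OF f f'])
  have sa: "schwartz (?a k)" and sa': "schwartz (?a' k)" and sb: "schwartz (?b k)" and sc: "schwartz (?c k)" for k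
    using approx_seq f f' g ff by auto
  have [measurable]: "f \<in> \<B>" "f' \<in> \<B>" "?a k \<in> \<B>" "?a' k \<in> \<B>" "?c k \<in> \<B>" for k
    using f f' schwartz_measurable[OF sa] schwartz_measurable[OF sa'] schwartz_measurable[OF sc] by (auto simp: L2_fun_iff)
  let ?d = "\<lambda>k y. ?c k y - (?a k y + ?a' k y)"
  have sd: "schwartz (?d k)" for k by (intro schwartz_diff schwartz_add sa sa' sc)
  have nd: "nrm2 (?d k) \<le> ennreal (10 * (1/4) ^ k)" for k
  proof -
    have 1: "nrm2 (\<lambda>y. ?c k y - (f y + f' y)) \<le> ennreal ((1/4) ^ k)"
      using approx_seq(2)[OF ff, of k] nrm2_minus_commute[of "\<lambda>y. f y + f' y"] by simp
    have 2: "nrm2 (\<lambda>y. (f y - ?a k y) + (f' y - ?a' k y)) \<le> ennreal (2 * (1/4) ^ k + 2 * (1/4) ^ k)"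
      by (rule nrm2_add_bounds[OF _ _ approx_seq(2)[OF f] approx_seq(2)[OF f']]) auto
    have "nrm2 (\<lambda>y. (?c k y - (f y + f' y)) + ((f y - ?a k y) + (f' y - ?a' k y))) \<le> ennreal (2 * (1/4) ^ k + 2 * (2 * (1/4) ^ k + 2 * (1/4) ^ k))"
      by (rule nrm2_add_bounds[OF _ _ 1 2]) auto
    then show ?thesis by (simp add: algebra_simps)
  qed
  have s: "AE x in lborel. summable (\<lambda>k. R (?d k) (?b k) x)"
    by (rule AE_summable[OF sd sb nd _ bounded_approx[OF g], where C="10 * (2 * (L2_norm g)\<^sup>2 + 2)"]) auto
  show ?thesis using s T_lim[OF f g] T_lim[OF f' g] T_lim[OF ff g]
  proof eventually_elim
    case (elim x)
    have lim: "(\<lambda>k. R (?d k) (?b k) x + (R (?a k) (?b k) x + R (?a' k) (?b k) x)) \<longlonglongrightarrow> 0 + (T f g x + T f' g x)"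
      by (intro tendsto_add summable_LIMSEQ_zero elim)
    have "R (?c k) (?b k) x \<le> R (?d k) (?b k) x + (R (?a k) (?b k) x + R (?a' k) (?b k) x)" for k
      using R_sub1[OF sd schwartz_add[OF sa sa'] sb, of k k k k x] R_sub1[OF sa sa' sb, of k k k x] by simp
    then have "T (\<lambda>y. f y + f' y) g x \<le> 0 + (T f g x + T f' g x)"
      by (intro LIMSEQ_le[OF elim(4) lim]) auto
    then show ?case by simp
  qed
qed

lemma T_hom1:
  assumes f: "L2_fun f" and g: "L2_fun g"
  shows "AE x in lborel. T (\<lambda>y. c * f y) g x = norm c * T f g x"
proof -
  let ?a = "approx_seq f" and ?b = "approx_seq g" and ?c = "approx_seq (\<lambda>y. c * f y)"
  have cf: "L2_fun (\<lambda>y. c * f y)" by (rule L2_fun_cmult[OF f])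
  have sa: "schwartz (?a k)" and sb: "schwartz (?b k)" and sc: "schwartz (?c k)" for k
    using approx_seq f g cf by auto
  have [measurable]: "f \<in> \<B>" "?a k \<in> \<B>" "?c k \<in> \<B>" for k
    using f schwartz_measurable[OF sa] schwartz_measurable[OF sc] by (auto simp: L2_fun_iff)
  let ?d = "\<lambda>k y. ?c k y - c * ?a k y"
  have sd: "schwartz (?d k)" for k by (intro schwartz_diff schwartz_cmult sa sc)
  have nd: "nrm2 (?d k) \<le> ennreal (2 * (1/4) ^ k + 2 * ((norm c)\<^sup>2 * (1/4) ^ k))" for k
  proof -
    have 1: "nrm2 (\<lambda>y. ?c k y - c * f y) \<le> ennreal ((1/4) ^ k)"
      using approx_seq(2)[OF cf, of k] nrm2_minus_commute[of "\<lambda>y. c * f y"] by simp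
    have "nrm2 (\<lambda>y. c * (f y - ?a k y)) = nsq c * nrm2 (\<lambda>y. f y - ?a k y)" by (rule nrm2_cmult) measurable
    also have "\<dots> \<le> nsq c * ennreal ((1/4) ^ k)" by (intro mult_left_mono approx_seq(2)[OF f]) auto
    also have "\<dots> = ennreal ((norm c)\<^sup>2 * (1/4) ^ k)" by (rule ennreal_mult[symmetric]) auto
    finally have 2: "nrm2 (\<lambda>y. c * (f y - ?a k y)) \<le> ennreal ((norm c)\<^sup>2 * (1/4) ^ k)" .
    have "nrm2 (\<lambda>y. (?c k y - c * f y) + c * (f y - ?a k y)) \<le> ennreal (2 * (1/4) ^ k + 2 * ((norm c)\<^sup>2 * (1/4) ^ k))"
      by (rule nrm2_add_bounds[OF _ _ 1 2]) auto
    then show ?thesis by (simp add: algebra_simps)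
  qed
  have s: "AE x in lborel. summable (\<lambda>k. R (?d k) (?b k) x)"
    by (rule AE_summable[OF sd sb nd _ bounded_approx[OF g], where C="(2 + 2 * (norm c)\<^sup>2) * (2 * (L2_norm g)\<^sup>2 + 2)"])
      (auto simp: algebra_simps)
  show ?thesis using s T_lim[OF f g] T_lim[OF cf g]
  proof eventually_elim
    case (elim x)
    have "(\<lambda>k. R (?c k) (?b k) x - norm c * R (?a k) (?b k) x) \<longlonglongrightarrow> 0"
    proof (rule Lim_null_comparison[OF always_eventually summable_LIMSEQ_zero[OF elim(1)]], rule allI)
      fix k
      show "norm (R (?c k) (?b k) x - norm c * R (?a k) (?b k) x) \<le> R (?d k) (?b k) x"
        using R_diff1[OF sc schwartz_cmult[OF sa] sb, of k k x c k] unfolding R_hom1[OF sa sb] by simp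
    qed
    moreover have "(\<lambda>k. R (?c k) (?b k) x - norm c * R (?a k) (?b k) x) \<longlonglongrightarrow> T (\<lambda>y. c * f y) g x - norm c * T f g x"
      by (intro tendsto_diff tendsto_mult tendsto_const elim)
    ultimately show ?case using LIMSEQ_unique by fastforce
  qed
qed

end

theorem (in schwartz_sublinear) extends: "extends_bounded_L2_L2_L1 S"
proof -
  interpret sw: schwartz_sublinear "\<lambda>f g. S g f" K by (rule swapped)
  have T: "sw.T g f x = T f g x" for f g x unfolding sw.T_def T_def sw.R_def R_def ..
  show ?thesis
    unfolding extends_bounded_L2_L2_L1_def
  proof (rule exI[of _ T], rule exI[of _ "2 * sqrt K"], intro conjI allI impI; (elim conjE)?)
    fix f g :: "'a \<Rightarrow> complex"
    show "schwartz f \<Longrightarrow> schwartz g \<Longrightarrow> AE x in lborel. S f g x = ennreal (T f g x)" by (rule T_schwartz)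
    show "L2_fun f \<Longrightarrow> L2_fun g \<Longrightarrow> AE x in lborel. 0 \<le> T f g x" by (rule T_bound)
    show "L2_fun f \<Longrightarrow> L2_fun g \<Longrightarrow> integrable lborel (T f g)" by (rule T_bound)
    show "L2_fun f \<Longrightarrow> L2_fun g \<Longrightarrow> (LINT x|lborel. \<bar>T f g x\<bar>) \<le> 2 * sqrt K * L2_norm f * L2_norm g" by (rule T_bound)
    show "L2_fun f \<Longrightarrow> L2_fun g \<Longrightarrow> AE x in lborel. T (\<lambda>y. c * f y) g x = norm c * T f g x" for c by (rule T_hom1)
    show "L2_fun f \<Longrightarrow> L2_fun g \<Longrightarrow> AE x in lborel. T f (\<lambda>y. c * g y) x = norm c * T f g x" for c
      using sw.T_hom1[of g f c] unfolding T .
    fix f' :: "'a \<Rightarrow> complex"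
    show "L2_fun f \<Longrightarrow> L2_fun f' \<Longrightarrow> L2_fun g \<Longrightarrow> AE x in lborel. T (\<lambda>y. f y + f' y) g x \<le> T f g x + T f' g x" by (rule T_sub1)
    show "L2_fun f \<Longrightarrow> L2_fun f' \<Longrightarrow> L2_fun g \<Longrightarrow> AE x in lborel. T g (\<lambda>y. f y + f' y) x \<le> T g f x + T g f' x"
      using sw.T_sub1[of f f' g] unfolding T .
  qed
qed

section \<open>Bilinear multiplier forms\<close>

lemma integrable_LL_product:
  fixes F G :: "'a::euclidean_space \<Rightarrow> complex"
  assumes F: "integrable lborel F" and G: "integrable lborel G"
  shows "integrable LL (\<lambda>z. F (fst z) * G (snd z))"
proof -
  have [measurable]: "F \<in> \<B>" "G \<in> \<B>" using F G by auto
  have "integrable LL (case_prod (\<lambda>\<xi> \<eta>. F \<xi> * G \<eta>))"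
    using nn_integral_product_finite[OF F G] by (intro integrable_lborel_pairI) (simp_all add: norm_mult)
  then show ?thesis by (simp add: case_prod_unfold)
qed

lemma integrable_LL_symbol:
  fixes F G :: "'a::euclidean_space \<Rightarrow> complex"
  assumes F: "integrable lborel F" and G: "integrable lborel G"
    and K: "K \<in> borel_measurable LL" "\<And>z. norm (K z) \<le> B"
  shows "integrable LL (\<lambda>z. K z * F (fst z) * G (snd z))"
  using integrable_mult_bounded[OF integrable_LL_product[OF F G] K] by (simp add: mult_ac)

lemma bilin_form_norm_le: "norm (bilin_form K x) \<le> (LINT z|LL. norm (K z))"
  unfolding bilin_form_def
  using integral_norm_bound[of LL "\<lambda>z. K z * \<e> (x \<bullet> (fst z + snd z))"] by (simp add: norm_mult)

lemma integrable_LL_cis: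
  fixes x :: "'a::euclidean_space"
  assumes "integrable LL K" shows "integrable LL (\<lambda>z. K z * \<e> (x \<bullet> (fst z + snd z)))"
  by (rule integrable_mult_cis[OF assms]) measurable

lemma bilin_form_add:
  assumes "integrable LL K" "integrable LL L"
  shows "bilin_form (\<lambda>z. K z + L z) x = bilin_form K x + bilin_form L x"
  unfolding bilin_form_def using integrable_LL_cis[OF assms(1), of x] integrable_LL_cis[OF assms(2), of x]
  by (simp add: distrib_right)

lemma bilin_form_sum:
  assumes "\<And>i. i \<in> I \<Longrightarrow> integrable LL (K i)" "finite I"
  shows "bilin_form (\<lambda>z. \<Sum>i\<in>I. K i z) x = (\<Sum>i\<in>I. bilin_form (K i) x)"
  unfolding bilin_form_def using integrable_LL_cis[OF assms(1), of _ x]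
  by (simp add: sum_distrib_right Bochner_Integration.integral_sum)

lemma bilin_form_cmult: "bilin_form (\<lambda>z. c * K z) x = c * bilin_form K x"
  unfolding bilin_form_def by (simp add: mult.assoc)

lemma bilin_form_tendsto:
  fixes K :: "nat \<Rightarrow> 'a::euclidean_space \<times> 'a \<Rightarrow> complex"
  assumes [measurable]: "\<And>n. K n \<in> borel_measurable LL" "K' \<in> borel_measurable LL" and H: "integrable LL H"
    and lim: "\<And>z. (\<lambda>n. K n z) \<longlonglongrightarrow> K' z" and le: "\<And>n z. norm (K n z) \<le> H z"
  shows "(\<lambda>n. bilin_form (K n) x) \<longlonglongrightarrow> bilin_form K' x"
  unfolding bilin_form_def
proof (rule integral_dominated_convergence[OF _ _ H])
  show "AE z in LL. (\<lambda>n. K n z * \<e> (x \<bullet> (fst z + snd z))) \<longlonglongrightarrow> K' z * \<e> (x \<bullet> (fst z + snd z))"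
    by (intro AE_I2 tendsto_mult tendsto_const lim)
  show "AE z in LL. norm (K n z * \<e> (x \<bullet> (fst z + snd z))) \<le> H z" for n
    by (simp add: norm_mult le)
qed measurable

lemma bilin_form_continuous:
  assumes K: "integrable LL K" shows "continuous_on UNIV (bilin_form K)"
  unfolding continuous_on_sequentially
proof (intro allI ballI impI, elim conjE)
  have [measurable]: "K \<in> borel_measurable LL" using K by simp
  fix X :: "nat \<Rightarrow> 'a" and x assume X: "X \<longlonglongrightarrow> x"
  show "(bilin_form K \<circ> X) \<longlonglongrightarrow> bilin_form K x"
    unfolding bilin_form_def comp_def
  proof (rule integral_dominated_convergence[where w="\<lambda>z. norm (K z)"])
    show "AE z in LL. (\<lambda>n. K z * \<e> (X n \<bullet> (fst z + snd z))) \<longlonglongrightarrow> K z * \<e> (x \<bullet> (fst z + snd z))"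
      by (intro AE_I2 tendsto_mult tendsto_const tendsto_cis tendsto_inner X)
    show "AE z in LL. norm (K z * \<e> (X n \<bullet> (fst z + snd z))) \<le> norm (K z)" for n
      by (simp add: norm_mult)
  qed (use K in \<open>simp_all, measurable\<close>)
qed

lemma bilin_mult_eq_bilin_form:
  fixes f g :: "'a::euclidean_space \<Rightarrow> complex"
  assumes F: "integrable lborel (fourier f)" and G: "integrable lborel (fourier g)"
    and K: "(\<lambda>z :: 'a \<times> 'a. M (s\<^sup>2 * (norm z)\<^sup>2)) \<in> borel_measurable LL" "\<And>t. t \<ge> 0 \<Longrightarrow> norm (M t) \<le> B"
  shows "bilin_mult (\<lambda>\<zeta>. M ((norm \<zeta>)\<^sup>2)) s f g x =
    bilin_form (\<lambda>z. M (s\<^sup>2 * (norm z)\<^sup>2) * fourier f (fst z) * fourier g (snd z)) x"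
proof -
  let ?h = "\<lambda>z. M (s\<^sup>2 * (norm z)\<^sup>2) * fourier f (fst z) * fourier g (snd z) * \<e> (x \<bullet> (fst z + snd z))"
  have "integrable LL ?h"
    by (intro integrable_LL_cis integrable_LL_symbol[where B=B] F G K) auto
  then have i: "integrable LL (case_prod (\<lambda>\<xi> \<eta>. ?h (\<xi>, \<eta>)))" by (simp add: case_prod_unfold)
  have n: "(norm (s *\<^sub>R \<xi>, s *\<^sub>R \<eta>))\<^sup>2 = s\<^sup>2 * (norm (\<xi>, \<eta>))\<^sup>2" for \<xi> \<eta> :: 'a
    by (simp add: norm_prod_square power_mult_distrib distrib_left)
  have "bilin_mult (\<lambda>\<zeta>. M ((norm \<zeta>)\<^sup>2)) s f g x = (LINT \<eta>|lborel. LINT \<xi>|lborel. ?h (\<xi>, \<eta>))"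
    unfolding bilin_mult_def n exp_eq_cis by simp
  also have "\<dots> = (LINT z|LL. ?h z)"
    using lborel_pair.integral_snd[OF i] by (simp add: case_prod_unfold)
  finally show ?thesis unfolding bilin_form_def .
qed

section \<open>Subordinated symbols and their dilates\<close>

lemma pos_powr_scale: "c > 0 \<Longrightarrow> pos_powr d (c * r) = c powr d * pos_powr d r"
  by (cases "r > 0") (simp_all add: pos_powr_pos pos_powr_nonpos powr_mult mult_nonneg_nonpos)

lemma subord_cmult: "subord d (\<lambda>\<tau>. a * w \<tau>) t = a * subord d w t"
  unfolding subord_def by (simp add: mult.assoc)

lemma subord_scale:
  assumes [measurable]: "w \<in> \<B>" and c: "c > 0"
  shows "subord d w (c * t) = subord d (\<lambda>\<tau>. of_real (c powr (2 * d + 2)) * w (c * \<tau>)) t"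
proof -
  have e: "c * c powr (2 * d + 1) = c powr (2 * d + 2)" using c by (simp add: powr_mult_base add.commute)
  have e2: "pos_powr (2 * d + 1) (c * \<tau> - c * t) = c powr (2 * d + 1) * pos_powr (2 * d + 1) (\<tau> - t)" for \<tau>
    unfolding right_diff_distrib[symmetric] by (rule pos_powr_scale[OF c])
  have "subord d w (c * t) = c *\<^sub>R (LINT \<tau>|lborel. w (c * \<tau>) * of_real (pos_powr (2 * d + 1) (c * \<tau> - c * t)))"
    unfolding subord_def using c by (subst integral_lborel_scale[of _ c]) auto
  also have "\<dots> = c *\<^sub>R (LINT \<tau>|lborel. of_real (c powr (2 * d + 1)) * (w (c * \<tau>) * of_real (pos_powr (2 * d + 1) (\<tau> - t))))"
    unfolding e2 by (simp add: mult.left_commute)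
  also have "\<dots> = of_real (c * c powr (2 * d + 1)) * subord d (\<lambda>\<tau>. w (c * \<tau>)) t"
    unfolding subord_def by (simp add: scaleR_conv_of_real mult.assoc)
  finally show ?thesis unfolding e subord_cmult .
qed

text \<open>The dilation that \<open>subord_scale\<close> performs on a density preserves both weighted norms, the one of
  \<open>bilinear_estimate_L1\<close> and the one of \<open>bilinear_square_function_estimate\<close>. This is why all estimates
  are uniform in the dilation parameter of the maximal operator.\<close>

lemma weighted_nn_integral_scale:
  assumes [measurable]: "u \<in> \<B>" and u: "\<And>\<tau>. u \<tau> \<ge> 0" and c: "c > 0"
  shows "(\<integral>\<^sub>+\<tau>. indicator {0<..} \<tau> * ennreal (\<tau> powr a * (c powr (a + 1) * u (c * \<tau>)))) =
    (\<integral>\<^sub>+\<tau>. indicator {0<..} \<tau> * ennreal (\<tau> powr a * u \<tau>))"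
proof -
  have "(\<integral>\<^sub>+\<tau>. indicator {0<..} \<tau> * ennreal (\<tau> powr a * u \<tau>)) =
      ennreal c * (\<integral>\<^sub>+\<tau>. indicator {0<..} (c * \<tau>) * ennreal ((c * \<tau>) powr a * u (c * \<tau>)))"
    using c by (subst nn_integral_lborel_scale[of _ c]) auto
  also have "\<dots> = (\<integral>\<^sub>+\<tau>. ennreal c * (indicator {0<..} (c * \<tau>) * ennreal ((c * \<tau>) powr a * u (c * \<tau>))))"
    by (rule nn_integral_cmult[symmetric]) measurable
  also have "\<dots> = (\<integral>\<^sub>+\<tau>. indicator {0<..} \<tau> * ennreal (\<tau> powr a * (c powr (a + 1) * u (c * \<tau>))))"
  proof (rule nn_integral_cong)
    fix \<tau> :: real
    show "ennreal c * (indicator {0<..} (c * \<tau>) * ennreal ((c * \<tau>) powr a * u (c * \<tau>))) =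
      indicator {0<..} \<tau> * ennreal (\<tau> powr a * (c powr (a + 1) * u (c * \<tau>)))"
    proof (cases "\<tau> > 0")
      case True
      have "c * ((c * \<tau>) powr a * u (c * \<tau>)) = \<tau> powr a * (c powr (a + 1) * u (c * \<tau>))"
        using c True by (simp add: powr_mult powr_add)
      then show ?thesis using c True u by (simp flip: ennreal_mult)
    next
      case False then show ?thesis using c by (simp add: zero_less_mult_iff)
    qed
  qed
  finally show ?thesis ..
qed

section \<open>Symbols with a square-integrable fractional derivative\<close>

lemma L2beta_norm_bound:
  assumes A: "L2beta_norm \<beta> M \<le> ennreal A" "A \<ge> 0"
  shows "L2beta_norm_sq \<beta> M \<le> ennreal (A\<^sup>2)"
proof (cases "L2beta_norm_sq \<beta> M = \<infinity>")
  case True then show ?thesis using A by (simp add: L2beta_norm_def top_unique)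
next
  case False
  then have q: "L2beta_norm_sq \<beta> M = ennreal (enn2real (L2beta_norm_sq \<beta> M))" by (simp add: top.not_eq_extremum)
  have "sqrt (enn2real (L2beta_norm_sq \<beta> M)) \<le> A" using A False by (simp add: L2beta_norm_def ennreal_le_iff)
  then have "enn2real (L2beta_norm_sq \<beta> M) \<le> A\<^sup>2" by (simp add: real_le_lsqrt sqrt_le_D)
  then show ?thesis by (subst q) (rule ennreal_leI)
qed

text \<open>With \<open>d = \<beta> / 2 - 1\<close> one has \<open>2 * d + 1 = \<beta> - 1\<close> and \<open>4 * d + 5 = 2 * \<beta> + 1\<close>. So the density is the
  fractional derivative of \<open>M t / t\<close> divided by \<open>Gamma \<beta>\<close>, and its weighted norm is the given one. The
  condition \<open>\<beta> > 1\<close> is \<open>d > -1/2\<close>.\<close>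

lemma smooth_piece_subordination:
  fixes M :: "real \<Rightarrow> complex"
  assumes sm: "\<And>k. k_smooth k UNIV (div_by_id M)" and z: "\<And>t. t \<notin> {a..B} \<Longrightarrow> div_by_id M t = 0"
    and b: "\<beta> > 1" and M0: "M 0 = 0" and A: "L2beta_norm \<beta> M \<le> ennreal A" "A \<ge> 0"
  shows "\<exists>w W. w \<in> \<B> \<and> 0 \<le> W \<and> sqrt W \<le> A / Gamma \<beta> \<and>
     (\<integral>\<^sub>+\<tau>. indicator {0<..} \<tau> * ennreal (\<tau> powr (4 * (\<beta> / 2 - 1) + 5) * (norm (w \<tau>))\<^sup>2)) = ennreal W \<and>
     (\<forall>t\<ge>0. M t = of_real t * subord (\<beta> / 2 - 1) w t)"
proof -
  let ?D = "frac_deriv \<beta> (div_by_id M)" and ?d = "\<beta> / 2 - 1"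
  have G: "Gamma \<beta> > 0" using b by (intro Gamma_real_pos) auto
  note fd = frac_deriv_subordination[OF sm z b]
  have [measurable]: "?D \<in> \<B>" by (rule fd(1))
  define w where "w \<tau> = of_real (1 / Gamma \<beta>) * ?D \<tau>" for \<tau>
  have [measurable]: "w \<in> \<B>" unfolding w_def by measurable
  have d: "2 * ?d + 1 = \<beta> - 1" "4 * ?d + 5 = 2 * \<beta> + 1" by auto
  have M: "M t = of_real t * subord ?d w t" if "t \<ge> 0" for t
  proof (cases "t = 0")
    case False
    have "subord ?d w t = of_real (1 / Gamma \<beta>) * subord ?d ?D t"
      unfolding w_def[abs_def] by (rule subord_cmult)
    also have "subord ?d ?D t = of_real (Gamma \<beta>) * div_by_id M t"
      unfolding subord_def d(1) by (rule fd(2))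
    also have "of_real (1 / Gamma \<beta>) * (of_real (Gamma \<beta>) * div_by_id M t) = div_by_id M t" using G by simp
    finally show ?thesis using that False by (simp add: div_by_id_def)
  qed (use M0 in simp)
  let ?I = "\<integral>\<^sub>+\<tau>. indicator {0<..} \<tau> * ennreal (\<tau> powr (4 * ?d + 5) * (norm (w \<tau>))\<^sup>2)"
  have "?I = (\<integral>\<^sub>+\<tau>. ennreal (1 / (Gamma \<beta>)\<^sup>2) * (ennreal ((norm (of_real (\<tau> powr (\<beta> + 1)) * ?D \<tau>))\<^sup>2 / \<tau>) * indicator {0<..} \<tau>))"
  proof (rule nn_integral_cong)
    fix \<tau> :: real
    show "indicator {0<..} \<tau> * ennreal (\<tau> powr (4 * ?d + 5) * (norm (w \<tau>))\<^sup>2) =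
      ennreal (1 / (Gamma \<beta>)\<^sup>2) * (ennreal ((norm (of_real (\<tau> powr (\<beta> + 1)) * ?D \<tau>))\<^sup>2 / \<tau>) * indicator {0<..} \<tau>)"
    proof (cases "\<tau> > 0")
      case True
      have "(\<tau> powr (\<beta> + 1))\<^sup>2 = \<tau> powr (2 * \<beta> + 1 + 1)" by (simp add: power2_eq_square add.commute flip: powr_add)
      also have "\<dots> = \<tau> powr (2 * \<beta> + 1) * \<tau>" using True by (subst powr_add) simp
      finally have sq: "(\<tau> powr (\<beta> + 1))\<^sup>2 = \<tau> powr (2 * \<beta> + 1) * \<tau>" .
      have "\<tau> powr (2 * \<beta> + 1) * (norm (w \<tau>))\<^sup>2 = 1 / (Gamma \<beta>)\<^sup>2 * ((norm (of_real (\<tau> powr (\<beta> + 1)) * ?D \<tau>))\<^sup>2 / \<tau>)"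
        using True unfolding w_def by (simp add: norm_mult norm_divide power_mult_distrib power_divide sq)
      then show ?thesis using True unfolding d by (simp add: ennreal_mult[symmetric] del: ennreal_mult' ennreal_mult'')
    qed simp
  qed
  also have "\<dots> = ennreal (1 / (Gamma \<beta>)\<^sup>2) * L2beta_norm_sq \<beta> M"
    unfolding L2beta_norm_sq_def by (rule nn_integral_cmult) measurable
  also have "\<dots> \<le> ennreal (1 / (Gamma \<beta>)\<^sup>2) * ennreal (A\<^sup>2)" by (intro mult_left_mono L2beta_norm_bound A) auto
  also have "\<dots> = ennreal ((A / Gamma \<beta>)\<^sup>2)" by (simp add: power_divide flip: ennreal_mult)
  finally have I: "?I \<le> ennreal ((A / Gamma \<beta>)\<^sup>2)" .
  then have "?I < \<infinity>" using le_less_trans[OF _ ennreal_less_top] by auto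
  then obtain W where W: "?I = ennreal W" "W \<ge> 0" by (rule ennreal_finiteE)
  have "W \<le> (A / Gamma \<beta>)\<^sup>2" using I W by (simp add: ennreal_le_iff)
  then have "sqrt W \<le> A / Gamma \<beta>" using A G by (intro real_le_lsqrt) auto
  then show ?thesis using W M by (intro exI[of _ w] exI[of _ W]) auto
qed

section \<open>The low frequency symbol\<close>

text \<open>Taylor's formula with integral remainder, expanded at a point to the right of the support: the density is the
  second derivative.\<close>

lemma low_piece_subordination:
  fixes h :: "real \<Rightarrow> complex"
  assumes sm: "k_smooth 2 {0..} h" and z: "\<And>t. t > b \<Longrightarrow> h t = 0" and b: "b > 0"
  shows "\<exists>w W. w \<in> \<B> \<and> 0 \<le> W \<and>
     (\<integral>\<^sub>+\<tau>. indicator {0<..} \<tau> * ennreal (\<tau> powr (2 * 0 + 1) * norm (w \<tau>))) = ennreal W \<and>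
     (\<forall>t\<ge>0. h t = subord 0 w t)"
proof -
  obtain h1 h2 where h1: "\<And>t. t \<ge> 0 \<Longrightarrow> (h has_vector_derivative h1 t) (at t within {0..})"
    and h2: "\<And>t. t \<ge> 0 \<Longrightarrow> (h1 has_vector_derivative h2 t) (at t within {0..})" and c: "continuous_on {0..} h2"
    using sm by (auto simp: numeral_2_eq_2)
  \<comment> \<open>At this point both \<open>h\<close> and its derivative vanish.\<close>
  let ?b = "b + 1"
  have hb: "h ?b = 0" by (rule z) simp
  have h1b: "h1 ?b = 0"
  proof -
    have "(h has_vector_derivative h1 ?b) (at ?b within {0..})" by (rule h1) (use b in simp)
    then have 1: "(h has_vector_derivative h1 ?b) (at ?b)"
      using b by (subst (asm) at_within_interior) (auto simp: interior_real_atLeast)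
    have "(h has_vector_derivative 0) (at ?b)"
      by (rule has_vector_derivative_transform_within_open[of "\<lambda>_. 0" _ _ "{b<..}"]) (auto simp: z)
    with 1 show ?thesis by (rule vector_derivative_unique_at)
  qed
  define w where "w \<tau> = indicator {0..?b} \<tau> *\<^sub>R h2 \<tau>" for \<tau>
  have cb: "continuous_on {0..?b} h2" by (rule continuous_on_subset[OF c]) auto
  have wm[measurable]: "w \<in> \<B>"
    unfolding w_def by (rule borel_measurable_continuous_on_indicator[OF _ cb]) simp
  have "compact (h2 ` {0..?b})" by (intro compact_continuous_image cb) simp
  then obtain K where K: "\<And>\<tau>. \<tau> \<in> {0..?b} \<Longrightarrow> norm (h2 \<tau>) \<le> K" "K > 0"
    using compact_imp_bounded bounded_pos by (metis imageI)
  have "(\<integral>\<^sub>+\<tau>. indicator {0<..} \<tau> * ennreal (\<tau> powr (2 * 0 + 1) * norm (w \<tau>)))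
    \<le> (\<integral>\<^sub>+\<tau>. ennreal (?b * K) * indicator {0..?b} \<tau>)"
  proof (rule nn_integral_mono)
    fix \<tau> :: real
    show "indicator {0<..} \<tau> * ennreal (\<tau> powr (2 * 0 + 1) * norm (w \<tau>)) \<le> ennreal (?b * K) * indicator {0..?b} \<tau>"
    proof (cases "\<tau> \<in> {0<..?b}")
      case True
      then have "\<tau> * norm (h2 \<tau>) \<le> ?b * K" using K by (intro mult_mono) auto
      then show ?thesis using True by (simp add: w_def ennreal_leI)
    qed (auto simp: w_def indicator_def)
  qed
  also have "\<dots> = ennreal (?b * K) * ennreal ?b" using b by (simp add: nn_integral_cmult_indicator)
  also have "\<dots> < \<infinity>" by (simp add: ennreal_mult_less_top)
  finally obtain W where W: "(\<integral>\<^sub>+\<tau>. indicator {0<..} \<tau> * ennreal (\<tau> powr (2 * 0 + 1) * norm (w \<tau>))) = ennreal W" "W \<ge> 0"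
    by (rule ennreal_finiteE)
  have "h t = subord 0 w t" if t: "t \<ge> 0" for t
  proof (cases "t \<le> ?b")
    case True
    have "subord 0 w t = (LINT \<tau>|lborel. indicator {t..?b} \<tau> *\<^sub>R (h2 \<tau> * of_real (\<tau> - t)))"
      unfolding subord_def
    proof (rule LINT_cong[OF refl])
      fix \<tau> show "w \<tau> * of_real (pos_powr (2 * 0 + 1) (\<tau> - t)) = indicator {t..?b} \<tau> *\<^sub>R (h2 \<tau> * of_real (\<tau> - t))"
        using t by (cases "\<tau> > t") (auto simp: w_def indicator_def pos_powr_def)
    qed
    also have "\<dots> = (h1 ?b * of_real (?b - t) - h ?b) - (h1 t * of_real (t - t) - h t)"
    proof (rule integral_FTC_Icc[where F="\<lambda>\<tau>. h1 \<tau> * of_real (\<tau> - t) - h \<tau>", OF True])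
      fix \<tau> assume \<tau>: "t \<le> \<tau>" "\<tau> \<le> ?b"
      have s: "{t..?b} \<subseteq> {0..}" using t by auto
      have 1: "((\<lambda>\<tau>. complex_of_real (\<tau> - t)) has_vector_derivative 1) (at \<tau> within {t..?b})"
        by (auto intro!: derivative_eq_intros simp: has_vector_derivative_def scaleR_conv_of_real)
      have "((\<lambda>\<tau>. h1 \<tau> * of_real (\<tau> - t) - h \<tau>) has_vector_derivative (h1 \<tau> * 1 + h2 \<tau> * of_real (\<tau> - t)) - h1 \<tau>) (at \<tau> within {t..?b})"
        using \<tau> t by (intro has_vector_derivative_diff has_vector_derivative_mult 1
          has_vector_derivative_within_subset[OF h1 s] has_vector_derivative_within_subset[OF h2 s]) auto
      then show "((\<lambda>\<tau>. h1 \<tau> * of_real (\<tau> - t) - h \<tau>) has_vector_derivative h2 \<tau> * of_real (\<tau> - t)) (at \<tau> within {t..?b})" by simp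
    next
      show "continuous_on {t..?b} (\<lambda>\<tau>. h2 \<tau> * of_real (\<tau> - t))"
        using t by (intro continuous_intros continuous_on_subset[OF c]) auto
    qed
    finally show ?thesis unfolding hb h1b by simp
  next
    case False
    have zero: "w \<tau> * of_real (pos_powr (2 * 0 + 1) (\<tau> - t)) = 0" for \<tau>
      using False by (cases "\<tau> > t") (auto simp: w_def pos_powr_nonpos)
    have "subord 0 w t = 0" unfolding subord_def zero by simp
    then show ?thesis using z[of t] False by simp
  qed
  then show ?thesis using W by (intro exI[of _ w] exI[of _ W]) auto
qed

section \<open>Maximal estimate for Schwartz functions\<close>

lemma subord_L1_bound:
  assumes d: "d > -1/2"
    and W: "(\<integral>\<^sub>+\<tau>. indicator {0<..} \<tau> * ennreal (\<tau> powr (2 * d + 1) * norm (w \<tau>))) = ennreal W" "W \<ge> 0"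
    and t: "t \<ge> 0"
  shows "norm (subord d w t) \<le> W"
proof -
  have "enorm (subord d w t) \<le> (\<integral>\<^sub>+\<tau>. enorm (w \<tau> * of_real (pos_powr (2 * d + 1) (\<tau> - t))))"
    unfolding subord_def by (rule norm_integral_le_nn_integral)
  also have "\<dots> \<le> (\<integral>\<^sub>+\<tau>. indicator {0<..} \<tau> * ennreal (\<tau> powr (2 * d + 1) * norm (w \<tau>)))"
  proof (rule nn_integral_mono)
    fix \<tau> :: real
    show "enorm (w \<tau> * of_real (pos_powr (2 * d + 1) (\<tau> - t))) \<le> indicator {0<..} \<tau> * ennreal (\<tau> powr (2 * d + 1) * norm (w \<tau>))"
    proof (cases "\<tau> > t")
      case True
      then have "(\<tau> - t) powr (2 * d + 1) \<le> \<tau> powr (2 * d + 1)" using t d by (intro powr_mono2) auto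
      then have "norm (w \<tau>) * (\<tau> - t) powr (2 * d + 1) \<le> \<tau> powr (2 * d + 1) * norm (w \<tau>)" by (simp add: mult.commute mult_left_mono)
      then show ?thesis using True t by (simp add: norm_mult pos_powr_pos ennreal_leI)
    qed (simp add: pos_powr_nonpos)
  qed
  finally show ?thesis using W by (simp add: ennreal_le_iff)
qed

lemma ennreal_sq_le_real:
  assumes "(ennreal (b * r))\<^sup>2 \<le> ennreal q" "b > 0" "r \<ge> 0" "q \<ge> 0"
  shows "r \<le> sqrt q / b"
proof -
  have "(b * r)\<^sup>2 \<le> q" using assms by (simp add: ennreal_power ennreal_le_iff)
  then have "b * r \<le> sqrt q" by (rule real_le_rsqrt)
  then show ?thesis using assms(2) by (simp add: field_simps)
qed

text \<open>A symbol given as a series of a low-frequency piece \<open>L\<close> and pieces \<open>P j\<close>, each with a density for its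
  subordination to truncated powers.\<close>

locale subordinated_symbol =
  fixes M L :: "real \<Rightarrow> complex" and P :: "nat \<Rightarrow> real \<Rightarrow> complex" and d :: real
    and w0 :: "real \<Rightarrow> complex" and w :: "nat \<Rightarrow> real \<Rightarrow> complex" and W0 :: real and W :: "nat \<Rightarrow> real"
  assumes d: "d > -1/2"
    and w0 [measurable]: "w0 \<in> \<B>" and w [measurable]: "\<And>j. w j \<in> \<B>"
    and W0: "(\<integral>\<^sub>+\<tau>. indicator {0<..} \<tau> * ennreal (\<tau> powr (2 * 0 + 1) * norm (w0 \<tau>))) = ennreal W0" "W0 \<ge> 0"
    and W: "\<And>j. (\<integral>\<^sub>+\<tau>. indicator {0<..} \<tau> * ennreal (\<tau> powr (4 * d + 5) * (norm (w j \<tau>))\<^sup>2)) = ennreal (W j)"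
      "\<And>j. W j \<ge> 0"
    and summable_W: "summable (\<lambda>j. sqrt (W j))"
    and L: "\<And>t. t \<ge> 0 \<Longrightarrow> L t = subord 0 w0 t"
    and P: "\<And>j t. t \<ge> 0 \<Longrightarrow> P j t = of_real t * subord d (w j) t"
    and M: "\<And>t. t \<ge> 0 \<Longrightarrow> (\<lambda>n. L t + (\<Sum>j<n. P j t)) \<longlonglongrightarrow> M t"
begin

definition partial_symbol :: "nat \<Rightarrow> real \<Rightarrow> complex" where
  "partial_symbol n t = L t + (\<Sum>j<n. P j t)"

definition symbol_bound :: real where
  "symbol_bound = W0 + (\<Sum>j. sqrt (W j))"

text \<open>The summand 1 keeps the constant positive, so that an infinite right-hand side in the estimate below remains
  infinite after multiplication.\<close>

definition operator_bound :: real where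
  "operator_bound = 1 + W0 / beta_const 0 + 2 / beta_const d * (\<Sum>j. sqrt (W j))"

lemma L_bound: "t \<ge> 0 \<Longrightarrow> norm (L t) \<le> W0"
  unfolding L by (rule subord_L1_bound[OF _ W0]) auto

lemma P_bound: "t \<ge> 0 \<Longrightarrow> norm (P j t) \<le> sqrt (W j)"
  unfolding P by (rule subord_bound[OF d w W])

lemma partial_symbol_bound: assumes "t \<ge> 0" shows "norm (partial_symbol n t) \<le> symbol_bound"
proof -
  have "norm (partial_symbol n t) \<le> norm (L t) + (\<Sum>j<n. norm (P j t))"
    unfolding partial_symbol_def by (rule order_trans[OF norm_triangle_ineq add_left_mono[OF norm_sum]])
  also have "\<dots> \<le> W0 + (\<Sum>j<n. sqrt (W j))" by (intro add_mono sum_mono L_bound P_bound assms)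
  also have "\<dots> \<le> symbol_bound"
    unfolding symbol_bound_def using W(2) by (intro add_left_mono sum_le_suminf summable_W) auto
  finally show ?thesis .
qed

lemma symbol_bounded: "t \<ge> 0 \<Longrightarrow> norm (M t) \<le> symbol_bound"
  by (rule LIMSEQ_le_const2[OF tendsto_norm[OF M]])
    (auto intro!: exI[of _ 0] partial_symbol_bound[unfolded partial_symbol_def])

lemma measurable_on_LL:
  shows "(\<lambda>z :: 'a::euclidean_space \<times> 'a. L (s\<^sup>2 * (norm z)\<^sup>2)) \<in> borel_measurable LL"
    and "(\<lambda>z :: 'a \<times> 'a. P j (s\<^sup>2 * (norm z)\<^sup>2)) \<in> borel_measurable LL"
    and "(\<lambda>z :: 'a \<times> 'a. partial_symbol n (s\<^sup>2 * (norm z)\<^sup>2)) \<in> borel_measurable LL"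
    and "(\<lambda>z :: 'a \<times> 'a. M (s\<^sup>2 * (norm z)\<^sup>2)) \<in> borel_measurable LL"
proof -
  show [measurable]: "(\<lambda>z :: 'a \<times> 'a. L (s\<^sup>2 * (norm z)\<^sup>2)) \<in> borel_measurable LL"
    by (simp add: L)
  show [measurable]: "(\<lambda>z :: 'a \<times> 'a. P j (s\<^sup>2 * (norm z)\<^sup>2)) \<in> borel_measurable LL" for j
    by (simp add: P)
  show [measurable]: "(\<lambda>z :: 'a \<times> 'a. partial_symbol n (s\<^sup>2 * (norm z)\<^sup>2)) \<in> borel_measurable LL" for n
    unfolding partial_symbol_def by measurable
  show "(\<lambda>z :: 'a \<times> 'a. M (s\<^sup>2 * (norm z)\<^sup>2)) \<in> borel_measurable LL"
    by (rule borel_measurable_LIMSEQ_metric[where f="\<lambda>n z. partial_symbol n (s\<^sup>2 * (norm z)\<^sup>2)"])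
      (auto simp: partial_symbol_def intro!: M)
qed

context
  fixes F G :: "'a::euclidean_space \<Rightarrow> complex" and x :: 'a and s :: real and N0F N0G NF NG :: ennreal
  assumes F: "integrable lborel F" and G: "integrable lborel G" and s: "s > 0"
    and N0F: "\<And>\<tau>. \<tau> > 0 \<Longrightarrow> energy 0 F \<tau> x \<le> ennreal (\<tau> powr (2 * 0 + 1)) * N0F"
    and N0G: "\<And>\<tau>. \<tau> > 0 \<Longrightarrow> energy 0 G \<tau> x \<le> ennreal (\<tau> powr (2 * 0 + 1)) * N0G"
    and NF: "\<And>\<tau>. \<tau> > 0 \<Longrightarrow> energy d F \<tau> x \<le> ennreal (\<tau> powr (2 * d + 1)) * NF"
    and NG: "\<And>\<tau>. \<tau> > 0 \<Longrightarrow> energy d G \<tau> x \<le> ennreal (\<tau> powr (2 * d + 1)) * NG"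
begin

lemma low_estimate:
  "(ennreal (beta_const 0 * norm (bilin_form (\<lambda>z. L (s\<^sup>2 * (norm z)\<^sup>2) * F (fst z) * G (snd z)) x)))\<^sup>2
    \<le> (ennreal W0)\<^sup>2 * (N0F * N0G)"
proof -
  have c: "s\<^sup>2 > 0" using s by simp
  let ?v = "\<lambda>\<tau>. of_real ((s\<^sup>2) powr (2 * 0 + 2)) * w0 (s\<^sup>2 * \<tau>)"
  have "(\<integral>\<^sub>+\<tau>. indicator {0<..} \<tau> * ennreal (\<tau> powr (2 * 0 + 1) * norm (?v \<tau>))) = ennreal W0"
    using weighted_nn_integral_scale[of "\<lambda>\<tau>. norm (w0 \<tau>)", OF _ _ c, of "2 * 0 + 1"] unfolding W0(1) by (simp add: norm_mult norm_power)
  from bilinear_estimate_L1[OF _ F G _ this N0F N0G] show ?thesis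
    unfolding subord_prod by (simp add: L subord_scale[OF w0 c])
qed

lemma piece_estimate:
  "(ennreal (beta_const d * norm (bilin_form (\<lambda>z. P j (s\<^sup>2 * (norm z)\<^sup>2) * F (fst z) * G (snd z)) x)))\<^sup>2
    \<le> 2 * ennreal (W j) * (square_fun d F x * NG + NF * square_fun d G x)"
proof (rule bilinear_square_function_estimate[OF d F G _ _ NF NG, where M="\<lambda>t. P j (s\<^sup>2 * t)"])
  have c: "s\<^sup>2 > 0" using s by simp
  let ?v = "\<lambda>\<tau>. of_real ((s\<^sup>2) powr (2 * d + 3)) * w j (s\<^sup>2 * \<tau>)"
  show "?v \<in> \<B>" by measurable
  have e: "((s\<^sup>2) powr (2 * d + 3))\<^sup>2 = (s\<^sup>2) powr (4 * d + 5 + 1)"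
    by (simp add: power2_eq_square add.commute flip: powr_add)
  show "(\<integral>\<^sub>+\<tau>. indicator {0<..} \<tau> * ennreal (\<tau> powr (4 * d + 5) * (norm (?v \<tau>))\<^sup>2)) = ennreal (W j)"
    using weighted_nn_integral_scale[of "\<lambda>\<tau>. (norm (w j \<tau>))\<^sup>2", OF _ _ c, of "4 * d + 5"]
    unfolding W(1) norm_mult power_mult_distrib by (simp add: e)
  fix t :: real assume t: "t \<ge> 0"
  have "(s\<^sup>2) * (s\<^sup>2) powr (2 * d + 2) = (s\<^sup>2) powr (2 * d + 3)" using c by (simp add: powr_mult_base add.commute)
  then have e: "of_real (s\<^sup>2) * (of_real ((s\<^sup>2) powr (2 * d + 2)) :: complex) = of_real ((s\<^sup>2) powr (2 * d + 3))"
    by (metis of_real_mult)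
  have S: "subord d (w j) (s\<^sup>2 * t) = of_real ((s\<^sup>2) powr (2 * d + 2)) * subord d (\<lambda>\<tau>. w j (s\<^sup>2 * \<tau>)) t"
    unfolding subord_scale[OF w c] subord_cmult ..
  have "P j (s\<^sup>2 * t) = of_real (s\<^sup>2 * t) * subord d (w j) (s\<^sup>2 * t)" by (rule P) (use t in simp)
  also have "\<dots> = of_real t * ((of_real (s\<^sup>2) * of_real ((s\<^sup>2) powr (2 * d + 2))) * subord d (\<lambda>\<tau>. w j (s\<^sup>2 * \<tau>)) t)"
    unfolding S by (simp only: of_real_mult mult_ac)
  also have "\<dots> = of_real t * subord d ?v t" unfolding e subord_cmult ..
  finally show "P j (s\<^sup>2 * t) = of_real t * subord d ?v t" .
qed

text \<open>The right-hand side does not involve \<open>s\<close>, so the estimate holds for the supremum over all dilations.\<close>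

lemma symbol_estimate:
  "(enorm (bilin_form (\<lambda>z. M (s\<^sup>2 * (norm z)\<^sup>2) * F (fst z) * G (snd z)) x))\<^sup>2
    \<le> ennreal (operator_bound\<^sup>2) * (N0F + NF + square_fun d F x) * (N0G + NG + square_fun d G x)"
  (is "_ \<le> ennreal (?D\<^sup>2) * ?YF * ?YG")
proof -
  have b0: "beta_const 0 > 0" and b: "beta_const d > 0" using d by (auto intro!: beta_const_pos)
  have S: "(\<Sum>j. sqrt (W j)) \<ge> 0" using W(2) by (intro suminf_nonneg summable_W) auto
  have D: "?D \<ge> 1" using b0 b S W0(2) by (simp add: operator_bound_def)
  show ?thesis
  proof (cases "?YF * ?YG = \<infinity>")
    case True
    then show ?thesis using D by (simp add: mult.assoc ennreal_mult_top)
  next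
    case False
    then obtain q where q: "?YF * ?YG = ennreal q" "q \<ge> 0" by (metis ennreal_cases infinity_ennreal_def)
    let ?B = "\<lambda>K. bilin_form (\<lambda>z :: 'a \<times> 'a. K (s\<^sup>2 * (norm z)\<^sup>2) * F (fst z) * G (snd z)) x"
    have low: "norm (?B L) \<le> W0 / beta_const 0 * sqrt q"
    proof -
      have "N0F * N0G \<le> ennreal q" unfolding q(1)[symmetric] by (intro mult_mono) (auto intro: add_increasing2)
      then have "(ennreal W0)\<^sup>2 * (N0F * N0G) \<le> (ennreal W0)\<^sup>2 * ennreal q" by (intro mult_left_mono) auto
      also have "\<dots> = ennreal (W0\<^sup>2 * q)" using W0 q by (simp add: ennreal_power ennreal_mult)
      finally have "norm (?B L) \<le> sqrt (W0\<^sup>2 * q) / beta_const 0"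
        using low_estimate b0 q by (intro ennreal_sq_le_real) auto
      then show ?thesis using W0 by (simp add: real_sqrt_mult)
    qed
    have piece: "norm (?B (P j)) \<le> 2 / beta_const d * sqrt q * sqrt (W j)" for j
    proof -
      have "square_fun d F x * NG + NF * square_fun d G x \<le> ennreal q + ennreal q"
        unfolding q(1)[symmetric] by (intro add_mono mult_mono) (auto intro: add_increasing2 add_increasing)
      then have "2 * ennreal (W j) * (square_fun d F x * NG + NF * square_fun d G x) \<le> 2 * ennreal (W j) * (ennreal q + ennreal q)"
        by (intro mult_left_mono) auto
      also have "\<dots> = ennreal (2\<^sup>2 * (W j * q))"
        using W(2)[of j] q by (simp add: ennreal_mult[symmetric] flip: ennreal_plus ennreal_numeral)
      finally have "norm (?B (P j)) \<le> sqrt (2\<^sup>2 * (W j * q)) / beta_const d"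
        using piece_estimate[of j] b q W(2)[of j] by (intro ennreal_sq_le_real) auto
      also have "sqrt (2\<^sup>2 * (W j * q)) = 2 * (sqrt (W j) * sqrt q)" by (simp add: real_sqrt_mult)
      finally show ?thesis by (simp add: mult_ac)
    qed
    have iK: "integrable LL (\<lambda>z. K (s\<^sup>2 * (norm z)\<^sup>2) * F (fst z) * G (snd z))"
      if "(\<lambda>z :: 'a \<times> 'a. K (s\<^sup>2 * (norm z)\<^sup>2)) \<in> borel_measurable LL" "\<And>t. t \<ge> 0 \<Longrightarrow> norm (K t) \<le> B" for K B
      using that by (intro integrable_LL_symbol[where B=B] F G) auto
    note iL = iK[OF measurable_on_LL(1) L_bound] and iP = iK[OF measurable_on_LL(2) P_bound]
    note [measurable] = measurable_on_LL F[THEN borel_measurable_integrable] G[THEN borel_measurable_integrable]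
    have part: "norm (?B (partial_symbol n)) \<le> ?D * sqrt q" for n
    proof -
      have "?B (partial_symbol n) = bilin_form (\<lambda>z. L (s\<^sup>2 * (norm z)\<^sup>2) * F (fst z) * G (snd z) + (\<Sum>j<n. P j (s\<^sup>2 * (norm z)\<^sup>2) * F (fst z) * G (snd z))) x"
        unfolding partial_symbol_def by (simp add: distrib_right sum_distrib_right)
      also have "\<dots> = ?B L + (\<Sum>j<n. ?B (P j))"
        using iL iP by (subst bilin_form_add) (auto simp: bilin_form_sum)
      finally have eq: "?B (partial_symbol n) = ?B L + (\<Sum>j<n. ?B (P j))" .
      have "norm (?B (partial_symbol n)) \<le> norm (?B L) + (\<Sum>j<n. norm (?B (P j)))"
        unfolding eq by (rule order_trans[OF norm_triangle_ineq add_left_mono[OF norm_sum]])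
      also have "\<dots> \<le> W0 / beta_const 0 * sqrt q + (\<Sum>j<n. 2 / beta_const d * sqrt q * sqrt (W j))"
        by (intro add_mono sum_mono low piece)
      also have "\<dots> = W0 / beta_const 0 * sqrt q + 2 / beta_const d * sqrt q * (\<Sum>j<n. sqrt (W j))"
        by (simp only: sum_distrib_left)
      also have "\<dots> \<le> W0 / beta_const 0 * sqrt q + 2 / beta_const d * sqrt q * (\<Sum>j. sqrt (W j))"
        using W(2) b q by (intro add_left_mono mult_left_mono sum_le_suminf summable_W) auto
      also have "\<dots> \<le> ?D * sqrt q" using q by (simp add: operator_bound_def algebra_simps)
      finally show ?thesis .
    qed
    have "(\<lambda>n. ?B (partial_symbol n)) \<longlonglongrightarrow> ?B M"
    proof (rule bilin_form_tendsto[where H="\<lambda>z. symbol_bound * norm (F (fst z) * G (snd z))"])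
      show "integrable LL (\<lambda>z. symbol_bound * norm (F (fst z) * G (snd z)))"
        using integrable_LL_product[OF F G] by simp
      show "(\<lambda>n. partial_symbol n (s\<^sup>2 * (norm z)\<^sup>2) * F (fst z) * G (snd z)) \<longlonglongrightarrow> M (s\<^sup>2 * (norm z)\<^sup>2) * F (fst z) * G (snd z)" for z :: "'a \<times> 'a"
        unfolding partial_symbol_def by (intro tendsto_mult tendsto_const M) simp
      show "norm (partial_symbol n (s\<^sup>2 * (norm z)\<^sup>2) * F (fst z) * G (snd z)) \<le> symbol_bound * norm (F (fst z) * G (snd z))" for n and z :: "'a \<times> 'a"
        unfolding mult.assoc norm_mult[of "partial_symbol _ _"] by (intro mult_right_mono partial_symbol_bound) auto
    qed measurable
    then have "norm (?B M) \<le> ?D * sqrt q"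
      by (intro LIMSEQ_le_const2[OF tendsto_norm]) (auto intro: part)
    then have "(norm (?B M))\<^sup>2 \<le> (?D * sqrt q)\<^sup>2" by (intro power_mono) auto
    then have "(norm (?B M))\<^sup>2 \<le> ?D\<^sup>2 * q" using q by (simp add: power_mult_distrib)
    then have "nsq (?B M) \<le> ennreal (?D\<^sup>2 * q)" by (rule ennreal_leI)
    also have "\<dots> = ennreal (?D\<^sup>2) * ?YF * ?YG" using q by (simp add: mult.assoc ennreal_mult)
    finally show ?thesis by (simp add: ennreal_power)
  qed
qed

end

subsection \<open>The maximal operator\<close>

abbreviation maximal :: "('a::euclidean_space \<Rightarrow> complex) \<Rightarrow> ('a \<Rightarrow> complex) \<Rightarrow> 'a \<Rightarrow> ennreal" where
  "maximal \<equiv> max_bilin_mult (\<lambda>\<zeta>. M ((norm \<zeta>)\<^sup>2))"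

abbreviation dilated :: "real \<Rightarrow> ('a::euclidean_space \<Rightarrow> complex) \<Rightarrow> ('a \<Rightarrow> complex) \<Rightarrow> 'a \<times> 'a \<Rightarrow> complex" where
  "dilated s f g z \<equiv> M (s\<^sup>2 * (norm z)\<^sup>2) * fourier f (fst z) * fourier g (snd z)"

lemma integrable_dilated:
  assumes "schwartz f" "schwartz g" shows "integrable LL (dilated s f g)"
  by (rule integrable_LL_symbol[OF schwartz_fourier_integrable[OF assms(1)] schwartz_fourier_integrable[OF assms(2)] measurable_on_LL(4) symbol_bounded]) simp

lemma maximal_eq:
  assumes "schwartz f" "schwartz g"
  shows "maximal f g x = (SUP s\<in>{0<..}. enorm (bilin_form (dilated s f g) x))"
  unfolding max_bilin_mult_def
  by (subst bilin_mult_eq_bilin_form[OF schwartz_fourier_integrable[OF assms(1)] schwartz_fourier_integrable[OF assms(2)] measurable_on_LL(4) symbol_bounded]) auto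

lemma fourier_schwartz_add:
  assumes "schwartz f" "schwartz g" shows "fourier (\<lambda>x. f x + g x) \<xi> = fourier f \<xi> + fourier g \<xi>"
proof -
  have "integrable lborel (\<lambda>x. f x * cis (- 2 * pi * (x \<bullet> \<xi>)))" "integrable lborel (\<lambda>x. g x * cis (- 2 * pi * (x \<bullet> \<xi>)))"
    by (intro integrable_mult_cis schwartz_integrable assms; measurable)+
  then show ?thesis unfolding fourier_eq_cis by (simp add: distrib_right)
qed

lemma fourier_cmult: "fourier (\<lambda>x. c * f x) \<xi> = c * fourier f \<xi>"
  unfolding fourier_def by (simp add: mult.assoc)

lemma maximal_triangle:
  assumes "schwartz f" "schwartz g" "schwartz f1" "schwartz g1" "schwartz f2" "schwartz g2"
    and eq: "\<And>s z. dilated s f g z = dilated s f1 g1 z + dilated s f2 g2 z"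
  shows "maximal f g x \<le> maximal f1 g1 x + maximal f2 g2 x"
  unfolding maximal_eq[OF assms(1,2)] maximal_eq[OF assms(3,4)] maximal_eq[OF assms(5,6)]
proof (rule SUP_least)
  fix s :: real assume s: "s \<in> {0<..}"
  have "bilin_form (dilated s f g) x = bilin_form (dilated s f1 g1) x + bilin_form (dilated s f2 g2) x"
    unfolding eq by (rule bilin_form_add; rule integrable_dilated) fact+
  then have "enorm (bilin_form (dilated s f g) x) \<le> enorm (bilin_form (dilated s f1 g1) x) + enorm (bilin_form (dilated s f2 g2) x)"
    by (simp add: norm_triangle_ineq flip: ennreal_plus)
  also have "\<dots> \<le> (SUP s\<in>{0<..}. enorm (bilin_form (dilated s f1 g1) x)) + (SUP s\<in>{0<..}. enorm (bilin_form (dilated s f2 g2) x))"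
    by (intro add_mono SUP_upper s)
  finally show "enorm (bilin_form (dilated s f g) x) \<le> \<dots>" .
qed

lemma maximal_homogeneous:
  assumes "schwartz f" "schwartz g" "schwartz f1" "schwartz g1"
    and eq: "\<And>s z. dilated s f g z = c * dilated s f1 g1 z"
  shows "maximal f g x = enorm c * maximal f1 g1 x"
  unfolding maximal_eq[OF assms(1,2)] maximal_eq[OF assms(3,4)] eq bilin_form_cmult norm_mult
  by (subst ennreal_mult) (auto simp: SUP_mult_left_ennreal)

text \<open>A supremum of continuous functions is lower semicontinuous.\<close>

lemma maximal_measurable:
  assumes f: "schwartz f" and g: "schwartz g" shows "maximal f g \<in> \<B>"
proof (rule borel_measurableI_greater)
  fix y :: ennreal
  have "open {x. y < enorm (bilin_form (dilated s f g) x)}" for s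
    by (intro open_Collect_less continuous_on_const continuous_on_ennreal continuous_on_norm bilin_form_continuous integrable_dilated f g)
  then have "open (\<Union>s\<in>{0<..}. {x. y < enorm (bilin_form (dilated s f g) x)})" by blast
  moreover have "{x \<in> space borel. y < maximal f g x} = (\<Union>s\<in>{0<..}. {x. y < enorm (bilin_form (dilated s f g) x)})"
    by (auto simp: maximal_eq[OF f g] less_SUP_iff)
  ultimately show "{x \<in> space borel. y < maximal f g x} \<in> sets borel" by simp
qed

lemma maximal_finite:
  assumes f: "schwartz f" and g: "schwartz g" shows "maximal f g x < \<infinity>"
proof -
  let ?H = "\<lambda>z. symbol_bound * norm (fourier f (fst z) * fourier g (snd z))"
  have H: "integrable LL ?H" using integrable_LL_product[OF schwartz_fourier_integrable[OF f] schwartz_fourier_integrable[OF g]] by simp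
  have "norm (bilin_form (dilated s f g) x) \<le> (LINT z|LL. ?H z)" for s
  proof (rule order_trans[OF bilin_form_norm_le integral_mono[OF integrable_norm[OF integrable_dilated[OF f g]] H]])
    fix z :: "'a \<times> 'a"
    show "norm (dilated s f g z) \<le> ?H z"
      unfolding mult.assoc norm_mult[of "M _"] by (intro mult_right_mono symbol_bounded) auto
  qed
  then have "maximal f g x \<le> ennreal (LINT z|LL. ?H z)"
    unfolding maximal_eq[OF f g] by (intro SUP_least ennreal_leI)
  then show ?thesis using le_less_trans ennreal_less_top by fastforce
qed

text \<open>The pointwise estimate of the square by a product of two integrable majorants, and Cauchy--Schwarz in \<open>x\<close>.\<close>

lemma maximal_L1_bound:
  obtains K where "K \<ge> 0" "\<And>f g :: 'a::euclidean_space \<Rightarrow> complex. schwartz f \<Longrightarrow> schwartz g \<Longrightarrow>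
    (\<integral>\<^sub>+x. maximal f g x)\<^sup>2 \<le> ennreal K * (nrm2 f * nrm2 g)"
proof -
  obtain c0 where c0: "c0 \<ge> 0" "\<And>g :: 'a \<Rightarrow> complex. integrable lborel g \<Longrightarrow> \<exists>N \<in> \<B>.
      (\<forall>\<tau>>0. \<forall>x. energy 0 (fourier g) \<tau> x \<le> ennreal (\<tau> powr (2 * 0 + 1)) * N x) \<and>
      (\<integral>\<^sub>+x. N x) \<le> ennreal c0 * (\<integral>\<^sub>+x. nsq (g x))"
    by (rule energy_maximal[of 0]) auto
  obtain c where c: "c \<ge> 0" "\<And>g :: 'a \<Rightarrow> complex. integrable lborel g \<Longrightarrow> \<exists>N \<in> \<B>.
      (\<forall>\<tau>>0. \<forall>x. energy d (fourier g) \<tau> x \<le> ennreal (\<tau> powr (2 * d + 1)) * N x) \<and>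
      (\<integral>\<^sub>+x. N x) \<le> ennreal c * (\<integral>\<^sub>+x. nsq (g x))"
    by (rule energy_maximal[OF d]) auto
  let ?C = "c0 + c + 1 / (2 * d + 1)"
  have d1: "2 * d + 1 > 0" using d by simp
  have C: "?C \<ge> 0" using c0(1) c(1) d1 by simp
  have Y: "\<exists>N0 N. N0 \<in> \<B> \<and> N \<in> \<B> \<and>
      (\<forall>\<tau>>0. \<forall>x. energy 0 (fourier f) \<tau> x \<le> ennreal (\<tau> powr (2 * 0 + 1)) * N0 x) \<and>
      (\<forall>\<tau>>0. \<forall>x. energy d (fourier f) \<tau> x \<le> ennreal (\<tau> powr (2 * d + 1)) * N x) \<and>
      (\<integral>\<^sub>+x. N0 x + N x + square_fun d (fourier f) x) \<le> ennreal ?C * nrm2 f"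
    if f: "schwartz f" for f :: "'a \<Rightarrow> complex"
  proof -
    have [measurable]: "f \<in> \<B>" by (rule schwartz_measurable[OF f])
    obtain N0 where N0: "N0 \<in> \<B>" "\<forall>\<tau>>0. \<forall>x. energy 0 (fourier f) \<tau> x \<le> ennreal (\<tau> powr (2 * 0 + 1)) * N0 x"
      "(\<integral>\<^sub>+x. N0 x) \<le> ennreal c0 * nrm2 f" using c0(2)[OF schwartz_integrable[OF f]] unfolding nrm2_def by blast
    obtain N where N: "N \<in> \<B>" "\<forall>\<tau>>0. \<forall>x. energy d (fourier f) \<tau> x \<le> ennreal (\<tau> powr (2 * d + 1)) * N x"
      "(\<integral>\<^sub>+x. N x) \<le> ennreal c * nrm2 f" using c(2)[OF schwartz_integrable[OF f]] unfolding nrm2_def by blast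
    note [measurable] = N0(1) N(1)
    have "(\<integral>\<^sub>+x. square_fun d (fourier f) x) \<le> ennreal (1 / (2 * d + 1)) * (\<integral>\<^sub>+\<xi>. nsq (fourier f \<xi>))"
      by (rule square_fun_integral_le[OF d]) measurable
    also have "\<dots> \<le> ennreal (1 / (2 * d + 1)) * nrm2 f" unfolding nrm2_def by (intro mult_left_mono fourier_L2_le) auto
    finally have S: "(\<integral>\<^sub>+x. square_fun d (fourier f) x) \<le> ennreal (1 / (2 * d + 1)) * nrm2 f" .
    have "(\<integral>\<^sub>+x. N0 x + N x + square_fun d (fourier f) x) = (\<integral>\<^sub>+x. N0 x) + (\<integral>\<^sub>+x. N x) + (\<integral>\<^sub>+x. square_fun d (fourier f) x)"
      by (simp add: nn_integral_add)
    also have "\<dots> \<le> ennreal c0 * nrm2 f + ennreal c * nrm2 f + ennreal (1 / (2 * d + 1)) * nrm2 f"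
      by (intro add_mono N0 N S)
    also have "\<dots> = ennreal ?C * nrm2 f" using c0(1) c(1) d1 by (simp add: distrib_right)
    finally have sum: "(\<integral>\<^sub>+x. N0 x + N x + square_fun d (fourier f) x) \<le> ennreal ?C * nrm2 f" .
    show ?thesis by (rule exI[of _ N0], rule exI[of _ N]) (intro conjI N0 N sum)
  qed
  have "(\<integral>\<^sub>+x. maximal f g x)\<^sup>2 \<le> ennreal (operator_bound\<^sup>2 * ?C * ?C) * (nrm2 f * nrm2 g)"
    if f: "schwartz f" and g: "schwartz g" for f g :: "'a \<Rightarrow> complex"
  proof -
    have [measurable]: "f \<in> \<B>" "g \<in> \<B>" by (rule schwartz_measurable[OF f], rule schwartz_measurable[OF g])
    obtain N0 N where N: "N0 \<in> \<B>" "N \<in> \<B>"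
      "\<forall>\<tau>>0. \<forall>x. energy 0 (fourier f) \<tau> x \<le> ennreal (\<tau> powr (2 * 0 + 1)) * N0 x"
      "\<forall>\<tau>>0. \<forall>x. energy d (fourier f) \<tau> x \<le> ennreal (\<tau> powr (2 * d + 1)) * N x"
      "(\<integral>\<^sub>+x. N0 x + N x + square_fun d (fourier f) x) \<le> ennreal ?C * nrm2 f" using Y[OF f] by blast
    obtain N0' N' where N': "N0' \<in> \<B>" "N' \<in> \<B>"
      "\<forall>\<tau>>0. \<forall>x. energy 0 (fourier g) \<tau> x \<le> ennreal (\<tau> powr (2 * 0 + 1)) * N0' x"
      "\<forall>\<tau>>0. \<forall>x. energy d (fourier g) \<tau> x \<le> ennreal (\<tau> powr (2 * d + 1)) * N' x"
      "(\<integral>\<^sub>+x. N0' x + N' x + square_fun d (fourier g) x) \<le> ennreal ?C * nrm2 g" using Y[OF g] by blast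
    note [measurable] = N(1,2) N'(1,2) maximal_measurable[OF f g]
    let ?YF = "\<lambda>x. N0 x + N x + square_fun d (fourier f) x" and ?YG = "\<lambda>x. N0' x + N' x + square_fun d (fourier g) x"
    have pw: "(maximal f g x)\<^sup>2 \<le> ennreal (operator_bound\<^sup>2) * ?YF x * ?YG x" for x
      unfolding maximal_eq[OF f g] power2_eq_square[of "Sup _"] SUP_mult_left_ennreal SUP_mult_right_ennreal
    proof (intro SUP_least)
      fix s t :: real assume st: "s \<in> {0<..}" "t \<in> {0<..}"
      let ?a = "\<lambda>s. enorm (bilin_form (dilated s f g) x)" and ?R = "ennreal (operator_bound\<^sup>2) * ?YF x * ?YG x"
      have le: "(?a s)\<^sup>2 \<le> ?R" if "s \<in> {0<..}" for s
        using that N(3,4) N'(3,4)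
        by (intro symbol_estimate schwartz_fourier_integrable f g) auto
      have "?a s * ?a t \<le> (max (?a s) (?a t))\<^sup>2" unfolding power2_eq_square by (intro mult_mono) auto
      also have "\<dots> \<le> ?R" using le[OF st(1)] le[OF st(2)] by (simp add: max_def)
      finally show "?a s * ?a t \<le> ?R" .
    qed
    have "(\<integral>\<^sub>+x. maximal f g x)\<^sup>2 \<le> (\<integral>\<^sub>+x. ennreal (operator_bound\<^sup>2) * ?YF x) * (\<integral>\<^sub>+x. ?YG x)"
      by (rule nn_integral_Cauchy_Schwarz_dominated[OF _ _ _ pw]) measurable
    also have "\<dots> = ennreal (operator_bound\<^sup>2) * (\<integral>\<^sub>+x. ?YF x) * (\<integral>\<^sub>+x. ?YG x)"
      by (subst nn_integral_cmult) auto
    also have "\<dots> \<le> ennreal (operator_bound\<^sup>2) * (ennreal ?C * nrm2 f) * (ennreal ?C * nrm2 g)"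
      by (intro mult_mono N(5) N'(5)) auto
    also have "\<dots> = ennreal (operator_bound\<^sup>2 * ?C * ?C) * (nrm2 f * nrm2 g)"
      using C by (simp add: ennreal_mult mult_ac del: ennreal_plus)
    finally show ?thesis .
  qed
  then show ?thesis using C that[of "operator_bound\<^sup>2 * ?C * ?C"] by auto
qed

theorem maximal_extends: "extends_bounded_L2_L2_L1 (maximal :: ('a::euclidean_space \<Rightarrow> complex) \<Rightarrow> ('a \<Rightarrow> complex) \<Rightarrow> 'a \<Rightarrow> ennreal)"
proof -
  obtain K where K: "K \<ge> 0" "\<And>f g :: 'a \<Rightarrow> complex. schwartz f \<Longrightarrow> schwartz g \<Longrightarrow>
    (\<integral>\<^sub>+x. maximal f g x)\<^sup>2 \<le> ennreal K * (nrm2 f * nrm2 g)" using maximal_L1_bound by blast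
  interpret schwartz_sublinear "maximal :: ('a \<Rightarrow> complex) \<Rightarrow> ('a \<Rightarrow> complex) \<Rightarrow> 'a \<Rightarrow> ennreal" K
  proof
    fix f f' g :: "'a \<Rightarrow> complex" and c :: complex and x :: 'a
    assume f: "schwartz f" and g: "schwartz g"
    show "maximal f g \<in> \<B>" by (rule maximal_measurable[OF f g])
    show "maximal f g x < \<infinity>" by (rule maximal_finite[OF f g])
    show "maximal (\<lambda>y. c * f y) g x = enorm c * maximal f g x"
      by (rule maximal_homogeneous[OF schwartz_cmult[OF f] g f g]) (simp add: fourier_cmult mult_ac)
    show "maximal f (\<lambda>y. c * g y) x = enorm c * maximal f g x"
      by (rule maximal_homogeneous[OF f schwartz_cmult[OF g] f g]) (simp add: fourier_cmult mult_ac)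
    show "(\<integral>\<^sub>+x. maximal f g x)\<^sup>2 \<le> ennreal K * (nrm2 f * nrm2 g)" by (rule K(2)[OF f g])
  next
    fix f f' g :: "'a \<Rightarrow> complex" and x :: 'a
    assume f: "schwartz f" "schwartz f'" and g: "schwartz g"
    show "maximal (\<lambda>y. f y + f' y) g x \<le> maximal f g x + maximal f' g x"
      by (rule maximal_triangle[OF schwartz_add[OF f] g f(1) g f(2) g])
        (simp add: fourier_schwartz_add[OF f] distrib_left distrib_right)
    show "maximal g (\<lambda>y. f y + f' y) x \<le> maximal g f x + maximal g f' x"
      by (rule maximal_triangle[OF g schwartz_add[OF f] g f(1) g f(2)])
        (simp add: fourier_schwartz_add[OF f] distrib_left distrib_right)
  qed (rule K(1))
  show ?thesis by (rule extends)
qed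

end

section \<open>The maximal theorem\<close>

theorem theorem2p9:
  fixes \<phi>\<^sub>0 \<phi> m\<^sub>0 :: "real \<Rightarrow> complex"
    and m :: "nat \<Rightarrow> real \<Rightarrow> complex"
    and \<epsilon> \<beta> C :: real
  assumes "smooth_on_halfline \<phi>" and "smooth_on_halfline \<phi>\<^sub>0"
    and "supp_halfline \<phi> \<subseteq> {1/2..2}" and "supp_halfline \<phi>\<^sub>0 \<subseteq> {0..3/2}"
    and "\<And>x. x \<ge> 0 \<Longrightarrow>
           ((\<lambda>j::nat. \<phi> (2 powr (- real j) * x)) has_sum (1 - \<phi>\<^sub>0 x)) {1..}"
    and "smooth_on_halfline m\<^sub>0"
    and "\<And>j t. j \<ge> 1 \<Longrightarrow> t \<ge> 0 \<Longrightarrow> m j t = m\<^sub>0 t * \<phi> (2 powr (- real j) * t)"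
    and "\<epsilon> > 0" and "\<beta> > 1"
    and "\<And>j. j \<ge> 1 \<Longrightarrow> L2beta_norm \<beta> (m j) \<le> ennreal (C * 2 powr (- real j * \<epsilon>))"
  shows "extends_bounded_L2_L2_L1
           (max_bilin_mult
             (\<lambda>\<zeta> :: (real ^ 'n) \<times> (real ^ 'n). m\<^sub>0 ((norm \<zeta>)\<^sup>2)))"
proof -
  note smooth = assms(1,2,6)[THEN smooth_on_halfline_k_smooth] and part = assms(5) and m = assms(7) and eps = assms(8) and \<beta> = assms(9) and bound = assms(10)
  have \<phi>: "\<phi> t = 0" if "t \<ge> 0" "t \<notin> {1/2..2}" for t
    using that assms(3) closure_subset[of "{t. 0 \<le> t \<and> \<phi> t \<noteq> 0}"] unfolding supp_halfline_def by blast
  have \<phi>\<^sub>0: "\<phi>\<^sub>0 t = 0" if "t \<ge> 0" "t \<notin> {0..3/2}" for t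
    using that assms(4) closure_subset[of "{t. 0 \<le> t \<and> \<phi>\<^sub>0 t \<noteq> 0}"] unfolding supp_halfline_def by blast
  have G: "Gamma \<beta> > 0" using \<beta> by (intro Gamma_real_pos) auto
  \<comment> \<open>The maximum with 0 covers negative \<open>C\<close>, for which the bound in the hypothesis is \<open>ennreal\<close> of a negative number, that is 0.\<close>
  define A where "A j = max C 0 * 2 powr (- real (Suc j) * \<epsilon>)" for j
  have A: "A j \<ge> 0" for j unfolding A_def by simp
  define Q where "Q j w W \<longleftrightarrow> w \<in> \<B> \<and> 0 \<le> W \<and> sqrt W \<le> A j / Gamma \<beta> \<and>
     (\<integral>\<^sub>+\<tau>. indicator {0<..} \<tau> * ennreal (\<tau> powr (4 * (\<beta> / 2 - 1) + 5) * (norm (w \<tau>))\<^sup>2)) = ennreal W \<and>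
     (\<forall>t\<ge>0. m (Suc j) t = of_real t * subord (\<beta> / 2 - 1) w t)" for j w W
  have piece: "\<exists>w W. Q j w W" for j
    unfolding Q_def
  proof (rule smooth_piece_subordination[OF _ _ \<beta> _ _ A])
    let ?c = "2 powr (- real (Suc j))" and ?f = "\<lambda>t. m\<^sub>0 t * \<phi> (2 powr (- real (Suc j)) * t) * (1 / of_real t)"
    have c: "?c > 0" by simp
    have h: "div_by_id (m (Suc j)) = (\<lambda>t. if t > 0 then ?f t else 0)"
      by (auto simp: div_by_id_def fun_eq_iff m)
    have z: "?f t = 0" if "t > 0" "t \<notin> {1/2 / ?c..2 / ?c}" for t
    proof -
      have "?c * t \<notin> {1/2..2}" using that c by (auto simp: field_simps simp del: powr_minus)
      then show ?thesis using \<phi>[of "?c * t"] that by simp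
    qed
    show "div_by_id (m (Suc j)) t = 0" if "t \<notin> {1/2 / ?c..2 / ?c}" for t unfolding h using z that by auto
    show "k_smooth k UNIV (div_by_id (m (Suc j)))" for k
      unfolding h
    proof (rule k_smooth_extend_zero[OF _ _ z])
      show "k_smooth k {0<..} ?f"
        by (intro k_smooth_mult k_smooth_inverse k_smooth_scale k_smooth_subset[OF smooth(1)] k_smooth_subset[OF smooth(3)]) auto
    qed auto
    show "m (Suc j) 0 = 0" using m[of "Suc j" 0] \<phi>[of 0] by simp
    have "C * 2 powr (- real (Suc j) * \<epsilon>) \<le> A j" unfolding A_def by (intro mult_right_mono) auto
    then show "L2beta_norm \<beta> (m (Suc j)) \<le> ennreal (A j)"
      using bound[of "Suc j"] by (auto intro: order_trans ennreal_leI)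
  qed
  obtain w W where "\<And>j. Q j (w j) (W j)" using piece by metis
  note w = this[unfolded Q_def]
  let ?h = "\<lambda>t. m\<^sub>0 t * \<phi>\<^sub>0 t"
  have "?h t = 0" if "t > 3/2" for t using \<phi>\<^sub>0[of t] that by simp
  then obtain w0 W0 where w0: "w0 \<in> \<B>" "0 \<le> W0"
     "(\<integral>\<^sub>+\<tau>. indicator {0<..} \<tau> * ennreal (\<tau> powr (2 * 0 + 1) * norm (w0 \<tau>))) = ennreal W0"
     "\<And>t. t \<ge> 0 \<Longrightarrow> ?h t = subord 0 w0 t"
    using low_piece_subordination[OF k_smooth_mult[OF smooth(3) smooth(2)], of "3/2"] by auto
  have sumA: "summable (\<lambda>j. A j / Gamma \<beta>)"
  proof -
    have "2 powr (- real (Suc j) * \<epsilon>) = 2 powr (- \<epsilon>) * (2 powr (- \<epsilon>)) ^ j" for j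
      by (simp add: powr_realpow[symmetric] powr_powr algebra_simps flip: powr_add)
    moreover have "2 powr (- \<epsilon>) < 1" using eps by (simp add: powr_less_one)
    ultimately show ?thesis unfolding A_def by (auto intro!: summable_divide summable_mult summable_geometric)
  qed
  interpret subordinated_symbol m\<^sub>0 ?h "\<lambda>j. m (Suc j)" "\<beta> / 2 - 1" w0 w W0 W
  proof
    show "summable (\<lambda>j. sqrt (W j))"
      by (rule summable_comparison_test[OF _ sumA]) (use w in auto)
    fix t :: real assume t: "t \<ge> 0"
    have Suc: "{1..} = range Suc" by (auto simp: Suc_le_eq gr0_conv_Suc image_iff)
    have "((\<lambda>j. \<phi> (2 powr (- real (Suc j)) * t)) has_sum (1 - \<phi>\<^sub>0 t)) UNIV"
      using part[OF t] has_sum_reindex[of Suc UNIV "\<lambda>j. \<phi> (2 powr (- real j) * t)" "1 - \<phi>\<^sub>0 t"]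
      unfolding Suc by (simp add: comp_def)
    then have "(\<lambda>n. \<Sum>j<n. \<phi> (2 powr (- real (Suc j)) * t)) \<longlonglongrightarrow> 1 - \<phi>\<^sub>0 t"
      using has_sum_imp_sums unfolding sums_def by blast
    then have "(\<lambda>n. m\<^sub>0 t * \<phi>\<^sub>0 t + m\<^sub>0 t * (\<Sum>j<n. \<phi> (2 powr (- real (Suc j)) * t))) \<longlonglongrightarrow> m\<^sub>0 t * \<phi>\<^sub>0 t + m\<^sub>0 t * (1 - \<phi>\<^sub>0 t)"
      by (intro tendsto_intros)
    then show "(\<lambda>n. m\<^sub>0 t * \<phi>\<^sub>0 t + (\<Sum>j<n. m (Suc j) t)) \<longlonglongrightarrow> m\<^sub>0 t"
      using t by (simp add: m sum_distrib_left algebra_simps)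
  qed (use \<beta> w w0 in auto)
  show ?thesis by (rule maximal_extends)
qed

end
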